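(* Let $\Omega=(0,l\pi)$, $l>0$, with homogeneous Neumann boundary conditions, and suppose that a $(k_1,k_2)$-mode Hopf--steady state bifurcation with $k_2=0$, $k_1\ne0$ occurs at the trivial equilibrium when $\alpha=(0,0)$ for $$\dot u(t)=D(\alpha)\Delta u(t)+L(\alpha)u_t+G(u_t,\alpha).$$ Then the coefficients $a_{11},a_{23},a_{111},a_{123},b_{12},b_{112},b_{223}$ of the third order normal form on the center manifold $$\begin{aligned} \dot z_1&=a_1(\alpha)z_1+a_{11}z_1^2+a_{23}z_2\bar z_2+a_{111}z_1^3+a_{123}z_1z_2\bar z_2+h.o.t.,\\ \dot z_2&=\mathrm i\omega_0z_2+b_2(\alpha)z_2+b_{12}z_1z_2+b_{112}z_1^2z_2+b_{223}z_2^2\bar z_2+h.o.t. \end{aligned}$$ (together with the complex conjugate of the second equation) are $$\begin{aligned} a_{11}=&a_{23}=b_{12}=0,\\ a_{111}=&\tfrac14\psi_1(0)C_{\phi_1\phi_1\phi_1}+\tfrac1{\omega_0}\psi_1(0)\mathrm{Re}(\mathrm iQ_{\phi_1\phi_2}\psi_2(0))Q_{\phi_1\phi_1}+\psi_1(0)Q_{\phi_1}(h_{200}^0+\tfrac1{\sqrt2}h_{200}^{2k_1}),\\ a_{123}=&\psi_1(0)C_{\phi_1\phi_2\bar\phi_2}+\tfrac2{\omega_0}\psi_1(0)\mathrm{Re}(\mathrm iQ_{\phi_1\phi_2}\psi_2(0))Q_{\phi_2\bar\phi_2}\\ &+\psi_1(0)[Q_{\phi_1}(h_{011}^0+\tfrac1{\sqrt2}h_{011}^{2k_1})+Q_{\phi_2}h_{101}^{k_1}+Q_{\bar\phi_2}h_{110}^{k_1}],\\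 b_{112}=&\tfrac12\psi_2(0)C_{\phi_1\phi_1\phi_2}+\tfrac1{2\mathrm i\omega_0}\psi_2(0)\{2Q_{\phi_1\phi_1}\psi_1(0)Q_{\phi_1\phi_2}+[-Q_{\phi_2\phi_2}\psi_2(0)+Q_{\phi_2\bar\phi_2}\bar\psi_2(0)]Q_{\phi_1\phi_1}\}\\ &+\psi_2(0)(Q_{\phi_1}h_{110}^{k_1}+Q_{\phi_2}h_{200}^0),\\ b_{223}=&\tfrac12\psi_2(0)C_{\phi_2\phi_2\bar\phi_2}+\tfrac1{4\mathrm i\omega_0}\psi_2(0)\{\tfrac23Q_{\bar\phi_2\bar\phi_2}\bar\psi_2(0)Q_{\phi_2\phi_2}+[-2Q_{\phi_2\phi_2}\psi_2(0)+4Q_{\phi_2\bar\phi_2}\bar\psi_2(0)]Q_{\phi_2\bar\phi_2}\}\\ &+\psi_2(0)(Q_{\phi_2}h_{011}^0+Q_{\bar\phi_2}h_{020}^0), \end{aligned}$$ where, for $\theta\in[-r,0]$, $$\begin{aligned} h_{200}^0(\theta)&=-\tfrac12\Big[\int_{-r}^0d\eta_0(s)\Big]^{-1}Q_{\phi_1\phi_1}+\tfrac1{2\mathrm i\omega_0}(\phi_2(\theta)\psi_2(0)-\bar\phi_2(\theta)\bar\psi_2(0))Q_{\phi_1\phi_1},\\ h_{200}^{2k_1}(\theta)&\equiv-\tfrac1{2\sqrt2}\Big[\int_{-r}^0d\eta_{2k_1}(s)\Big]^{-1}Q_{\phi_1\phi_1},\\ h_{011}^0(\theta)&=-\Big[\int_{-r}^0d\eta_0(s)\Big]^{-1}Q_{\phi_2\bar\phi_2}+\tfrac1{\mathrm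 i\omega_0}(\phi_2(\theta)\psi_2(0)-\bar\phi_2(\theta)\bar\psi_2(0))Q_{\phi_2\bar\phi_2},\\ h_{011}^{2k_1}(\theta)&=0,\\ h_{020}^0(\theta)&=\tfrac12\Big[2\mathrm i\omega_0I-\int_{-r}^0e^{2\mathrm i\omega_0s}d\eta_0(s)\Big]^{-1}Q_{\phi_2\phi_2}e^{2\mathrm i\omega_0\theta}-\tfrac1{2\mathrm i\omega_0}[\phi_2(\theta)\psi_2(0)+\tfrac13\bar\phi_2(\theta)\bar\psi_2(0)]Q_{\phi_2\phi_2},\\ h_{110}^{k_1}(\theta)&=\Big[\mathrm i\omega_0I-\int_{-r}^0e^{\mathrm i\omega_0s}d\eta_{k_1}(s)\Big]^{-1}Q_{\phi_1\phi_2}e^{\mathrm i\omega_0\theta}-\tfrac1{\mathrm i\omega_0}\phi_1(0)\psi_1(0)Q_{\phi_1\phi_2},\\ h_{002}^0(\theta)&=\overline{h_{020}^0(\theta)},\qquad h_{101}^{k_1}(\theta)=\overline{h_{110}^{k_1}(\theta)}. \end{aligned}$$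
   Context: **Equation.** $\Omega=(0,l\pi)$, $l>0$; $X$ is a Hilbert space of complex-valued functions on $[0,l\pi]$ with $\langle u,v\rangle=\frac1{l\pi}\int_0^{l\pi}u\bar v\,dx$. With homogeneous Neumann conditions, $-\Delta$ has eigenvalues $\mu_k=k^2/l^2$, $k\in\mathbb N_0$, with orthonormal eigenfunctions $\beta_0=1$, $\beta_k(x)=\sqrt2\cos(kx/l)$. Fix $m\in\mathbb N$, $r>0$; $\mathcal C=C([-r,0];X^m)$ and $C([-r,0];\mathbb C^m)$ carry the sup norm. $u_t(\theta)=u(t+\theta)$. $dom(\Delta)$ is the set of $u\in (W^{2,2})^m$ satisfying the Neumann condition. $D(\alpha)=\mathrm{diag}(d_1(\alpha),\dots,d_m(\alpha))$, $d_i(0)>0$; $\alpha=(\alpha_1,\alpha_2)$ lies in a neighborhood $V$ of $0\in\mathbb R^2$; $\alpha\mapsto L(\alpha)$ is a $C^1$ map into bounded linear operators $\mathcal C\to X^m$; $G:\mathcal C\times V\to X^m$ is $C^k$, $k\ge3$, with $G(0,\alpha)=0$ and $D_\varphi G(0,\alpha)=0$. $L$ and $G$ are real on real functions. $L_0=L(0)$, $D_0=D(0)$. Formal Taylor expansions: $L(\alpha)=L_0+\frac12L_1(\alpha)+\cdots$, $D(\alpha)=D_0+\frac12D_1(\alpha)+\cdots$ with $L_1,D_1$ linear in $\alpha$, and $G(v,0)=\frac1{2!}Q(v,v)+\frac1{3!}C(v,v,v)+O(|v|^4)$ with $Q,C$ symmetric multilinear (extended complex-multilinearly). Write $Q_{XY}=Q_XY=Q(X,Y)$,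 $C_{XYZ}=C(X,Y,Z)$. These operators act pointwise in $x$: $L(\alpha)(\varphi\beta)=(L(\alpha)\varphi)\beta$, $Q(\varphi\beta,\psi\beta')=Q(\varphi,\psi)\beta\beta'$, and similarly for $C$, for $\varphi,\psi\in C([-r,0];\mathbb C^m)$ and scalar functions $\beta,\beta'$ of $x$. For vector functions $\langle v,\beta_k\rangle$ is taken componentwise. **Definition ($(k_1,k_2)$-mode Hopf--steady state bifurcation).** The following four hypotheses hold. (H1) $D_0\Delta$ generates a $C_0$-semigroup $T(t)$ on $X^m$ with $|T(t)|\le Me^{\omega t}$, $t\ge0$, for some $M\ge1$, $\omega\in\mathbb R$, and $T(t)$ is compact for every $t>0$. (H2) $L_0$ extends to a bounded linear operator from $B\mathcal C$ to $X^m$, where $B\mathcal C$ is the space (sup norm) of functions $[-r,0]\to X^m$ continuous on $[-r,0)$ with a limit as $\theta\to0^-$. (H3) For each $k\in\mathbb N_0$, $L_0$ maps $\mathcal B_k=\{\langle v(\cdot),\beta_k\rangle\beta_k:v\in\mathcal C\}$ into $\mathrm{span}\{e_i\beta_k:1\le i\le m\}$, $e_i$ the canonical basis. (H4) For $\alpha\in V$, the characteristic equation $\det(\lambda I+\mu_kD(\alpha)-L(\alpha)(e^{\lambda\cdot}I))=0$ with $k=k_1$ has a simple real root $\gamma(\alpha)$ with $\gamma(0)=0$, $\frac{\partial\gamma}{\partial\alpha_2}(0)\ne0$; with $k=k_2$ it has a pair of simple complex conjugate roots $\nu(\alpha)\pm\mathrm i\omega(\alpha)$ with $\nu(0)=0$,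 $\omega(0)=\omega_0>0$, $\frac{\partial\nu}{\partial\alpha_1}(0)\ne0$; all other eigenvalues (over all $k\in\mathbb N_0$) have nonzero real part. **Bases.** $\eta_k$ is the $m\times m$ matrix function of bounded variation with $-\mu_kD_0\psi(0)+L_0\psi=\int_{-r}^0d\eta_k(\theta)\psi(\theta)$ for $\psi\in C([-r,0];\mathbb C^m)$. For $\psi\in C([0,r];\mathbb C^{m*})$ (row vectors), $(\psi,\varphi)_k=\psi(0)\varphi(0)-\int_{-r}^0\int_0^\theta\psi(\xi-\theta)\,d\eta_k(\theta)\varphi(\xi)\,d\xi$. $\phi_1(\theta)\equiv\phi_1(0)$ (real) spans the eigenspace for $\lambda=0$ of $\dot z=-\mu_{k_1}D_0z+L_0z_t$; $\phi_2(\theta)=\phi_2(0)e^{\mathrm i\omega_0\theta}$ that for $\mathrm i\omega_0$ of $\dot z=-\mu_{k_2}D_0z+L_0z_t$; $\psi_1(s)\equiv\psi_1(0)$ (real) and $\psi_2(s)=\psi_2(0)e^{-\mathrm i\omega_0s}$ are the corresponding adjoint eigenvectors. With $\Phi_1=\phi_1$, $\Psi_1=\psi_1$, $\Phi_2=(\phi_2,\bar\phi_2)$, $\Psi_2=(\psi_2,\bar\psi_2)^T$ one normalizes $(\Psi_i,\Phi_i)_{k_i}=I$. **Reduction.** $\pi\phi=\sum_{i=1,2}\Phi_i(\Psi_i,\langle\phi(\cdot),\beta_{k_i}\rangle)_{k_i}\beta_{k_i}$ (extended to $B\mathcal C$); $X_0(\theta)=0$ for $\theta<0$, $X_0(0)=I$;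 $\mathcal Q^1=\{\phi\in\mathcal C:\dot\phi\in\mathcal C,\ \phi(0)\in dom(\Delta),\ \pi\phi=0\}$; $A_1\phi=\dot\phi+X_0[L_0\phi+D_0\Delta\phi(0)-\dot\phi(0)]$ on $\mathcal Q^1$. Writing the solution as $w(z)+y$, $w(z)=\phi_1z_1\beta_{k_1}+(\phi_2z_2+\bar\phi_2\bar z_2)\beta_{k_2}$, $z=(z_1,z_2,\bar z_2)$, $y\in\mathcal Q^1$, the equation becomes $\dot z=Bz+\frac1{2!}f_2^1+\frac1{3!}f_3^1+\cdots$, $\dot y=A_1y+\frac1{2!}f_2^2+\cdots$, with $B=\mathrm{diag}(0,\mathrm i\omega_0,-\mathrm i\omega_0)$, $F_2(v,\alpha)=L_1(\alpha)v+D_1(\alpha)\Delta v(0)+Q(v,v)$, $F_3(v,0)=C(v,v,v)$, $f_j^1$ having components $\psi_1(0)\langle F_j,\beta_{k_1}\rangle$, $\psi_2(0)\langle F_j,\beta_{k_2}\rangle$, $\bar\psi_2(0)\langle F_j,\beta_{k_2}\rangle$, and $f_2^2=(I-\pi)X_0F_2$, all evaluated at $v=w(z)+y$. **Normal form.** Let $(M_j^1p)(z,\alpha)=D_zp\,Bz-Bp$ on homogeneous $\mathbb C^3$-valued polynomials of degree $j$. The complement of $\mathrm{Im}(M_2^1)$ is spanned by $z_1^2e_1,z_2\bar z_2e_1,z_1\alpha_ie_1,z_1z_2e_2,z_2\alpha_ie_2,z_1\bar z_2e_3,\bar z_2\alpha_ie_3$ and that of $\mathrm{Im}(M_3^1)$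 (with $\alpha=0$) by $z_1^3e_1,z_1z_2\bar z_2e_1,z_1^2z_2e_2,z_2^2\bar z_2e_2,z_1^2\bar z_2e_3,z_2\bar z_2^2e_3$; $\mathrm{Proj}$ is projection onto these complements along the remaining monomials. $U_2^1$ is the combination of the remaining quadratic monomials in $z$ with $M_2^1U_2^1=f_2^1(z,0,0)-\mathrm{Proj}f_2^1(z,0,0)$; $U_2^2=2h$, where $h(z)=h_{200}z_1^2+h_{020}z_2^2+h_{002}\bar z_2^2+h_{110}z_1z_2+h_{101}z_1\bar z_2+h_{011}z_2\bar z_2$ has coefficients in $\mathcal Q^1$ and is the unique solution of $D_zh(z)Bz-A_1h(z)=\frac12f_2^2(z,0,0)$; $h_q^k=\langle h_q,\beta_k\rangle$. After $(z,y)=(\hat z,\hat y)+\frac1{2!}U_2(\hat z)$, $U_2=(U_2^1,U_2^2)$, the normal form on the local center manifold is $\dot z=Bz+\frac12g_2^1(z,0,\alpha)+\frac1{3!}g_3^1(z,0,0)+h.o.t.$, $g_2^1(z,0,\alpha)=\mathrm{Proj}f_2^1(z,0,\alpha)$, $g_3^1(z,0,0)=\mathrm{Proj}\{f_3^1(z,0,0)+\frac32[(D_{(z,y)}f_2^1(z,y,0))_{y=0}U_2(z)-D_zU_2^1(z)g_2^1(z,0,0)]\}$; $h.o.t.$ stands for terms of order $\ge4$ in $(z,\alpha)$ and all terms of order $\ge3$ that involve $\alpha$. Also $a_1(\alpha)=\frac12\psi_1(0)(L_1(\alpha)\phi_1-\mu_{k_1}D_1(\alpha)\phi_1(0))$,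 $b_2(\alpha)=\frac12\psi_2(0)(L_1(\alpha)\phi_2-\mu_{k_2}D_1(\alpha)\phi_2(0))$. *)

theory Defs
  imports "HOL-Analysis.Analysis"
begin

section \<open>Vectors and matrices over the complex numbers\<close>

text \<open>Row vectors and column vectors both have type \<open>complex^'m\<close>; the product of a row
  and a column is bilinear (no conjugation).\<close>

definition rdot :: "complex^'m \<Rightarrow> complex^'m \<Rightarrow> complex" (infix "\<odot>" 65) where
  "p \<odot> v = (\<Sum>i\<in>UNIV. p $ i * v $ i)"

definition outer :: "complex^'m \<Rightarrow> complex^'m \<Rightarrow> complex^'m^'m" where
  "outer v p = (\<chi> i j. v $ i * p $ j)"

definition cnjv :: "complex^'m \<Rightarrow> complex^'m" where
  "cnjv v = (\<chi> i. cnj (v $ i))"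

definition Re_mat :: "complex^'m^'m \<Rightarrow> complex^'m^'m" where
  "Re_mat A = (\<chi> i j. complex_of_real (Re (A $ i $ j)))"


section \<open>Maps of class \<open>C\<^sup>k\<close> between normed spaces\<close>

text \<open>\<open>D j x [v\<^sub>1,\<dots>,v\<^sub>j]\<close> is the \<open>j\<close>-th derivative at \<open>x\<close> in the directions
  \<open>v\<^sub>1,\<dots>,v\<^sub>j\<close>. The last conjunct is continuity of \<open>D j\<close> in the norm of bounded multilinear
  maps; by the mean value theorem it upgrades the differentiability of \<open>D j \<cdot> vs\<close> for each
  fixed \<open>vs\<close> to Frechet differentiability in that norm.\<close>

definition Ck_on :: "nat \<Rightarrow> ('a::real_normed_vector \<Rightarrow> 'b::real_normed_vector) \<Rightarrow> 'a set \<Rightarrow> bool"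
  where
  "Ck_on k f U \<longleftrightarrow> (\<exists>D :: nat \<Rightarrow> 'a \<Rightarrow> 'a list \<Rightarrow> 'b.
     (\<forall>x\<in>U. D 0 x [] = f x) \<and>
     (\<forall>j<k. \<forall>x\<in>U. \<forall>vs. length vs = j \<longrightarrow>
        ((\<lambda>y. D j y vs) has_derivative (\<lambda>v. D (Suc j) x (v # vs))) (at x)) \<and>
     (\<forall>j\<le>k. \<forall>x\<in>U. \<forall>\<epsilon>>0. \<exists>\<delta>>0. \<forall>y\<in>U. dist y x < \<delta> \<longrightarrow>
        (\<forall>vs. length vs = j \<longrightarrow>
           norm (D j y vs - D j x vs) \<le> \<epsilon> * prod_list (map norm vs))))"


section \<open>Riemann--Stieltjes integral and bounded variation\<close>

definition has_RS_integral ::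
    "(real \<Rightarrow> complex) \<Rightarrow> (real \<Rightarrow> complex) \<Rightarrow> real \<Rightarrow> real \<Rightarrow> complex \<Rightarrow> bool" where
  "has_RS_integral f g a b I \<longleftrightarrow> (\<forall>\<epsilon>>0. \<exists>\<delta>>0. \<forall>p.
     p tagged_division_of {a..b} \<and> (\<lambda>x. ball x \<delta>) fine p \<longrightarrow>
     cmod ((\<Sum>(x, K)\<in>p. f x * (g (Sup K) - g (Inf K))) - I) < \<epsilon>)"

definition RS_integral ::
    "real \<Rightarrow> real \<Rightarrow> (real \<Rightarrow> complex) \<Rightarrow> (real \<Rightarrow> complex) \<Rightarrow> complex" where
  "RS_integral a b f g = (THE I. has_RS_integral f g a b I)"

definition bounded_variation_on :: "(real \<Rightarrow> complex) \<Rightarrow> real \<Rightarrow> real \<Rightarrow> bool" where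
  "bounded_variation_on g a b \<longleftrightarrow>
     (\<exists>K. \<forall>p. p division_of {a..b} \<longrightarrow> (\<Sum>I\<in>p. cmod (g (Sup I) - g (Inf I))) \<le> K)"


section \<open>\<open>C\<^sub>0\<close>-semigroups\<close>

definition C0_semigroup :: "(real \<Rightarrow> ('a::real_normed_vector \<Rightarrow>\<^sub>L 'a)) \<Rightarrow> bool" where
  "C0_semigroup T \<longleftrightarrow> T 0 = id_blinfun \<and>
     (\<forall>s\<ge>0. \<forall>t\<ge>0. T (s + t) = T s o\<^sub>L T t) \<and>
     (\<forall>u. ((\<lambda>t. T t u) \<longlongrightarrow> u) (at_right 0))"

text \<open>\<open>A u w\<close> is the graph of an unbounded operator: \<open>u\<close> is in the domain and is mapped
  to \<open>w\<close>.\<close>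

definition generates ::
    "('a::real_normed_vector \<Rightarrow> 'a \<Rightarrow> bool) \<Rightarrow> (real \<Rightarrow> ('a \<Rightarrow>\<^sub>L 'a)) \<Rightarrow> bool" where
  "generates A T \<longleftrightarrow> C0_semigroup T \<and>
     (\<forall>u w. A u w \<longleftrightarrow> ((\<lambda>t. (1 / t) *\<^sub>R (T t u - u)) \<longlongrightarrow> w) (at_right 0))"

definition compact_operator :: "('a::real_normed_vector \<Rightarrow>\<^sub>L 'b::real_normed_vector) \<Rightarrow> bool" where
  "compact_operator T \<longleftrightarrow> compact (closure (blinfun_apply T ` cball 0 1))"


section \<open>Delayed reaction-diffusion systems\<close>

text \<open>
  The type \<open>'x\<close> is the Hilbert space \<open>X\<close>, and \<open>val u\<close> is a representative of \<open>u\<close> as a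
  complex-valued function, of which only the values at almost every point of \<open>[0, l\<pi>]\<close>
  matter. \<open>X\<^sup>m\<close> is \<open>'x^'m\<close>.

  \<open>C([-r,0]; Y)\<close> is isometric to the subspace of \<open>real \<Rightarrow>\<^sub>C Y\<close> of functions that are constant
  on \<open>(-\<infinity>,-r]\<close> and on \<open>[0,\<infinity>)\<close>; the isometry is \<open>hist\<close> below. An operator on
  \<open>C([-r,0]; Y)\<close> is given as an operator on \<open>real \<Rightarrow>\<^sub>C Y\<close> that is only evaluated on the range
  of \<open>hist\<close> (every operator on \<open>C([-r,0]; Y)\<close> arises so, by composition with restriction to
  \<open>[-r,0]\<close>, and this preserves boundedness and smoothness).

  \<open>D(\<alpha>)\<close> is the diagonal matrix with diagonal \<open>dcoef \<alpha>\<close>; \<open>Lop\<close>, \<open>Gop\<close>, \<open>Qop\<close>, \<open>Cop\<close> are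
  \<open>L\<close>, \<open>G\<close>, \<open>Q\<close>, \<open>C\<close>.\<close>

record (overloaded) ('x::"{real_inner,banach}", 'm::finite) pfde =
  len :: real
  delay :: real
  val :: "'x \<Rightarrow> real \<Rightarrow> complex"
  nbhd :: "(real^2) set"
  dcoef :: "real^2 \<Rightarrow> real^'m"
  Lop :: "real^2 \<Rightarrow> ((real \<Rightarrow>\<^sub>C ('x^'m)) \<Rightarrow>\<^sub>L ('x^'m))"
  Gop :: "(real \<Rightarrow>\<^sub>C ('x^'m)) \<Rightarrow> real^2 \<Rightarrow> 'x^'m"
  Qop :: "(real \<Rightarrow>\<^sub>C ('x^'m)) \<Rightarrow> (real \<Rightarrow>\<^sub>C ('x^'m)) \<Rightarrow> 'x^'m"
  Cop :: "(real \<Rightarrow>\<^sub>C ('x^'m)) \<Rightarrow> (real \<Rightarrow>\<^sub>C ('x^'m)) \<Rightarrow> (real \<Rightarrow>\<^sub>C ('x^'m)) \<Rightarrow> 'x^'m"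

definition Om :: "('x::{real_inner,banach}, 'm::finite, 'z) pfde_scheme \<Rightarrow> real measure" where
  "Om S = lebesgue_on {0..len S * pi}"

definition ip :: "('x::{real_inner,banach}, 'm::finite, 'z) pfde_scheme \<Rightarrow>
    (real \<Rightarrow> complex) \<Rightarrow> (real \<Rightarrow> complex) \<Rightarrow> complex" where
  "ip S f g = complex_of_real (1 / (len S * pi)) * (LINT x|Om S. f x * cnj (g x))"

definition mu :: "('x::{real_inner,banach}, 'm::finite, 'z) pfde_scheme \<Rightarrow> nat \<Rightarrow> real" where
  "mu S k = (real k)\<^sup>2 / (len S)\<^sup>2"

definition beta :: "('x::{real_inner,banach}, 'm::finite, 'z) pfde_scheme \<Rightarrow>
    nat \<Rightarrow> real \<Rightarrow> complex" where
  "beta S k x = (if k = 0 then 1 else complex_of_real (sqrt 2 * cos (real k * x / len S)))"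

text \<open>The norm of \<open>X\<close> is only required to dominate the norm of the pairing \<open>ip\<close>, not to be
  equal to it: pointwise products are bounded on spaces such as \<open>W\<^sup>1\<^sup>,\<^sup>2\<close> but not on \<open>L\<^sup>2\<close>.\<close>

definition func_space :: "('x::{real_inner,banach}, 'm::finite, 'z) pfde_scheme \<Rightarrow> bool" where
  "func_space S \<longleftrightarrow>
     (\<forall>u. val S u \<in> borel_measurable (Om S) \<and> integrable (Om S) (\<lambda>x. (cmod (val S u x))\<^sup>2)) \<and>
     (\<forall>u v. AE x in Om S. val S (u + v) x = val S u x + val S v x) \<and>
     (\<forall>a u. AE x in Om S. val S (a *\<^sub>R u) x = complex_of_real a * val S u x) \<and>
     (\<forall>c u. \<exists>w. (AE x in Om S. val S w x = c * val S u x) \<and> norm w = cmod c * norm u) \<and>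
     (\<forall>u. (AE x in Om S. val S u x = 0) \<longrightarrow> u = 0) \<and>
     (\<exists>K. \<forall>u. cmod (ip S (val S u) (val S u)) \<le> K * (norm u)\<^sup>2) \<and>
     (\<forall>k. \<exists>u. AE x in Om S. val S u x = beta S k x)"

definition rep :: "('x::{real_inner,banach}, 'm::finite, 'z) pfde_scheme \<Rightarrow>
    (real \<Rightarrow> complex) \<Rightarrow> 'x" where
  "rep S f = (THE u. AE x in Om S. val S u x = f x)"

text \<open>Complex scalar multiplication on \<open>X\<^sup>m\<close>.\<close>

definition csc :: "('x::{real_inner,banach}, 'm::finite, 'z) pfde_scheme \<Rightarrow>
    complex \<Rightarrow> 'x^'m \<Rightarrow> 'x^'m" where
  "csc S c u = (\<chi> i. rep S (\<lambda>x. c * val S (u $ i) x))"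

text \<open>The element \<open>c b\<close> of \<open>X\<^sup>m\<close>, for a vector \<open>c\<close> and a scalar function \<open>b\<close>.\<close>

definition tens :: "('x::{real_inner,banach}, 'm::finite, 'z) pfde_scheme \<Rightarrow>
    complex^'m \<Rightarrow> (real \<Rightarrow> complex) \<Rightarrow> 'x^'m" where
  "tens S c b = (\<chi> i. rep S (\<lambda>x. c $ i * b x))"

definition coef :: "('x::{real_inner,banach}, 'm::finite, 'z) pfde_scheme \<Rightarrow>
    nat \<Rightarrow> 'x^'m \<Rightarrow> complex^'m" where
  "coef S k u = (\<chi> i. ip S (val S (u $ i)) (beta S k))"

definition real_valued :: "('x::{real_inner,banach}, 'm::finite, 'z) pfde_scheme \<Rightarrow>
    'x^'m \<Rightarrow> bool" where
  "real_valued S u \<longleftrightarrow> (\<forall>i. AE x in Om S. val S (u $ i) x \<in> \<real>)"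

definition I\<^sub>r :: "('x::{real_inner,banach}, 'm::finite, 'z) pfde_scheme \<Rightarrow> real set" where
  "I\<^sub>r S = {- delay S..0}"

definition hist :: "('x::{real_inner,banach}, 'm::finite, 'z) pfde_scheme \<Rightarrow>
    (real \<Rightarrow> 'x^'m) \<Rightarrow> (real \<Rightarrow>\<^sub>C ('x^'m))" where
  "hist S \<phi> = Bcontfun (ext_cont \<phi> (- delay S) 0)"

text \<open>Weak derivative on \<open>(0, l\<pi>)\<close>, tested against \<open>C\<^sup>1\<close> functions of compact support.\<close>

definition weak_deriv :: "('x::{real_inner,banach}, 'm::finite, 'z) pfde_scheme \<Rightarrow>
    (real \<Rightarrow> complex) \<Rightarrow> (real \<Rightarrow> complex) \<Rightarrow> bool" where
  "weak_deriv S f g \<longleftrightarrow> (\<forall>\<tau> \<tau>' :: real \<Rightarrow> real.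
     (\<forall>x. (\<tau> has_real_derivative \<tau>' x) (at x)) \<and> continuous_on UNIV \<tau>' \<and>
     (\<exists>a b. 0 < a \<and> b < len S * pi \<and> (\<forall>x. x \<notin> {a..b} \<longrightarrow> \<tau> x = 0)) \<longrightarrow>
     (LINT x|Om S. f x * complex_of_real (\<tau>' x)) =
       - (LINT x|Om S. g x * complex_of_real (\<tau> x)))"

text \<open>\<open>u \<in> W\<^sup>2\<^sup>,\<^sup>2\<close> satisfies the Neumann condition and \<open>\<Delta> u = w\<close>. Here \<open>du\<close> is the continuous
  representative of the weak derivative of \<open>u\<close>; it gives the boundary condition its meaning.\<close>

definition neumann_lap :: "('x::{real_inner,banach}, 'm::finite, 'z) pfde_scheme \<Rightarrow>
    'x \<Rightarrow> 'x \<Rightarrow> bool" where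
  "neumann_lap S u w \<longleftrightarrow> (\<exists>du. weak_deriv S (val S u) du \<and> weak_deriv S du (val S w) \<and>
     continuous_on {0..len S * pi} du \<and> du 0 = 0 \<and> du (len S * pi) = 0)"

definition dom_lap :: "('x::{real_inner,banach}, 'm::finite, 'z) pfde_scheme \<Rightarrow> ('x^'m) set" where
  "dom_lap S = {u. \<forall>i. \<exists>w. neumann_lap S (u $ i) w}"

definition lap :: "('x::{real_inner,banach}, 'm::finite, 'z) pfde_scheme \<Rightarrow> 'x^'m \<Rightarrow> 'x^'m" where
  "lap S u = (\<chi> i. THE w. neumann_lap S (u $ i) w)"

definition diagX :: "real^'m \<Rightarrow> ('x::real_vector)^'m \<Rightarrow> 'x^'m" where
  "diagX d u = (\<chi> i. (d $ i) *\<^sub>R (u $ i))"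

definition diagC :: "real^'m \<Rightarrow> complex^'m \<Rightarrow> complex^'m" where
  "diagC d v = (\<chi> i. complex_of_real (d $ i) * v $ i)"

text \<open>The linear terms \<open>L\<^sub>1(\<alpha>)\<close>, \<open>D\<^sub>1(\<alpha>)\<close> of \<open>L(\<alpha>) = L\<^sub>0 + L\<^sub>1(\<alpha>)/2 + \<dots>\<close> and
  \<open>D(\<alpha>) = D\<^sub>0 + D\<^sub>1(\<alpha>)/2 + \<dots>\<close>.\<close>

definition L1 :: "('x::{real_inner,banach}, 'm::finite, 'z) pfde_scheme \<Rightarrow>
    real^2 \<Rightarrow> ((real \<Rightarrow>\<^sub>C ('x^'m)) \<Rightarrow>\<^sub>L ('x^'m))" where
  "L1 S \<alpha> = 2 *\<^sub>R frechet_derivative (Lop S) (at 0) \<alpha>"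

definition D1 :: "('x::{real_inner,banach}, 'm::finite, 'z) pfde_scheme \<Rightarrow>
    real^2 \<Rightarrow> real^'m" where
  "D1 S \<alpha> = 2 *\<^sub>R frechet_derivative (dcoef S) (at 0) \<alpha>"

text \<open>The action of the operators on \<open>C([-r,0]; \<complex>\<^sup>m)\<close>, whose elements are identified with
  functions that are constant in \<open>x\<close>.\<close>

definition cst :: "('x::{real_inner,banach}, 'm::finite, 'z) pfde_scheme \<Rightarrow>
    (real \<Rightarrow> complex^'m) \<Rightarrow> (real \<Rightarrow>\<^sub>C ('x^'m))" where
  "cst S \<phi> = hist S (\<lambda>\<theta>. tens S (\<phi> \<theta>) (beta S 0))"

definition Lh :: "('x::{real_inner,banach}, 'm::finite, 'z) pfde_scheme \<Rightarrow>
    real^2 \<Rightarrow> (real \<Rightarrow> complex^'m) \<Rightarrow> complex^'m" where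
  "Lh S \<alpha> \<phi> = coef S 0 (Lop S \<alpha> (cst S \<phi>))"

definition L1h :: "('x::{real_inner,banach}, 'm::finite, 'z) pfde_scheme \<Rightarrow>
    real^2 \<Rightarrow> (real \<Rightarrow> complex^'m) \<Rightarrow> complex^'m" where
  "L1h S \<alpha> \<phi> = coef S 0 (L1 S \<alpha> (cst S \<phi>))"

definition Qh :: "('x::{real_inner,banach}, 'm::finite, 'z) pfde_scheme \<Rightarrow>
    (real \<Rightarrow> complex^'m) \<Rightarrow> (real \<Rightarrow> complex^'m) \<Rightarrow> complex^'m" where
  "Qh S \<phi> \<psi> = coef S 0 (Qop S (cst S \<phi>) (cst S \<psi>))"

definition Ch :: "('x::{real_inner,banach}, 'm::finite, 'z) pfde_scheme \<Rightarrow>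
    (real \<Rightarrow> complex^'m) \<Rightarrow> (real \<Rightarrow> complex^'m) \<Rightarrow> (real \<Rightarrow> complex^'m) \<Rightarrow> complex^'m" where
  "Ch S \<phi> \<psi> \<rho> = coef S 0 (Cop S (cst S \<phi>) (cst S \<psi>) (cst S \<rho>))"

definition linear_part :: "('x::{real_inner,banach}, 'm::finite, 'z) pfde_scheme \<Rightarrow> bool" where
  "linear_part S \<longleftrightarrow>
     (\<forall>i. dcoef S 0 $ i > 0) \<and> dcoef S differentiable (at 0) \<and>
     Ck_on 1 (Lop S) (nbhd S) \<and>
     (\<forall>\<alpha>\<in>nbhd S. \<forall>c \<phi>. continuous_on (I\<^sub>r S) \<phi> \<longrightarrow>
        Lop S \<alpha> (hist S (\<lambda>\<theta>. csc S c (\<phi> \<theta>))) = csc S c (Lop S \<alpha> (hist S \<phi>))) \<and>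
     (\<forall>\<alpha>\<in>nbhd S. \<forall>\<phi>. continuous_on (I\<^sub>r S) \<phi> \<and> (\<forall>\<theta>\<in>I\<^sub>r S. real_valued S (\<phi> \<theta>)) \<longrightarrow>
        real_valued S (Lop S \<alpha> (hist S \<phi>)))"

text \<open>\<open>Q\<close> and \<open>C\<close> are complex-multilinear, whereas \<open>G\<close> need only be real-differentiable, so
  the Taylor expansion of \<open>G\<close> is required at real-valued functions \<open>v\<close> only.\<close>

definition nonlinear_part :: "('x::{real_inner,banach}, 'm::finite, 'z) pfde_scheme \<Rightarrow> bool" where
  "nonlinear_part S \<longleftrightarrow>
     (\<exists>k\<ge>3. Ck_on k (\<lambda>(\<phi>, \<alpha>). Gop S \<phi> \<alpha>) (UNIV \<times> nbhd S)) \<and>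
     (\<forall>\<alpha>\<in>nbhd S. Gop S 0 \<alpha> = 0 \<and> ((\<lambda>\<phi>. Gop S \<phi> \<alpha>) has_derivative (\<lambda>_. 0)) (at 0)) \<and>
     (\<forall>\<alpha>\<in>nbhd S. \<forall>\<phi>. continuous_on (I\<^sub>r S) \<phi> \<and> (\<forall>\<theta>\<in>I\<^sub>r S. real_valued S (\<phi> \<theta>)) \<longrightarrow>
        real_valued S (Gop S (hist S \<phi>) \<alpha>)) \<and>
     bounded_bilinear (Qop S) \<and>
     (\<forall>u v. Qop S u v = Qop S v u) \<and>
     (\<forall>c \<phi> v. continuous_on (I\<^sub>r S) \<phi> \<longrightarrow>
        Qop S (hist S (\<lambda>\<theta>. csc S c (\<phi> \<theta>))) v = csc S c (Qop S (hist S \<phi>) v)) \<and>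
     (\<forall>v w. linear (\<lambda>u. Cop S u v w)) \<and>
     (\<exists>K. \<forall>u v w. norm (Cop S u v w) \<le> K * norm u * norm v * norm w) \<and>
     (\<forall>u v w. Cop S u v w = Cop S v u w \<and> Cop S u v w = Cop S u w v) \<and>
     (\<forall>c \<phi> v w. continuous_on (I\<^sub>r S) \<phi> \<longrightarrow>
        Cop S (hist S (\<lambda>\<theta>. csc S c (\<phi> \<theta>))) v w = csc S c (Cop S (hist S \<phi>) v w)) \<and>
     (\<exists>K. \<exists>\<delta>>0. \<forall>\<phi>. continuous_on (I\<^sub>r S) \<phi> \<and> (\<forall>\<theta>\<in>I\<^sub>r S. real_valued S (\<phi> \<theta>)) \<and>
        norm (hist S \<phi>) < \<delta> \<longrightarrow>
        (let v = hist S \<phi> in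
         norm (Gop S v 0 - (1 / 2) *\<^sub>R Qop S v v - (1 / 6) *\<^sub>R Cop S v v v) \<le> K * norm v ^ 4))"

text \<open>The scalar functions of \<open>x\<close> range over all of \<open>X\<close>.\<close>

definition pointwise_action :: "('x::{real_inner,banach}, 'm::finite, 'z) pfde_scheme \<Rightarrow> bool" where
  "pointwise_action S \<longleftrightarrow>
     (\<forall>\<alpha>\<in>nbhd S. \<forall>\<phi> u i. continuous_on (I\<^sub>r S) \<phi> \<longrightarrow>
        (AE x in Om S. val S (Lop S \<alpha> (hist S (\<lambda>\<theta>. tens S (\<phi> \<theta>) (val S u))) $ i) x =
           Lh S \<alpha> \<phi> $ i * val S u x)) \<and>
     (\<forall>\<phi> \<psi> u v i. continuous_on (I\<^sub>r S) \<phi> \<and> continuous_on (I\<^sub>r S) \<psi> \<longrightarrow>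
        (AE x in Om S. val S (Qop S (hist S (\<lambda>\<theta>. tens S (\<phi> \<theta>) (val S u)))
                                    (hist S (\<lambda>\<theta>. tens S (\<psi> \<theta>) (val S v))) $ i) x =
           Qh S \<phi> \<psi> $ i * val S u x * val S v x)) \<and>
     (\<forall>\<phi> \<psi> \<rho> u v w i. continuous_on (I\<^sub>r S) \<phi> \<and> continuous_on (I\<^sub>r S) \<psi> \<and>
          continuous_on (I\<^sub>r S) \<rho> \<longrightarrow>
        (AE x in Om S. val S (Cop S (hist S (\<lambda>\<theta>. tens S (\<phi> \<theta>) (val S u)))
                                    (hist S (\<lambda>\<theta>. tens S (\<psi> \<theta>) (val S v)))
                                    (hist S (\<lambda>\<theta>. tens S (\<rho> \<theta>) (val S w))) $ i) x =
           Ch S \<phi> \<psi> \<rho> $ i * val S u x * val S v x * val S w x))"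

definition pfde_system :: "('x::{real_inner,banach}, 'm::finite, 'z) pfde_scheme \<Rightarrow> bool" where
  "pfde_system S \<longleftrightarrow> len S > 0 \<and> delay S > 0 \<and> open (nbhd S) \<and> 0 \<in> nbhd S \<and>
     func_space S \<and> linear_part S \<and> nonlinear_part S \<and> pointwise_action S"


section \<open>The Hopf--steady state bifurcation\<close>

definition H1 :: "('x::{real_inner,banach}, 'm::finite, 'z) pfde_scheme \<Rightarrow> bool" where
  "H1 S \<longleftrightarrow> (\<exists>T M \<omega>.
     generates (\<lambda>u w. u \<in> dom_lap S \<and> w = diagX (dcoef S 0) (lap S u)) T \<and>
     M \<ge> 1 \<and> (\<forall>t\<ge>0. norm (T t) \<le> M * exp (\<omega> * t)) \<and> (\<forall>t>0. compact_operator (T t)))"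

definition BC :: "('x::{real_inner,banach}, 'm::finite, 'z) pfde_scheme \<Rightarrow>
    (real \<Rightarrow> 'x^'m) set" where
  "BC S = {\<phi>. continuous_on {- delay S..<0} \<phi> \<and> (\<exists>a. (\<phi> \<longlongrightarrow> a) (at_left 0))}"

definition H2 :: "('x::{real_inner,banach}, 'm::finite, 'z) pfde_scheme \<Rightarrow> bool" where
  "H2 S \<longleftrightarrow> (\<exists>E :: (real \<Rightarrow> 'x^'m) \<Rightarrow> 'x^'m.
     (\<forall>\<phi>\<in>BC S. \<forall>\<psi>\<in>BC S. E (\<lambda>\<theta>. \<phi> \<theta> + \<psi> \<theta>) = E \<phi> + E \<psi>) \<and>
     (\<forall>c. \<forall>\<phi>\<in>BC S. E (\<lambda>\<theta>. csc S c (\<phi> \<theta>)) = csc S c (E \<phi>)) \<and>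
     (\<exists>K. \<forall>\<phi>\<in>BC S. norm (E \<phi>) \<le> K * (SUP \<theta>\<in>I\<^sub>r S. norm (\<phi> \<theta>))) \<and>
     (\<forall>\<phi>. continuous_on (I\<^sub>r S) \<phi> \<longrightarrow> E \<phi> = Lop S 0 (hist S \<phi>)))"

definition H3 :: "('x::{real_inner,banach}, 'm::finite, 'z) pfde_scheme \<Rightarrow> bool" where
  "H3 S \<longleftrightarrow> (\<forall>k v. continuous_on (I\<^sub>r S) v \<longrightarrow>
     (\<exists>c. Lop S 0 (hist S (\<lambda>\<theta>. tens S (coef S k (v \<theta>)) (beta S k))) = tens S c (beta S k)))"

definition char_mat :: "('x::{real_inner,banach}, 'm::finite, 'z) pfde_scheme \<Rightarrow>
    nat \<Rightarrow> real^2 \<Rightarrow> complex \<Rightarrow> complex^'m^'m" where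
  "char_mat S k \<alpha> \<zeta> = (\<chi> i j.
     (if i = j then \<zeta> + complex_of_real (mu S k * dcoef S \<alpha> $ i) else 0)
       - Lh S \<alpha> (\<lambda>\<theta>. exp (\<zeta> * complex_of_real \<theta>) *s axis j 1) $ i)"

definition char_fun :: "('x::{real_inner,banach}, 'm::finite, 'z) pfde_scheme \<Rightarrow>
    nat \<Rightarrow> real^2 \<Rightarrow> complex \<Rightarrow> complex" where
  "char_fun S k \<alpha> \<zeta> = det (char_mat S k \<alpha> \<zeta>)"

definition simple_root :: "(complex \<Rightarrow> complex) \<Rightarrow> complex \<Rightarrow> bool" where
  "simple_root f \<zeta> \<longleftrightarrow> f \<zeta> = 0 \<and> (\<exists>d. d \<noteq> 0 \<and> (f has_field_derivative d) (at \<zeta>))"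

definition H4 :: "('x::{real_inner,banach}, 'm::finite, 'z) pfde_scheme \<Rightarrow>
    nat \<Rightarrow> nat \<Rightarrow> real \<Rightarrow> bool" where
  "H4 S k\<^sub>1 k\<^sub>2 \<omega>\<^sub>0 \<longleftrightarrow> (\<exists>(\<gamma> :: real^2 \<Rightarrow> real) (\<nu> :: real^2 \<Rightarrow> real) (\<omega> :: real^2 \<Rightarrow> real).
     (\<forall>\<alpha>\<in>nbhd S.
        simple_root (char_fun S k\<^sub>1 \<alpha>) (complex_of_real (\<gamma> \<alpha>)) \<and>
        simple_root (char_fun S k\<^sub>2 \<alpha>) (Complex (\<nu> \<alpha>) (\<omega> \<alpha>)) \<and>
        simple_root (char_fun S k\<^sub>2 \<alpha>) (Complex (\<nu> \<alpha>) (- \<omega> \<alpha>)) \<and>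
        (\<forall>k \<zeta>. char_fun S k \<alpha> \<zeta> = 0 \<and>
           \<not> (k = k\<^sub>1 \<and> \<zeta> = complex_of_real (\<gamma> \<alpha>)) \<and>
           \<not> (k = k\<^sub>2 \<and> (\<zeta> = Complex (\<nu> \<alpha>) (\<omega> \<alpha>) \<or> \<zeta> = Complex (\<nu> \<alpha>) (- \<omega> \<alpha>)))
           \<longrightarrow> Re \<zeta> \<noteq> 0)) \<and>
     \<gamma> 0 = 0 \<and> (\<exists>d. d \<noteq> 0 \<and> ((\<lambda>t. \<gamma> (t *\<^sub>R axis 2 1)) has_real_derivative d) (at 0)) \<and>
     \<nu> 0 = 0 \<and> \<omega> 0 = \<omega>\<^sub>0 \<and> \<omega>\<^sub>0 > 0 \<and>
     (\<exists>d. d \<noteq> 0 \<and> ((\<lambda>t. \<nu> (t *\<^sub>R axis 1 1)) has_real_derivative d) (at 0)))"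

definition hopf_steady_state :: "('x::{real_inner,banach}, 'm::finite, 'z) pfde_scheme \<Rightarrow>
    nat \<Rightarrow> nat \<Rightarrow> real \<Rightarrow> bool" where
  "hopf_steady_state S k\<^sub>1 k\<^sub>2 \<omega>\<^sub>0 \<longleftrightarrow> H1 S \<and> H2 S \<and> H3 S \<and> H4 S k\<^sub>1 k\<^sub>2 \<omega>\<^sub>0"


section \<open>Eigenfunctions, bilinear forms, bases\<close>

text \<open>\<open>phi10\<close>, \<open>phi20\<close>, \<open>psi10\<close>, \<open>psi20\<close> are the values at \<open>0\<close> of the eigenvectors
  \<open>\<phi>\<^sub>1\<close>, \<open>\<phi>\<^sub>2\<close>, \<open>\<psi>\<^sub>1\<close>, \<open>\<psi>\<^sub>2\<close>.\<close>

record (overloaded) ('x::"{real_inner,banach}", 'm::finite) reduction = "('x, 'm) pfde" +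
  mode1 :: nat
  mode2 :: nat
  om0 :: real
  eta :: "nat \<Rightarrow> real \<Rightarrow> complex^'m^'m"
  phi10 :: "complex^'m"
  phi20 :: "complex^'m"
  psi10 :: "complex^'m"
  psi20 :: "complex^'m"

definition phi1 :: "('x::{real_inner,banach}, 'm::finite) reduction \<Rightarrow> real \<Rightarrow> complex^'m" where
  "phi1 S \<theta> = phi10 S"

definition phi2 :: "('x::{real_inner,banach}, 'm::finite) reduction \<Rightarrow> real \<Rightarrow> complex^'m" where
  "phi2 S \<theta> = exp (\<i> * complex_of_real (om0 S * \<theta>)) *s phi20 S"

definition phi2b :: "('x::{real_inner,banach}, 'm::finite) reduction \<Rightarrow> real \<Rightarrow> complex^'m" where
  "phi2b S \<theta> = cnjv (phi2 S \<theta>)"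

definition psi1 :: "('x::{real_inner,banach}, 'm::finite) reduction \<Rightarrow> real \<Rightarrow> complex^'m" where
  "psi1 S s = psi10 S"

definition psi2 :: "('x::{real_inner,banach}, 'm::finite) reduction \<Rightarrow> real \<Rightarrow> complex^'m" where
  "psi2 S s = exp (- \<i> * complex_of_real (om0 S * s)) *s psi20 S"

definition psi2b :: "('x::{real_inner,banach}, 'm::finite) reduction \<Rightarrow> real \<Rightarrow> complex^'m" where
  "psi2b S s = cnjv (psi2 S s)"

text \<open>\<open>\<integral> f d\<eta>\<^sub>k\<close> over \<open>[-r,0]\<close> for scalar \<open>f\<close> (a matrix) and \<open>\<integral> d\<eta>\<^sub>k \<psi>\<close> for a column
  function \<open>\<psi>\<close> (a column).\<close>

definition eta_int :: "('x::{real_inner,banach}, 'm::finite) reduction \<Rightarrow>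
    nat \<Rightarrow> (real \<Rightarrow> complex) \<Rightarrow> complex^'m^'m" where
  "eta_int S k f = (\<chi> i j. RS_integral (- delay S) 0 f (\<lambda>\<theta>. eta S k \<theta> $ i $ j))"

definition eta_col :: "('x::{real_inner,banach}, 'm::finite) reduction \<Rightarrow>
    nat \<Rightarrow> (real \<Rightarrow> complex^'m) \<Rightarrow> complex^'m" where
  "eta_col S k \<psi> =
     (\<chi> i. \<Sum>j\<in>UNIV. RS_integral (- delay S) 0 (\<lambda>\<theta>. \<psi> \<theta> $ j) (\<lambda>\<theta>. eta S k \<theta> $ i $ j))"

text \<open>\<open>\<integral> \<psi>(-\<theta>) d\<eta>\<^sub>k(\<theta>)\<close> over \<open>[-r,0]\<close> for a row function \<open>\<psi>\<close> on \<open>[0,r]\<close> (a row).\<close>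

definition eta_row :: "('x::{real_inner,banach}, 'm::finite) reduction \<Rightarrow>
    nat \<Rightarrow> (real \<Rightarrow> complex^'m) \<Rightarrow> complex^'m" where
  "eta_row S k \<psi> =
     (\<chi> j. \<Sum>i\<in>UNIV. RS_integral (- delay S) 0 (\<lambda>\<theta>. \<psi> (- \<theta>) $ i) (\<lambda>\<theta>. eta S k \<theta> $ i $ j))"

definition eta_represents :: "('x::{real_inner,banach}, 'm::finite) reduction \<Rightarrow> bool" where
  "eta_represents S \<longleftrightarrow> (\<forall>k.
     (\<forall>i j. bounded_variation_on (\<lambda>\<theta>. eta S k \<theta> $ i $ j) (- delay S) 0) \<and>
     (\<forall>\<psi>. continuous_on (I\<^sub>r S) \<psi> \<longrightarrow>
        - (diagC (mu S k *\<^sub>R dcoef S 0) (\<psi> 0)) + Lh S 0 \<psi> = eta_col S k \<psi>))"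

text \<open>The form \<open>(\<psi>, \<phi>)\<^sub>k\<close>; since \<open>\<theta> \<le> 0\<close>, the inner integral from \<open>0\<close> to \<open>\<theta>\<close> is minus the
  integral over \<open>[\<theta>, 0]\<close>. The function \<open>\<phi>\<close> may have a jump at \<open>0\<close>.\<close>

definition bform :: "('x::{real_inner,banach}, 'm::finite) reduction \<Rightarrow>
    nat \<Rightarrow> (real \<Rightarrow> complex^'m) \<Rightarrow> (real \<Rightarrow> complex^'m) \<Rightarrow> complex" where
  "bform S k \<psi> \<phi> = \<psi> 0 \<odot> \<phi> 0 -
     (\<Sum>i\<in>UNIV. \<Sum>j\<in>UNIV. RS_integral (- delay S) 0
        (\<lambda>\<theta>. - integral {\<theta>..0} (\<lambda>\<xi>. \<psi> (\<xi> - \<theta>) $ i * \<phi> \<xi> $ j)) (\<lambda>\<theta>. eta S k \<theta> $ i $ j))"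

text \<open>Eigenfunctions of the infinitesimal generator of \<open>z' = -\<mu>\<^sub>k D\<^sub>0 z + L\<^sub>0 z\<^sub>t\<close>, which is
  \<open>\<phi> \<mapsto> \<phi>'\<close> on the domain \<open>\<phi>'(0) = -\<mu>\<^sub>k D\<^sub>0 \<phi>(0) + L\<^sub>0 \<phi>\<close>, and of its formal adjoint, which
  is \<open>\<psi> \<mapsto> -\<psi>'\<close> on the domain \<open>-\<psi>'(0) = \<integral> \<psi>(-\<theta>) d\<eta>\<^sub>k(\<theta>)\<close>.\<close>

definition eigenfun :: "('x::{real_inner,banach}, 'm::finite) reduction \<Rightarrow>
    nat \<Rightarrow> complex \<Rightarrow> (real \<Rightarrow> complex^'m) \<Rightarrow> bool" where
  "eigenfun S k \<zeta> \<phi> \<longleftrightarrow>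
     (\<forall>\<theta>\<in>I\<^sub>r S. (\<phi> has_vector_derivative \<zeta> *s \<phi> \<theta>) (at \<theta> within I\<^sub>r S)) \<and>
     \<zeta> *s \<phi> 0 = - (diagC (mu S k *\<^sub>R dcoef S 0) (\<phi> 0)) + Lh S 0 \<phi>"

definition adj_eigenfun :: "('x::{real_inner,banach}, 'm::finite) reduction \<Rightarrow>
    nat \<Rightarrow> complex \<Rightarrow> (real \<Rightarrow> complex^'m) \<Rightarrow> bool" where
  "adj_eigenfun S k \<zeta> \<psi> \<longleftrightarrow>
     (\<forall>s\<in>{0..delay S}. (\<psi> has_vector_derivative - (\<zeta> *s \<psi> s)) (at s within {0..delay S})) \<and>
     \<zeta> *s \<psi> 0 = eta_row S k \<psi>"

definition spans_eigenspace :: "('x::{real_inner,banach}, 'm::finite) reduction \<Rightarrow>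
    nat \<Rightarrow> complex \<Rightarrow> (real \<Rightarrow> complex^'m) \<Rightarrow> bool" where
  "spans_eigenspace S k \<zeta> \<phi> \<longleftrightarrow>
     (\<forall>\<rho>. eigenfun S k \<zeta> \<rho> \<longleftrightarrow> (\<exists>c. \<forall>\<theta>\<in>I\<^sub>r S. \<rho> \<theta> = c *s \<phi> \<theta>))"

definition bases :: "('x::{real_inner,banach}, 'm::finite) reduction \<Rightarrow> bool" where
  "bases S \<longleftrightarrow> eta_represents S \<and>
     cnjv (phi10 S) = phi10 S \<and> cnjv (psi10 S) = psi10 S \<and>
     spans_eigenspace S (mode1 S) 0 (phi1 S) \<and>
     spans_eigenspace S (mode2 S) (\<i> * complex_of_real (om0 S)) (phi2 S) \<and>
     adj_eigenfun S (mode1 S) 0 (psi1 S) \<and>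
     adj_eigenfun S (mode2 S) (\<i> * complex_of_real (om0 S)) (psi2 S) \<and>
     bform S (mode1 S) (psi1 S) (phi1 S) = 1 \<and>
     bform S (mode2 S) (psi2 S) (phi2 S) = 1 \<and> bform S (mode2 S) (psi2 S) (phi2b S) = 0 \<and>
     bform S (mode2 S) (psi2b S) (phi2 S) = 0 \<and> bform S (mode2 S) (psi2b S) (phi2b S) = 1"


section \<open>Reduction\<close>

text \<open>The coordinates \<open>z = (z\<^sub>1, z\<^sub>2, cnj z\<^sub>2)\<close> are treated as three independent complex variables
  \<open>z $ 1\<close>, \<open>z $ 2\<close>, \<open>z $ 3\<close>; polynomial identities in them are equivalent to the identities on
  the real form \<open>z $ 1 \<in> \<real>\<close>, \<open>z $ 3 = cnj (z $ 2)\<close>.\<close>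

definition pi_proj :: "('x::{real_inner,banach}, 'm::finite) reduction \<Rightarrow>
    (real \<Rightarrow> 'x^'m) \<Rightarrow> real \<Rightarrow> 'x^'m" where
  "pi_proj S \<phi> \<theta> =
     (let c\<^sub>1 = (\<lambda>\<theta>. coef S (mode1 S) (\<phi> \<theta>)); c\<^sub>2 = (\<lambda>\<theta>. coef S (mode2 S) (\<phi> \<theta>)) in
      tens S (bform S (mode1 S) (psi1 S) c\<^sub>1 *s phi1 S \<theta>) (beta S (mode1 S)) +
      tens S (bform S (mode2 S) (psi2 S) c\<^sub>2 *s phi2 S \<theta> +
              bform S (mode2 S) (psi2b S) c\<^sub>2 *s phi2b S \<theta>) (beta S (mode2 S)))"

definition X\<^sub>0 :: "('x::zero) \<Rightarrow> real \<Rightarrow> 'x" where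
  "X\<^sub>0 u \<theta> = (if \<theta> = 0 then u else 0)"

definition dot :: "('x::{real_inner,banach}, 'm::finite) reduction \<Rightarrow>
    (real \<Rightarrow> 'x^'m) \<Rightarrow> real \<Rightarrow> 'x^'m" where
  "dot S \<phi> \<theta> = vector_derivative \<phi> (at \<theta> within I\<^sub>r S)"

definition Q1 :: "('x::{real_inner,banach}, 'm::finite) reduction \<Rightarrow> (real \<Rightarrow> 'x^'m) set" where
  "Q1 S = {\<phi>. (\<forall>\<theta>\<in>I\<^sub>r S. \<phi> differentiable (at \<theta> within I\<^sub>r S)) \<and>
     continuous_on (I\<^sub>r S) (dot S \<phi>) \<and> \<phi> 0 \<in> dom_lap S \<and> (\<forall>\<theta>\<in>I\<^sub>r S. pi_proj S \<phi> \<theta> = 0)}"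

definition A1 :: "('x::{real_inner,banach}, 'm::finite) reduction \<Rightarrow>
    (real \<Rightarrow> 'x^'m) \<Rightarrow> real \<Rightarrow> 'x^'m" where
  "A1 S \<phi> \<theta> = dot S \<phi> \<theta> +
     X\<^sub>0 (Lop S 0 (hist S \<phi>) + diagX (dcoef S 0) (lap S (\<phi> 0)) - dot S \<phi> 0) \<theta>"

definition wz :: "('x::{real_inner,banach}, 'm::finite) reduction \<Rightarrow>
    complex^3 \<Rightarrow> real \<Rightarrow> 'x^'m" where
  "wz S z \<theta> = tens S (z $ 1 *s phi1 S \<theta>) (beta S (mode1 S)) +
     tens S (z $ 2 *s phi2 S \<theta> + z $ 3 *s phi2b S \<theta>) (beta S (mode2 S))"

definition Bz :: "('x::{real_inner,banach}, 'm::finite) reduction \<Rightarrow> complex^3 \<Rightarrow> complex^3" where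
  "Bz S z = vector [0, \<i> * complex_of_real (om0 S) * z $ 2, - \<i> * complex_of_real (om0 S) * z $ 3]"

definition F2 :: "('x::{real_inner,banach}, 'm::finite) reduction \<Rightarrow>
    (real \<Rightarrow> 'x^'m) \<Rightarrow> real^2 \<Rightarrow> 'x^'m" where
  "F2 S v \<alpha> = L1 S \<alpha> (hist S v) + diagX (D1 S \<alpha>) (lap S (v 0)) + Qop S (hist S v) (hist S v)"

definition F3 :: "('x::{real_inner,banach}, 'm::finite) reduction \<Rightarrow> (real \<Rightarrow> 'x^'m) \<Rightarrow> 'x^'m" where
  "F3 S v = Cop S (hist S v) (hist S v) (hist S v)"

definition modes :: "('x::{real_inner,banach}, 'm::finite) reduction \<Rightarrow> 'x^'m \<Rightarrow> complex^3" where
  "modes S u = vector [psi1 S 0 \<odot> coef S (mode1 S) u,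
     psi2 S 0 \<odot> coef S (mode2 S) u, psi2b S 0 \<odot> coef S (mode2 S) u]"

text \<open>\<open>f\<^sub>2\<^sup>1(z,y,\<alpha>)\<close>, \<open>f\<^sub>3\<^sup>1(z,0,0)\<close> and \<open>f\<^sub>2\<^sup>2(z,y,\<alpha>)\<close>.\<close>

definition f21 :: "('x::{real_inner,banach}, 'm::finite) reduction \<Rightarrow>
    complex^3 \<Rightarrow> (real \<Rightarrow> 'x^'m) \<Rightarrow> real^2 \<Rightarrow> complex^3" where
  "f21 S z y \<alpha> = modes S (F2 S (\<lambda>\<theta>. wz S z \<theta> + y \<theta>) \<alpha>)"

definition f31 :: "('x::{real_inner,banach}, 'm::finite) reduction \<Rightarrow> complex^3 \<Rightarrow> complex^3" where
  "f31 S z = modes S (F3 S (wz S z))"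

definition f22 :: "('x::{real_inner,banach}, 'm::finite) reduction \<Rightarrow>
    complex^3 \<Rightarrow> (real \<Rightarrow> 'x^'m) \<Rightarrow> real^2 \<Rightarrow> real \<Rightarrow> 'x^'m" where
  "f22 S z y \<alpha> \<theta> =
     (let F = X\<^sub>0 (F2 S (\<lambda>\<theta>. wz S z \<theta> + y \<theta>) \<alpha>) in F \<theta> - pi_proj S F \<theta>)"


section \<open>Normal form\<close>

text \<open>An exponent \<open>(a,b,c,d,e)\<close> stands for the monomial
  \<open>z\<^sub>1\<^sup>a z\<^sub>2\<^sup>b z\<^sub>3\<^sup>c \<alpha>\<^sub>1\<^sup>d \<alpha>\<^sub>2\<^sup>e\<close>.\<close>

type_synonym expo = "nat \<times> nat \<times> nat \<times> nat \<times> nat"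

definition expos :: "nat \<Rightarrow> expo set" where
  "expos n = {(a, b, c, d, e). a + b + c + d + e = n}"

definition monom_fn :: "expo \<Rightarrow> complex^3 \<Rightarrow> real^2 \<Rightarrow> complex" where
  "monom_fn = (\<lambda>(a, b, c, d, e) z \<alpha>.
     z $ 1 ^ a * z $ 2 ^ b * z $ 3 ^ c * complex_of_real (\<alpha> $ 1 ^ d * \<alpha> $ 2 ^ e))"

definition hom_poly :: "nat \<Rightarrow> (complex^3 \<Rightarrow> real^2 \<Rightarrow> complex^3) \<Rightarrow>
    (3 \<Rightarrow> expo \<Rightarrow> complex) \<Rightarrow> bool" where
  "hom_poly n p c \<longleftrightarrow> (\<forall>z \<alpha> i. p z \<alpha> $ i = (\<Sum>e\<in>expos n. c i e * monom_fn e z \<alpha>))"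

text \<open>The monomials spanning, in each component, the chosen complement of the image of
  \<open>M\<^sub>2\<^sup>1\<close> (degree 2) and \<open>M\<^sub>3\<^sup>1\<close> (degree 3, \<open>\<alpha> = 0\<close>).\<close>

definition resonant :: "nat \<Rightarrow> 3 \<Rightarrow> expo set" where
  "resonant n i =
     (if n = 2 then
        (if i = 1 then {(2,0,0,0,0), (0,1,1,0,0), (1,0,0,1,0), (1,0,0,0,1)}
         else if i = 2 then {(1,1,0,0,0), (0,1,0,1,0), (0,1,0,0,1)}
         else {(1,0,1,0,0), (0,0,1,1,0), (0,0,1,0,1)})
      else if n = 3 then
        (if i = 1 then {(3,0,0,0,0), (1,1,1,0,0)}
         else if i = 2 then {(2,1,0,0,0), (0,2,1,0,0)}
         else {(2,0,1,0,0), (0,1,2,0,0)})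
      else {})"

definition Proj :: "nat \<Rightarrow> (complex^3 \<Rightarrow> real^2 \<Rightarrow> complex^3) \<Rightarrow>
    complex^3 \<Rightarrow> real^2 \<Rightarrow> complex^3" where
  "Proj n p z \<alpha> =
     (let c = (SOME c. hom_poly n p c) in \<chi> i. \<Sum>e\<in>resonant n i. c i e * monom_fn e z \<alpha>)"

definition M1 :: "('x::{real_inner,banach}, 'm::finite) reduction \<Rightarrow>
    (complex^3 \<Rightarrow> complex^3) \<Rightarrow> complex^3 \<Rightarrow> complex^3" where
  "M1 S p z = frechet_derivative p (at z) (Bz S z) - Bz S (p z)"

definition is_U21 :: "('x::{real_inner,banach}, 'm::finite) reduction \<Rightarrow>
    (complex^3 \<Rightarrow> complex^3) \<Rightarrow> bool" where
  "is_U21 S U \<longleftrightarrow>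
     (\<exists>c. hom_poly 2 (\<lambda>z \<alpha>. U z) c \<and> (\<forall>i. \<forall>e\<in>resonant 2 i. c i e = 0)) \<and>
     (\<forall>z. M1 S U z = f21 S z (\<lambda>\<theta>. 0) 0 - Proj 2 (\<lambda>z \<alpha>. f21 S z (\<lambda>\<theta>. 0) 0) z 0)"

text \<open>\<open>h a b c\<close> is the coefficient of \<open>z\<^sub>1\<^sup>a z\<^sub>2\<^sup>b z\<^sub>3\<^sup>c\<close> in \<open>h(z)\<close>.\<close>

definition hz :: "('x::{real_inner,banach}, 'm::finite) reduction \<Rightarrow>
    (nat \<Rightarrow> nat \<Rightarrow> nat \<Rightarrow> real \<Rightarrow> 'x^'m) \<Rightarrow> complex^3 \<Rightarrow> real \<Rightarrow> 'x^'m" where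
  "hz S h z \<theta> =
     csc S (z $ 1 ^ 2) (h 2 0 0 \<theta>) + csc S (z $ 2 ^ 2) (h 0 2 0 \<theta>) + csc S (z $ 3 ^ 2) (h 0 0 2 \<theta>) +
     csc S (z $ 1 * z $ 2) (h 1 1 0 \<theta>) + csc S (z $ 1 * z $ 3) (h 1 0 1 \<theta>) +
     csc S (z $ 2 * z $ 3) (h 0 1 1 \<theta>)"

definition is_h :: "('x::{real_inner,banach}, 'm::finite) reduction \<Rightarrow>
    (nat \<Rightarrow> nat \<Rightarrow> nat \<Rightarrow> real \<Rightarrow> 'x^'m) \<Rightarrow> bool" where
  "is_h S h \<longleftrightarrow>
     {h 2 0 0, h 0 2 0, h 0 0 2, h 1 1 0, h 1 0 1, h 0 1 1} \<subseteq> Q1 S \<and>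
     (\<forall>z. \<forall>\<theta>\<in>I\<^sub>r S. frechet_derivative (\<lambda>z. hz S h z \<theta>) (at z) (Bz S z) - A1 S (hz S h z) \<theta> =
        (1 / 2) *\<^sub>R f22 S z (\<lambda>\<theta>. 0) 0 \<theta>)"

definition g21 :: "('x::{real_inner,banach}, 'm::finite) reduction \<Rightarrow>
    complex^3 \<Rightarrow> real^2 \<Rightarrow> complex^3" where
  "g21 S z \<alpha> = Proj 2 (\<lambda>z \<alpha>. f21 S z (\<lambda>\<theta>. 0) \<alpha>) z \<alpha>"

text \<open>\<open>(D\<^bsub>(z,y)\<^esub> f\<^sub>2\<^sup>1(z,y,0))\<^bsub>y=0\<^esub> U\<^sub>2(z)\<close> with \<open>U\<^sub>2 = (U\<^sub>2\<^sup>1, 2h)\<close>, as a directional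
  derivative.\<close>

definition Df21_U :: "('x::{real_inner,banach}, 'm::finite) reduction \<Rightarrow>
    (complex^3 \<Rightarrow> complex^3) \<Rightarrow> (nat \<Rightarrow> nat \<Rightarrow> nat \<Rightarrow> real \<Rightarrow> 'x^'m) \<Rightarrow>
    complex^3 \<Rightarrow> complex^3" where
  "Df21_U S U h z = vector_derivative
     (\<lambda>t. f21 S (z + t *\<^sub>R U z) (\<lambda>\<theta>. t *\<^sub>R (2 *\<^sub>R hz S h z \<theta>)) 0) (at 0)"

definition g31 :: "('x::{real_inner,banach}, 'm::finite) reduction \<Rightarrow>
    (complex^3 \<Rightarrow> complex^3) \<Rightarrow> (nat \<Rightarrow> nat \<Rightarrow> nat \<Rightarrow> real \<Rightarrow> 'x^'m) \<Rightarrow>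
    complex^3 \<Rightarrow> complex^3" where
  "g31 S U h z = Proj 3 (\<lambda>z \<alpha>. f31 S z + (3 / 2) *\<^sub>R
     (Df21_U S U h z - frechet_derivative U (at z) (g21 S z 0))) z 0"

text \<open>The right-hand side of the normal form on the center manifold, without the terms of
  order at least 4 in \<open>(z,\<alpha>)\<close> and those of order at least 3 that involve \<open>\<alpha>\<close>.\<close>

definition normal_form :: "('x::{real_inner,banach}, 'm::finite) reduction \<Rightarrow>
    (complex^3 \<Rightarrow> complex^3) \<Rightarrow> (nat \<Rightarrow> nat \<Rightarrow> nat \<Rightarrow> real \<Rightarrow> 'x^'m) \<Rightarrow>
    complex^3 \<Rightarrow> real^2 \<Rightarrow> complex^3" where
  "normal_form S U h z \<alpha> = Bz S z + (1 / 2) *\<^sub>R g21 S z \<alpha> + (1 / 6) *\<^sub>R g31 S U h z"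

definition a1 :: "('x::{real_inner,banach}, 'm::finite) reduction \<Rightarrow> real^2 \<Rightarrow> complex" where
  "a1 S \<alpha> = (1 / 2) * (psi1 S 0 \<odot>
     (L1h S \<alpha> (phi1 S) - diagC (mu S (mode1 S) *\<^sub>R D1 S \<alpha>) (phi1 S 0)))"

definition b2 :: "('x::{real_inner,banach}, 'm::finite) reduction \<Rightarrow> real^2 \<Rightarrow> complex" where
  "b2 S \<alpha> = (1 / 2) * (psi2 S 0 \<odot>
     (L1h S \<alpha> (phi2 S) - diagC (mu S (mode2 S) *\<^sub>R D1 S \<alpha>) (phi2 S 0)))"

text \<open>\<open>h\<^sub>q\<^sup>k = \<langle>h\<^sub>q, \<beta>\<^sub>k\<rangle>\<close>.\<close>

definition hmode :: "('x::{real_inner,banach}, 'm::finite) reduction \<Rightarrow>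
    (real \<Rightarrow> 'x^'m) \<Rightarrow> nat \<Rightarrow> real \<Rightarrow> complex^'m" where
  "hmode S hq k \<theta> = coef S k (hq \<theta>)"

end

theory Submission
  imports Defs "HOL-Computational_Algebra.Polynomial"
begin

text \<open>Write \<open>k = k\<^sub>1\<close> and \<open>w(z) = \<phi>\<^sub>1 z\<^sub>1 \<beta>\<^sub>k + (\<phi>\<^sub>2 z\<^sub>2 + \<phi>\<^sub>3 z\<^sub>3) \<beta>\<^sub>0\<close>, where \<open>\<phi>\<^sub>3\<close> is the conjugate of
  \<open>\<phi>\<^sub>2\<close> and \<open>z\<^sub>3\<close> stands for that of \<open>z\<^sub>2\<close>. The operators act pointwise in \<open>x\<close>, so \<open>Q(w,w)\<close> and
  \<open>C(w,w,w)\<close> are combinations of products of the cosines \<open>\<beta>\<^sub>0\<close> and \<open>\<beta>\<^sub>k\<close>, and the addition theorem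
  turns these into \<open>\<beta>\<^sub>0\<close>, \<open>\<beta>\<^sub>k\<close>, \<open>\<beta>\<^sub>2\<^sub>k\<close>, \<open>\<beta>\<^sub>3\<^sub>k\<close> (\<open>beta_square\<close>, \<open>beta_cube\<close>). In \<open>Q(w,w)\<close> the
  monomials \<open>z\<^sub>1 z\<^sub>2\<close> and \<open>z\<^sub>1 z\<^sub>3\<close> occur on mode \<open>k\<close> only, the other four on mode \<open>0\<close> (and \<open>z\<^sub>1\<^sup>2\<close> also
  on mode \<open>2k\<close>); see \<open>coef_QW\<close>. The first equation of the normal form reads off mode \<open>k\<close>, the other
  two read off mode \<open>0\<close>, so none of the resonant quadratic monomials \<open>z\<^sub>1\<^sup>2\<close>, \<open>z\<^sub>2 z\<^sub>3\<close> (first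
  equation), \<open>z\<^sub>1 z\<^sub>2\<close> (second), \<open>z\<^sub>1 z\<^sub>3\<close> (third) is present. This gives \<open>a\<^sub>1\<^sub>1 = a\<^sub>2\<^sub>3 = b\<^sub>1\<^sub>2 = 0\<close>, and it
  makes \<open>g\<^sub>2\<^sup>1(z,0,0)\<close> vanish.

  Consequently the cubic part of the normal form is the resonant part of
  \<open>C(w,w,w) + 3 Q(w, w(U)) + 6 Q(w,h)\<close> (\<open>cubic_terms\<close>). The coefficients of \<open>U\<close> arise from those of
  \<open>Q(w,w)\<close> by division by \<open>\<plusminus>i\<omega>\<^sub>0\<close> or \<open>\<plusminus>3i\<omega>\<^sub>0\<close> (\<open>U_coefficients\<close>). In \<open>Q(w,h)\<close> only the Fourier
  coefficients of \<open>h\<close> on the modes \<open>0\<close>, \<open>k\<close>, \<open>2k\<close> are felt (\<open>coef_Q_hist\<close>). Collecting the resonant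
  monomials of degree 3 gives the cubic coefficients (\<open>g31_nth\<close>).

  The functions \<open>h\<close> are found mode by mode. The homological equation, projected to one mode and
  one monomial in \<open>z\<close>, is the boundary value problem \<open>v' = \<lambda>v + P/2\<close> on \<open>[-r,0)\<close>,
  \<open>\<lambda>v(0) - (L\<^sub>0 v - \<mu>\<^sub>k D\<^sub>0 v(0)) = (F - P(0))/2\<close> with \<open>\<lambda>\<close> one of \<open>0\<close>, \<open>\<plusminus>i\<omega>\<^sub>0\<close>, \<open>\<plusminus>2i\<omega>\<^sub>0\<close>, where \<open>F\<close> is a
  coefficient of \<open>Q(w,w)\<close> and \<open>P\<close> a combination of the critical eigenfunctions (\<open>h_solves\<close>). The
  difference of two solutions is \<open>e\<^sup>\<lambda>\<^sup>\<theta> c\<close> with \<open>c\<close> in the kernel of the characteristic matrix at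
  \<open>\<lambda>\<close>, and (H4) makes that matrix invertible on the modes in question (\<open>solves_unique\<close>,
  \<open>M_invertible\<close>). So it suffices to verify that the stated formulas are solutions: an
  eigenfunction to the eigenvalue \<open>\<xi>\<close> in \<open>P\<close> contributes itself divided by \<open>2(\<xi> - \<lambda>)\<close>, and \<open>F\<close>
  contributes \<open>e\<^sup>\<lambda>\<^sup>\<theta>\<close> times half the inverse of the characteristic matrix applied to \<open>F\<close>.

  Three facts carry this computation. First, pointwise action is postulated for histories of the
  form \<open>\<phi>(\<theta>) u\<close>, whereas \<open>h\<close> is an arbitrary continuous history; sums of such products are dense in
  \<open>C([-r,0]; X\<^sup>m)\<close>, so identities between bounded operators extend (\<open>tensor_induct\<close>,
  \<open>pointwise_transfer\<close>). Second, the Neumann Laplacian multiplies the \<open>k\<close>-th Fourier coefficient by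
  \<open>-\<mu>\<^sub>k\<close> (\<open>coef_lap\<close>), which is integration by parts against a cosine, done with cutoff functions as
  the derivatives are weak. Third, \<open>Q\<close> and \<open>C\<close> are real on real functions, because \<open>G\<close> is and they
  are its Taylor coefficients (\<open>diagonal_real\<close>); hence the third equation of the normal form is the
  conjugate of the second.\<close>

section \<open>Vectors and matrices over the complex numbers\<close>

lemma cnjv_nth [simp]: "cnjv v $ i = cnj (v $ i)"
  by (simp add: cnjv_def)

lemma cnjv_cnjv [simp]: "cnjv (cnjv v) = v"
  by (simp add: vec_eq_iff)

lemma cnjv_add: "cnjv (u + v) = cnjv u + cnjv v"
  by (simp add: vec_eq_iff)

lemma cnjv_diff: "cnjv (u - v) = cnjv u - cnjv v"
  by (simp add: vec_eq_iff)

lemma cnjv_smult: "cnjv (c *s v) = cnj c *s cnjv v"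
  by (simp add: vec_eq_iff)

lemma bounded_linear_cnjv: "bounded_linear cnjv"
  by (rule bounded_linear_intro[where K=1])
    (simp_all add: cnjv_add vec_eq_iff norm_vec_def)

lemma bounded_linear_smult: "bounded_linear (\<lambda>v. c *s v :: complex^'m)"
  by (rule bounded_linear_intro[where K="cmod c"])
    (simp_all add: vector_add_ldistrib vec_eq_iff norm_vec_def norm_mult L2_set_right_distrib mult.commute)

lemma continuous_cnjv: "continuous_on A \<phi> \<Longrightarrow> continuous_on A (\<lambda>\<theta>. cnjv (\<phi> \<theta>))"
  using bounded_linear.continuous_on[OF bounded_linear_cnjv] .

lemma continuous_smult_const:
  fixes \<phi> :: "real \<Rightarrow> complex^'m"
  shows "continuous_on A \<phi> \<Longrightarrow> continuous_on A (\<lambda>\<theta>. c *s \<phi> \<theta>)"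
  using bounded_linear.continuous_on[OF bounded_linear_smult] .

lemma bounded_linear_smult_left: "bounded_linear (\<lambda>t. t *s c :: complex^'n)"
  by (rule bounded_linear_intro[where K="norm c"])
    (simp_all add: vec_eq_iff distrib_right norm_vec_def norm_mult L2_set_right_distrib)

lemma continuous_smult:
  fixes \<phi> :: "real \<Rightarrow> complex^'k"
  assumes "continuous_on A \<phi>" "continuous_on A f"
  shows "continuous_on A (\<lambda>\<theta>. f \<theta> *s \<phi> \<theta>)"
  unfolding vector_scalar_mult_def using assms
  by (intro continuous_on_vec_lambda continuous_intros)

text \<open>A complex-linear map is determined by its values on real functions, since
  \<open>\<phi> = Re \<phi> + i Im \<phi>\<close>; so a relation of conjugation between two such maps need only be known there.\<close>

lemma conj_extend:
  fixes F F' :: "(real \<Rightarrow> complex^'m) \<Rightarrow> complex^'n"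
  assumes add: "\<And>\<phi> \<psi>. continuous_on I \<phi> \<Longrightarrow> continuous_on I \<psi> \<Longrightarrow> F (\<lambda>\<theta>. \<phi> \<theta> + \<psi> \<theta>) = F \<phi> + F \<psi>"
    and smult: "\<And>c \<phi>. continuous_on I \<phi> \<Longrightarrow> F (\<lambda>\<theta>. c *s \<phi> \<theta>) = c *s F \<phi>"
    and add': "\<And>\<phi> \<psi>. continuous_on I \<phi> \<Longrightarrow> continuous_on I \<psi> \<Longrightarrow> F' (\<lambda>\<theta>. \<phi> \<theta> + \<psi> \<theta>) = F' \<phi> + F' \<psi>"
    and smult': "\<And>c \<phi>. continuous_on I \<phi> \<Longrightarrow> F' (\<lambda>\<theta>. c *s \<phi> \<theta>) = c *s F' \<phi>"
    and real: "\<And>\<phi>. continuous_on I \<phi> \<Longrightarrow> (\<And>\<theta>. cnjv (\<phi> \<theta>) = \<phi> \<theta>) \<Longrightarrow> F' \<phi> = cnjv (F \<phi>)"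
    and \<phi>: "continuous_on I \<phi>"
  shows "F' (\<lambda>\<theta>. cnjv (\<phi> \<theta>)) = cnjv (F \<phi>)"
proof -
  define a where "a \<theta> = (1/2) *s (\<phi> \<theta> + cnjv (\<phi> \<theta>))" for \<theta>
  define b where "b \<theta> = (1/(2*\<i>)) *s (\<phi> \<theta> - cnjv (\<phi> \<theta>))" for \<theta>
  have c: "continuous_on I a" "continuous_on I b"
    unfolding a_def b_def by (intro continuous_smult_const continuous_intros continuous_cnjv \<phi>)+
  have r: "cnjv (a \<theta>) = a \<theta>" "cnjv (b \<theta>) = b \<theta>" for \<theta>
    by (simp_all add: a_def b_def vec_eq_iff field_simps)
  have 1: "\<phi> = (\<lambda>\<theta>. a \<theta> + \<i> *s b \<theta>)" "(\<lambda>\<theta>. cnjv (\<phi> \<theta>)) = (\<lambda>\<theta>. a \<theta> + (-\<i>) *s b \<theta>)"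
    by (auto simp: a_def b_def vec_eq_iff fun_eq_iff field_simps)
  have "F' (\<lambda>\<theta>. cnjv (\<phi> \<theta>)) = F' a + (-\<i>) *s F' b"
    unfolding 1(2) by (simp only: add' smult' c continuous_smult_const)
  also have "\<dots> = cnjv (F a + \<i> *s F b)"
    using real[OF c(1) r(1)] real[OF c(2) r(2)] by (simp add: cnjv_add cnjv_smult)
  also have "F a + \<i> *s F b = F \<phi>"
    unfolding 1(1) using c by (subst add) (auto intro: continuous_smult_const simp: smult)
  finally show ?thesis .
qed

lemma rdot_add: "p \<odot> (u + v) = (p \<odot> u) + (p \<odot> v)"
  by (simp add: rdot_def distrib_left sum.distrib)

lemma rdot_diff: "p \<odot> (u - v) = (p \<odot> u) - (p \<odot> v)"
  by (simp add: rdot_def right_diff_distrib sum_subtractf)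

lemma rdot_smult: "p \<odot> (c *s u) = c * (p \<odot> u)"
  by (simp add: rdot_def sum_distrib_left mult_ac)

lemma rdot_scaleR: "p \<odot> (a *\<^sub>R u) = a *\<^sub>R (p \<odot> u)"
  by (simp add: rdot_def scaleR_sum_right)

lemma rdot_zero [simp]: "p \<odot> 0 = 0"
  by (simp add: rdot_def)

lemma rdot_cnj: "cnjv p \<odot> cnjv u = cnj (p \<odot> u)"
  by (simp add: rdot_def)

lemma rdot_minus: "p \<odot> (- v) = - (p \<odot> v)"
  by (simp add: rdot_def sum_negf)

lemma linear_rdot: "linear (\<lambda>v. p \<odot> v)"
  by (rule linearI) (simp_all add: rdot_add rdot_scaleR)

lemma outer_mult: "outer v p *v x = (p \<odot> x) *s v"
  by (simp add: outer_def matrix_vector_mult_def rdot_def vec_eq_iff sum_distrib_left mult_ac)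

lemma smult_scaleR: "a *\<^sub>R v = complex_of_real a *s v" for v :: "complex^'n"
  by (simp add: vec_eq_iff scaleR_conv_of_real[where 'a=complex])

lemma invertible_iff_ker: "invertible A \<longleftrightarrow> (\<forall>x. A *v x = 0 \<longrightarrow> x = 0)" for A :: "complex^'n^'n"
  by (simp add: invertible_left_inverse matrix_left_invertible_ker)

lemma matrix_inv_solve:
  fixes A :: "complex^'n^'n"
  assumes "invertible A"
  shows "A *v (matrix_inv A *v x) = x"
proof -
  have "A ** matrix_inv A = mat 1"
    using someI_ex[OF assms[unfolded invertible_def]] unfolding matrix_inv_def by blast
  then show ?thesis by (simp add: matrix_vector_mul_assoc)
qed

lemma sum_smult_axis: "(\<Sum>j\<in>UNIV. c $ j *s (a *s axis j 1)) = a *s c" for c :: "complex^'n"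
proof -
  have "c $ j * (a * axis j 1 $ i) = (if j = i then a * c $ i else 0)" for i j
    by (simp add: axis_def)
  then show ?thesis by (simp only: vec_eq_iff sum_component vector_smult_component) simp
qed

lemma mat_mult_vec: "mat a *v c = a *s c" for c :: "complex^'n"
proof -
  have "mat a $ i $ j * c $ j = (if j = i then a * c $ i else 0)" for i j
    by (simp add: mat_def)
  then show ?thesis by (simp add: vec_eq_iff matrix_vector_mult_def)
qed

lemma Re_mat_mult: "Re_mat A *v x = (1/2) *s (A *v x + (\<chi> i j. cnj (A $ i $ j)) *v x)"
proof -
  have "complex_of_real (Re w) = (w + cnj w) / 2" for w by (simp add: complex_eq_iff)
  then show ?thesis
    by (simp add: Re_mat_def matrix_vector_mult_def vec_eq_iff sum.distrib[symmetric] sum_divide_distrib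
        distrib_right add_divide_distrib)
qed

lemma cnj_outer: "(\<chi> i j. cnj (outer v p $ i $ j)) = outer (cnjv v) (cnjv p)"
  by (simp add: outer_def vec_eq_iff)

lemma scaleR_outer: "a *\<^sub>R outer v p = outer (complex_of_real a *s v) p"
  by (simp add: outer_def vec_eq_iff scaleR_conv_of_real[where 'a=complex] mult.assoc)

lemma minus_outer: "- outer v p = outer (- v) p"
  by (simp add: outer_def vec_eq_iff)

section \<open>Homogeneous polynomials and their resonant parts\<close>

text \<open>Polynomials in \<open>(z,\<alpha>)\<close> are written as lists of exponents and coefficients. An exponent may
  be repeated, so that sums of polynomials are concatenations and no monomials have to be
  collected until a single coefficient is asked for.\<close>

definition mcoeff :: "(expo \<times> complex) list \<Rightarrow> expo \<Rightarrow> complex" where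
  "mcoeff L e = (\<Sum>(e', a)\<leftarrow>L. if e' = e then a else 0)"

definition meval :: "(expo \<times> complex) list \<Rightarrow> complex^3 \<Rightarrow> real^2 \<Rightarrow> complex" where
  "meval L z \<alpha> = (\<Sum>(e, a)\<leftarrow>L. a * monom_fn e z \<alpha>)"

lemma mcoeff_simps [simp]:
  "mcoeff [] e = 0" "mcoeff ((e', a) # L) e = (if e' = e then a else 0) + mcoeff L e"
  "mcoeff (L @ L') e = mcoeff L e + mcoeff L' e"
  by (simp_all add: mcoeff_def)

lemma meval_simps [simp]:
  "meval [] z \<alpha> = 0" "meval ((e, a) # L) z \<alpha> = a * monom_fn e z \<alpha> + meval L z \<alpha>"
  "meval (L @ L') z \<alpha> = meval L z \<alpha> + meval L' z \<alpha>"
  by (simp_all add: meval_def)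

lemma finite_expos: "finite (expos n)"
proof (rule finite_subset)
  show "expos n \<subseteq> {..n} \<times> {..n} \<times> {..n} \<times> {..n} \<times> {..n}"
    by (auto simp: expos_def)
qed simp

lemma meval_eq_sum:
  assumes "fst ` set L \<subseteq> expos n"
  shows "meval L z \<alpha> = (\<Sum>e\<in>expos n. mcoeff L e * monom_fn e z \<alpha>)"
  using assms
proof (induction L)
  case (Cons x L)
  obtain e a where x: "x = (e, a)" by fastforce
  have "(\<Sum>e'\<in>expos n. (if e = e' then a else 0) * monom_fn e' z \<alpha>) =
      (\<Sum>e'\<in>expos n. if e = e' then a * monom_fn e z \<alpha> else 0)"
    by (intro sum.cong) auto
  also have "\<dots> = a * monom_fn e z \<alpha>"
    using Cons.prems finite_expos by (simp add: x)
  finally show ?case using Cons by (simp add: x distrib_right sum.distrib)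
qed simp

text \<open>The exponents read as the digits of a number in base 4, which are unambiguous in degree
  at most 3.\<close>

definition code :: "expo \<Rightarrow> nat" where
  "code = (\<lambda>(a, b, c, d, e). a + 4 * (b + 4 * (c + 4 * (d + 4 * e))))"

lemma code_inj:
  assumes "n < 4"
  shows "inj_on code (expos n)"
proof -
  have digit: "a + 4 * x = a' + 4 * x' \<Longrightarrow> a < 4 \<Longrightarrow> a' < 4 \<Longrightarrow> a = a' \<and> x = x'" for a x a' x' :: nat
    by presburger
  show ?thesis
  proof (rule inj_onI)
    fix x y assume "x \<in> expos n" "y \<in> expos n" and eq: "code x = code y"
    then obtain a b c d e a' b' c' d' e' where xy: "x = (a, b, c, d, e)" "y = (a', b', c', d', e')"
      and "a + b + c + d + e = n" "a' + b' + c' + d' + e' = n"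
      by (auto simp: expos_def)
    then have lt: "a < 4" "a' < 4" "b < 4" "b' < 4" "c < 4" "c' < 4" "d < 4" "d' < 4"
      using assms by linarith+
    have "a + 4 * (b + 4 * (c + 4 * (d + 4 * e))) = a' + 4 * (b' + 4 * (c' + 4 * (d' + 4 * e')))"
      using eq by (simp add: xy code_def)
    note 1 = digit[OF this lt(1,2)]
    note 2 = digit[OF conjunct2[OF 1] lt(3,4)]
    note 3 = digit[OF conjunct2[OF 2] lt(5,6)]
    note 4 = digit[OF conjunct2[OF 3] lt(7,8)]
    show "x = y" using 1 2 3 4 by (simp add: xy)
  qed
qed

text \<open>Kronecker substitution: on this curve the monomial with exponent \<open>e\<close> takes the value
  \<open>t ^ code e\<close>, so a polynomial in five variables becomes one in \<open>t\<close> with the same coefficients.\<close>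

definition curve_z :: "real \<Rightarrow> complex^3" where
  "curve_z t = vector [complex_of_real t, complex_of_real t ^ 4, complex_of_real t ^ 16]"

definition curve_\<alpha> :: "real \<Rightarrow> real^2" where
  "curve_\<alpha> t = vector [t ^ 64, t ^ 256]"

lemma monom_fn_curve: "monom_fn e (curve_z t) (curve_\<alpha> t) = complex_of_real t ^ code e"
  by (cases e) (simp add: monom_fn_def curve_z_def curve_\<alpha>_def code_def vector_3 vector_2
      power_mult[symmetric] power_add[symmetric] algebra_simps)

text \<open>The difference of two representations vanishes along the Kronecker curve, hence is a
  polynomial in \<open>t\<close> with infinitely many zeros. This makes the choice of coefficients in \<open>Proj\<close>
  harmless.\<close>

lemma hom_poly_unique:
  assumes n: "n < 4" and c: "hom_poly n p c" and d: "hom_poly n p d" and e: "e \<in> expos n"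
  shows "c i e = d i e"
proof -
  (* The difference of the two polynomials along the Kronecker curve. *)
  define q where "q = (\<Sum>e\<in>expos n. Polynomial.monom (c i e - d i e) (code e))"
  have "poly q (complex_of_real t) = 0" for t
  proof -
    have "poly q (complex_of_real t) = (\<Sum>e\<in>expos n. (c i e - d i e) * monom_fn e (curve_z t) (curve_\<alpha> t))"
      by (simp add: q_def poly_sum poly_monom monom_fn_curve)
    also have "\<dots> = p (curve_z t) (curve_\<alpha> t) $ i - p (curve_z t) (curve_\<alpha> t) $ i"
      using c d unfolding hom_poly_def by (simp add: left_diff_distrib sum_subtractf)
    finally show ?thesis by simp
  qed
  then have "range complex_of_real \<subseteq> {x. poly q x = 0}" by auto
  moreover have "infinite (range complex_of_real)"
    using infinite_UNIV_char_0[where 'a=real] by (simp add: finite_image_iff inj_of_real)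
  ultimately have "q = 0" using poly_roots_finite finite_subset by blast
  have "coeff q (code e) = (\<Sum>e'\<in>expos n. if e = e' then c i e' - d i e' else 0)"
    unfolding q_def coeff_sum coeff_monom
    using inj_onD[OF code_inj[OF n]] e by (intro sum.cong) auto
  also have "\<dots> = c i e - d i e" using e finite_expos by simp
  finally show ?thesis using \<open>q = 0\<close> by simp
qed

lemma Proj_eq:
  assumes n: "n = 2 \<or> n = 3"
    and p: "\<And>z \<alpha> i. p z \<alpha> $ i = meval (L i) z \<alpha>" and L: "\<And>i. fst ` set (L i) \<subseteq> expos n"
  shows "Proj n p z \<alpha> $ i = (\<Sum>e\<in>resonant n i. mcoeff (L i) e * monom_fn e z \<alpha>)"
proof -
  have 1: "hom_poly n p (\<lambda>i. mcoeff (L i))"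
    unfolding hom_poly_def
  proof (intro allI)
    fix z \<alpha> i
    show "p z \<alpha> $ i = (\<Sum>e\<in>expos n. mcoeff (L i) e * monom_fn e z \<alpha>)"
      unfolding p by (rule meval_eq_sum[OF L])
  qed
  then have 2: "hom_poly n p (SOME c. hom_poly n p c)" by (rule someI[of "hom_poly n p"])
  have res: "resonant n i \<subseteq> expos n"
    using n by (elim disjE) (simp_all add: resonant_def expos_def)
  have "(SOME c. hom_poly n p c) i e = mcoeff (L i) e" if "e \<in> resonant n i" for e
    by (rule hom_poly_unique[OF _ 2 1]) (use n res that in auto)
  then show ?thesis unfolding Proj_def Let_def by simp
qed

text \<open>The quadratic form in \<open>z\<close> with coefficients at \<open>z\<^sub>1\<^sup>2\<close>, \<open>z\<^sub>2\<^sup>2\<close>, \<open>z\<^sub>3\<^sup>2\<close>, \<open>z\<^sub>1 z\<^sub>2\<close>, \<open>z\<^sub>1 z\<^sub>3\<close>, \<open>z\<^sub>2 z\<^sub>3\<close>,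
  always listed in this order.\<close>

definition quad :: "complex^'n \<Rightarrow> complex^'n \<Rightarrow> complex^'n \<Rightarrow> complex^'n \<Rightarrow> complex^'n \<Rightarrow> complex^'n \<Rightarrow>
    complex^3 \<Rightarrow> complex^'n" where
  "quad a b c d e f z = (z $ 1 ^ 2) *s a + (z $ 2 ^ 2) *s b + (z $ 3 ^ 2) *s c +
     (z $ 1 * z $ 2) *s d + (z $ 1 * z $ 3) *s e + (z $ 2 * z $ 3) *s f"

lemma quad_eqD:
  assumes "\<And>z. quad a b c d e f z = quad a' b' c' d' e' f' z"
  shows "a = a'" "b = b'" "c = c'" "d = d'" "e = e'" "f = f'"
proof -
  have 1: "a = a'" using assms[of "vector [1, 0, 0]"] by (simp add: quad_def vector_3)
  have 2: "b = b'" using assms[of "vector [0, 1, 0]"] by (simp add: quad_def vector_3)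
  have 3: "c = c'" using assms[of "vector [0, 0, 1]"] by (simp add: quad_def vector_3)
  show "d = d'" using assms[of "vector [1, 1, 0]"] 1 2 by (simp add: quad_def vector_3)
  show "e = e'" using assms[of "vector [1, 0, 1]"] 1 3 by (simp add: quad_def vector_3)
  show "f = f'" using assms[of "vector [0, 1, 1]"] 2 3 by (simp add: quad_def vector_3)
  show "a = a'" "b = b'" "c = c'" by fact+
qed

lemma quad_add:
  "quad a b c d e f z + quad a' b' c' d' e' f' z =
    quad (a + a') (b + b') (c + c') (d + d') (e + e') (f + f') z"
  by (simp add: quad_def vec_eq_iff algebra_simps)

lemma quad_diff:
  "quad a b c d e f z - quad a' b' c' d' e' f' z =
    quad (a - a') (b - b') (c - c') (d - d') (e - e') (f - f') z"
  by (simp add: quad_def vec_eq_iff algebra_simps)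

lemma quad_smult:
  "s *s quad a b c d e f z = quad (s *s a) (s *s b) (s *s c) (s *s d) (s *s e) (s *s f) z"
  by (simp add: quad_def vec_eq_iff algebra_simps)

lemma monomial_derivs:
  "((\<lambda>z::complex^3. z $ i ^ 2) has_derivative (\<lambda>w. 2 * z $ i * w $ i)) (at z)"
  "((\<lambda>z::complex^3. z $ i * z $ j) has_derivative (\<lambda>w. z $ i * w $ j + w $ i * z $ j)) (at z)"
proof -
  have n: "((\<lambda>z::complex^3. z $ i) has_derivative (\<lambda>w. w $ i)) (at z)" for i
    by (rule bounded_linear_imp_has_derivative[OF bounded_linear_vec_nth])
  show 1: "((\<lambda>z::complex^3. z $ i * z $ j) has_derivative (\<lambda>w. z $ i * w $ j + w $ i * z $ j)) (at z)" for i j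
    by (rule has_derivative_mult[OF n n])
  show "((\<lambda>z::complex^3. z $ i ^ 2) has_derivative (\<lambda>w. 2 * z $ i * w $ i)) (at z)"
    using 1[of i i] by (simp add: power2_eq_square mult_ac)
qed

lemma quad_has_derivative:
  "(quad a b c d e f has_derivative (\<lambda>w. (2 * z $ 1 * w $ 1) *s a + (2 * z $ 2 * w $ 2) *s b +
     (2 * z $ 3 * w $ 3) *s c + (z $ 1 * w $ 2 + w $ 1 * z $ 2) *s d +
     (z $ 1 * w $ 3 + w $ 1 * z $ 3) *s e + (z $ 2 * w $ 3 + w $ 2 * z $ 3) *s f)) (at z)"
  unfolding quad_def[abs_def]
  by (intro has_derivative_add bounded_linear.has_derivative[OF bounded_linear_smult_left] monomial_derivs)

definition squad :: "complex \<Rightarrow> complex \<Rightarrow> complex \<Rightarrow> complex \<Rightarrow> complex \<Rightarrow> complex \<Rightarrow> complex^3 \<Rightarrow> complex" where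
  "squad a b c d e f z = z $ 1 ^ 2 * a + z $ 2 ^ 2 * b + z $ 3 ^ 2 * c +
     z $ 1 * z $ 2 * d + z $ 1 * z $ 3 * e + z $ 2 * z $ 3 * f"

lemma quad_nth: "quad a b c d e f z $ i = squad (a $ i) (b $ i) (c $ i) (d $ i) (e $ i) (f $ i) z"
  by (simp add: quad_def squad_def)

lemma rdot_quad: "p \<odot> quad a b c d e f z = squad (p \<odot> a) (p \<odot> b) (p \<odot> c) (p \<odot> d) (p \<odot> e) (p \<odot> f) z"
  by (simp add: quad_def squad_def rdot_add rdot_smult)

text \<open>The list of monomials of \<open>s z\<^sub>1\<^sup>x z\<^sub>2\<^sup>y z\<^sub>3\<^sup>w\<close> times the quadratic form with coefficients
  \<open>a, \<dots>, f\<close>; all cubic terms coming from \<open>Q\<close> have this shape with \<open>x + y + w = 1\<close>.\<close>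

definition cub :: "nat \<Rightarrow> nat \<Rightarrow> nat \<Rightarrow> complex \<Rightarrow> complex \<Rightarrow> complex \<Rightarrow> complex \<Rightarrow> complex \<Rightarrow> complex \<Rightarrow> complex \<Rightarrow>
    (expo \<times> complex) list" where
  "cub x y w s a b c d e f = [((x + 2, y, w, 0, 0), s * a), ((x, y + 2, w, 0, 0), s * b),
     ((x, y, w + 2, 0, 0), s * c), ((x + 1, y + 1, w, 0, 0), s * d), ((x + 1, y, w + 1, 0, 0), s * e),
     ((x, y + 1, w + 1, 0, 0), s * f)]"

lemma meval_cub:
  "meval (cub x y w s a b c d e f) z \<alpha> = s * (z $ 1 ^ x * z $ 2 ^ y * z $ 3 ^ w) * squad a b c d e f z"
  by (simp add: cub_def monom_fn_def squad_def power_add power2_eq_square algebra_simps)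

lemma linear_expand:
  fixes g :: "real^2 \<Rightarrow> complex"
  assumes "linear g"
  shows "g \<alpha> = complex_of_real (\<alpha> $ 1) * g (axis 1 1) + complex_of_real (\<alpha> $ 2) * g (axis 2 1)"
proof -
  have "\<alpha> = (\<alpha> $ 1) *\<^sub>R axis 1 1 + (\<alpha> $ 2) *\<^sub>R axis 2 1"
    by (simp add: vec_eq_iff forall_2 axis_def)
  then have "g \<alpha> = g ((\<alpha> $ 1) *\<^sub>R axis 1 1 + (\<alpha> $ 2) *\<^sub>R axis 2 1)" by simp
  then show ?thesis
    by (simp only: linear_add[OF assms] linear_cmul[OF assms] scaleR_conv_of_real[where 'a=complex])
qed

section \<open>The function space and its Fourier coefficients\<close>

locale neumann_space =
  fixes S :: "('x::{real_inner,banach}, 'm::finite, 'z) pfde_scheme"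
  assumes len_pos: "len S > 0" and space: "func_space S"
begin

lemma val_measurable [measurable]: "val S u \<in> borel_measurable (Om S)"
  and val_square_integrable: "integrable (Om S) (\<lambda>x. (cmod (val S u x))\<^sup>2)"
  and val_add: "AE x in Om S. val S (u + v) x = val S u x + val S v x"
  and val_scaleR: "AE x in Om S. val S (a *\<^sub>R u) x = complex_of_real a * val S u x"
  and val_eq_0: "AE x in Om S. val S u x = 0 \<Longrightarrow> u = 0"
  and ex_val_mult: "\<exists>w. (AE x in Om S. val S w x = c * val S u x) \<and> norm w = cmod c * norm u"
  and ip_bound: "\<exists>K. \<forall>u. cmod (ip S (val S u) (val S u)) \<le> K * (norm u)\<^sup>2"
  and ex_val_beta: "\<exists>u. AE x in Om S. val S u x = beta S k x"
  using space unfolding func_space_def by auto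

lemma finite_Om: "finite_measure (Om S)"
  unfolding Om_def by (rule finite_measure_lebesgue_on) simp

lemma val_inj:
  assumes "AE x in Om S. val S u x = val S v x"
  shows "u = v"
proof -
  have "AE x in Om S. val S (u + (-1) *\<^sub>R v) x = 0"
    using assms val_add[of u "(-1) *\<^sub>R v"] val_scaleR[of "-1" v] by eventually_elim simp
  from val_eq_0[OF this] show ?thesis by simp
qed

text \<open>Elements of \<open>X\<close> are determined by their values almost everywhere, so \<open>rep\<close>, which is a
  definite description, returns any element that has been found to represent a function.\<close>

lemma rep_eq: "AE x in Om S. val S u x = f x \<Longrightarrow> rep S f = u"
  unfolding rep_def
proof (rule the_equality)
  fix v assume "AE x in Om S. val S u x = f x" "AE x in Om S. val S v x = f x"
  then have "AE x in Om S. val S v x = val S u x" by eventually_elim simp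
  then show "v = u" by (rule val_inj)
qed

lemma val_sc: "AE x in Om S. val S (rep S (\<lambda>x. c * val S u x)) x = c * val S u x"
  and norm_sc: "norm (rep S (\<lambda>x. c * val S u x)) = cmod c * norm u"
proof -
  obtain w where w: "AE x in Om S. val S w x = c * val S u x" "norm w = cmod c * norm u"
    using ex_val_mult by blast
  then have "rep S (\<lambda>x. c * val S u x) = w" by (intro rep_eq)
  with w show "AE x in Om S. val S (rep S (\<lambda>x. c * val S u x)) x = c * val S u x"
    "norm (rep S (\<lambda>x. c * val S u x)) = cmod c * norm u" by simp_all
qed

lemma val_csc: "AE x in Om S. val S (csc S c u $ i) x = c * val S (u $ i) x"
  unfolding csc_def using val_sc by simp

lemma norm_csc: "norm (csc S c u) = cmod c * norm u"
  unfolding norm_vec_def csc_def by (simp add: norm_sc L2_set_right_distrib)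

lemma vec_val_inj:
  assumes "\<And>i. AE x in Om S. val S (u $ i) x = val S (v $ i) x"
  shows "u = v"
  using assms val_inj by (simp add: vec_eq_iff)

lemma val_add_vec: "AE x in Om S. val S ((u + v) $ i) x = val S (u $ i) x + val S (v $ i) x"
  using val_add by simp

lemma val_scaleR_vec: "AE x in Om S. val S ((a *\<^sub>R u) $ i) x = complex_of_real a * val S (u $ i) x"
  using val_scaleR by simp

lemma csc_add: "csc S c (u + v) = csc S c u + csc S c v"
proof (rule vec_val_inj)
  fix i
  show "AE x in Om S. val S (csc S c (u + v) $ i) x = val S ((csc S c u + csc S c v) $ i) x"
    using val_csc[of c "u + v" i] val_csc[of c u i] val_csc[of c v i] val_add_vec[of u v i]
      val_add_vec[of "csc S c u" "csc S c v" i]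
    by eventually_elim (simp add: algebra_simps)
qed

lemma csc_scaleR: "csc S c (a *\<^sub>R u) = a *\<^sub>R csc S c u"
proof (rule vec_val_inj)
  fix i
  show "AE x in Om S. val S (csc S c (a *\<^sub>R u) $ i) x = val S ((a *\<^sub>R csc S c u) $ i) x"
    using val_csc[of c "a *\<^sub>R u" i] val_csc[of c u i] val_scaleR_vec[of a u i]
      val_scaleR_vec[of a "csc S c u" i]
    by eventually_elim (simp add: algebra_simps)
qed

lemma csc_add_left: "csc S (c + d) u = csc S c u + csc S d u"
proof (rule vec_val_inj)
  fix i
  show "AE x in Om S. val S (csc S (c + d) u $ i) x = val S ((csc S c u + csc S d u) $ i) x"
    using val_csc[of "c + d" u i] val_csc[of c u i] val_csc[of d u i]
      val_add_vec[of "csc S c u" "csc S d u" i]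
    by eventually_elim (simp add: algebra_simps)
qed

lemma csc_scaleR_left: "csc S (a *\<^sub>R c) u = a *\<^sub>R csc S c u"
proof (rule vec_val_inj)
  fix i
  show "AE x in Om S. val S (csc S (a *\<^sub>R c) u $ i) x = val S ((a *\<^sub>R csc S c u) $ i) x"
    using val_csc[of "a *\<^sub>R c" u i] val_csc[of c u i] val_scaleR_vec[of a "csc S c u" i]
    by eventually_elim (simp add: scaleR_conv_of_real[where 'a=complex] algebra_simps)
qed

lemma bounded_linear_csc: "bounded_linear (csc S c)"
  by (rule bounded_linear_intro[where K="cmod c"]) (simp_all add: csc_add csc_scaleR norm_csc)

lemma bounded_linear_csc_left: "bounded_linear (\<lambda>c. csc S c u)"
  by (rule bounded_linear_intro[where K="norm u"])
    (simp_all add: csc_add_left csc_scaleR_left norm_csc)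

text \<open>Since \<open>tens\<close> is built on a definite description, the value of \<open>tens S c b\<close> is under control only
  when \<open>b\<close> represents an element of \<open>X\<close>.\<close>

definition realized :: "(real \<Rightarrow> complex) \<Rightarrow> bool" where
  "realized b \<longleftrightarrow> b \<in> borel_measurable (Om S) \<and> (\<exists>u. AE x in Om S. val S u x = b x)"

lemma realized_val: "realized (val S u)"
  unfolding realized_def using val_measurable by auto

lemma val_tens:
  assumes "realized b"
  shows "AE x in Om S. val S (tens S c b $ i) x = c $ i * b x"
proof -
  obtain u where u: "AE x in Om S. val S u x = b x" using assms by (auto simp: realized_def)
  obtain w where w: "AE x in Om S. val S w x = c $ i * val S u x"
    using ex_val_mult by blast
  have *: "AE x in Om S. val S w x = c $ i * b x" using u w by eventually_elim simp
  then have "rep S (\<lambda>x. c $ i * b x) = w" by (rule rep_eq)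
  with * show ?thesis by (simp add: tens_def)
qed

lemma tens_cong_AE:
  assumes b: "realized b" and eq: "AE x in Om S. b' x = b x"
  shows "tens S c b' = tens S c b"
proof -
  have "rep S (\<lambda>x. c $ i * b' x) = tens S c b $ i" for i
  proof (rule rep_eq)
    show "AE x in Om S. val S (tens S c b $ i) x = c $ i * b' x"
      using val_tens[OF b, of c i] eq by eventually_elim simp
  qed
  then show ?thesis by (simp add: tens_def vec_eq_iff)
qed

lemma tens_smult:
  assumes "realized b"
  shows "tens S (d *s c) b = csc S d (tens S c b)"
proof (rule vec_val_inj)
  fix i
  show "AE x in Om S. val S (tens S (d *s c) b $ i) x = val S (csc S d (tens S c b) $ i) x"
    using val_tens[OF assms, of "d *s c" i] val_tens[OF assms, of c i]
      val_csc[of d "tens S c b" i]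
    by eventually_elim simp
qed

lemma tens_add:
  assumes "realized b"
  shows "tens S (c + d) b = tens S c b + tens S d b"
proof (rule vec_val_inj)
  fix i
  show "AE x in Om S. val S (tens S (c + d) b $ i) x = val S ((tens S c b + tens S d b) $ i) x"
    using val_tens[OF assms, of "c + d" i] val_tens[OF assms, of c i] val_tens[OF assms, of d i]
      val_add_vec[of "tens S c b" "tens S d b" i]
    by eventually_elim (simp add: algebra_simps)
qed

lemma tens_scaleR:
  assumes "realized b"
  shows "tens S (a *\<^sub>R c) b = a *\<^sub>R tens S c b"
proof (rule vec_val_inj)
  fix i
  show "AE x in Om S. val S (tens S (a *\<^sub>R c) b $ i) x = val S ((a *\<^sub>R tens S c b) $ i) x"
    using val_tens[OF assms, of "a *\<^sub>R c" i] val_tens[OF assms, of c i]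
      val_scaleR_vec[of a "tens S c b" i]
    by eventually_elim (simp add: scaleR_conv_of_real[where 'a=complex])
qed

lemma norm_tens:
  assumes b: "realized b" and u: "AE x in Om S. val S u x = b x"
  shows "norm (tens S c b) = norm c * norm u"
proof -
  have "norm (tens S c b $ i) = cmod (c $ i) * norm u" for i
  proof -
    have "AE x in Om S. val S (rep S (\<lambda>x. c $ i * val S u x)) x = val S (tens S c b $ i) x"
      using val_sc[of "c $ i" u] val_tens[OF b, of c i] u
      by eventually_elim simp
    from val_inj[OF this] norm_sc[of "c $ i" u] show ?thesis by simp
  qed
  then show ?thesis unfolding norm_vec_def
    by (simp add: L2_set_left_distrib)
qed

lemma bounded_linear_tens:
  assumes "realized b"
  shows "bounded_linear (\<lambda>c. tens S c b)"
proof -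
  obtain u where "AE x in Om S. val S u x = b x" using assms by (auto simp: realized_def)
  from norm_tens[OF assms this] show ?thesis
    by (intro bounded_linear_intro[where K="norm u"])
      (auto simp: assms tens_add tens_scaleR)
qed

text \<open>Fourier coefficients with a general continuous weight in place of \<open>\<beta>\<^sub>k\<close>: the \<open>k\<close>-th coefficient
  of \<open>\<beta>\<^sub>a u\<close> is the mean of \<open>u\<close> against \<open>\<beta>\<^sub>a \<beta>\<^sub>k\<close>, although the product \<open>\<beta>\<^sub>a u\<close> need not belong to \<open>X\<close>.\<close>

definition wmean :: "(real \<Rightarrow> complex) \<Rightarrow> (real \<Rightarrow> complex) \<Rightarrow> complex" where
  "wmean w f = complex_of_real (1 / (len S * pi)) * (LINT x|Om S. f x * w x)"

definition wcoef :: "(real \<Rightarrow> complex) \<Rightarrow> 'x^'m \<Rightarrow> complex^'m" where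
  "wcoef w u = (\<chi> i. wmean w (val S (u $ i)))"

lemma beta_cnj [simp]: "cnj (beta S k x) = beta S k x"
  by (simp add: beta_def)

lemma coef_eq_wcoef: "coef S k = wcoef (beta S k)"
  by (simp add: fun_eq_iff coef_def wcoef_def wmean_def ip_def)

lemma continuous_beta [continuous_intros]: "continuous_on A (beta S k)"
proof (cases "k = 0")
  case True
  then have "beta S k = (\<lambda>x. 1)" by (auto simp: beta_def)
  then show ?thesis by simp
next
  case False
  then have "beta S k = (\<lambda>x. complex_of_real (sqrt 2 * cos (real k * x / len S)))"
    by (auto simp: beta_def)
  moreover have "continuous_on A (\<lambda>x. complex_of_real (sqrt 2 * cos (real k * x / len S)))"
    using len_pos by (intro continuous_intros) auto
  ultimately show ?thesis by simp
qed

lemma le_1_plus_square: "a \<le> 1 + a\<^sup>2" for a :: real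
proof (cases "a \<le> 1")
  case False
  then have "a * 1 \<le> a * a" by (intro mult_left_mono) auto
  then show ?thesis unfolding power2_eq_square by linarith
qed (simp add: add_increasing2)

lemma val_integrable: "integrable (Om S) (val S u)"
proof (rule Bochner_Integration.integrable_bound)
  interpret finite_measure "Om S" by (rule finite_Om)
  show "integrable (Om S) (\<lambda>x. 1 + (cmod (val S u x))\<^sup>2)"
    by (intro Bochner_Integration.integrable_add val_square_integrable) simp
  show "AE x in Om S. norm (val S u x) \<le> norm (1 + (cmod (val S u x))\<^sup>2)"
  proof (rule AE_I2)
    fix x
    show "norm (val S u x) \<le> norm (1 + (cmod (val S u x))\<^sup>2)"
      using le_1_plus_square[of "cmod (val S u x)"] by (simp add: abs_of_nonneg)
  qed
qed simp

lemma weight_measurable: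
  assumes "continuous_on {0..len S * pi} w"
  shows "w \<in> borel_measurable (Om S)"
  unfolding Om_def using assms by (intro continuous_imp_measurable_on_sets_lebesgue) auto

lemma realized_beta: "realized (beta S k)"
  unfolding realized_def using ex_val_beta by (auto intro!: weight_measurable continuous_intros)

lemma weight_bound:
  fixes w :: "real \<Rightarrow> complex"
  assumes "continuous_on {0..len S * pi} w"
  obtains K where "K > 0" "\<And>x. x \<in> {0..len S * pi} \<Longrightarrow> cmod (w x) \<le> K"
proof -
  have "bounded (w ` {0..len S * pi})"
    using assms by (intro compact_imp_bounded compact_continuous_image) auto
  then show thesis using that unfolding bounded_pos by (metis imageI)
qed

lemma integrable_times_weight:
  assumes "integrable (Om S) f" "continuous_on {0..len S * pi} w"
  shows "integrable (Om S) (\<lambda>x. f x * w x :: complex)"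
proof -
  obtain K where K: "K > 0" "\<And>x. x \<in> {0..len S * pi} \<Longrightarrow> cmod (w x) \<le> K"
    using weight_bound[OF assms(2)] by blast
  have [measurable]: "w \<in> borel_measurable (Om S)" "f \<in> borel_measurable (Om S)"
    using weight_measurable[OF assms(2)] assms(1) by auto
  show ?thesis
  proof (rule Bochner_Integration.integrable_bound)
    show "integrable (Om S) (\<lambda>x. K * cmod (f x))"
      using assms(1) by simp
    show "AE x in Om S. norm (f x * w x) \<le> norm (K * cmod (f x))"
    proof (rule AE_I2)
      fix x assume "x \<in> space (Om S)"
      then have "cmod (w x) \<le> K" using K by (simp add: Om_def)
      then have "cmod (w x) * cmod (f x) \<le> K * cmod (f x)" by (rule mult_right_mono) simp
      then show "norm (f x * w x) \<le> norm (K * cmod (f x))"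
        using K(1) by (simp add: norm_mult mult.commute)
    qed
  qed simp
qed

lemma wmean_cong_AE:
  assumes "AE x in Om S. f x = g x" "f \<in> borel_measurable (Om S)" "g \<in> borel_measurable (Om S)"
    and "continuous_on {0..len S * pi} w"
  shows "wmean w f = wmean w g"
proof -
  note weight_measurable[OF assms(4), measurable] assms(2,3)[measurable]
  have "(LINT x|Om S. f x * w x) = (LINT x|Om S. g x * w x)"
    using assms(1) by (intro integral_cong_AE) auto
  then show ?thesis by (simp add: wmean_def)
qed

lemma wmean_add:
  assumes "integrable (Om S) f" "integrable (Om S) g" "continuous_on {0..len S * pi} w"
  shows "wmean w (\<lambda>x. f x + g x) = wmean w f + wmean w g"
  using assms unfolding wmean_def
  by (simp add: integrable_times_weight distrib_right distrib_left)

lemma wmean_mult: "wmean w (\<lambda>x. c * f x) = c * wmean w f"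
  unfolding wmean_def by (simp add: mult.assoc)

lemma wcoef_add:
  assumes "continuous_on {0..len S * pi} w"
  shows "wcoef w (u + v) = wcoef w u + wcoef w v"
proof -
  have "wmean w (val S (u $ i + v $ i)) = wmean w (val S (u $ i)) + wmean w (val S (v $ i))" for i
    using wmean_cong_AE[OF val_add[of "u $ i" "v $ i"]] assms
    by (simp add: wmean_add val_integrable)
  then show ?thesis by (simp add: wcoef_def vec_eq_iff)
qed

lemma wcoef_csc:
  assumes "continuous_on {0..len S * pi} w"
  shows "wcoef w (csc S c u) = c *s wcoef w u"
  using wmean_cong_AE[OF val_csc] assms
  by (simp add: wcoef_def vec_eq_iff wmean_mult)

lemma wcoef_scaleR:
  assumes "continuous_on {0..len S * pi} w"
  shows "wcoef w (a *\<^sub>R u) = a *\<^sub>R wcoef w u"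
  using wmean_cong_AE[OF val_scaleR] assms
  by (simp add: wcoef_def vec_eq_iff wmean_mult scaleR_conv_of_real[where 'a=complex])

lemma wcoef_tens:
  assumes "continuous_on {0..len S * pi} w" "realized b"
  shows "wcoef w (tens S c b) = wmean w b *s c"
proof -
  obtain u where u: "AE x in Om S. val S u x = b x" using assms by (auto simp: realized_def)
  have 1: "AE x in Om S. val S (tens S c b $ i) x = c $ i * val S u x" for i
    using u val_tens[OF assms(2), of c i] by eventually_elim simp
  have 2: "tens S c b = tens S c (val S u)"
    using u by (intro tens_cong_AE) (auto simp: realized_val elim!: eventually_mono)
  have [simp]: "wmean w b = wmean w (val S u)"
  proof -
    have "(LINT x|Om S. b x * w x) = (LINT x|Om S. val S u x * w x)"
    proof -
      have "AE x in Om S. b x * w x = val S u x * w x" using u by eventually_elim simp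
      moreover have "AE x in Om S. b x = val S u x" using u by eventually_elim simp
      moreover have "b \<in> borel_measurable (Om S)"
        using assms(2) by (simp add: realized_def)
      ultimately show ?thesis using weight_measurable[OF assms(1)]
        by (intro integral_cong_AE) auto
    qed
    then show ?thesis by (simp add: wmean_def)
  qed
  show ?thesis
    using wmean_cong_AE[OF 1] assms
    by (simp add: wcoef_def vec_eq_iff wmean_mult mult.commute)
qed

text \<open>The norm of \<open>X\<close> dominates the \<open>L\<^sup>2\<close> norm of the values up to a constant, and \<open>|a| \<le> 1 + a\<^sup>2\<close>
  passes from \<open>L\<^sup>2\<close> to \<open>L\<^sup>1\<close> on the unit ball of \<open>X\<close>; homogeneity does the rest.\<close>

lemma bounded_linear_wcoef:
  assumes w: "continuous_on {0..len S * pi} w"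
  shows "bounded_linear (wcoef w)"
proof -
  obtain K where K: "K > 0" "\<And>x. x \<in> {0..len S * pi} \<Longrightarrow> cmod (w x) \<le> K"
    using weight_bound[OF w] by blast
  obtain C where C: "\<And>u. cmod (ip S (val S u) (val S u)) \<le> C * (norm u)\<^sup>2"
    using ip_bound by blast
  interpret finite_measure "Om S" by (rule finite_Om)
  define V where "V = len S * pi"
  have V: "V > 0" using len_pos by (simp add: V_def)
  have sq: "(LINT x|Om S. (cmod (val S u x))\<^sup>2) \<le> V * \<bar>C\<bar>" if "norm u \<le> 1" for u
  proof -
    have "ip S (val S u) (val S u) = complex_of_real ((LINT x|Om S. (cmod (val S u x))\<^sup>2) / V)"
      unfolding ip_def V_def complex_norm_square[symmetric] of_real_power[symmetric]
      by (simp only: integral_complex_of_real of_real_mult[symmetric]) simp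
    then have "cmod (ip S (val S u) (val S u)) = \<bar>(LINT x|Om S. (cmod (val S u x))\<^sup>2) / V\<bar>"
      by (simp only: norm_of_real)
    then have "(LINT x|Om S. (cmod (val S u x))\<^sup>2) / V \<le> C * (norm u)\<^sup>2"
      using C[of u] by linarith
    also have "\<dots> \<le> \<bar>C\<bar> * 1"
      using that by (intro mult_mono) (auto simp: power_le_one)
    finally show ?thesis using V by (simp add: field_simps)
  qed
  define B where "B = K * (measure (Om S) (space (Om S)) + V * \<bar>C\<bar>) / V"
  have b1: "cmod (wmean w (val S u)) \<le> B" if "norm u \<le> 1" for u
  proof -
    have "cmod (LINT x|Om S. val S u x * w x) \<le> (LINT x|Om S. cmod (val S u x * w x))"
      by simp
    also have "\<dots> \<le> (LINT x|Om S. K * (1 + (cmod (val S u x))\<^sup>2))"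
    proof (rule integral_mono)
      show "integrable (Om S) (\<lambda>x. cmod (val S u x * w x))"
        by (intro integrable_norm integrable_times_weight val_integrable w)
      show "integrable (Om S) (\<lambda>x. K * (1 + (cmod (val S u x))\<^sup>2))"
        by (intro integrable_mult_right Bochner_Integration.integrable_add val_square_integrable) simp
      fix x assume "x \<in> space (Om S)"
      then have wx: "cmod (w x) \<le> K" using K by (simp add: Om_def)
      have "cmod (val S u x) \<le> 1 + (cmod (val S u x))\<^sup>2"
        by (rule le_1_plus_square)
      then have "cmod (w x) * cmod (val S u x) \<le> K * (1 + (cmod (val S u x))\<^sup>2)"
        using wx K(1) by (intro mult_mono) auto
      then show "cmod (val S u x * w x) \<le> K * (1 + (cmod (val S u x))\<^sup>2)"
        by (simp add: norm_mult mult.commute)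
    qed
    also have "\<dots> = K * (measure (Om S) (space (Om S)) + (LINT x|Om S. (cmod (val S u x))\<^sup>2))"
      by (simp add: val_square_integrable)
    also have "\<dots> \<le> K * (measure (Om S) (space (Om S)) + V * \<bar>C\<bar>)"
      using sq[OF that] K by simp
    finally show ?thesis
      using V unfolding wmean_def V_def[symmetric] norm_mult norm_of_real B_def
      by (simp add: abs_of_pos divide_right_mono)
  qed
  (* Scale u to norm 1. The vector (\<chi> i. u) only serves to reuse wcoef_scaleR. *)
  have b2: "cmod (wmean w (val S u)) \<le> B * norm u" for u
  proof (cases "u = 0")
    case True
    have "wcoef w (0 *\<^sub>R (\<chi> i. u)) = 0" by (simp only: wcoef_scaleR[OF w]) simp
    then have "wmean w (val S 0) = 0" by (simp add: wcoef_def vec_eq_iff)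
    then show ?thesis using True by simp
  next
    case False
    have "wcoef w ((1 / norm u) *\<^sub>R (\<chi> i. u)) = (1 / norm u) *\<^sub>R wcoef w (\<chi> i. u)"
      by (rule wcoef_scaleR[OF w])
    then have "wmean w (val S ((1 / norm u) *\<^sub>R u)) = (1 / norm u) *\<^sub>R wmean w (val S u)"
      by (simp add: wcoef_def vec_eq_iff)
    moreover have "cmod (wmean w (val S ((1 / norm u) *\<^sub>R u))) \<le> B"
      using False by (intro b1) simp
    ultimately show ?thesis using False by (simp add: field_simps)
  qed
  show ?thesis
  proof (rule bounded_linear_intro)
    fix u
    have "norm (wcoef w u) \<le> (\<Sum>i\<in>UNIV. cmod (wmean w (val S (u $ i))))"
      unfolding norm_vec_def wcoef_def by (rule order_trans[OF L2_set_le_sum]) auto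
    also have "\<dots> \<le> (\<Sum>i\<in>(UNIV::'m set). B * norm u)"
    proof (rule sum_mono)
      fix i
      have "0 \<le> B" using K V by (simp add: B_def)
      then show "cmod (wmean w (val S (u $ i))) \<le> B * norm u"
        using b2[of "u $ i"] mult_left_mono[OF Finite_Cartesian_Product.norm_nth_le[of u i], of B] by linarith
    qed
    finally show "norm (wcoef w u) \<le> norm u * (CARD('m) * B)"
      by (simp add: mult_ac)
  qed (simp_all add: w wcoef_add wcoef_scaleR)
qed

lemma mean_cos:
  fixes n :: int
  shows "(LINT x|Om S. cos (real_of_int n * x / len S)) = (if n = 0 then len S * pi else 0)"
proof (cases "n = 0")
  case True
  then show ?thesis using len_pos by (simp add: Om_def measure_restrict_space)
next
  case False
  define F where "F x = (len S / n) * sin (real_of_int n * x / len S)" for x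
  have "((\<lambda>x. cos (real_of_int n * x / len S)) has_integral (F (len S * pi) - F 0)) {0..len S * pi}"
  proof (rule fundamental_theorem_of_calculus)
    fix x
    have "(F has_real_derivative cos (real_of_int n * x / len S)) (at x within {0..len S * pi})"
      unfolding F_def using False len_pos by (auto intro!: derivative_eq_intros simp: field_simps)
    then show "(F has_vector_derivative cos (real_of_int n * x / len S)) (at x within {0..len S * pi})"
      by (simp add: has_real_derivative_iff_has_vector_derivative)
  qed (use len_pos in simp)
  moreover have "F (len S * pi) - F 0 = 0"
    using len_pos by (simp add: F_def sin_npi_int mult.commute)
  moreover have "(LINT x|Om S. cos (real_of_int n * x / len S)) =
      integral {0..len S * pi} (\<lambda>x. cos (real_of_int n * x / len S))"
    unfolding Om_def
    by (intro lebesgue_integral_eq_integral continuous_imp_integrable_real continuous_intros)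
      (use len_pos in auto)
  ultimately show ?thesis using False by (simp add: integral_unique)
qed

lemma integrable_cos: "integrable (Om S) (\<lambda>x. cos (real_of_int n * x / len S))"
  unfolding Om_def
  by (intro continuous_imp_integrable_real continuous_intros) (use len_pos in auto)

lemma mean_cos_cos:
  "(LINT x|Om S. cos (real j * x / len S) * cos (real k * x / len S)) =
     (if j = k then (if k = 0 then len S * pi else len S * pi / 2) else 0)"
proof -
  have "cos (real j * x / len S) * cos (real k * x / len S) =
      (1 / 2) * cos (real_of_int (int j - int k) * x / len S) +
      (1 / 2) * cos (real_of_int (int j + int k) * x / len S)" for x
    by (simp add: cos_times_cos diff_divide_distrib add_divide_distrib left_diff_distrib
        distrib_right)
  then have "(LINT x|Om S. cos (real j * x / len S) * cos (real k * x / len S)) =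
      (1 / 2) * (LINT x|Om S. cos (real_of_int (int j - int k) * x / len S)) +
      (1 / 2) * (LINT x|Om S. cos (real_of_int (int j + int k) * x / len S))"
    by (simp only: Bochner_Integration.integral_add integrable_mult_right integral_mult_right_zero
        integrable_cos)
  then show ?thesis unfolding mean_cos by auto
qed

lemma beta_eq:
  "beta S k = (\<lambda>x. complex_of_real ((if k = 0 then 1 else sqrt 2) * cos (real k * x / len S)))"
  by (auto simp: beta_def fun_eq_iff)

lemma sqrt2_square: "complex_of_real (sqrt 2) * complex_of_real (sqrt 2) = 2"
  by (simp flip: of_real_mult)

lemma wmean_beta: "wmean (beta S k) (beta S j) = (if j = k then 1 else 0)"
proof -
  define cj where "cj = (if j = 0 then 1 else sqrt 2)"
  define ck where "ck = (if k = 0 then 1 else sqrt 2)"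
  have "(LINT x|Om S. beta S j x * beta S k x) =
    (CLINT x|Om S. complex_of_real (cj * ck * (cos (real j * x / len S) * cos (real k * x / len S))))"
    unfolding beta_eq cj_def ck_def
    by (intro Bochner_Integration.integral_cong) (auto simp: mult_ac)
  also have "\<dots> = complex_of_real (cj * ck * (if j = k then (if k = 0 then len S * pi else len S * pi / 2) else 0))"
    unfolding mean_cos_cos[symmetric] integral_complex_of_real by simp
  finally show ?thesis using len_pos by (auto simp: wmean_def cj_def ck_def sqrt2_square)
qed

lemma beta_0: "beta S 0 = (\<lambda>x. 1)"
  by (auto simp: beta_def)

text \<open>This identity is the source of the factor \<open>1/\<surd>2\<close> and of the mode \<open>2k\<^sub>1\<close>.\<close>

lemma beta_square:
  assumes "k \<noteq> 0"
  shows "(\<lambda>x. beta S k x * beta S k x) =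
    (\<lambda>x. beta S 0 x + complex_of_real (1 / sqrt 2) * beta S (2 * k) x)"
proof
  fix x
  define t where "t = real k * x / len S"
  have t: "real (2 * k) * x / len S = 2 * t"
    by (simp add: t_def)
  have "sqrt 2 * cos t * (sqrt 2 * cos t) = 2 * (cos t)\<^sup>2"
    by (simp add: power2_eq_square)
  also have "\<dots> = 1 + 1 / sqrt 2 * (sqrt 2 * cos (2 * t))"
    by (simp add: cos_double_cos)
  finally show "beta S k x * beta S k x = beta S 0 x + complex_of_real (1 / sqrt 2) * beta S (2 * k) x"
    using assms unfolding beta_eq t t_def[symmetric]
    by (simp only: of_real_mult[symmetric] of_real_add[symmetric]) simp
qed

lemma beta_times_double:
  assumes "k \<noteq> 0"
  shows "beta S k x * beta S (2 * k) x =
    complex_of_real (1 / sqrt 2) * (beta S k x + beta S (3 * k) x)"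
proof -
  define t where "t = real k * x / len S"
  have t: "real (2 * k) * x / len S = 2 * t" "real (3 * k) * x / len S = 3 * t"
    by (simp_all add: t_def)
  have "cos (2 * t) * cos t = (cos (2 * t - t) + cos (2 * t + t)) / 2"
    by (rule cos_times_cos)
  then have "cos t * cos (2 * t) = (cos t + cos (3 * t)) / 2"
    by (simp add: mult.commute)
  moreover have "sqrt 2 * cos t * (sqrt 2 * cos (2 * t)) = 2 * (cos t * cos (2 * t))"
    by simp
  ultimately have "sqrt 2 * cos t * (sqrt 2 * cos (2 * t)) = cos t + cos (3 * t)"
    by (simp only:) simp
  also have "\<dots> = 1 / sqrt 2 * (sqrt 2 * cos t + sqrt 2 * cos (3 * t))"
    by (simp add: distrib_left)
  finally have "sqrt 2 * cos t * (sqrt 2 * cos (2 * t)) =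
      1 / sqrt 2 * (sqrt 2 * cos t + sqrt 2 * cos (3 * t))" .
  then show ?thesis
    using assms unfolding beta_eq t t_def[symmetric]
    by (simp only: of_real_mult[symmetric] of_real_add[symmetric]) simp
qed

lemma beta_cube:
  assumes "k \<noteq> 0"
  shows "(\<lambda>x. beta S k x * beta S k x * beta S k x) =
    (\<lambda>x. (3 / 2) * beta S k x + (1 / 2) * beta S (3 * k) x)"
proof
  fix x
  have s: "complex_of_real (1 / sqrt 2) * (complex_of_real (1 / sqrt 2) * z) = z / 2" for z
  proof -
    have "complex_of_real (1 / sqrt 2) * (complex_of_real (1 / sqrt 2) * z) =
        complex_of_real (1 / sqrt 2 * (1 / sqrt 2)) * z" by (simp only: of_real_mult mult.assoc)
    then show ?thesis by simp
  qed
  have "beta S k x * beta S k x * beta S k x =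
      beta S k x + complex_of_real (1 / sqrt 2) * (beta S k x * beta S (2 * k) x)"
    unfolding fun_cong[OF beta_square[OF assms], of x]
    unfolding distrib_right by (simp add: beta_0 mult_ac)
  also have "\<dots> = beta S k x + (beta S k x + beta S (3 * k) x) / 2"
    unfolding beta_times_double[OF assms] s by simp
  finally show "beta S k x * beta S k x * beta S k x =
      (3 / 2) * beta S k x + (1 / 2) * beta S (3 * k) x"
    by (simp add: field_simps)
qed

lemma integrable_beta: "integrable (Om S) (beta S k)"
proof -
  interpret finite_measure "Om S" by (rule finite_Om)
  have "integrable (Om S) (\<lambda>x. 1 * beta S k x)"
    by (intro integrable_times_weight continuous_beta) simp
  then show ?thesis by simp
qed

lemma wmean_comb:
  assumes "continuous_on {0..len S * pi} w"
  shows "wmean w (\<lambda>x. c * beta S j x + d * beta S k x) = c * wmean w (beta S j) + d * wmean w (beta S k)"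
  by (subst wmean_add) (simp_all add: assms integrable_beta wmean_mult)

lemma wmean_beta_square:
  assumes "k \<noteq> 0"
  shows "wmean (beta S j) (\<lambda>x. beta S k x * beta S k x) =
    (if j = 0 then 1 else if j = 2 * k then complex_of_real (1 / sqrt 2) else 0)"
  using wmean_comb[of "beta S j" 1 0 "complex_of_real (1 / sqrt 2)" "2 * k"] assms
  unfolding beta_square[OF assms] mult_1 by (auto simp: wmean_beta continuous_beta)

lemma wmean_beta_cube:
  assumes "k \<noteq> 0"
  shows "wmean (beta S j) (\<lambda>x. beta S k x * beta S k x * beta S k x) =
    (if j = k then 3 / 2 else if j = 3 * k then 1 / 2 else 0)"
  using assms unfolding beta_cube[OF assms]
  by (subst wmean_comb) (auto simp: wmean_beta continuous_beta)

lemma wcoef_weight_add: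
  assumes "continuous_on {0..len S * pi} v" "continuous_on {0..len S * pi} w"
  shows "wcoef (\<lambda>x. v x + c * w x) u = wcoef v u + c *s wcoef w u"
proof -
  have "wmean (\<lambda>x. v x + c * w x) f = wmean v f + c * wmean w f" if "integrable (Om S) f" for f
  proof -
    have "wmean (\<lambda>x. v x + c * w x) f = complex_of_real (1 / (len S * pi)) *
        (LINT x|Om S. f x * v x + c * (f x * w x))"
      by (simp add: wmean_def algebra_simps)
    also have "\<dots> = wmean v f + c * wmean w f"
      using assms that unfolding wmean_def
      by (subst Bochner_Integration.integral_add)
        (simp_all add: integrable_times_weight distrib_left)
    finally show ?thesis .
  qed
  then show ?thesis by (simp add: wcoef_def vec_eq_iff val_integrable)
qed

lemma wcoef_beta_square:
  assumes "k \<noteq> 0"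
  shows "wcoef (\<lambda>x. beta S k x * beta S k x) u =
    coef S 0 u + complex_of_real (1 / sqrt 2) *s coef S (2 * k) u"
  unfolding beta_square[OF assms] coef_eq_wcoef by (rule wcoef_weight_add) (rule continuous_beta)+

text \<open>With \<open>wmean_beta\<close> this is the orthonormality of the \<open>\<beta>\<^sub>k\<close> for vector functions.\<close>

lemma coef_tens:
  "realized b \<Longrightarrow> coef S k (tens S c b) = wmean (beta S k) b *s c"
  unfolding coef_eq_wcoef by (rule wcoef_tens) (rule continuous_beta)

lemma coef_csc: "coef S k (csc S c u) = c *s coef S k u"
  unfolding coef_eq_wcoef by (rule wcoef_csc) (rule continuous_beta)

lemma bounded_linear_coef: "bounded_linear (coef S k)"
  unfolding coef_eq_wcoef by (rule bounded_linear_wcoef) (rule continuous_beta)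

lemma tens_diff: "realized b \<Longrightarrow> tens S (c - d) b = tens S c b - tens S d b"
  using linear_diff[OF bounded_linear.linear[OF bounded_linear_tens]] by blast

end

section \<open>Histories\<close>

locale delay_space = neumann_space S for S :: "('x::{real_inner,banach}, 'm::finite, 'z) pfde_scheme" +
  assumes delay_pos: "delay S > 0"
begin

lemma zero_in_Ir [simp]: "0 \<in> I\<^sub>r S"
  using delay_pos by (simp add: I\<^sub>r_def)

abbreviation clip :: "real \<Rightarrow> real" where "clip \<equiv> clamp (- delay S) 0"

lemma clip_in [simp]: "clip \<theta> \<in> I\<^sub>r S"
  using clamp_in_interval[of "- delay S" 0 \<theta>] delay_pos by (simp add: I\<^sub>r_def)

lemma hist_apply:
  assumes "continuous_on (I\<^sub>r S) \<phi>"
  shows "apply_bcontfun (hist S \<phi>) \<theta> = \<phi> (clip \<theta>)"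
proof -
  have c: "continuous_on (cbox (- delay S) 0) \<phi>" using assms by (simp add: I\<^sub>r_def)
  obtain g where g: "\<And>x. apply_bcontfun g x = \<phi> (clip x)"
    using continuous_on_cbox_bcontfunE[OF c] by metis
  then have "ext_cont \<phi> (- delay S) 0 = apply_bcontfun g" by (simp add: ext_cont_def fun_eq_iff)
  then show ?thesis unfolding hist_def by (simp add: apply_bcontfun_inverse g)
qed

lemma hist_cong: "(\<And>\<theta>. \<theta> \<in> I\<^sub>r S \<Longrightarrow> \<phi> \<theta> = \<psi> \<theta>) \<Longrightarrow> hist S \<phi> = hist S \<psi>"
  unfolding hist_def ext_cont_def by simp

lemma hist_add:
  assumes "continuous_on (I\<^sub>r S) \<phi>" "continuous_on (I\<^sub>r S) \<psi>"
  shows "hist S (\<lambda>\<theta>. \<phi> \<theta> + \<psi> \<theta>) = hist S \<phi> + hist S \<psi>"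
  by (rule bcontfun_eqI) (simp add: hist_apply assms continuous_on_add plus_bcontfun.rep_eq)

lemma hist_diff:
  assumes "continuous_on (I\<^sub>r S) \<phi>" "continuous_on (I\<^sub>r S) \<psi>"
  shows "hist S (\<lambda>\<theta>. \<phi> \<theta> - \<psi> \<theta>) = hist S \<phi> - hist S \<psi>"
  by (rule bcontfun_eqI) (simp add: hist_apply assms continuous_on_diff minus_bcontfun.rep_eq)

lemma hist_scaleR:
  assumes "continuous_on (I\<^sub>r S) \<phi>"
  shows "hist S (\<lambda>\<theta>. a *\<^sub>R \<phi> \<theta>) = a *\<^sub>R hist S \<phi>"
  by (rule bcontfun_eqI)
    (simp add: hist_apply assms continuous_on_scaleR continuous_on_const scaleR_bcontfun.rep_eq)

lemma norm_hist_le: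
  assumes "continuous_on (I\<^sub>r S) \<phi>" "\<And>\<theta>. \<theta> \<in> I\<^sub>r S \<Longrightarrow> norm (\<phi> \<theta>) \<le> K"
  shows "norm (hist S \<phi>) \<le> K"
  by (rule norm_bound) (simp add: hist_apply assms)

lemma continuous_tens:
  assumes "realized b" "continuous_on A \<phi>"
  shows "continuous_on A (\<lambda>\<theta>. tens S (\<phi> \<theta>) b)"
  using bounded_linear.continuous_on[OF bounded_linear_tens[OF assms(1)] assms(2)] .

lemma continuous_csc:
  assumes "continuous_on A \<phi>"
  shows "continuous_on A (\<lambda>\<theta>. csc S c (\<phi> \<theta>))"
  using bounded_linear.continuous_on[OF bounded_linear_csc assms] .

lemma continuous_wcoef:
  assumes "continuous_on {0..len S * pi} w" "continuous_on A \<phi>"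
  shows "continuous_on A (\<lambda>\<theta>. wcoef w (\<phi> \<theta>))"
  using bounded_linear.continuous_on[OF bounded_linear_wcoef[OF assms(1)] assms(2)] .

lemma continuous_coef:
  "continuous_on A \<phi> \<Longrightarrow> continuous_on A (\<lambda>\<theta>. coef S k (\<phi> \<theta>))"
  using bounded_linear.continuous_on[OF bounded_linear_coef] .

lemma cst_add:
  assumes "continuous_on (I\<^sub>r S) \<phi>" "continuous_on (I\<^sub>r S) \<psi>"
  shows "cst S (\<lambda>\<theta>. \<phi> \<theta> + \<psi> \<theta>) = cst S \<phi> + cst S \<psi>"
  unfolding cst_def
  using hist_add[OF continuous_tens[OF realized_beta assms(1)] continuous_tens[OF realized_beta assms(2)]]
  by (simp add: tens_add[OF realized_beta])

lemma cst_diff: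
  assumes "continuous_on (I\<^sub>r S) \<phi>" "continuous_on (I\<^sub>r S) \<psi>"
  shows "cst S (\<lambda>\<theta>. \<phi> \<theta> - \<psi> \<theta>) = cst S \<phi> - cst S \<psi>"
  unfolding cst_def
  using hist_diff[OF continuous_tens[OF realized_beta assms(1)] continuous_tens[OF realized_beta assms(2)]]
  by (simp add: tens_diff[OF realized_beta])

lemma cst_smult: "cst S (\<lambda>\<theta>. c *s \<phi> \<theta>) = hist S (\<lambda>\<theta>. csc S c (tens S (\<phi> \<theta>) (beta S 0)))"
  unfolding cst_def by (simp only: tens_smult[OF realized_beta])

lemma cst_cong: "(\<And>\<theta>. \<theta> \<in> I\<^sub>r S \<Longrightarrow> \<phi> \<theta> = \<psi> \<theta>) \<Longrightarrow> cst S \<phi> = cst S \<psi>"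
  unfolding cst_def by (intro hist_cong) simp

text \<open>The bound by the supremum over \<open>[-r,0]\<close>, with one constant for all \<open>\<phi>\<close>; it lets limits pass
  through \<open>cst\<close>.\<close>

lemma norm_cst_le:
  obtains K where "K \<ge> 0"
    "\<And>\<phi> B. continuous_on (I\<^sub>r S) \<phi> \<Longrightarrow> (\<And>\<theta>. \<theta> \<in> I\<^sub>r S \<Longrightarrow> norm (\<phi> \<theta>) \<le> B) \<Longrightarrow>
      norm (cst S \<phi>) \<le> K * B"
proof -
  obtain u where u: "AE x in Om S. val S u x = beta S 0 x" using ex_val_beta by blast
  show thesis
  proof (rule that[of "norm u"])
    fix \<phi> :: "real \<Rightarrow> complex^'m" and B assume *: "continuous_on (I\<^sub>r S) \<phi>" "\<And>\<theta>. \<theta> \<in> I\<^sub>r S \<Longrightarrow> norm (\<phi> \<theta>) \<le> B"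
    show "norm (cst S \<phi>) \<le> norm u * B"
      unfolding cst_def
    proof (rule norm_hist_le)
      fix \<theta> assume "\<theta> \<in> I\<^sub>r S"
      then show "norm (tens S (\<phi> \<theta>) (beta S 0)) \<le> norm u * B"
        using *(2)[of \<theta>]
        by (simp add: norm_tens[OF realized_beta u] mult.commute[of _ "norm u"] mult_left_mono)
    qed (intro continuous_tens realized_beta *)
  qed simp
qed

text \<open>Finite sums of histories \<open>\<psi>(\<theta>) u\<close> are uniformly dense in \<open>C([-r,0]; X\<^sup>m)\<close>. By uniform continuity
  \<open>\<phi>\<close> is approximated by \<open>\<Sum> p\<^sub>c(\<theta>) \<phi>(c)\<close> for a partition of unity \<open>p\<^sub>c\<close> subordinate to a fine cover of
  \<open>[-r,0]\<close>, and each \<open>\<phi>(c)\<close> is the sum of its components, which are elements of \<open>X\<close>.\<close>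

lemma tensor_induct [consumes 1, case_names tens add lim]:
  assumes cont: "continuous_on (I\<^sub>r S) \<phi>"
    and tens: "\<And>\<psi> u. continuous_on (I\<^sub>r S) \<psi> \<Longrightarrow> P (\<lambda>\<theta>. tens S (\<psi> \<theta>) (val S u))"
    and add: "\<And>\<phi> \<psi>. continuous_on (I\<^sub>r S) \<phi> \<Longrightarrow> continuous_on (I\<^sub>r S) \<psi> \<Longrightarrow> P \<phi> \<Longrightarrow> P \<psi> \<Longrightarrow>
      P (\<lambda>\<theta>. \<phi> \<theta> + \<psi> \<theta>)"
    and lim: "\<And>\<phi>. continuous_on (I\<^sub>r S) \<phi> \<Longrightarrow>
      (\<And>\<epsilon>. \<epsilon> > 0 \<Longrightarrow> \<exists>\<psi>. continuous_on (I\<^sub>r S) \<psi> \<and> P \<psi> \<and> (\<forall>\<theta>\<in>I\<^sub>r S. norm (\<phi> \<theta> - \<psi> \<theta>) \<le> \<epsilon>)) \<Longrightarrow> P \<phi>"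
  shows "P \<phi>"
proof (rule lim[OF cont])
  fix \<epsilon> :: real assume \<epsilon>: "\<epsilon> > 0"
  have sum: "continuous_on (I\<^sub>r S) (\<lambda>\<theta>. \<Sum>a\<in>A. f a \<theta>) \<and> P (\<lambda>\<theta>. \<Sum>a\<in>A. f a \<theta>)"
    if "finite A" "\<And>a. a \<in> A \<Longrightarrow> continuous_on (I\<^sub>r S) (f a) \<and> P (f a)"
    for A :: "'k set" and f
    using that
  proof (induction A rule: finite_induct)
    case empty
    have "P (\<lambda>\<theta>. tens S 0 (val S 0))" by (rule tens) simp
    moreover have "tens S 0 (val S 0) = 0"
      using linear_0[OF bounded_linear.linear[OF bounded_linear_tens[OF realized_val]]] .
    ultimately show ?case by simp
  next
    case (insert a A)
    then show ?case by (auto intro!: add continuous_on_add)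
  qed
  have comp: "compact (I\<^sub>r S)" by (simp add: I\<^sub>r_def)
  from compact_uniformly_continuous[OF cont comp] \<epsilon>
  obtain \<delta> where \<delta>: "\<delta> > 0" "\<And>s t. s \<in> I\<^sub>r S \<Longrightarrow> t \<in> I\<^sub>r S \<Longrightarrow> dist t s < \<delta> \<Longrightarrow> dist (\<phi> t) (\<phi> s) < \<epsilon>"
    unfolding uniformly_continuous_on_def by metis
  obtain N where N: "finite N" "N \<subseteq> I\<^sub>r S" "I\<^sub>r S \<subseteq> (\<Union>c\<in>N. ball c \<delta>)"
    using seq_compact_imp_totally_bounded[OF compact_imp_seq_compact[OF comp]] \<delta>(1) by metis
  (* Tent functions on a \<delta>-net; divided by their sum they form a partition of unity. *)
  define g where "g c \<theta> = max 0 (\<delta> - \<bar>\<theta> - c\<bar>)" for c \<theta> :: real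
  define s where "s \<theta> = (\<Sum>c\<in>N. g c \<theta>)" for \<theta>
  have g0: "0 \<le> g c \<theta>" for c \<theta> by (simp add: g_def)
  have spos: "0 < s \<theta>" if \<theta>: "\<theta> \<in> I\<^sub>r S" for \<theta>
  proof -
    obtain c where "c \<in> N" "dist c \<theta> < \<delta>" using subsetD[OF N(3) \<theta>] by auto
    then have "c \<in> N" "0 < g c \<theta>" by (auto simp: g_def dist_real_def)
    then show ?thesis unfolding s_def using N(1) g0 by (intro sum_pos2) auto
  qed
  have gcont: "continuous_on (I\<^sub>r S) (\<lambda>\<theta>. g c \<theta> / s \<theta>)" for c
    unfolding s_def g_def
    by (intro continuous_intros) (use spos in \<open>fastforce simp: s_def g_def\<close>)
  define \<psi> where "\<psi> \<theta> = (\<Sum>(c, i)\<in>N \<times> (UNIV::'m set).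
      tens S ((g c \<theta> / s \<theta>) *\<^sub>R axis i 1) (val S (\<phi> c $ i)))" for \<theta>
  have \<psi>: "continuous_on (I\<^sub>r S) \<psi> \<and> P \<psi>"
    unfolding \<psi>_def split_def
    by (intro sum conjI tens continuous_tens realized_val continuous_on_scaleR gcont)
      (use N in auto)
  (* The inner sum over components reassembles the vector \<phi> c. *)
  have \<psi>eq: "\<psi> \<theta> = (\<Sum>c\<in>N. (g c \<theta> / s \<theta>) *\<^sub>R \<phi> c)" for \<theta>
  proof -
    have "(\<Sum>i\<in>UNIV. tens S (a *\<^sub>R axis i 1) (val S (v $ i))) = a *\<^sub>R v" for a and v :: "'x^'m"
    proof -
      have 1: "tens S (axis i 1) (val S (v $ i)) = axis i (v $ i)" for i
      proof (rule vec_val_inj)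
        fix j
        have z: "AE x in Om S. val S 0 x = 0"
          using val_scaleR[of 0 0] by simp
        show "AE x in Om S. val S (tens S (axis i 1) (val S (v $ i)) $ j) x = val S (axis i (v $ i) $ j) x"
          using val_tens[OF realized_val, of "axis i 1" "v $ i" j] z
          by eventually_elim (auto simp: axis_def)
      qed
      have "(\<Sum>i\<in>UNIV. axis i (v $ i)) = v"
        by (simp add: vec_eq_iff axis_def if_distrib cong: if_cong)
      then show ?thesis
        by (simp add: tens_scaleR[OF realized_val] 1 flip: scaleR_sum_right)
    qed
    then show ?thesis unfolding \<psi>_def by (simp add: sum.cartesian_product[symmetric])
  qed
  have "norm (\<phi> \<theta> - \<psi> \<theta>) \<le> \<epsilon>" if \<theta>: "\<theta> \<in> I\<^sub>r S" for \<theta>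
  proof -
    have one: "(\<Sum>c\<in>N. g c \<theta> / s \<theta>) = 1"
      using spos[OF \<theta>] by (simp add: s_def flip: sum_divide_distrib)
    then have "\<phi> \<theta> - \<psi> \<theta> = (\<Sum>c\<in>N. (g c \<theta> / s \<theta>) *\<^sub>R (\<phi> \<theta> - \<phi> c))"
      unfolding \<psi>eq by (simp add: scaleR_diff_right sum_subtractf flip: scaleR_sum_left)
    also have "norm \<dots> \<le> (\<Sum>c\<in>N. (g c \<theta> / s \<theta>) * \<epsilon>)"
    proof (rule sum_norm_le)
      fix c assume c: "c \<in> N"
      have nn: "0 \<le> g c \<theta> / s \<theta>" using spos[OF \<theta>] g0 by simp
      show "norm ((g c \<theta> / s \<theta>) *\<^sub>R (\<phi> \<theta> - \<phi> c)) \<le> (g c \<theta> / s \<theta>) * \<epsilon>"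
      proof (cases "\<bar>\<theta> - c\<bar> < \<delta>")
        case True
        then have "norm (\<phi> \<theta> - \<phi> c) \<le> \<epsilon>"
          using \<delta>(2)[of c \<theta>] c N(2) \<theta> by (force simp: dist_norm)
        then show ?thesis using nn unfolding norm_scaleR by (simp only: abs_of_nonneg mult_left_mono)
      next
        case False
        then show ?thesis by (simp add: g_def)
      qed
    qed
    also have "\<dots> = \<epsilon>" unfolding sum_distrib_right[symmetric] one by simp
    finally show ?thesis .
  qed
  with \<psi> show "\<exists>\<psi>. continuous_on (I\<^sub>r S) \<psi> \<and> P \<psi> \<and> (\<forall>\<theta>\<in>I\<^sub>r S. norm (\<phi> \<theta> - \<psi> \<theta>) \<le> \<epsilon>)"
    by blast
qed

text \<open>Both sides are bounded and linear in \<open>\<phi>\<close>, so the identity follows from the case of tensors by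
  density. Here \<open>T\<close> is an operator on \<open>C([-r,0]; X\<^sup>m)\<close> and \<open>R\<close> gives its action on functions constant
  in \<open>x\<close>; the weights may differ because \<open>T\<close> may multiply by a fixed function of \<open>x\<close>.\<close>

lemma pointwise_transfer:
  assumes T: "bounded_linear T" and R: "bounded_linear R"
    and R_smult: "\<And>c \<psi>. continuous_on (I\<^sub>r S) \<psi> \<Longrightarrow>
      coef S 0 (R (cst S (\<lambda>\<theta>. c *s \<psi> \<theta>))) = c *s coef S 0 (R (cst S \<psi>))"
    and w: "continuous_on {0..len S * pi} w" and v: "continuous_on {0..len S * pi} v"
    and tensor: "\<And>\<psi> u. continuous_on (I\<^sub>r S) \<psi> \<Longrightarrow>
      wcoef w (T (hist S (\<lambda>\<theta>. tens S (\<psi> \<theta>) (val S u)))) =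
        wmean v (val S u) *s coef S 0 (R (cst S \<psi>))"
    and \<phi>: "continuous_on (I\<^sub>r S) \<phi>"
  shows "wcoef w (T (hist S \<phi>)) = coef S 0 (R (cst S (\<lambda>\<theta>. wcoef v (\<phi> \<theta>))))"
  using \<phi>
proof (induction \<phi> rule: tensor_induct)
  case (tens \<psi> u)
  then show ?case
    by (simp add: tensor wcoef_tens[OF v realized_val] R_smult)
next
  case (add \<phi> \<psi>)
  note lin = bounded_linear.linear[OF T] bounded_linear.linear[OF R]
    bounded_linear.linear[OF bounded_linear_wcoef[OF w]] bounded_linear.linear[OF bounded_linear_coef]
  show ?case
    using add
    by (simp add: hist_add wcoef_add[OF v] cst_add continuous_wcoef[OF v] linear_add[OF lin(1)]
        linear_add[OF lin(2)] linear_add[OF lin(3)] linear_add[OF lin(4)])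
next
  case (lim \<phi>)
  (* The defect A is bounded by a multiple of the distance to histories on which it vanishes. *)
  define A where "A \<phi> = wcoef w (T (hist S \<phi>)) - coef S 0 (R (cst S (\<lambda>\<theta>. wcoef v (\<phi> \<theta>))))" for \<phi> :: "real \<Rightarrow> 'x^'m"
  obtain K1 where K1: "\<And>h. norm (wcoef w (T h)) \<le> norm h * K1" "K1 \<ge> 0"
    using bounded_linear.nonneg_bounded[OF bounded_linear_compose[OF bounded_linear_wcoef[OF w] T]]
    by auto
  obtain K2 where K2: "\<And>h. norm (coef S 0 (R h)) \<le> norm h * K2" "K2 \<ge> 0"
    using bounded_linear.nonneg_bounded[OF bounded_linear_compose[OF bounded_linear_coef R]] by auto
  obtain K3 where K3: "\<And>u. norm (wcoef v u) \<le> norm u * K3" "K3 \<ge> 0"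
    using bounded_linear.nonneg_bounded[OF bounded_linear_wcoef[OF v]] by auto
  obtain K4 where K4: "K4 \<ge> 0"
    "\<And>\<phi> B. continuous_on (I\<^sub>r S) \<phi> \<Longrightarrow> (\<And>\<theta>. \<theta> \<in> I\<^sub>r S \<Longrightarrow> norm (\<phi> \<theta>) \<le> B) \<Longrightarrow>
      norm (cst S \<phi>) \<le> K4 * B"
    using norm_cst_le by blast
  have lin: "linear (\<lambda>h. wcoef w (T h))" "linear (\<lambda>h. coef S 0 (R h))" "linear (wcoef v)"
    using bounded_linear_compose[OF bounded_linear_wcoef[OF w] T] bounded_linear_wcoef[OF v]
      bounded_linear_compose[OF bounded_linear_coef R] bounded_linear.linear by auto
  have bound: "norm (A \<phi>) \<le> (K1 + K4 * K3 * K2) * \<epsilon>" if \<epsilon>: "\<epsilon> > 0" for \<epsilon>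
  proof -
    obtain \<psi> where \<psi>: "continuous_on (I\<^sub>r S) \<psi>" "A \<psi> = 0" "\<And>\<theta>. \<theta> \<in> I\<^sub>r S \<Longrightarrow> norm (\<phi> \<theta> - \<psi> \<theta>) \<le> \<epsilon>"
      using lim(2)[OF \<epsilon>] unfolding A_def right_minus_eq by blast
    have "A \<phi> = A \<phi> - A \<psi>" using \<psi>(2) by simp
    also have "\<dots> = wcoef w (T (hist S (\<lambda>\<theta>. \<phi> \<theta> - \<psi> \<theta>))) -
        coef S 0 (R (cst S (\<lambda>\<theta>. wcoef v (\<phi> \<theta> - \<psi> \<theta>))))"
      unfolding A_def using \<psi>(1) lim(1)
      by (simp add: hist_diff cst_diff continuous_wcoef[OF v] linear_diff[OF lin(1)]
          linear_diff[OF lin(2)] linear_diff[OF lin(3)])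
    also have "norm \<dots> \<le> \<epsilon> * K1 + (K4 * (K3 * \<epsilon>)) * K2"
    proof (rule order_trans[OF norm_triangle_ineq4], rule add_mono)
      have "norm (hist S (\<lambda>\<theta>. \<phi> \<theta> - \<psi> \<theta>)) \<le> \<epsilon>"
        using \<psi> lim(1) by (intro norm_hist_le continuous_intros) auto
      then show "norm (wcoef w (T (hist S (\<lambda>\<theta>. \<phi> \<theta> - \<psi> \<theta>)))) \<le> \<epsilon> * K1"
        using K1 by (meson mult_right_mono order_trans)
      have "norm (cst S (\<lambda>\<theta>. wcoef v (\<phi> \<theta> - \<psi> \<theta>))) \<le> K4 * (K3 * \<epsilon>)"
      proof (rule K4(2))
        show "continuous_on (I\<^sub>r S) (\<lambda>\<theta>. wcoef v (\<phi> \<theta> - \<psi> \<theta>))"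
          using \<psi> lim(1) by (intro continuous_wcoef v continuous_intros)
        fix \<theta> assume "\<theta> \<in> I\<^sub>r S"
        then show "norm (wcoef v (\<phi> \<theta> - \<psi> \<theta>)) \<le> K3 * \<epsilon>"
          using K3 \<psi>(3) by (metis mult.commute mult_left_mono order_trans)
      qed
      then show "norm (coef S 0 (R (cst S (\<lambda>\<theta>. wcoef v (\<phi> \<theta> - \<psi> \<theta>))))) \<le> K4 * (K3 * \<epsilon>) * K2"
        using K2 by (meson mult_right_mono order_trans)
    qed
    finally show ?thesis by (simp add: algebra_simps)
  qed
  define C where "C = K1 + K4 * K3 * K2"
  have "C \<ge> 0" using K1 K2 K3 K4 by (simp add: C_def)
  have "norm (A \<phi>) \<le> e" if "e > 0" for e
  proof -
    have "norm (A \<phi>) \<le> C * (e / (C + 1))" using bound[of "e / (C + 1)"] that \<open>C \<ge> 0\<close>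
      by (simp add: C_def)
    also have "\<dots> \<le> e" using that \<open>C \<ge> 0\<close> by (simp add: field_simps)
    finally show ?thesis .
  qed
  then have "A \<phi> = 0" using field_le_epsilon[of "norm (A \<phi>)" 0] by simp
  then show ?case by (simp add: A_def)
qed

end

section \<open>The Neumann Laplacian\<close>

lemma has_derivative_pos_part_square:
  "((\<lambda>t::real. (max 0 t)\<^sup>2) has_real_derivative 2 * max 0 t) (at t)"
proof -
  consider "t > 0" | "t < 0" | "t = 0" by linarith
  then show ?thesis
  proof cases
    case 1
    have "((\<lambda>t::real. t\<^sup>2) has_real_derivative 2 * max 0 t) (at t)"
      using 1 by (auto intro!: derivative_eq_intros)
    then show ?thesis
      by (rule DERIV_cong_ev[THEN iffD1, rotated -1, OF _ refl _ refl])
        (use eventually_nhds_in_open[of "{0<..}" t] 1 in \<open>auto elim!: eventually_mono\<close>)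
  next
    case 2
    have "((\<lambda>t::real. 0) has_real_derivative 2 * max 0 t) (at t)"
      using 2 by (auto intro!: derivative_eq_intros)
    then show ?thesis
      by (rule DERIV_cong_ev[THEN iffD1, rotated -1, OF _ refl _ refl])
        (use eventually_nhds_in_open[of "{..<0}" t] 2 in \<open>auto elim!: eventually_mono\<close>)
  next
    case 3
    have "((\<lambda>h. (max 0 h)\<^sup>2 / h) \<longlongrightarrow> (0::real)) (at 0)"
    proof (rule Lim_null_comparison)
      have "(max 0 h)\<^sup>2 / \<bar>h\<bar> \<le> \<bar>h\<bar>" for h :: real
        by (simp add: max_def power2_eq_square)
      then show "\<forall>\<^sub>F h in at 0. norm ((max 0 h)\<^sup>2 / h) \<le> \<bar>h::real\<bar>"
        by (simp add: abs_divide)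
      show "((\<lambda>h::real. \<bar>h\<bar>) \<longlongrightarrow> 0) (at 0)" by (auto intro!: tendsto_eq_intros)
    qed
    then show ?thesis using 3 by (simp add: DERIV_def)
  qed
qed

lemma continuous_on_of_deriv:
  fixes \<tau> :: "real \<Rightarrow> real"
  assumes "\<And>x. (\<tau> has_real_derivative \<tau>' x) (at x)"
  shows "continuous_on A \<tau>"
  using DERIV_isCont[OF assms] by (intro continuous_at_imp_continuous_on) auto

text \<open>A \<open>C\<^sup>1\<close> transition from 0 on \<open>(-\<infinity>,0]\<close> to 1 on \<open>[1,\<infinity>)\<close>, piecewise quadratic so that its
  derivative is explicit and bounded by 2.\<close>

definition smooth_step :: "real \<Rightarrow> real" where
  "smooth_step t = 2 * (max 0 t)\<^sup>2 - 4 * (max 0 (t - 1/2))\<^sup>2 + 2 * (max 0 (t - 1))\<^sup>2"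

definition smooth_step' :: "real \<Rightarrow> real" where
  "smooth_step' t = 4 * max 0 t - 8 * max 0 (t - 1/2) + 4 * max 0 (t - 1)"

lemma smooth_step_deriv: "(smooth_step has_real_derivative smooth_step' t) (at t)"
proof -
  have *: "((\<lambda>t::real. (max 0 (t - c))\<^sup>2) has_real_derivative 2 * max 0 (t - c)) (at t)" for c
    by (rule DERIV_chain2[where f="\<lambda>t. (max 0 t)\<^sup>2" and g="\<lambda>t. t - c" and Db=1, simplified,
          OF has_derivative_pos_part_square]) (auto intro!: derivative_eq_intros)
  show ?thesis
    unfolding smooth_step_def[abs_def] smooth_step'_def
    by (rule DERIV_cong[OF DERIV_add[OF DERIV_diff[OF DERIV_cmult DERIV_cmult] DERIV_cmult],
          OF has_derivative_pos_part_square * *]) simp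
qed

lemma smooth_step_0: "t \<le> 0 \<Longrightarrow> smooth_step t = 0"
  by (simp add: smooth_step_def max_def)

lemma smooth_step_1: "t \<ge> 1 \<Longrightarrow> smooth_step t = 1"
  by (simp add: smooth_step_def max_def power2_eq_square algebra_simps)

lemma smooth_step'_0: "t \<le> 0 \<or> t \<ge> 1 \<Longrightarrow> smooth_step' t = 0"
  by (auto simp add: smooth_step'_def max_def)

lemma smooth_step'_bounds: "0 \<le> smooth_step' t" "smooth_step' t \<le> 2"
  by (auto simp add: smooth_step'_def max_def)

lemma smooth_step_mono: "s \<le> t \<Longrightarrow> smooth_step s \<le> smooth_step t"
  using DERIV_nonneg_imp_nondecreasing[of s t smooth_step] smooth_step_deriv smooth_step'_bounds(1)
  by blast

lemma smooth_step_bounds: "0 \<le> smooth_step t" "smooth_step t \<le> 1"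
  using smooth_step_mono[of "min t 0" t] smooth_step_0[of "min t 0"]
    smooth_step_mono[of t "max t 1"] smooth_step_1[of "max t 1"] by auto

lemma continuous_smooth_step' [continuous_intros]:
  "continuous_on A f \<Longrightarrow> continuous_on A (\<lambda>x. smooth_step' (f x))"
  unfolding smooth_step'_def by (intro continuous_intros)

lemma continuous_smooth_step [continuous_intros]:
  "continuous_on A f \<Longrightarrow> continuous_on A (\<lambda>x. smooth_step (f x))"
  unfolding smooth_step_def by (intro continuous_intros)

text \<open>A cutoff supported in \<open>[a + 1/n, b - 1/n]\<close> and equal to 1 on \<open>[a + 2/n, b - 2/n]\<close>.\<close>

definition bump :: "real \<Rightarrow> real \<Rightarrow> nat \<Rightarrow> real \<Rightarrow> real" where
  "bump a b n x = smooth_step (n * (x - a) - 1) * smooth_step (n * (b - x) - 1)"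

definition bump' :: "real \<Rightarrow> real \<Rightarrow> nat \<Rightarrow> real \<Rightarrow> real" where
  "bump' a b n x = n * smooth_step' (n * (x - a) - 1) * smooth_step (n * (b - x) - 1) -
     smooth_step (n * (x - a) - 1) * (n * smooth_step' (n * (b - x) - 1))"

lemma bump_deriv: "(bump a b n has_real_derivative bump' a b n x) (at x)"
proof -
  have "((\<lambda>x. smooth_step (n * (x - a) - 1)) has_real_derivative
      smooth_step' (n * (x - a) - 1) * n) (at x)"
    by (rule DERIV_chain2[OF smooth_step_deriv]) (auto intro!: derivative_eq_intros)
  moreover have "((\<lambda>x. smooth_step (n * (b - x) - 1)) has_real_derivative
      smooth_step' (n * (b - x) - 1) * (- n)) (at x)"
    by (rule DERIV_chain2[OF smooth_step_deriv]) (auto intro!: derivative_eq_intros)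
  ultimately show ?thesis
    unfolding bump_def[abs_def] bump'_def by (auto intro!: derivative_eq_intros simp: mult_ac)
qed

lemma continuous_bump [continuous_intros]:
  "continuous_on A (bump a b n)" "continuous_on A (bump' a b n)"
  unfolding bump_def[abs_def] bump'_def[abs_def] by (intro continuous_intros)+

lemma bump_bounds: "0 \<le> bump a b n x" "bump a b n x \<le> 1"
  unfolding bump_def using smooth_step_bounds by (auto intro: mult_le_one)

lemma bump_outside:
  assumes "n > 0" "x \<notin> {a + 1 / n .. b - 1 / n}"
  shows "bump a b n x = 0"
proof -
  have "n * (x - a) - 1 \<le> 0 \<or> n * (b - x) - 1 \<le> 0"
    using assms by (auto simp: field_simps)
  then show ?thesis unfolding bump_def using smooth_step_0 by auto
qed

lemma eventually_scaled_ge: "c > 0 \<Longrightarrow> \<forall>\<^sub>F n in sequentially. real n * c - 1 \<ge> 1"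
proof -
  assume c: "c > 0"
  obtain N :: nat where "2 / c < N" using reals_Archimedean2 by blast
  then have "real n * c - 1 \<ge> 1" if "n \<ge> N" for n
  proof -
    have "2 / c \<le> real n" using \<open>2 / c < N\<close> that by linarith
    then show ?thesis using c by (simp add: field_simps)
  qed
  then show ?thesis unfolding eventually_sequentially by blast
qed

lemma bump_tendsto: "(\<lambda>n. bump a b n x) \<longlonglongrightarrow> indicator {a<..<b} x"
proof (cases "x \<in> {a<..<b}")
  case True
  then have "\<forall>\<^sub>F n in sequentially. real n * (x - a) - 1 \<ge> 1"
    "\<forall>\<^sub>F n in sequentially. real n * (b - x) - 1 \<ge> 1"
    by (intro eventually_scaled_ge; simp)+
  then have "\<forall>\<^sub>F n in sequentially. bump a b n x = 1"
    by eventually_elim (simp add: bump_def smooth_step_1)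
  then show ?thesis using True by (simp add: tendsto_eventually)
next
  case False
  then have "bump a b n x = 0" for n
    using smooth_step_0[of "n * (x - a) - 1"] smooth_step_0[of "n * (b - x) - 1"]
      mult_nonneg_nonpos[of "real n" "x - a"] mult_nonneg_nonpos[of "real n" "b - x"]
    by (auto simp: bump_def)
  then show ?thesis using False by simp
qed

lemma bump'_bound:
  "\<bar>bump' a b n x\<bar> \<le> n * smooth_step' (n * (x - a) - 1) + n * smooth_step' (n * (b - x) - 1)"
proof -
  have "\<bar>bump' a b n x\<bar> \<le> \<bar>n * smooth_step' (n * (x - a) - 1) * smooth_step (n * (b - x) - 1)\<bar> +
     \<bar>smooth_step (n * (x - a) - 1) * (n * smooth_step' (n * (b - x) - 1))\<bar>"
    unfolding bump'_def by (rule abs_triangle_ineq4)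
  also have "\<dots> \<le> n * smooth_step' (n * (x - a) - 1) * 1 + 1 * (n * smooth_step' (n * (b - x) - 1))"
    unfolding abs_mult using smooth_step_bounds smooth_step'_bounds
    by (intro add_mono mult_mono) auto
  finally show ?thesis by simp
qed

lemma bump'_tendsto:
  assumes "x \<in> {a..b}" "a < b"
  shows "(\<lambda>n. bump' a b n x) \<longlonglongrightarrow> 0"
proof -
  have *: "\<forall>\<^sub>F n in sequentially. smooth_step' (real n * c - 1) = 0" if "c \<ge> 0" for c
  proof (cases "c = 0")
    case False
    with that have "c > 0" by simp
    from eventually_scaled_ge[OF this] show ?thesis
      by eventually_elim (simp add: smooth_step'_0)
  qed (simp add: smooth_step'_0)
  have "\<forall>\<^sub>F n in sequentially. smooth_step' (real n * (x - a) - 1) = 0"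
    "\<forall>\<^sub>F n in sequentially. smooth_step' (real n * (b - x) - 1) = 0"
    using assms by (intro *; simp)+
  then have "\<forall>\<^sub>F n in sequentially. bump' a b n x = 0"
    by eventually_elim (simp add: bump'_def)
  then show ?thesis by (simp add: tendsto_eventually)
qed

context neumann_space
begin

abbreviation (input) "bdry \<equiv> len S * pi"

lemma bdry_pos: "0 < bdry" using len_pos by simp

definition test_function :: "(real \<Rightarrow> real) \<Rightarrow> (real \<Rightarrow> real) \<Rightarrow> bool" where
  "test_function \<tau> \<tau>' \<longleftrightarrow> (\<forall>x. (\<tau> has_real_derivative \<tau>' x) (at x)) \<and> continuous_on UNIV \<tau>' \<and>
     (\<exists>a b. 0 < a \<and> b < bdry \<and> (\<forall>x. x \<notin> {a..b} \<longrightarrow> \<tau> x = 0))"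

lemma weak_derivI:
  assumes "\<And>\<tau> \<tau>'. test_function \<tau> \<tau>' \<Longrightarrow> continuous_on {0..bdry} \<tau> \<Longrightarrow> continuous_on {0..bdry} \<tau>' \<Longrightarrow>
    (LINT x|Om S. f x * complex_of_real (\<tau>' x)) = - (LINT x|Om S. g x * complex_of_real (\<tau> x))"
  shows "weak_deriv S f g"
  unfolding weak_deriv_def
proof (intro allI impI)
  fix \<tau> \<tau>' :: "real \<Rightarrow> real"
  assume "(\<forall>x. (\<tau> has_real_derivative \<tau>' x) (at x)) \<and> continuous_on UNIV \<tau>' \<and>
    (\<exists>a b. 0 < a \<and> b < bdry \<and> (\<forall>x. x \<notin> {a..b} \<longrightarrow> \<tau> x = 0))"
  then show "(LINT x|Om S. f x * complex_of_real (\<tau>' x)) = - (LINT x|Om S. g x * complex_of_real (\<tau> x))"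
    using continuous_on_of_deriv[of \<tau> \<tau>']
    by (intro assms) (auto simp: test_function_def intro: continuous_on_subset)
qed

lemma weak_derivD:
  "weak_deriv S f g \<Longrightarrow> test_function \<tau> \<tau>' \<Longrightarrow>
    (LINT x|Om S. f x * complex_of_real (\<tau>' x)) = - (LINT x|Om S. g x * complex_of_real (\<tau> x))"
  unfolding weak_deriv_def test_function_def by blast

lemma integrable_times_real:
  assumes "integrable (Om S) f" "continuous_on {0..bdry} \<tau>"
  shows "integrable (Om S) (\<lambda>x. f x * complex_of_real (\<tau> x))"
  using assms by (intro integrable_times_weight continuous_intros)

lemma borel_in_Om_sets:
  assumes "A \<in> sets borel"
  shows "{x \<in> space (Om S). x \<in> A} \<in> sets (Om S)"
proof -
  have "{x \<in> space (Om S). x \<in> A} = {0..bdry} \<inter> A" by (auto simp: Om_def)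
  then show ?thesis using assms unfolding Om_def by (auto simp: sets_restrict_space)
qed

lemma integral_bump_tendsto:
  assumes f: "integrable (Om S) f"
  shows "(\<lambda>n. LINT x|Om S. f x * complex_of_real (bump a b n x)) \<longlonglongrightarrow>
    (LINT x|Om S. f x * complex_of_real (indicator {a<..<b} x))"
proof (rule integral_dominated_convergence[where w="\<lambda>x. cmod (f x)"])
  have [measurable]: "f \<in> borel_measurable (Om S)" using f by auto
  show "(\<lambda>x. f x * complex_of_real (bump a b n x)) \<in> borel_measurable (Om S)" for n
    by (intro borel_measurable_integrable integrable_times_real f continuous_bump)
  have [measurable]: "{x \<in> space (Om S). x \<in> {a<..<b}} \<in> sets (Om S)"
    by (rule borel_in_Om_sets) simp
  show "(\<lambda>x. f x * complex_of_real (indicator {a<..<b} x)) \<in> borel_measurable (Om S)"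
    unfolding indicator_def of_bool_def by measurable
  show "integrable (Om S) (\<lambda>x. cmod (f x))" using f by simp
  show "AE x in Om S. (\<lambda>n. f x * complex_of_real (bump a b n x)) \<longlonglongrightarrow>
      f x * complex_of_real (indicator {a<..<b} x)"
    by (intro AE_I2 tendsto_intros bump_tendsto)
  show "AE x in Om S. norm (f x * complex_of_real (bump a b n x)) \<le> cmod (f x)" for n
    using bump_bounds by (intro AE_I2) (auto simp: norm_mult intro: mult_right_le_one_le)
qed

lemma AE_Om_not_in:
  assumes "N \<in> null_sets lebesgue"
  shows "AE x in Om S. x \<notin> N"
  unfolding Om_def by (subst AE_restrict_space_iff) (use AE_not_in[OF assms] in auto)

text \<open>The cutoffs \<open>bump a b n\<close> converge to the indicator of \<open>(a,b)\<close>, so \<open>f\<close> has integral zero over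
  every interval, hence over every Borel set by Dynkin's lemma, hence \<open>f = 0\<close> almost everywhere.\<close>

lemma fundamental_lemma:
  assumes f: "integrable (Om S) f"
    and test: "\<And>\<tau> \<tau>'. test_function \<tau> \<tau>' \<Longrightarrow> (LINT x|Om S. f x * complex_of_real (\<tau> x)) = 0"
  shows "AE x in Om S. f x = 0"
proof -
  interpret finite_measure "Om S" by (rule finite_Om)
  have [measurable]: "f \<in> borel_measurable (Om S)" using f by auto
  have interval0: "(LINT x|Om S. f x * complex_of_real (indicator {a<..<b} x)) = 0"
    if "0 \<le> a" "b \<le> bdry" for a b
  proof -
    have "(LINT x|Om S. f x * complex_of_real (bump a b n x)) = 0" if "n > 0" for n
    proof (rule test)
      show "test_function (bump a b n) (bump' a b n)"
        unfolding test_function_def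
      proof (intro conjI allI exI impI)
        show "0 < a + 1 / n" using \<open>0 \<le> a\<close> \<open>n > 0\<close> by (simp add: add_nonneg_pos)
        have "0 < 1 / real n" using \<open>n > 0\<close> by simp
        then show "b - 1 / n < bdry" using \<open>b \<le> bdry\<close> by linarith
      qed (use that in \<open>auto intro: bump_deriv continuous_bump bump_outside\<close>)
    qed
    then have "\<forall>\<^sub>F n in sequentially. (LINT x|Om S. f x * complex_of_real (bump a b n x)) = 0"
      by (intro eventually_sequentiallyI[of 1]) auto
    then have "(\<lambda>n. LINT x|Om S. f x * complex_of_real (bump a b n x)) \<longlonglongrightarrow> 0"
      by (rule tendsto_eventually)
    with integral_bump_tendsto[OF f] show ?thesis by (rule LIMSEQ_unique)
  qed
  (* J is a complex measure on Borel sets that vanishes on the open intervals. *)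
  define J where "J A = (LINT x|Om S. f x * complex_of_real (indicator A x))" for A
  have meas [measurable]: "(\<lambda>x. f x * complex_of_real (indicator A x)) \<in> borel_measurable (Om S)"
    and int: "integrable (Om S) (\<lambda>x. f x * complex_of_real (indicator A x))"
    if "A \<in> sets borel" for A
  proof -
    have [measurable]: "{x \<in> space (Om S). x \<in> A} \<in> sets (Om S)"
      by (rule borel_in_Om_sets[OF that])
    show *: "(\<lambda>x. f x * complex_of_real (indicator A x)) \<in> borel_measurable (Om S)"
      unfolding indicator_def of_bool_def by measurable
    show "integrable (Om S) (\<lambda>x. f x * complex_of_real (indicator A x))"
      by (rule Bochner_Integration.integrable_bound[OF f *])
        (auto simp: norm_mult indicator_def)
  qed
  have interval: "J {a<..<b} = 0" for a b
  proof -
    have "J {a<..<b} = J {max a 0<..<min b bdry}"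
      unfolding J_def
    proof (rule integral_cong_AE)
      have fin: "AE x in Om S. x \<notin> {0, bdry}"
        by (rule AE_Om_not_in) (simp add: negligible_iff_null_sets[symmetric])
      have "AE x in Om S. x \<in> {0..bdry}" by (rule AE_I2) (simp add: Om_def)
      with fin show "AE x in Om S. f x * complex_of_real (indicator {a<..<b} x) =
          f x * complex_of_real (indicator {max a 0<..<min b bdry} x)"
        by eventually_elim (auto simp: indicator_def)
    qed (use meas in auto)
    also have "\<dots> = 0" unfolding J_def by (rule interval0) auto
    finally show ?thesis .
  qed
  have borel0: "J A = 0" if "A \<in> sets borel" for A
  proof -
    have gen: "sets borel = sigma_sets UNIV (range (\<lambda>(a, b). {a<..<b::real}))"
    proof -
      have "(\<lambda>(a, b). box a b) = (\<lambda>(a, b). {a<..<b::real})" by (auto simp: fun_eq_iff)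
      then have "sets (sigma UNIV (range (\<lambda>(a, b). box a b :: real set))) =
          sigma_sets UNIV (range (\<lambda>(a, b). {a<..<b::real}))"
        by (simp only: sets_measure_of Pow_UNIV subset_UNIV)
      then show ?thesis unfolding borel_eq_box .
    qed
    have stable: "Int_stable (range (\<lambda>(a, b). {a<..<b::real}))"
    proof (rule Int_stableI)
      fix A B assume "A \<in> range (\<lambda>(a, b). {a<..<b::real})" "B \<in> range (\<lambda>(a, b). {a<..<b::real})"
      then obtain a b c d where "A = {a<..<b}" "B = {c<..<d}" by auto
      then have "A \<inter> B = {max a c<..<min b d}" by auto
      then show "A \<inter> B \<in> range (\<lambda>(a, b). {a<..<b::real})" by auto
    qed
    have total: "J UNIV = 0"
    proof -
      have "J {-1<..<bdry + 1} = J UNIV"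
        unfolding J_def by (intro Bochner_Integration.integral_cong) (auto simp: Om_def)
      then show ?thesis using interval by simp
    qed
    show ?thesis
      using that unfolding gen
    proof (induction rule: sigma_sets_induct_disjoint[OF stable, of UNIV, simplified Pow_UNIV, OF subset_UNIV, consumes 1, case_names basic empty compl union])
      case (basic A)
      then show ?case using interval by auto
    next
      case empty
      show ?case by (simp add: J_def)
    next
      case (compl A)
      then have A: "A \<in> sets borel" by (simp add: gen)
      have "J UNIV - J A = (LINT x|Om S. f x * complex_of_real (indicator UNIV x) -
          f x * complex_of_real (indicator A x))"
        unfolding J_def
        by (rule Bochner_Integration.integral_diff[symmetric]) (rule int, use A in simp)+
      also have "\<dots> = J (UNIV - A)"
        unfolding J_def
        by (intro Bochner_Integration.integral_cong) (auto simp: indicator_def)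
      finally have "J UNIV - J A = J (UNIV - A)" .
      then show ?case using total compl by simp
    next
      case (union A)
      then have A: "A i \<in> sets borel" for i by (auto simp: gen)
      have "(\<lambda>n. J (\<Union>i<n. A i)) \<longlonglongrightarrow> J (\<Union>i. A i)"
        unfolding J_def
      proof (rule integral_dominated_convergence[where w="\<lambda>x. cmod (f x)"])
        show "AE x in Om S. (\<lambda>n. f x * complex_of_real (indicator (\<Union>i<n. A i) x)) \<longlonglongrightarrow>
            f x * complex_of_real (indicator (\<Union>i. A i) x)"
          by (intro AE_I2 tendsto_intros LIMSEQ_indicator_UN)
        show "AE x in Om S. norm (f x * complex_of_real (indicator (\<Union>i<n. A i) x)) \<le> cmod (f x)" for n
          by (intro AE_I2) (auto simp: norm_mult indicator_def)
      qed (use f A in \<open>auto intro!: meas\<close>)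
      moreover have "J (\<Union>i<n. A i) = (\<Sum>i<n. J (A i))" for n
      proof -
        have "indicator (\<Union>i<n. A i) x = (\<Sum>i<n. indicator (A i) x :: real)" for x
          using union(1) by (intro indicator_UN_disjoint) (auto simp: disjoint_family_on_def)
        then have "J (\<Union>i<n. A i) = (LINT x|Om S. (\<Sum>i<n. f x * complex_of_real (indicator (A i) x)))"
          unfolding J_def by (simp add: sum_distrib_left)
        also have "\<dots> = (\<Sum>i<n. J (A i))"
          unfolding J_def by (intro Bochner_Integration.integral_sum int A)
        finally show ?thesis .
      qed
      ultimately have "(\<lambda>n::nat. 0) \<longlonglongrightarrow> J (\<Union>i. A i)" using union by simp
      then show ?case by (simp add: LIMSEQ_const_iff)
    qed
  qed
  show ?thesis
  proof (rule density_zero[OF f])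
    fix A assume A: "A \<in> sets (Om S)"
    then have "A \<in> sets lebesgue"
      unfolding Om_def by (auto simp: sets_restrict_space)
    then obtain B N N' where A': "A = B \<union> N" "N \<subseteq> N'" "N' \<in> null_sets lborel" "B \<in> sets borel"
      by (auto elim: sets_completionE)
    have "AE x in Om S. x \<notin> N'"
      using A'(3) by (intro AE_Om_not_in null_sets_completionI)
    then have eq: "AE x in Om S. indicator A x *\<^sub>R f x = f x * complex_of_real (indicator B x)"
    proof eventually_elim
      case (elim x)
      then have "x \<in> A \<longleftrightarrow> x \<in> B" using A'(1,2) by auto
      then show ?case by (simp add: indicator_def)
    qed
    have "(\<lambda>x. indicator A x *\<^sub>R f x) \<in> borel_measurable (Om S)"
      using A by measurable
    then have "set_lebesgue_integral (Om S) A f = J B"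
      unfolding set_lebesgue_integral_def J_def
      by (intro integral_cong_AE eq meas A'(4))
    then show "set_lebesgue_integral (Om S) A f = 0" using borel0[OF A'(4)] by simp
  qed
qed

lemma weak_deriv_unique:
  assumes "weak_deriv S f g" "weak_deriv S f h" and g: "integrable (Om S) g" and h: "integrable (Om S) h"
  shows "AE x in Om S. g x = h x"
proof -
  have "AE x in Om S. g x - h x = 0"
  proof (rule fundamental_lemma)
    fix \<tau> \<tau>' assume t: "test_function \<tau> \<tau>'"
    then have c: "continuous_on {0..bdry} \<tau>"
      unfolding test_function_def using continuous_on_of_deriv[of \<tau> \<tau>'] by blast
    have "(LINT x|Om S. (g x - h x) * complex_of_real (\<tau> x)) =
        (LINT x|Om S. g x * complex_of_real (\<tau> x)) - (LINT x|Om S. h x * complex_of_real (\<tau> x))"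
      unfolding left_diff_distrib
      by (intro Bochner_Integration.integral_diff integrable_times_real g h c)
    then show "(LINT x|Om S. (g x - h x) * complex_of_real (\<tau> x)) = 0"
      using weak_derivD[OF assms(1) t] weak_derivD[OF assms(2) t] by simp
  qed (use g h in simp)
  then show ?thesis by simp
qed

lemma AE_eq_sym: "AE x in M. f x = g x \<Longrightarrow> AE x in M. g x = f x"
  by (simp add: eq_commute)

lemma weak_deriv_cong:
  assumes "weak_deriv S f g" "AE x in Om S. f x = f' x" "AE x in Om S. g x = g' x"
    and m: "f \<in> borel_measurable (Om S)" "f' \<in> borel_measurable (Om S)"
      "g \<in> borel_measurable (Om S)" "g' \<in> borel_measurable (Om S)"
  shows "weak_deriv S f' g'"
proof (rule weak_derivI)
  fix \<tau> \<tau>' :: "real \<Rightarrow> real"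
  assume tt: "test_function \<tau> \<tau>'" and c: "continuous_on {0..bdry} \<tau>" "continuous_on {0..bdry} \<tau>'"
  have cm: "(\<lambda>x. complex_of_real (\<tau> x)) \<in> borel_measurable (Om S)"
    "(\<lambda>x. complex_of_real (\<tau>' x)) \<in> borel_measurable (Om S)"
    using c by (auto intro!: weight_measurable continuous_intros)
  have "(LINT x|Om S. f' x * complex_of_real (\<tau>' x)) = (LINT x|Om S. f x * complex_of_real (\<tau>' x))"
    using assms(2) cm m by (intro integral_cong_AE) (auto elim!: eventually_mono)
  moreover have "(LINT x|Om S. g' x * complex_of_real (\<tau> x)) = (LINT x|Om S. g x * complex_of_real (\<tau> x))"
    using assms(3) cm m by (intro integral_cong_AE) (auto elim!: eventually_mono)
  ultimately show "(LINT x|Om S. f' x * complex_of_real (\<tau>' x)) = - (LINT x|Om S. g' x * complex_of_real (\<tau> x))"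
    using weak_derivD[OF assms(1) tt] by simp
qed

lemma integrable_continuous:
  fixes f :: "real \<Rightarrow> complex"
  assumes "continuous_on {0..bdry} f"
  shows "integrable (Om S) f"
  unfolding Om_def using continuous_imp_integrable[of 0 bdry f] assms by simp

lemma neumann_unique:
  assumes "neumann_lap S u w" "neumann_lap S u v"
  shows "w = v"
proof -
  obtain d where d: "weak_deriv S (val S u) d" "weak_deriv S d (val S w)" "continuous_on {0..bdry} d"
    using assms(1) by (auto simp: neumann_lap_def)
  obtain e where e: "weak_deriv S (val S u) e" "weak_deriv S e (val S v)" "continuous_on {0..bdry} e"
    using assms(2) by (auto simp: neumann_lap_def)
  have "AE x in Om S. e x = d x"
    using weak_deriv_unique[OF e(1) d(1)] d(3) e(3) by (simp add: integrable_continuous)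
  then have "weak_deriv S d (val S v)"
    using e(2) d(3) e(3)
    by (intro weak_deriv_cong[OF e(2)]) (auto simp: weight_measurable)
  from weak_deriv_unique[OF d(2) this] show ?thesis
    by (intro val_inj) (simp add: val_integrable)
qed

text \<open>Integration by parts against a \<open>C\<^sup>1\<close> function \<open>\<tau>\<close> that need not vanish near the ends of the
  interval. Cut \<open>\<tau>\<close> off by \<open>bump 0 bdry n\<close>; the derivative of the cutoff contributes the integral in
  \<open>lim\<close>, which is the boundary term.\<close>

lemma weak_deriv_boundary:
  assumes wd: "weak_deriv S f g" and f: "integrable (Om S) f" and g: "integrable (Om S) g"
    and \<tau>: "\<And>x. (\<tau> has_real_derivative \<tau>' x) (at x)" "continuous_on UNIV \<tau>'"
    and lim: "(\<lambda>n. LINT x|Om S. f x * complex_of_real (bump' 0 bdry n x * \<tau> x)) \<longlonglongrightarrow> 0"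
  shows "(LINT x|Om S. f x * complex_of_real (\<tau>' x)) = - (LINT x|Om S. g x * complex_of_real (\<tau> x))"
proof -
  have c: "continuous_on A \<tau>" "continuous_on A \<tau>'" for A
    using \<tau> continuous_on_of_deriv[of \<tau> \<tau>'] by (auto intro: continuous_on_subset)
  have full: "(\<lambda>n. LINT x|Om S. h x * complex_of_real (bump 0 bdry n x)) \<longlonglongrightarrow> (LINT x|Om S. h x)"
    if h: "integrable (Om S) h" for h
  proof -
    have "AE x in Om S. x \<notin> {0, bdry}"
      by (rule AE_Om_not_in) (simp add: negligible_iff_null_sets[symmetric])
    moreover have "AE x in Om S. x \<in> {0..bdry}" by (rule AE_I2) (simp add: Om_def)
    ultimately have eq: "AE x in Om S. h x * complex_of_real (indicator {0<..<bdry} x) = h x"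
      by eventually_elim (auto simp: indicator_def)
    have "(\<lambda>x. h x * complex_of_real (indicator {0<..<bdry} x)) \<in> borel_measurable (Om S)"
    proof -
      have [measurable]: "h \<in> borel_measurable (Om S)" using h by auto
      have [measurable]: "{x \<in> space (Om S). x \<in> {0<..<bdry}} \<in> sets (Om S)"
        by (rule borel_in_Om_sets) simp
      show ?thesis unfolding indicator_def of_bool_def by measurable
    qed
    then have "(LINT x|Om S. h x * complex_of_real (indicator {0<..<bdry} x)) = (LINT x|Om S. h x)"
      using h eq by (intro integral_cong_AE) auto
    with integral_bump_tendsto[OF h, of 0 bdry] show ?thesis by simp
  qed
  (* a: derivative falling on the cutoff; b: derivative falling on \<tau>; d: the other side. *)
  define a where "a n = (LINT x|Om S. f x * complex_of_real (bump' 0 bdry n x * \<tau> x))" for n :: nat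
  define b where "b n = (LINT x|Om S. f x * complex_of_real (\<tau>' x) * complex_of_real (bump 0 bdry n x))" for n :: nat
  define d where "d n = (LINT x|Om S. g x * complex_of_real (\<tau> x) * complex_of_real (bump 0 bdry n x))" for n :: nat
  have "a n + b n = - d n" if n: "n > 0" for n
  proof -
    have t: "test_function (\<lambda>x. bump 0 bdry n x * \<tau> x) (\<lambda>x. bump' 0 bdry n x * \<tau> x + \<tau>' x * bump 0 bdry n x)"
      unfolding test_function_def
    proof (intro conjI allI exI impI)
      show "((\<lambda>x. bump 0 bdry n x * \<tau> x) has_real_derivative
          bump' 0 bdry n x * \<tau> x + \<tau>' x * bump 0 bdry n x) (at x)" for x
        by (rule DERIV_mult[OF bump_deriv \<tau>(1)])
      show "continuous_on UNIV (\<lambda>x. bump' 0 bdry n x * \<tau> x + \<tau>' x * bump 0 bdry n x)"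
        by (intro continuous_intros c)
      show "(0::real) < 1 / n" "bdry - 1 / n < bdry" using n by auto
      fix x assume "x \<notin> {1 / real n..bdry - 1 / real n}"
      then show "bump 0 bdry n x * \<tau> x = 0" using bump_outside[OF n, of x 0 bdry] by simp
    qed
    have "a n + b n = (LINT x|Om S. f x * complex_of_real (bump' 0 bdry n x * \<tau> x) +
        f x * complex_of_real (\<tau>' x) * complex_of_real (bump 0 bdry n x))"
      unfolding a_def b_def
      by (intro Bochner_Integration.integral_add[symmetric] integrable_times_real f continuous_intros c)
    also have "\<dots> = (LINT x|Om S. f x * complex_of_real (bump' 0 bdry n x * \<tau> x + \<tau>' x * bump 0 bdry n x))"
      by (simp add: algebra_simps)
    also have "\<dots> = - (LINT x|Om S. g x * complex_of_real (bump 0 bdry n x * \<tau> x))"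
      by (rule weak_derivD[OF wd t])
    also have "\<dots> = - d n" unfolding d_def by (simp add: mult_ac)
    finally show ?thesis .
  qed
  then have ev: "\<forall>\<^sub>F n in sequentially. a n + b n = - d n"
    by (intro eventually_sequentiallyI[of 1]) auto
  have "(\<lambda>n. a n + b n) \<longlonglongrightarrow> 0 + (LINT x|Om S. f x * complex_of_real (\<tau>' x))"
    using lim full[OF integrable_times_real[OF f c(2)]] unfolding a_def b_def by (intro tendsto_add)
  moreover have "(\<lambda>n. - d n) \<longlonglongrightarrow> - (LINT x|Om S. g x * complex_of_real (\<tau> x))"
    using full[OF integrable_times_real[OF g c(1)]] unfolding d_def by (intro tendsto_minus)
  moreover have "(\<lambda>n. - d n) \<longlonglongrightarrow> 0 + (LINT x|Om S. f x * complex_of_real (\<tau>' x))"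
    using calculation(1) tendsto_cong[OF ev] by blast
  ultimately show ?thesis using LIMSEQ_unique by force
qed

text \<open>The derivative of the cutoff at either end has total mass at most 1, being the derivative of a
  function with values in \<open>[0,1]\<close>.\<close>

lemma integral_step:
  assumes "n > 0"
  shows "(LINT x|Om S. real n * smooth_step' (real n * (x - 0) - 1)) \<le> 1"
    and "(LINT x|Om S. real n * smooth_step' (real n * (bdry - x) - 1)) \<le> 1"
proof -
  have ftc: "(LINT x|Om S. F' x) \<le> 1"
    if "\<And>x. (F has_real_derivative F' x) (at x)" "continuous_on UNIV F'" "F bdry - F 0 \<le> 1" for F F'
  proof -
    have "(F' has_integral (F bdry - F 0)) {0..bdry}"
      using bdry_pos that(1) by (intro fundamental_theorem_of_calculus)
        (auto simp: has_real_derivative_iff_has_vector_derivative intro: has_vector_derivative_at_within)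
    moreover have "(LINT x|Om S. F' x) = integral {0..bdry} F'"
      unfolding Om_def using that(2)
      by (intro lebesgue_integral_eq_integral continuous_imp_integrable_real)
        (auto intro: continuous_on_subset)
    ultimately show ?thesis using that(3) by (simp add: integral_unique)
  qed
  show "(LINT x|Om S. real n * smooth_step' (real n * (x - 0) - 1)) \<le> 1"
  proof (rule ftc)
    show "((\<lambda>x. smooth_step (real n * (x - 0) - 1)) has_real_derivative
        real n * smooth_step' (real n * (x - 0) - 1)) (at x)" for x
      by (rule DERIV_cong[OF DERIV_chain2[OF smooth_step_deriv]]) (auto intro!: derivative_eq_intros)
    show "smooth_step (real n * (bdry - 0) - 1) - smooth_step (real n * (0 - 0) - 1) \<le> 1"
      using smooth_step_bounds[of "real n * (bdry - 0) - 1"] smooth_step_bounds[of "real n * (0 - 0) - 1"]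
      by linarith
  qed (intro continuous_intros)
  show "(LINT x|Om S. real n * smooth_step' (real n * (bdry - x) - 1)) \<le> 1"
  proof (rule ftc)
    show "((\<lambda>x. - smooth_step (real n * (bdry - x) - 1)) has_real_derivative
        real n * smooth_step' (real n * (bdry - x) - 1)) (at x)" for x
      by (rule DERIV_cong[OF DERIV_minus[OF DERIV_chain2[OF smooth_step_deriv]]]) (auto intro!: derivative_eq_intros)
    show "- smooth_step (real n * (bdry - bdry) - 1) - - smooth_step (real n * (bdry - 0) - 1) \<le> 1"
      using smooth_step_bounds[of "real n * (bdry - 0) - 1"] smooth_step_bounds[of "real n * (bdry - bdry) - 1"]
      by linarith
  qed (intro continuous_intros)
qed

lemma smooth_step'_nonzero:
  assumes "smooth_step' (real n * y - 1) \<noteq> 0"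
  shows "real n * y < 2" "0 < y"
proof -
  have "\<not> (real n * y - 1 \<le> 0)" "\<not> (real n * y - 1 \<ge> 1)" using assms smooth_step'_0 by blast+
  then have "1 < real n * y" "real n * y < 2" by linarith+
  then show "real n * y < 2" "0 < y"
    using mult_nonneg_nonpos[of "real n" y] by (auto simp: not_less[symmetric])
qed

text \<open>The boundary term of a continuous function \<open>d\<close> with \<open>d = 0\<close> at both ends: the derivative of the
  cutoff is carried by shrinking neighbourhoods of the ends, where \<open>d\<close> is small, and has bounded
  mass.\<close>

lemma boundary_term_continuous:
  assumes d: "continuous_on {0..bdry} d" "d 0 = 0" "d bdry = 0"
    and \<tau>: "continuous_on {0..bdry} \<tau>" "\<And>x. \<bar>\<tau> x\<bar> \<le> 1"
  shows "(\<lambda>n. LINT x|Om S. d x * complex_of_real (bump' 0 bdry n x * \<tau> x)) \<longlonglongrightarrow> 0"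
proof (rule LIMSEQ_I)
  fix \<epsilon> :: real assume \<epsilon>: "\<epsilon> > 0"
  have cont: "\<exists>\<delta>>0. \<forall>x\<in>{0..bdry}. dist x y < \<delta> \<longrightarrow> dist (d x) (d y) < \<epsilon> / 3"
    if "y \<in> {0..bdry}" for y
  proof -
    have "\<epsilon> / 3 > 0" using \<epsilon> by simp
    then show ?thesis using d(1) that unfolding continuous_on_iff by blast
  qed
  obtain \<delta>1 where \<delta>1: "\<delta>1 > 0" "\<forall>x\<in>{0..bdry}. dist x 0 < \<delta>1 \<longrightarrow> dist (d x) (d 0) < \<epsilon> / 3"
    using cont[of 0] bdry_pos by auto
  obtain \<delta>2 where \<delta>2: "\<delta>2 > 0" "\<forall>x\<in>{0..bdry}. dist x bdry < \<delta>2 \<longrightarrow> dist (d x) (d bdry) < \<epsilon> / 3"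
    using cont[of bdry] bdry_pos by auto
  have \<delta>: "\<delta>1 > 0" "\<delta>2 > 0"
    "\<And>x. x \<in> {0..bdry} \<Longrightarrow> x < \<delta>1 \<Longrightarrow> cmod (d x) < \<epsilon> / 3"
    "\<And>x. x \<in> {0..bdry} \<Longrightarrow> bdry - x < \<delta>2 \<Longrightarrow> cmod (d x) < \<epsilon> / 3"
    using \<delta>1 \<delta>2 d(2,3) by (auto simp: dist_real_def dist_complex_def)
  define \<delta> where "\<delta> = min \<delta>1 \<delta>2"
  have "\<delta> > 0" using \<delta> by (simp add: \<delta>_def)
  obtain N :: nat where N: "2 / \<delta> < N" using reals_Archimedean2 by blast
  show "\<exists>N. \<forall>n\<ge>N. norm ((LINT x|Om S. d x * complex_of_real (bump' 0 bdry n x * \<tau> x)) - 0) < \<epsilon>"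
  proof (intro exI allI impI)
    fix n assume "n \<ge> N"
    then have "2 / \<delta> < n" using N by linarith
    then have n2: "2 < n * \<delta>" using \<open>\<delta> > 0\<close> by (simp add: field_simps)
    then have "n > 0" by (cases n) auto
    (* The derivative of the step is supported within distance \<delta> of the end. *)
    have close: "y < \<delta>" if "smooth_step' (real n * y - 1) \<noteq> 0" for y
    proof (rule ccontr)
      assume "\<not> y < \<delta>"
      then have "real n * \<delta> \<le> real n * y" by (intro mult_left_mono) auto
      with smooth_step'_nonzero(1)[OF that] n2 show False by linarith
    qed
    define s1 where "s1 x = real n * smooth_step' (real n * (x - 0) - 1)" for x
    define s2 where "s2 x = real n * smooth_step' (real n * (bdry - x) - 1)" for x
    have s_int: "integrable (Om S) s1" "integrable (Om S) s2"
      unfolding Om_def s1_def s2_def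
      by (intro continuous_imp_integrable_real continuous_intros)+
    have s_nonneg: "0 \<le> s1 x" "0 \<le> s2 x" for x
      unfolding s1_def s2_def using smooth_step'_bounds by auto
    have pt: "norm (d x * complex_of_real (bump' 0 bdry n x * \<tau> x)) \<le> \<epsilon> / 3 * (s1 x + s2 x)"
      if x: "x \<in> {0..bdry}" for x
    proof -
      have "norm (d x * complex_of_real (bump' 0 bdry n x * \<tau> x)) \<le> cmod (d x) * ((s1 x + s2 x) * 1)"
        unfolding norm_mult norm_of_real abs_mult
        using bump'_bound[of 0 bdry n x] \<tau>(2)[of x]
        by (intro mult_left_mono mult_mono) (auto simp: s1_def s2_def)
      also have "\<dots> \<le> \<epsilon> / 3 * (s1 x + s2 x)"
      proof (cases "s1 x = 0 \<and> s2 x = 0")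
        case False
        then have "x - 0 < \<delta> \<or> bdry - x < \<delta>"
          using close unfolding s1_def s2_def by (metis mult_zero_right)
        then have "cmod (d x) \<le> \<epsilon> / 3" using \<delta>(3,4)[OF x] by (auto simp: \<delta>_def)
        then show ?thesis unfolding mult_1_right using s_nonneg
          by (intro mult_right_mono add_nonneg_nonneg)
      qed simp
      finally show ?thesis .
    qed
    have "norm (LINT x|Om S. d x * complex_of_real (bump' 0 bdry n x * \<tau> x)) \<le>
        (LINT x|Om S. norm (d x * complex_of_real (bump' 0 bdry n x * \<tau> x)))" by simp
    also have "\<dots> \<le> (LINT x|Om S. \<epsilon> / 3 * (s1 x + s2 x))"
    proof (rule integral_mono)
      show "integrable (Om S) (\<lambda>x. norm (d x * complex_of_real (bump' 0 bdry n x * \<tau> x)))"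
        by (intro integrable_norm integrable_continuous continuous_intros d \<tau>)
      show "norm (d x * complex_of_real (bump' 0 bdry n x * \<tau> x)) \<le> \<epsilon> / 3 * (s1 x + s2 x)"
        if "x \<in> space (Om S)" for x using pt that by (simp add: Om_def)
    qed (use s_int in simp)
    also have "\<dots> = \<epsilon> / 3 * ((LINT x|Om S. s1 x) + (LINT x|Om S. s2 x))" using s_int by simp
    also have "\<dots> \<le> \<epsilon> / 3 * (1 + 1)"
      using integral_step[OF \<open>n > 0\<close>] \<epsilon> unfolding s1_def s2_def by (intro mult_left_mono add_mono) auto
    also have "\<dots> < \<epsilon>" using \<epsilon> by simp
    finally show "norm ((LINT x|Om S. d x * complex_of_real (bump' 0 bdry n x * \<tau> x)) - 0) < \<epsilon>" by simp
  qed
qed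

text \<open>The boundary term when \<open>f\<close> is merely integrable but \<open>\<tau>\<close> vanishes linearly at both ends: the
  derivative of the cutoff is of size \<open>n\<close> at distance less than \<open>2/n\<close> from an end, so its product with
  \<open>\<tau>\<close> stays bounded and dominated convergence applies.\<close>

lemma boundary_term_integrable:
  assumes f: "integrable (Om S) f" and \<tau>: "continuous_on {0..bdry} \<tau>"
    "\<And>x. x \<in> {0..bdry} \<Longrightarrow> \<bar>\<tau> x\<bar> \<le> C * x" "\<And>x. x \<in> {0..bdry} \<Longrightarrow> \<bar>\<tau> x\<bar> \<le> C * (bdry - x)"
  shows "(\<lambda>n. LINT x|Om S. f x * complex_of_real (bump' 0 bdry n x * \<tau> x)) \<longlonglongrightarrow> 0"
proof -
  have "0 \<le> \<bar>\<tau> bdry\<bar>" by simp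
  also have "\<dots> \<le> C * bdry" using \<tau>(2)[of bdry] bdry_pos by simp
  finally have C: "C \<ge> 0" using bdry_pos by (simp only: zero_le_mult_iff) linarith
  have "(\<lambda>n. LINT x|Om S. f x * complex_of_real (bump' 0 bdry n x * \<tau> x)) \<longlonglongrightarrow> (LINT x|Om S. 0)"
  proof (rule integral_dominated_convergence[where w="\<lambda>x. cmod (f x) * (8 * C)"])
    show "(\<lambda>x. f x * complex_of_real (bump' 0 bdry n x * \<tau> x)) \<in> borel_measurable (Om S)" for n
      by (intro borel_measurable_integrable integrable_times_real f continuous_intros \<tau>)
    show "integrable (Om S) (\<lambda>x. cmod (f x) * (8 * C))" using f by simp
    show "AE x in Om S. (\<lambda>n. f x * complex_of_real (bump' 0 bdry n x * \<tau> x)) \<longlonglongrightarrow> 0"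
    proof (rule AE_I2)
      fix x assume "x \<in> space (Om S)"
      then have "x \<in> {0..bdry}" by (simp add: Om_def)
      from bump'_tendsto[OF this bdry_pos] show "(\<lambda>n. f x * complex_of_real (bump' 0 bdry n x * \<tau> x)) \<longlonglongrightarrow> 0"
        by (auto intro!: tendsto_eq_intros)
    qed
    show "AE x in Om S. norm (f x * complex_of_real (bump' 0 bdry n x * \<tau> x)) \<le> cmod (f x) * (8 * C)" for n
    proof (rule AE_I2)
      fix x assume "x \<in> space (Om S)"
      then have x: "x \<in> {0..bdry}" by (simp add: Om_def)
      (* Where the derivative of the step is nonzero, it is at most 2 and n y < 2. *)
      have part: "real n * smooth_step' (real n * y - 1) * \<bar>\<tau> x\<bar> \<le> 4 * C"
        if "\<bar>\<tau> x\<bar> \<le> C * y" for y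
      proof (cases "smooth_step' (real n * y - 1) = 0")
        case False
        note y = smooth_step'_nonzero[OF False]
        have "real n * smooth_step' (real n * y - 1) * \<bar>\<tau> x\<bar> \<le> real n * 2 * (C * y)"
          using that smooth_step'_bounds by (intro mult_mono) auto
        also have "\<dots> = 2 * C * (real n * y)" by simp
        also have "\<dots> \<le> 2 * C * 2" using y C by (intro mult_left_mono) auto
        finally show ?thesis by simp
      qed (use C in simp)
      have "\<bar>bump' 0 bdry n x * \<tau> x\<bar> \<le> (real n * smooth_step' (real n * (x - 0) - 1) +
          real n * smooth_step' (real n * (bdry - x) - 1)) * \<bar>\<tau> x\<bar>"
        unfolding abs_mult using bump'_bound[of 0 bdry n x] by (intro mult_right_mono) auto
      also have "\<dots> \<le> 8 * C"
        using part[of "x - 0"] part[of "bdry - x"] \<tau>(2,3)[OF x] by (simp add: distrib_right)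
      finally show "norm (f x * complex_of_real (bump' 0 bdry n x * \<tau> x)) \<le> cmod (f x) * (8 * C)"
        unfolding norm_mult norm_of_real by (intro mult_left_mono) auto
    qed
  qed simp
  then show ?thesis by simp
qed

text \<open>Two integrations by parts against \<open>cos(kx/l)\<close>. In the first the boundary term vanishes by the
  Neumann condition, in the second because \<open>sin(kx/l)\<close> vanishes at \<open>0\<close> and \<open>l\<pi>\<close>.\<close>

lemma wmean_neumann_lap:
  assumes "neumann_lap S u w"
  shows "wmean (beta S k) (val S w) = - complex_of_real (mu S k) * wmean (beta S k) (val S u)"
proof -
  obtain d where d: "weak_deriv S (val S u) d" "weak_deriv S d (val S w)" "continuous_on {0..bdry} d"
    "d 0 = 0" "d bdry = 0"
    using assms by (auto simp: neumann_lap_def)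
  define c where "c = real k / len S"
  have c0: "c \<ge> 0" using len_pos by (simp add: c_def)
  have cb: "c * bdry = real k * pi" using len_pos by (simp add: c_def)
  define \<tau> where "\<tau> x = cos (c * x)" for x
  define \<tau>1 where "\<tau>1 x = - c * sin (c * x)" for x
  have "(LINT x|Om S. d x * complex_of_real (\<tau>1 x)) = - (LINT x|Om S. val S w x * complex_of_real (\<tau> x))"
  proof (rule weak_deriv_boundary[OF d(2) integrable_continuous[OF d(3)] val_integrable])
    show "(\<tau> has_real_derivative \<tau>1 x) (at x)" for x
      unfolding \<tau>_def[abs_def] \<tau>1_def by (auto intro!: derivative_eq_intros)
    show "continuous_on UNIV \<tau>1" unfolding \<tau>1_def[abs_def] by (intro continuous_intros)
    show "(\<lambda>n. LINT x|Om S. d x * complex_of_real (bump' 0 bdry n x * \<tau> x)) \<longlonglongrightarrow> 0"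
      by (rule boundary_term_continuous[OF d(3-5)]) (auto simp: \<tau>_def[abs_def] intro!: continuous_intros)
  qed
  moreover have "(LINT x|Om S. val S u x * complex_of_real (- (c\<^sup>2) * \<tau> x)) =
      - (LINT x|Om S. d x * complex_of_real (\<tau>1 x))"
  proof (rule weak_deriv_boundary[OF d(1) val_integrable integrable_continuous[OF d(3)]])
    show "(\<tau>1 has_real_derivative - (c\<^sup>2) * \<tau> x) (at x)" for x
      unfolding \<tau>_def[abs_def] \<tau>1_def by (auto intro!: derivative_eq_intros simp: power2_eq_square)
    show "continuous_on UNIV (\<lambda>x. - (c\<^sup>2) * \<tau> x)" unfolding \<tau>_def by (intro continuous_intros)
    show "(\<lambda>n. LINT x|Om S. val S u x * complex_of_real (bump' 0 bdry n x * \<tau>1 x)) \<longlonglongrightarrow> 0"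
    proof (rule boundary_term_integrable[OF val_integrable])
      show "continuous_on {0..bdry} \<tau>1" unfolding \<tau>1_def[abs_def] by (intro continuous_intros)
      fix x assume x: "x \<in> {0..bdry}"
      have lip: "\<bar>sin (c * y)\<bar> \<le> c * y" if "y \<ge> 0" for y
        using abs_sin_x_le_abs_x[of "c * y"] that c0 by simp
      show "\<bar>\<tau>1 x\<bar> \<le> c * c * x"
        using mult_left_mono[OF lip[of x] c0] x c0 by (simp add: \<tau>1_def abs_mult)
      (* Reflection at the right end, where c x = k \<pi>. *)
      have "sin (c * x) = sin (real k * pi - c * (bdry - x))"
        unfolding cb[symmetric] by (simp add: algebra_simps)
      also have "\<bar>\<dots>\<bar> = \<bar>sin (c * (bdry - x))\<bar>"
        by (simp add: sin_diff sin_npi cos_npi abs_mult power_abs)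
      finally show "\<bar>\<tau>1 x\<bar> \<le> c * c * (bdry - x)"
        using mult_left_mono[OF lip[of "bdry - x"] c0] x c0 by (simp add: \<tau>1_def abs_mult)
    qed
  qed
  moreover have "(LINT x|Om S. val S u x * complex_of_real (- (c\<^sup>2) * \<tau> x)) =
      - complex_of_real (c\<^sup>2) * (LINT x|Om S. val S u x * complex_of_real (\<tau> x))"
  proof -
    have "val S u x * complex_of_real (- (c\<^sup>2) * \<tau> x) =
        - complex_of_real (c\<^sup>2) * (val S u x * complex_of_real (\<tau> x))" for x by simp
    then show ?thesis by (simp only: integral_mult_right_zero)
  qed
  ultimately have main: "(LINT x|Om S. val S w x * complex_of_real (\<tau> x)) =
      - complex_of_real (c\<^sup>2) * (LINT x|Om S. val S u x * complex_of_real (\<tau> x))"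
    by simp
  define s where "s = complex_of_real (if k = 0 then 1 else sqrt 2)"
  have b: "beta S k x = s * complex_of_real (\<tau> x)" for x
    by (simp add: beta_eq s_def \<tau>_def c_def)
  have "(LINT x|Om S. f x * beta S k x) = s * (LINT x|Om S. f x * complex_of_real (\<tau> x))" for f
    unfolding b by (simp add: mult.left_commute)
  moreover have "c\<^sup>2 = mu S k" by (simp add: c_def mu_def power_divide)
  ultimately show ?thesis unfolding wmean_def using main by simp
qed

lemma lap_eq: "neumann_lap S (u $ i) w \<Longrightarrow> lap S u $ i = w"
  unfolding lap_def using neumann_unique by auto

lemma coef_lap:
  assumes "u \<in> dom_lap S"
  shows "coef S k (lap S u) = - complex_of_real (mu S k) *s coef S k u"
proof -
  have "wmean (beta S k) (val S (lap S u $ i)) = - complex_of_real (mu S k) * wmean (beta S k) (val S (u $ i))" for i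
  proof -
    obtain w where w: "neumann_lap S (u $ i) w" using assms by (auto simp: dom_lap_def)
    show ?thesis using wmean_neumann_lap[OF w] lap_eq[OF w] by simp
  qed
  then show ?thesis by (simp add: coef_eq_wcoef wcoef_def vec_eq_iff)
qed

lemma weak_deriv_add:
  assumes "weak_deriv S f g" "weak_deriv S f' g'"
    and "integrable (Om S) f" "integrable (Om S) g" "integrable (Om S) f'" "integrable (Om S) g'"
  shows "weak_deriv S (\<lambda>x. f x + f' x) (\<lambda>x. g x + g' x)"
proof (rule weak_derivI)
  fix \<tau> \<tau>' :: "real \<Rightarrow> real"
  assume tt: "test_function \<tau> \<tau>'" and c: "continuous_on {0..bdry} \<tau>" "continuous_on {0..bdry} \<tau>'"
  show "(LINT x|Om S. (f x + f' x) * complex_of_real (\<tau>' x)) =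
      - (LINT x|Om S. (g x + g' x) * complex_of_real (\<tau> x))"
    using weak_derivD[OF assms(1) tt] weak_derivD[OF assms(2) tt] assms(3-6)
    by (simp add: distrib_right integrable_times_real c)
qed

lemma weak_deriv_mult:
  assumes "weak_deriv S f g"
  shows "weak_deriv S (\<lambda>x. a * f x) (\<lambda>x. a * g x)"
proof (rule weak_derivI)
  fix \<tau> \<tau>' :: "real \<Rightarrow> real"
  assume "test_function \<tau> \<tau>'"
  from weak_derivD[OF assms this] show "(LINT x|Om S. a * f x * complex_of_real (\<tau>' x)) =
      - (LINT x|Om S. a * g x * complex_of_real (\<tau> x))"
    by (simp only: mult.assoc integral_mult_right_zero mult_minus_right)
qed

lemma neumann_lap_add:
  assumes "neumann_lap S u w" "neumann_lap S v z"
  shows "neumann_lap S (u + v) (w + z)"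
proof -
  obtain d where d: "weak_deriv S (val S u) d" "weak_deriv S d (val S w)" "continuous_on {0..bdry} d"
    "d 0 = 0" "d bdry = 0"
    using assms(1) by (auto simp: neumann_lap_def)
  obtain e where e: "weak_deriv S (val S v) e" "weak_deriv S e (val S z)" "continuous_on {0..bdry} e"
    "e 0 = 0" "e bdry = 0"
    using assms(2) by (auto simp: neumann_lap_def)
  note i = integrable_continuous[OF d(3)] integrable_continuous[OF e(3)]
  note m = borel_measurable_integrable[OF Bochner_Integration.integrable_add[OF i]]
  have "weak_deriv S (val S (u + v)) (\<lambda>x. d x + e x)"
    by (rule weak_deriv_cong[OF weak_deriv_add[OF d(1) e(1)] AE_eq_sym[OF val_add[of u v]]])
      (simp_all add: val_integrable i m)
  moreover have "weak_deriv S (\<lambda>x. d x + e x) (val S (w + z))"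
    by (rule weak_deriv_cong[OF weak_deriv_add[OF d(2) e(2)] _ AE_eq_sym[OF val_add[of w z]]])
      (simp_all add: val_integrable i m)
  ultimately show ?thesis unfolding neumann_lap_def
    by (intro exI[of _ "\<lambda>x. d x + e x"]) (auto intro!: continuous_intros simp: d e)
qed

lemma neumann_lap_mult:
  assumes "neumann_lap S u w"
  shows "neumann_lap S (rep S (\<lambda>x. c * val S u x)) (rep S (\<lambda>x. c * val S w x))"
proof -
  obtain d where d: "weak_deriv S (val S u) d" "weak_deriv S d (val S w)" "continuous_on {0..bdry} d"
    "d 0 = 0" "d bdry = 0"
    using assms(1) by (auto simp: neumann_lap_def)
  have [measurable]: "d \<in> borel_measurable (Om S)"
    by (rule borel_measurable_integrable[OF integrable_continuous[OF d(3)]])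
  have m: "(\<lambda>x. c * d x) \<in> borel_measurable (Om S)" by measurable
  have "weak_deriv S (val S (rep S (\<lambda>x. c * val S u x))) (\<lambda>x. c * d x)"
    by (rule weak_deriv_cong[OF weak_deriv_mult[OF d(1), of c] AE_eq_sym[OF val_sc[of c u]]])
      (simp_all add: m)
  moreover have "weak_deriv S (\<lambda>x. c * d x) (val S (rep S (\<lambda>x. c * val S w x)))"
    by (rule weak_deriv_cong[OF weak_deriv_mult[OF d(2), of c] _ AE_eq_sym[OF val_sc[of c w]]])
      (simp_all add: m)
  ultimately show ?thesis unfolding neumann_lap_def
    by (intro exI[of _ "\<lambda>x. c * d x"]) (auto intro!: continuous_intros simp: d)
qed

lemma dom_lap_add:
  assumes "u \<in> dom_lap S" "v \<in> dom_lap S"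
  shows "u + v \<in> dom_lap S"
  unfolding dom_lap_def
proof (intro CollectI allI)
  fix i
  obtain w z where "neumann_lap S (u $ i) w" "neumann_lap S (v $ i) z"
    using assms unfolding dom_lap_def by blast
  from neumann_lap_add[OF this] show "\<exists>w. neumann_lap S ((u + v) $ i) w" by auto
qed

lemma dom_lap_csc:
  assumes "u \<in> dom_lap S"
  shows "csc S c u \<in> dom_lap S"
  unfolding dom_lap_def
proof (intro CollectI allI)
  fix i
  obtain w where "neumann_lap S (u $ i) w" using assms unfolding dom_lap_def by blast
  from neumann_lap_mult[OF this] show "\<exists>w. neumann_lap S (csc S c u $ i) w"
    unfolding csc_def by auto
qed

lemma smooth_weak_deriv:
  fixes F F' :: "real \<Rightarrow> complex"
  assumes F: "\<And>x. (F has_vector_derivative F' x) (at x)" "continuous_on UNIV F'"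
  shows "weak_deriv S F F'"
proof (rule weak_derivI)
  fix \<tau> \<tau>' :: "real \<Rightarrow> real"
  assume tt: "test_function \<tau> \<tau>'" and c: "continuous_on {0..bdry} \<tau>" "continuous_on {0..bdry} \<tau>'"
  then have t: "\<forall>x. (\<tau> has_real_derivative \<tau>' x) (at x)" by (simp add: test_function_def)
  obtain a b where ab: "0 < a" "b < bdry" "\<forall>x. x \<notin> {a..b} \<longrightarrow> \<tau> x = 0"
    using tt by (auto simp: test_function_def)
  have cF: "continuous_on {0..bdry} F" "continuous_on {0..bdry} F'"
    using has_vector_derivative_continuous[OF F(1)] F(2)
    by (auto intro: continuous_at_imp_continuous_on continuous_on_subset)
  define G where "G x = F x * complex_of_real (\<tau>' x) + F' x * complex_of_real (\<tau> x)" for x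
  have cG: "continuous_on {0..bdry} G" unfolding G_def by (intro continuous_intros c cF)
  have "((\<lambda>x. F x * complex_of_real (\<tau> x)) has_vector_derivative G x) (at x)" for x
    unfolding G_def
    by (rule has_vector_derivative_mult[OF F(1)])
      (use t in \<open>auto intro!: has_vector_derivative_of_real simp: has_real_derivative_iff_has_vector_derivative\<close>)
  then have "(G has_integral (F bdry * complex_of_real (\<tau> bdry) - F 0 * complex_of_real (\<tau> 0))) {0..bdry}"
    using bdry_pos by (intro fundamental_theorem_of_calculus) (auto intro: has_vector_derivative_at_within)
  moreover have "\<tau> bdry = 0" "\<tau> 0 = 0" using ab by auto
  moreover have "(LINT x|Om S. G x) = integral {0..bdry} G"
    unfolding Om_def using integrable_continuous[OF cG]
    by (intro lebesgue_integral_eq_integral) (auto simp: Om_def)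
  ultimately have "(LINT x|Om S. G x) = 0" by (simp add: integral_unique)
  moreover have "(LINT x|Om S. G x) = (LINT x|Om S. F x * complex_of_real (\<tau>' x)) + (LINT x|Om S. F' x * complex_of_real (\<tau> x))"
    unfolding G_def
    by (intro Bochner_Integration.integral_add integrable_continuous continuous_intros c cF)
  ultimately show "(LINT x|Om S. F x * complex_of_real (\<tau>' x)) = - (LINT x|Om S. F' x * complex_of_real (\<tau> x))"
    by (simp add: eq_neg_iff_add_eq_0)
qed

text \<open>Needed so that \<open>lap\<close>, a definite description, has its intended value on \<open>w(z)(0)\<close>.\<close>

lemma tens_beta_in_dom_lap: "tens S c (beta S k) \<in> dom_lap S"
proof -
  define s where "s = (if k = 0 then 1 else sqrt 2)"
  define q where "q = real k / len S"
  define d where "d x = complex_of_real (- s * q * sin (q * x))" for x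
  obtain b where b: "AE x in Om S. val S b x = beta S k x" using ex_val_beta by blast
  obtain w where w: "AE x in Om S. val S w x = complex_of_real (- q\<^sup>2) * val S b x"
    using ex_val_mult by blast
  have w': "AE x in Om S. complex_of_real (- s * q\<^sup>2 * cos (q * x)) = val S w x"
    using b w by eventually_elim (simp add: beta_eq s_def q_def)
  have "weak_deriv S (\<lambda>x. complex_of_real (s * cos (q * x))) d"
  proof (rule smooth_weak_deriv)
    have "((\<lambda>x. s * cos (q * x)) has_real_derivative - s * q * sin (q * x)) (at x)" for x
      by (auto intro!: derivative_eq_intros)
    then show "((\<lambda>x. complex_of_real (s * cos (q * x))) has_vector_derivative d x) (at x)" for x
      unfolding d_def by (rule has_vector_derivative_of_real)
    show "continuous_on UNIV d" unfolding d_def[abs_def] by (intro continuous_intros)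
  qed
  then have 1: "weak_deriv S (val S b) d"
  proof (rule weak_deriv_cong)
    show "AE x in Om S. complex_of_real (s * cos (q * x)) = val S b x"
      using b by eventually_elim (simp add: beta_eq s_def q_def)
  qed (auto simp: d_def[abs_def] intro!: weight_measurable continuous_intros)
  have "weak_deriv S d (\<lambda>x. complex_of_real (- s * q\<^sup>2 * cos (q * x)))"
  proof (rule smooth_weak_deriv)
    have "((\<lambda>x. - s * q * sin (q * x)) has_real_derivative - s * q\<^sup>2 * cos (q * x)) (at x)" for x
      by (auto intro!: derivative_eq_intros simp: power2_eq_square)
    then show "(d has_vector_derivative complex_of_real (- s * q\<^sup>2 * cos (q * x))) (at x)" for x
      unfolding d_def[abs_def] by (rule has_vector_derivative_of_real)
    show "continuous_on UNIV (\<lambda>x. complex_of_real (- s * q\<^sup>2 * cos (q * x)))" by (intro continuous_intros)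
  qed
  then have 2: "weak_deriv S d (val S w)"
    by (rule weak_deriv_cong[OF _ _ w'])
      (auto simp: d_def[abs_def] intro!: weight_measurable continuous_intros)
  have "q * bdry = real k * pi" using len_pos by (simp add: q_def)
  then have "d bdry = 0" unfolding d_def by (simp only: sin_npi) simp
  then have n: "neumann_lap S b w" unfolding neumann_lap_def using 1 2
    by (intro exI[of _ d]) (auto simp: d_def[abs_def] intro!: continuous_intros)
  have "tens S c (beta S k) = tens S c (val S b)"
    by (rule tens_cong_AE[OF realized_val AE_eq_sym[OF b]])
  then show ?thesis unfolding dom_lap_def tens_def using neumann_lap_mult[OF n] by auto
qed

end

section \<open>The operators on Fourier modes\<close>

text \<open>Divide by \<open>t\<^sup>2\<close> and let \<open>t\<close> tend to 0; then divide by \<open>t\<^sup>3\<close>.\<close>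

lemma fourth_order_zero:
  fixes a b K d :: real
  assumes d: "d > 0" and bound: "\<And>t. 0 < t \<Longrightarrow> t < d \<Longrightarrow> \<bar>t\<^sup>2 * a + t ^ 3 * b\<bar> \<le> K * t ^ 4"
  shows "a = 0" "b = 0"
proof -
  have ev: "\<forall>\<^sub>F t in at_right 0. 0 < t \<and> t < d"
    using d eventually_at_right_real[OF d] by (auto elim!: eventually_mono)
  have *: "\<bar>a + t * b\<bar> \<le> K * t\<^sup>2" if "0 < t" "t < d" for t
  proof -
    have "t\<^sup>2 * \<bar>a + t * b\<bar> = \<bar>t\<^sup>2 * a + t ^ 3 * b\<bar>"
    proof -
      have "t\<^sup>2 * a + t ^ 3 * b = t\<^sup>2 * (a + t * b)"
        by (simp add: power2_eq_square power3_eq_cube algebra_simps)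
      then show ?thesis by (simp add: abs_mult)
    qed
    also have "\<dots> \<le> t\<^sup>2 * (K * t\<^sup>2)"
      using bound[OF that] by (simp add: power2_eq_square power4_eq_xxxx mult_ac)
    finally show ?thesis using that by simp
  qed
  have "((\<lambda>t. K * t\<^sup>2 - \<bar>a + t * b\<bar>) \<longlongrightarrow> K * 0\<^sup>2 - \<bar>a + 0 * b\<bar>) (at_right 0)"
    by (intro tendsto_intros)
  moreover have "\<forall>\<^sub>F t in at_right 0. 0 \<le> K * t\<^sup>2 - \<bar>a + t * b\<bar>"
    using ev by eventually_elim (use * in auto)
  ultimately have "0 \<le> K * 0\<^sup>2 - \<bar>a + 0 * b\<bar>"
    by (intro tendsto_lowerbound[where F="at_right (0::real)"]) auto
  then show a: "a = 0" by simp
  have **: "\<bar>b\<bar> \<le> K * t" if "0 < t" "t < d" for t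
    using *[OF that] that by (simp add: a abs_mult power2_eq_square)
  have "((\<lambda>t. K * t - \<bar>b\<bar>) \<longlongrightarrow> K * 0 - \<bar>b\<bar>) (at_right 0)"
    by (intro tendsto_intros)
  moreover have "\<forall>\<^sub>F t in at_right 0. 0 \<le> K * t - \<bar>b\<bar>"
    using ev by eventually_elim (use ** in auto)
  ultimately have "0 \<le> K * 0 - \<bar>b\<bar>"
    by (intro tendsto_lowerbound[where F="at_right (0::real)"]) auto
  then show "b = 0" by simp
qed

locale rd_system =
  fixes S :: "('x::{real_inner,banach}, 'm::finite, 'z) pfde_scheme"
  assumes sys: "pfde_system S"

sublocale rd_system \<subseteq> delay_space
  using sys by unfold_locales (auto simp: pfde_system_def)

context rd_system
begin

abbreviation cont :: "(real \<Rightarrow> 'b::topological_space) \<Rightarrow> bool" where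
  "cont \<phi> \<equiv> continuous_on (I\<^sub>r S) \<phi>"

lemma zero_in_nbhd: "0 \<in> nbhd S" and open_nbhd: "open (nbhd S)"
  using sys by (auto simp: pfde_system_def)

lemma Lop_csc:
  "\<alpha> \<in> nbhd S \<Longrightarrow> cont \<phi> \<Longrightarrow>
    Lop S \<alpha> (hist S (\<lambda>\<theta>. csc S c (\<phi> \<theta>))) = csc S c (Lop S \<alpha> (hist S \<phi>))"
  and Lop_real:
  "\<alpha> \<in> nbhd S \<Longrightarrow> cont \<phi> \<Longrightarrow> (\<And>\<theta>. \<theta> \<in> I\<^sub>r S \<Longrightarrow> real_valued S (\<phi> \<theta>)) \<Longrightarrow>
    real_valued S (Lop S \<alpha> (hist S \<phi>))"
  and Lop_Ck: "Ck_on 1 (Lop S) (nbhd S)"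
  and dcoef_diff: "dcoef S differentiable (at 0)"
  using sys by (auto simp: pfde_system_def linear_part_def)

lemma
  G_real: "\<alpha> \<in> nbhd S \<Longrightarrow> cont \<phi> \<Longrightarrow> (\<And>\<theta>. \<theta> \<in> I\<^sub>r S \<Longrightarrow> real_valued S (\<phi> \<theta>)) \<Longrightarrow>
    real_valued S (Gop S (hist S \<phi>) \<alpha>)"
  and Q_bilinear: "bounded_bilinear (Qop S)"
  and Q_commute: "Qop S u v = Qop S v u"
  and Q_csc: "cont \<phi> \<Longrightarrow> Qop S (hist S (\<lambda>\<theta>. csc S c (\<phi> \<theta>))) v = csc S c (Qop S (hist S \<phi>) v)"
  and C_linear: "linear (\<lambda>u. Cop S u v w)"
  and C_commute: "Cop S u v w = Cop S v u w" "Cop S u v w = Cop S u w v"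
  and C_csc: "cont \<phi> \<Longrightarrow> Cop S (hist S (\<lambda>\<theta>. csc S c (\<phi> \<theta>))) v w = csc S c (Cop S (hist S \<phi>) v w)"
  and G_expansion: "\<exists>K. \<exists>\<delta>>0. \<forall>\<phi>. cont \<phi> \<and> (\<forall>\<theta>\<in>I\<^sub>r S. real_valued S (\<phi> \<theta>)) \<and>
        norm (hist S \<phi>) < \<delta> \<longrightarrow>
         norm (Gop S (hist S \<phi>) 0 - (1 / 2) *\<^sub>R Qop S (hist S \<phi>) (hist S \<phi>) -
           (1 / 6) *\<^sub>R Cop S (hist S \<phi>) (hist S \<phi>) (hist S \<phi>)) \<le> K * norm (hist S \<phi>) ^ 4"
proof -
  have n: "nonlinear_part S" using sys by (simp add: pfde_system_def)
  note n3 = n[unfolded nonlinear_part_def Let_def, THEN conjunct2, THEN conjunct2]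
  note n5 = n3[THEN conjunct2, THEN conjunct2]
  note n7 = n5[THEN conjunct2, THEN conjunct2]
  note n9 = n7[THEN conjunct2, THEN conjunct2]
  show "\<alpha> \<in> nbhd S \<Longrightarrow> cont \<phi> \<Longrightarrow> (\<And>\<theta>. \<theta> \<in> I\<^sub>r S \<Longrightarrow> real_valued S (\<phi> \<theta>)) \<Longrightarrow>
      real_valued S (Gop S (hist S \<phi>) \<alpha>)"
    using n3[THEN conjunct1] by simp
  show "bounded_bilinear (Qop S)"
    using n3[THEN conjunct2, THEN conjunct1] .
  show "Qop S u v = Qop S v u" using n5[THEN conjunct1] by blast
  show "cont \<phi> \<Longrightarrow> Qop S (hist S (\<lambda>\<theta>. csc S c (\<phi> \<theta>))) v = csc S c (Qop S (hist S \<phi>) v)"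
    using n5[THEN conjunct2, THEN conjunct1] by simp
  show "linear (\<lambda>u. Cop S u v w)" using n7[THEN conjunct1] by simp
  show "Cop S u v w = Cop S v u w" "Cop S u v w = Cop S u w v"
    using n9[THEN conjunct1] by blast+
  show "cont \<phi> \<Longrightarrow> Cop S (hist S (\<lambda>\<theta>. csc S c (\<phi> \<theta>))) v w = csc S c (Cop S (hist S \<phi>) v w)"
    using n9[THEN conjunct2, THEN conjunct1] by simp
  show "\<exists>K. \<exists>\<delta>>0. \<forall>\<phi>. cont \<phi> \<and> (\<forall>\<theta>\<in>I\<^sub>r S. real_valued S (\<phi> \<theta>)) \<and>
        norm (hist S \<phi>) < \<delta> \<longrightarrow>
         norm (Gop S (hist S \<phi>) 0 - (1 / 2) *\<^sub>R Qop S (hist S \<phi>) (hist S \<phi>) -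
           (1 / 6) *\<^sub>R Cop S (hist S \<phi>) (hist S \<phi>) (hist S \<phi>)) \<le> K * norm (hist S \<phi>) ^ 4"
    using n9[THEN conjunct2, THEN conjunct2] .
qed

interpretation Q: bounded_bilinear "Qop S" by (rule Q_bilinear)

lemma L_pointwise:
  "\<alpha> \<in> nbhd S \<Longrightarrow> cont \<phi> \<Longrightarrow>
    AE x in Om S. val S (Lop S \<alpha> (hist S (\<lambda>\<theta>. tens S (\<phi> \<theta>) (val S u))) $ i) x =
      Lh S \<alpha> \<phi> $ i * val S u x"
  and Q_pointwise:
  "cont \<phi> \<Longrightarrow> cont \<psi> \<Longrightarrow>
    AE x in Om S. val S (Qop S (hist S (\<lambda>\<theta>. tens S (\<phi> \<theta>) (val S u)))
        (hist S (\<lambda>\<theta>. tens S (\<psi> \<theta>) (val S v))) $ i) x =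
      Qh S \<phi> \<psi> $ i * val S u x * val S v x"
  and C_pointwise:
  "cont \<phi> \<Longrightarrow> cont \<psi> \<Longrightarrow> cont \<rho> \<Longrightarrow>
    AE x in Om S. val S (Cop S (hist S (\<lambda>\<theta>. tens S (\<phi> \<theta>) (val S u)))
        (hist S (\<lambda>\<theta>. tens S (\<psi> \<theta>) (val S v))) (hist S (\<lambda>\<theta>. tens S (\<rho> \<theta>) (val S w))) $ i) x =
      Ch S \<phi> \<psi> \<rho> $ i * val S u x * val S v x * val S w x"
proof -
  have p: "pointwise_action S" using sys by (simp add: pfde_system_def)
  note p2 = p[unfolded pointwise_action_def, THEN conjunct2]
  show "\<alpha> \<in> nbhd S \<Longrightarrow> cont \<phi> \<Longrightarrow>
    AE x in Om S. val S (Lop S \<alpha> (hist S (\<lambda>\<theta>. tens S (\<phi> \<theta>) (val S u))) $ i) x =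
      Lh S \<alpha> \<phi> $ i * val S u x"
    using p[unfolded pointwise_action_def, THEN conjunct1] by simp
  show "cont \<phi> \<Longrightarrow> cont \<psi> \<Longrightarrow>
    AE x in Om S. val S (Qop S (hist S (\<lambda>\<theta>. tens S (\<phi> \<theta>) (val S u)))
        (hist S (\<lambda>\<theta>. tens S (\<psi> \<theta>) (val S v))) $ i) x =
      Qh S \<phi> \<psi> $ i * val S u x * val S v x"
    using p2[THEN conjunct1] by simp
  show "cont \<phi> \<Longrightarrow> cont \<psi> \<Longrightarrow> cont \<rho> \<Longrightarrow>
    AE x in Om S. val S (Cop S (hist S (\<lambda>\<theta>. tens S (\<phi> \<theta>) (val S u)))
        (hist S (\<lambda>\<theta>. tens S (\<psi> \<theta>) (val S v))) (hist S (\<lambda>\<theta>. tens S (\<rho> \<theta>) (val S w))) $ i) x =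
      Ch S \<phi> \<psi> \<rho> $ i * val S u x * val S v x * val S w x"
    using p2[THEN conjunct2] by simp
qed

definition bt :: "nat \<Rightarrow> 'x" where
  "bt k = rep S (beta S k)"

lemma val_bt: "AE x in Om S. val S (bt k) x = beta S k x"
  using ex_val_beta[of k] rep_eq unfolding bt_def by metis

lemma tens_beta: "tens S c (beta S k) = tens S c (val S (bt k))"
  using tens_cong_AE[OF realized_beta val_bt] by simp

lemma wcoef_AE:
  assumes "\<And>i. AE x in Om S. val S (u $ i) x = c $ i * f x"
    and "f \<in> borel_measurable (Om S)" and "continuous_on {0..len S * pi} w"
  shows "wcoef w u = wmean w f *s c"
proof -
  have "wmean w (val S (u $ i)) = c $ i * wmean w f" for i
    using wmean_cong_AE[OF assms(1)] assms(2,3) by (simp add: wmean_mult)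
  then show ?thesis by (simp add: wcoef_def vec_eq_iff mult.commute)
qed

lemma beta_measurable: "beta S k \<in> borel_measurable (Om S)"
  by (rule weight_measurable) (rule continuous_beta)

lemma coef_Q_tens:
  assumes "cont \<phi>" "cont \<psi>"
  shows "coef S k (Qop S (hist S (\<lambda>\<theta>. tens S (\<phi> \<theta>) (beta S a))) (hist S (\<lambda>\<theta>. tens S (\<psi> \<theta>) (beta S b)))) =
    wmean (beta S k) (\<lambda>x. beta S a x * beta S b x) *s Qh S \<phi> \<psi>"
  unfolding coef_eq_wcoef tens_beta
proof (rule wcoef_AE)
  fix i
  show "AE x in Om S. val S (Qop S (hist S (\<lambda>\<theta>. tens S (\<phi> \<theta>) (val S (bt a))))
      (hist S (\<lambda>\<theta>. tens S (\<psi> \<theta>) (val S (bt b)))) $ i) x = Qh S \<phi> \<psi> $ i * (beta S a x * beta S b x)"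
    using Q_pointwise[OF assms, of "bt a" "bt b" i] val_bt[of a] val_bt[of b]
    by eventually_elim simp
  show "(\<lambda>x. beta S a x * beta S b x) \<in> borel_measurable (Om S)"
    using beta_measurable by measurable
qed (rule continuous_beta)

lemma coef_C_tens:
  assumes "cont \<phi>" "cont \<psi>" "cont \<rho>"
  shows "coef S k (Cop S (hist S (\<lambda>\<theta>. tens S (\<phi> \<theta>) (beta S a)))
      (hist S (\<lambda>\<theta>. tens S (\<psi> \<theta>) (beta S b))) (hist S (\<lambda>\<theta>. tens S (\<rho> \<theta>) (beta S d)))) =
    wmean (beta S k) (\<lambda>x. beta S a x * beta S b x * beta S d x) *s Ch S \<phi> \<psi> \<rho>"
  unfolding coef_eq_wcoef tens_beta
proof (rule wcoef_AE)
  fix i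
  show "AE x in Om S. val S (Cop S (hist S (\<lambda>\<theta>. tens S (\<phi> \<theta>) (val S (bt a))))
      (hist S (\<lambda>\<theta>. tens S (\<psi> \<theta>) (val S (bt b)))) (hist S (\<lambda>\<theta>. tens S (\<rho> \<theta>) (val S (bt d)))) $ i) x =
      Ch S \<phi> \<psi> \<rho> $ i * (beta S a x * beta S b x * beta S d x)"
    using C_pointwise[OF assms, of "bt a" "bt b" "bt d" i] val_bt[of a] val_bt[of b] val_bt[of d]
    by eventually_elim simp
  show "(\<lambda>x. beta S a x * beta S b x * beta S d x) \<in> borel_measurable (Om S)"
    using beta_measurable by measurable
qed (rule continuous_beta)

lemma cont_tens_beta: "cont \<phi> \<Longrightarrow> cont (\<lambda>\<theta>. tens S (\<phi> \<theta>) (beta S k))"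
  by (rule continuous_tens[OF realized_beta])

lemma linear_coef: "linear (coef S k)"
  using bounded_linear_coef bounded_linear.linear by blast

lemmas coef_add = linear_add[OF linear_coef]
  and coef_diff = linear_diff[OF linear_coef]
  and coef_scaleR = linear_cmul[OF linear_coef]
  and coef_zero = linear_0[OF linear_coef]

lemma Lh_add: "cont \<phi> \<Longrightarrow> cont \<psi> \<Longrightarrow> Lh S \<alpha> (\<lambda>\<theta>. \<phi> \<theta> + \<psi> \<theta>) = Lh S \<alpha> \<phi> + Lh S \<alpha> \<psi>"
  by (simp add: Lh_def cst_add blinfun.add_right coef_add)

lemma Lh_smult: "\<alpha> \<in> nbhd S \<Longrightarrow> cont \<phi> \<Longrightarrow> Lh S \<alpha> (\<lambda>\<theta>. c *s \<phi> \<theta>) = c *s Lh S \<alpha> \<phi>"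
  unfolding Lh_def cst_smult by (simp add: cst_def Lop_csc cont_tens_beta coef_csc)

lemma Lh_cong: "(\<And>\<theta>. \<theta> \<in> I\<^sub>r S \<Longrightarrow> \<phi> \<theta> = \<psi> \<theta>) \<Longrightarrow> Lh S \<alpha> \<phi> = Lh S \<alpha> \<psi>"
  unfolding Lh_def by (simp cong: cst_cong)

lemma Qh_commute: "Qh S \<phi> \<psi> = Qh S \<psi> \<phi>"
  unfolding Qh_def by (subst Q_commute) simp

lemma Qh_add_left: "cont \<phi> \<Longrightarrow> cont \<psi> \<Longrightarrow> Qh S (\<lambda>\<theta>. \<phi> \<theta> + \<psi> \<theta>) \<rho> = Qh S \<phi> \<rho> + Qh S \<psi> \<rho>"
  by (simp add: Qh_def cst_add Q.add_left coef_add)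

lemma Qh_add_right: "cont \<phi> \<Longrightarrow> cont \<psi> \<Longrightarrow> Qh S \<rho> (\<lambda>\<theta>. \<phi> \<theta> + \<psi> \<theta>) = Qh S \<rho> \<phi> + Qh S \<rho> \<psi>"
  unfolding Qh_commute[of \<rho>] by (rule Qh_add_left)

lemma Qh_smult_left: "cont \<phi> \<Longrightarrow> Qh S (\<lambda>\<theta>. c *s \<phi> \<theta>) \<rho> = c *s Qh S \<phi> \<rho>"
  unfolding Qh_def cst_smult by (simp add: cst_def Q_csc cont_tens_beta coef_csc)

lemma Qh_smult_right: "cont \<phi> \<Longrightarrow> Qh S \<rho> (\<lambda>\<theta>. c *s \<phi> \<theta>) = c *s Qh S \<rho> \<phi>"
  unfolding Qh_commute[of \<rho>] by (rule Qh_smult_left)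

lemma Qh_cong_right: "(\<And>\<theta>. \<theta> \<in> I\<^sub>r S \<Longrightarrow> \<phi> \<theta> = \<psi> \<theta>) \<Longrightarrow> Qh S \<rho> \<phi> = Qh S \<rho> \<psi>"
  unfolding Qh_def by (simp cong: cst_cong)

lemma Ch_commute: "Ch S \<phi> \<psi> \<rho> = Ch S \<psi> \<phi> \<rho>" "Ch S \<phi> \<psi> \<rho> = Ch S \<phi> \<rho> \<psi>"
  unfolding Ch_def by (subst C_commute(1), simp) (subst C_commute(2), simp)

lemma Ch_add_left:
  "cont \<phi> \<Longrightarrow> cont \<psi> \<Longrightarrow> Ch S (\<lambda>\<theta>. \<phi> \<theta> + \<psi> \<theta>) \<rho> \<sigma> = Ch S \<phi> \<rho> \<sigma> + Ch S \<psi> \<rho> \<sigma>"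
  by (simp add: Ch_def cst_add linear_add[OF C_linear] coef_add)

lemma Ch_smult_left: "cont \<phi> \<Longrightarrow> Ch S (\<lambda>\<theta>. c *s \<phi> \<theta>) \<rho> \<sigma> = c *s Ch S \<phi> \<rho> \<sigma>"
  unfolding Ch_def cst_smult by (simp add: cst_def C_csc cont_tens_beta coef_csc)

lemma Ch_add_mid:
  "cont \<phi> \<Longrightarrow> cont \<psi> \<Longrightarrow> Ch S \<rho> (\<lambda>\<theta>. \<phi> \<theta> + \<psi> \<theta>) \<sigma> = Ch S \<rho> \<phi> \<sigma> + Ch S \<rho> \<psi> \<sigma>"
  unfolding Ch_commute(1)[of \<rho>] by (rule Ch_add_left)

lemma Ch_smult_mid: "cont \<phi> \<Longrightarrow> Ch S \<rho> (\<lambda>\<theta>. c *s \<phi> \<theta>) \<sigma> = c *s Ch S \<rho> \<phi> \<sigma>"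
  unfolding Ch_commute(1)[of \<rho>] by (rule Ch_smult_left)

lemma Ch_add_right:
  "cont \<phi> \<Longrightarrow> cont \<psi> \<Longrightarrow> Ch S \<rho> \<sigma> (\<lambda>\<theta>. \<phi> \<theta> + \<psi> \<theta>) = Ch S \<rho> \<sigma> \<phi> + Ch S \<rho> \<sigma> \<psi>"
  unfolding Ch_commute(2)[of \<rho> \<sigma>] by (rule Ch_add_mid)

lemma Ch_smult_right: "cont \<phi> \<Longrightarrow> Ch S \<rho> \<sigma> (\<lambda>\<theta>. c *s \<phi> \<theta>) = c *s Ch S \<rho> \<sigma> \<phi>"
  unfolding Ch_commute(2)[of \<rho> \<sigma>] by (rule Ch_smult_mid)

text \<open>The operator on mode \<open>k\<close> of an arbitrary continuous history is the operator on
  \<open>C([-r,0]; \<complex>\<^sup>m)\<close> applied to its \<open>k\<close>-th Fourier coefficient.\<close>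

lemma coef_L:
  assumes "\<alpha> \<in> nbhd S" "cont \<phi>"
  shows "coef S k (Lop S \<alpha> (hist S \<phi>)) = Lh S \<alpha> (\<lambda>\<theta>. coef S k (\<phi> \<theta>))"
  unfolding coef_eq_wcoef Lh_def
proof (rule pointwise_transfer[unfolded coef_eq_wcoef])
  show "bounded_linear (blinfun_apply (Lop S \<alpha>))" by (rule blinfun.bounded_linear_right)
  then show "bounded_linear (blinfun_apply (Lop S \<alpha>))" .
  fix \<psi> :: "real \<Rightarrow> complex^'m" assume \<psi>: "cont \<psi>"
  show "wcoef (beta S 0) (Lop S \<alpha> (cst S (\<lambda>\<theta>. c *s \<psi> \<theta>))) = c *s wcoef (beta S 0) (Lop S \<alpha> (cst S \<psi>))" for c
    using Lh_smult[OF assms(1) \<psi>, of c] by (simp add: Lh_def coef_eq_wcoef)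
  show "wcoef (beta S k) (Lop S \<alpha> (hist S (\<lambda>\<theta>. tens S (\<psi> \<theta>) (val S u)))) =
      wmean (beta S k) (val S u) *s wcoef (beta S 0) (Lop S \<alpha> (cst S \<psi>))" for u
    using L_pointwise[OF assms(1) \<psi>, of u]
    by (intro wcoef_AE continuous_beta) (simp_all add: Lh_def coef_eq_wcoef)
qed (rule assms continuous_beta)+

text \<open>One argument is arbitrary, because \<open>Q(w,h)\<close> has to be evaluated at the unknown \<open>h\<close>.\<close>

lemma coef_Q_mixed:
  assumes \<rho>: "cont \<rho>" and \<phi>: "cont \<phi>"
  shows "coef S k (Qop S (hist S (\<lambda>\<theta>. tens S (\<rho> \<theta>) (beta S a))) (hist S \<phi>)) =
    Qh S \<rho> (\<lambda>\<theta>. wcoef (\<lambda>x. beta S a x * beta S k x) (\<phi> \<theta>))"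
  unfolding coef_eq_wcoef Qh_def
proof (rule pointwise_transfer[unfolded coef_eq_wcoef])
  show "bounded_linear (Qop S (hist S (\<lambda>\<theta>. tens S (\<rho> \<theta>) (beta S a))))" "bounded_linear (Qop S (cst S \<rho>))"
    by (rule Q.bounded_linear_right)+
  show "continuous_on {0..len S * pi} (\<lambda>x. beta S a x * beta S k x)"
    by (intro continuous_intros)
  fix \<psi> :: "real \<Rightarrow> complex^'m" assume \<psi>: "cont \<psi>"
  show "wcoef (beta S 0) (Qop S (cst S \<rho>) (cst S (\<lambda>\<theta>. c *s \<psi> \<theta>))) =
      c *s wcoef (beta S 0) (Qop S (cst S \<rho>) (cst S \<psi>))" for c
    using Qh_smult_right[OF \<psi>, of \<rho> c] by (simp add: Qh_def coef_eq_wcoef)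
  fix u
  have m: "wmean (beta S k) (\<lambda>x. beta S a x * val S u x) = wmean (\<lambda>x. beta S a x * beta S k x) (val S u)"
    unfolding wmean_def by (simp add: mult_ac)
  have "wcoef (beta S k) (Qop S (hist S (\<lambda>\<theta>. tens S (\<rho> \<theta>) (beta S a))) (hist S (\<lambda>\<theta>. tens S (\<psi> \<theta>) (val S u)))) =
      wmean (beta S k) (\<lambda>x. beta S a x * val S u x) *s Qh S \<rho> \<psi>"
  proof (rule wcoef_AE)
    fix i
    show "AE x in Om S. val S (Qop S (hist S (\<lambda>\<theta>. tens S (\<rho> \<theta>) (beta S a)))
        (hist S (\<lambda>\<theta>. tens S (\<psi> \<theta>) (val S u))) $ i) x = Qh S \<rho> \<psi> $ i * (beta S a x * val S u x)"
      using Q_pointwise[OF \<rho> \<psi>, of "bt a" u i] val_bt[of a] unfolding tens_beta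
      by eventually_elim simp
    show "(\<lambda>x. beta S a x * val S u x) \<in> borel_measurable (Om S)"
      using beta_measurable by measurable
  qed (rule continuous_beta)
  then show "wcoef (beta S k) (Qop S (hist S (\<lambda>\<theta>. tens S (\<rho> \<theta>) (beta S a))) (hist S (\<lambda>\<theta>. tens S (\<psi> \<theta>) (val S u)))) =
      wmean (\<lambda>x. beta S a x * beta S k x) (val S u) *s wcoef (beta S 0) (Qop S (cst S \<rho>) (cst S \<psi>))"
    unfolding m by (simp add: Qh_def coef_eq_wcoef)
qed (rule assms continuous_beta)+

lemma real_valued_tens:
  assumes "cnjv c = c"
  shows "real_valued S (tens S c (beta S 0))"
  unfolding real_valued_def
proof
  fix i
  have "cnj (c $ i) = c $ i" using assms by (metis cnjv_nth)
  then have "c $ i \<in> \<real>" by (simp add: Reals_cnj_iff)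
  then show "AE x in Om S. val S (tens S c (beta S 0) $ i) x \<in> \<real>"
    using val_tens[OF realized_beta, of c 0 i] by (auto elim!: eventually_mono simp: beta_0)
qed

lemma coef_real:
  assumes "real_valued S u"
  shows "cnjv (coef S 0 u) = coef S 0 u"
proof -
  have "cnj (LINT x|Om S. val S (u $ i) x) = (LINT x|Om S. val S (u $ i) x)" for i
  proof -
    have "AE x in Om S. val S (u $ i) x \<in> \<real>"
      using assms by (simp add: real_valued_def)
    then have "AE x in Om S. cnj (val S (u $ i) x) = val S (u $ i) x"
      by (auto elim!: eventually_mono simp: Reals_cnj_iff)
    then have "(LINT x|Om S. cnj (val S (u $ i) x)) = (LINT x|Om S. val S (u $ i) x)"
      by (intro integral_cong_AE) (auto intro!: measurable_compose[OF val_measurable] borel_measurable_continuous_onI continuous_intros)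
    then show ?thesis by simp
  qed
  then show ?thesis
    by (simp add: coef_eq_wcoef wcoef_def wmean_def beta_0 vec_eq_iff)
qed

lemma Lh_cnj:
  assumes "\<alpha> \<in> nbhd S" "cont \<phi>"
  shows "Lh S \<alpha> (\<lambda>\<theta>. cnjv (\<phi> \<theta>)) = cnjv (Lh S \<alpha> \<phi>)"
proof (rule conj_extend[where I="I\<^sub>r S" and F="Lh S \<alpha>" and F'="Lh S \<alpha>"])
  fix \<phi> :: "real \<Rightarrow> complex^'m" assume *: "cont \<phi>" "\<And>\<theta>. cnjv (\<phi> \<theta>) = \<phi> \<theta>"
  have "real_valued S (Lop S \<alpha> (cst S \<phi>))"
    unfolding cst_def using assms(1) * by (intro Lop_real cont_tens_beta real_valued_tens)
  from coef_real[OF this] show "Lh S \<alpha> \<phi> = cnjv (Lh S \<alpha> \<phi>)" by (simp add: Lh_def)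
qed (use assms in \<open>auto simp: Lh_add Lh_smult\<close>)

text \<open>For real \<open>\<phi>\<close> and small \<open>t\<close>, the imaginary part of the expansion of \<open>G(t\<phi>)\<close> reads
  \<open>t\<^sup>2 Im Q(\<phi>,\<phi>)/2 + t\<^sup>3 Im C(\<phi>,\<phi>,\<phi>)/6 = O(t\<^sup>4)\<close>, as \<open>G(t\<phi>)\<close> is real; so both coefficients vanish.\<close>

lemma diagonal_real:
  assumes "cont \<phi>" "\<And>\<theta>. cnjv (\<phi> \<theta>) = \<phi> \<theta>"
  shows "cnjv (Qh S \<phi> \<phi>) = Qh S \<phi> \<phi>" "cnjv (Ch S \<phi> \<phi> \<phi>) = Ch S \<phi> \<phi> \<phi>"
proof -
  obtain K \<delta> where \<delta>: "\<delta> > 0" and K: "\<And>\<psi>. cont \<psi> \<Longrightarrow> (\<And>\<theta>. \<theta> \<in> I\<^sub>r S \<Longrightarrow> real_valued S (\<psi> \<theta>)) \<Longrightarrow>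
      norm (hist S \<psi>) < \<delta> \<Longrightarrow>
      norm (Gop S (hist S \<psi>) 0 - (1 / 2) *\<^sub>R Qop S (hist S \<psi>) (hist S \<psi>) -
           (1 / 6) *\<^sub>R Cop S (hist S \<psi>) (hist S \<psi>) (hist S \<psi>)) \<le> K * norm (hist S \<psi>) ^ 4"
    using G_expansion by blast
  obtain N where N: "\<And>u. norm (coef S 0 u) \<le> norm u * N" "N \<ge> 0"
    using bounded_linear.nonneg_bounded[OF bounded_linear_coef] by blast
  define v where "v = cst S \<phi>"
  (* For 0 < t < d the history t v lies in the ball where the expansion of G holds. *)
  define d where "d = \<delta> / (norm v + 1)"
  have d: "d > 0" using \<delta> by (simp add: d_def add_nonneg_pos)
  have bound: "\<bar>t\<^sup>2 * (Im (Qh S \<phi> \<phi> $ i) / 2) + t ^ 3 * (Im (Ch S \<phi> \<phi> \<phi> $ i) / 6)\<bar> \<le>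
      (K * norm v ^ 4 * N) * t ^ 4" if t: "0 < t" "t < d" for t i
  proof -
    define \<psi> where "\<psi> \<theta> = t *\<^sub>R \<phi> \<theta>" for \<theta>
    have c\<psi>: "cont \<psi>" unfolding \<psi>_def by (intro continuous_intros assms)
    have "cst S \<psi> = t *\<^sub>R v"
      unfolding v_def cst_def \<psi>_def tens_scaleR[OF realized_beta]
      by (rule hist_scaleR[OF cont_tens_beta[OF assms(1)]])
    then have h: "hist S (\<lambda>\<theta>. tens S (\<psi> \<theta>) (beta S 0)) = t *\<^sub>R v" by (simp add: cst_def)
    have r: "real_valued S (tens S (\<psi> \<theta>) (beta S 0))" for \<theta>
      using assms(2)[of \<theta>] by (intro real_valued_tens) (simp add: \<psi>_def vec_eq_iff)
    have "norm (t *\<^sub>R v) < \<delta>"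
    proof -
      have "t * (norm v + 1) < \<delta>" using t \<delta> by (simp add: d_def pos_less_divide_eq add_nonneg_pos)
      then show ?thesis using t by (simp add: distrib_left)
    qed
    from K[of "\<lambda>\<theta>. tens S (\<psi> \<theta>) (beta S 0)", unfolded h, OF cont_tens_beta[OF c\<psi>] r this]
    have 1: "norm (Gop S (t *\<^sub>R v) 0 - (1 / 2) *\<^sub>R Qop S (t *\<^sub>R v) (t *\<^sub>R v) -
        (1 / 6) *\<^sub>R Cop S (t *\<^sub>R v) (t *\<^sub>R v) (t *\<^sub>R v)) \<le> K * norm (t *\<^sub>R v) ^ 4" .
    define g where "g = coef S 0 (Gop S (t *\<^sub>R v) 0)"
    have "real_valued S (Gop S (t *\<^sub>R v) 0)"
      using G_real[OF zero_in_nbhd cont_tens_beta[OF c\<psi>] r] by (simp add: h)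
    then have g: "cnjv g = g" unfolding g_def by (rule coef_real)
    have C3: "Cop S (t *\<^sub>R v) (t *\<^sub>R v) (t *\<^sub>R v) = t ^ 3 *\<^sub>R Cop S v v v"
      using linear_cmul[OF C_linear] C_commute
      by (metis (no_types, opaque_lifting) power3_eq_cube scaleR_scaleR mult.assoc)
    have Q2: "Qop S (t *\<^sub>R v) (t *\<^sub>R v) = t\<^sup>2 *\<^sub>R Qop S v v"
      by (simp add: Q.scaleR_left Q.scaleR_right power2_eq_square)
    have "coef S 0 (Gop S (t *\<^sub>R v) 0 - (1 / 2) *\<^sub>R Qop S (t *\<^sub>R v) (t *\<^sub>R v) -
        (1 / 6) *\<^sub>R Cop S (t *\<^sub>R v) (t *\<^sub>R v) (t *\<^sub>R v)) =
        g - (t\<^sup>2 / 2) *\<^sub>R Qh S \<phi> \<phi> - (t ^ 3 / 6) *\<^sub>R Ch S \<phi> \<phi> \<phi>"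
      unfolding C3 Q2 coef_diff coef_scaleR g_def Qh_def Ch_def v_def[symmetric] by simp
    then have "norm (g - (t\<^sup>2 / 2) *\<^sub>R Qh S \<phi> \<phi> - (t ^ 3 / 6) *\<^sub>R Ch S \<phi> \<phi> \<phi>) \<le> K * norm (t *\<^sub>R v) ^ 4 * N"
      using order_trans[OF N(1) mult_right_mono[OF 1 N(2)]] by (simp only:)
    moreover have "\<bar>Im ((g - (t\<^sup>2 / 2) *\<^sub>R Qh S \<phi> \<phi> - (t ^ 3 / 6) *\<^sub>R Ch S \<phi> \<phi> \<phi>) $ i)\<bar> \<le>
        norm (g - (t\<^sup>2 / 2) *\<^sub>R Qh S \<phi> \<phi> - (t ^ 3 / 6) *\<^sub>R Ch S \<phi> \<phi> \<phi>)"
      by (rule order_trans[OF abs_Im_le_cmod Finite_Cartesian_Product.norm_nth_le])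
    moreover have "Im (g $ i) = 0"
    proof -
      have "cnj (g $ i) = g $ i" using g by (metis cnjv_nth)
      then show ?thesis by (simp add: complex_eq_iff)
    qed
    then have "\<bar>Im ((g - (t\<^sup>2 / 2) *\<^sub>R Qh S \<phi> \<phi> - (t ^ 3 / 6) *\<^sub>R Ch S \<phi> \<phi> \<phi>) $ i)\<bar> =
        \<bar>t\<^sup>2 * (Im (Qh S \<phi> \<phi> $ i) / 2) + t ^ 3 * (Im (Ch S \<phi> \<phi> \<phi> $ i) / 6)\<bar>"
      by (simp add: abs_minus_commute algebra_simps)
    ultimately show ?thesis using t by (simp add: power_mult_distrib mult_ac)
  qed
  have "Im (Qh S \<phi> \<phi> $ i) = 0" "Im (Ch S \<phi> \<phi> \<phi> $ i) = 0" for i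
    using fourth_order_zero[OF d bound, of i] by auto
  then show "cnjv (Qh S \<phi> \<phi>) = Qh S \<phi> \<phi>" "cnjv (Ch S \<phi> \<phi> \<phi>) = Ch S \<phi> \<phi> \<phi>"
    by (simp_all add: vec_eq_iff complex_eq_iff)
qed

text \<open>Polarization reduces this, and likewise \<open>Ch_real\<close>, to the diagonal.\<close>

lemma Qh_real:
  assumes "cont \<phi>" "\<And>\<theta>. cnjv (\<phi> \<theta>) = \<phi> \<theta>" "cont \<psi>" "\<And>\<theta>. cnjv (\<psi> \<theta>) = \<psi> \<theta>"
  shows "cnjv (Qh S \<phi> \<psi>) = Qh S \<phi> \<psi>"
proof -
  have pol: "Qh S \<phi> \<psi> = (1/2) *s (Qh S (\<lambda>\<theta>. \<phi> \<theta> + \<psi> \<theta>) (\<lambda>\<theta>. \<phi> \<theta> + \<psi> \<theta>) - Qh S \<phi> \<phi> - Qh S \<psi> \<psi>)"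
    using assms Qh_commute[of \<psi> \<phi>] by (simp add: Qh_add_left Qh_add_right continuous_on_add vec_eq_iff)
  show ?thesis
    unfolding pol cnjv_smult cnjv_diff
    using diagonal_real(1)[of "\<lambda>\<theta>. \<phi> \<theta> + \<psi> \<theta>"] diagonal_real(1)[of \<phi>] diagonal_real(1)[of \<psi>] assms
    by (simp add: continuous_on_add cnjv_add)
qed

lemma Ch_real:
  assumes "cont \<phi>" "\<And>\<theta>. cnjv (\<phi> \<theta>) = \<phi> \<theta>" "cont \<psi>" "\<And>\<theta>. cnjv (\<psi> \<theta>) = \<psi> \<theta>"
    and "cont \<rho>" "\<And>\<theta>. cnjv (\<rho> \<theta>) = \<rho> \<theta>"
  shows "cnjv (Ch S \<phi> \<psi> \<rho>) = Ch S \<phi> \<psi> \<rho>"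
proof -
  define T where "T \<phi> = Ch S \<phi> \<phi> \<phi>" for \<phi>
  have pol: "Ch S \<phi> \<psi> \<rho> = (1/6) *s (T (\<lambda>\<theta>. \<phi> \<theta> + (\<psi> \<theta> + \<rho> \<theta>)) - T (\<lambda>\<theta>. \<phi> \<theta> + \<psi> \<theta>) -
      T (\<lambda>\<theta>. \<phi> \<theta> + \<rho> \<theta>) - T (\<lambda>\<theta>. \<psi> \<theta> + \<rho> \<theta>) - (- T \<phi> - T \<psi> - T \<rho>))"
  proof -
    note order = Ch_commute(1)[of \<psi> \<phi>] Ch_commute(1)[of \<rho> \<phi>] Ch_commute(1)[of \<rho> \<psi>]
      Ch_commute(2)[of _ \<psi> \<phi>] Ch_commute(2)[of _ \<rho> \<phi>] Ch_commute(2)[of _ \<rho> \<psi>]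
    show ?thesis
      unfolding T_def
      by (simp only: Ch_add_left Ch_add_mid Ch_add_right continuous_on_add assms order)
        (simp add: vec_eq_iff)
  qed
  (* Written as a scalar multiple, so that conjugation can be distributed. *)
  have neg: "- T \<phi> - T \<psi> - T \<rho> = (-1) *s T \<phi> - T \<psi> - T \<rho>" by (simp add: vec_eq_iff)
  have r: "cnjv (T \<phi>) = T \<phi>" if "cont \<phi>" "\<And>\<theta>. cnjv (\<phi> \<theta>) = \<phi> \<theta>" for \<phi>
    unfolding T_def using that by (rule diagonal_real)
  show ?thesis
    unfolding pol neg cnjv_smult cnjv_diff
    using assms by (simp add: r continuous_on_add cnjv_add)
qed

lemma Qh_cnj:
  assumes \<phi>: "cont \<phi>" and \<psi>: "cont \<psi>"
  shows "Qh S (\<lambda>\<theta>. cnjv (\<phi> \<theta>)) (\<lambda>\<theta>. cnjv (\<psi> \<theta>)) = cnjv (Qh S \<phi> \<psi>)"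
proof -
  have 1: "Qh S (\<lambda>\<theta>. cnjv (\<phi> \<theta>)) \<rho> = cnjv (Qh S \<phi> \<rho>)" if "cont \<rho>" "\<And>\<theta>. cnjv (\<rho> \<theta>) = \<rho> \<theta>" for \<rho>
    by (rule conj_extend[where I="I\<^sub>r S" and F="\<lambda>\<phi>. Qh S \<phi> \<rho>"])
      (use that \<phi> in \<open>auto simp: Qh_add_left Qh_smult_left Qh_real\<close>)
  show ?thesis
    by (rule conj_extend[where I="I\<^sub>r S" and F="Qh S \<phi>"])
      (use \<psi> 1 in \<open>auto simp: Qh_add_right Qh_smult_right\<close>)
qed

lemma Ch_cnj:
  assumes \<phi>: "cont \<phi>" and \<psi>: "cont \<psi>" and \<rho>: "cont \<rho>"
  shows "Ch S (\<lambda>\<theta>. cnjv (\<phi> \<theta>)) (\<lambda>\<theta>. cnjv (\<psi> \<theta>)) (\<lambda>\<theta>. cnjv (\<rho> \<theta>)) = cnjv (Ch S \<phi> \<psi> \<rho>)"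
proof -
  have 1: "Ch S (\<lambda>\<theta>. cnjv (\<phi> \<theta>)) \<sigma> \<tau> = cnjv (Ch S \<phi> \<sigma> \<tau>)"
    if "cont \<sigma>" "\<And>\<theta>. cnjv (\<sigma> \<theta>) = \<sigma> \<theta>" "cont \<tau>" "\<And>\<theta>. cnjv (\<tau> \<theta>) = \<tau> \<theta>" for \<sigma> \<tau>
    by (rule conj_extend[where I="I\<^sub>r S" and F="\<lambda>\<phi>. Ch S \<phi> \<sigma> \<tau>"])
      (use that \<phi> in \<open>auto simp: Ch_add_left Ch_smult_left Ch_real\<close>)
  have 2: "Ch S (\<lambda>\<theta>. cnjv (\<phi> \<theta>)) (\<lambda>\<theta>. cnjv (\<psi> \<theta>)) \<tau> = cnjv (Ch S \<phi> \<psi> \<tau>)"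
    if "cont \<tau>" "\<And>\<theta>. cnjv (\<tau> \<theta>) = \<tau> \<theta>" for \<tau>
    by (rule conj_extend[where I="I\<^sub>r S" and F="\<lambda>\<psi>. Ch S \<phi> \<psi> \<tau>"])
      (use that \<psi> 1 in \<open>auto simp: Ch_add_mid Ch_smult_mid\<close>)
  show ?thesis
    by (rule conj_extend[where I="I\<^sub>r S" and F="Ch S \<phi> \<psi>"])
      (use \<rho> 2 in \<open>auto simp: Ch_add_right Ch_smult_right\<close>)
qed

lemma Lop_has_derivative: "(Lop S has_derivative frechet_derivative (Lop S) (at 0)) (at 0)"
proof -
  have "\<exists>D :: nat \<Rightarrow> real^2 \<Rightarrow> (real^2) list \<Rightarrow> ((real \<Rightarrow>\<^sub>C ('x^'m)) \<Rightarrow>\<^sub>L ('x^'m)).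
      (\<forall>x\<in>nbhd S. D 0 x [] = Lop S x) \<and>
      (\<forall>j<1. \<forall>x\<in>nbhd S. \<forall>vs. length vs = j \<longrightarrow>
        ((\<lambda>y. D j y vs) has_derivative (\<lambda>v. D (Suc j) x (v # vs))) (at x))"
    using Lop_Ck unfolding Ck_on_def by (elim exE conjE) (intro exI conjI)
  then obtain D :: "nat \<Rightarrow> real^2 \<Rightarrow> (real^2) list \<Rightarrow> ((real \<Rightarrow>\<^sub>C ('x^'m)) \<Rightarrow>\<^sub>L ('x^'m))"
    where D: "\<forall>x\<in>nbhd S. D 0 x [] = Lop S x"
      "\<forall>j<1. \<forall>x\<in>nbhd S. \<forall>vs. length vs = j \<longrightarrow>
        ((\<lambda>y. D j y vs) has_derivative (\<lambda>v. D (Suc j) x (v # vs))) (at x)"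
    by (elim exE conjE)
  have "((\<lambda>y. D 0 y []) has_derivative (\<lambda>v. D (Suc 0) 0 [v])) (at 0)"
    using D(2) zero_in_nbhd by simp
  then have "(Lop S has_derivative (\<lambda>v. D (Suc 0) 0 [v])) (at 0)"
    by (rule has_derivative_transform_within_open[OF _ open_nbhd zero_in_nbhd]) (use D(1) in simp)
  then have "Lop S differentiable at 0" by (rule differentiableI)
  then show ?thesis by (simp add: frechet_derivative_works)
qed

text \<open>A linear relation that \<open>L(\<alpha>)\<close> satisfies for every \<open>\<alpha>\<close> near 0 is inherited by its derivative at 0.
  All properties of \<open>L\<^sub>1\<close> are obtained in this way.\<close>

lemma L1_transfer:
  fixes \<Lambda> \<Lambda>' :: "'x^'m \<Rightarrow> complex^'m"
  assumes \<Lambda>: "bounded_linear \<Lambda>" "bounded_linear \<Lambda>'"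
    and eq: "\<And>\<alpha>. \<alpha> \<in> nbhd S \<Longrightarrow> \<Lambda> (Lop S \<alpha> v) = \<Lambda>' (Lop S \<alpha> w)"
  shows "\<Lambda> (L1 S \<alpha> v) = \<Lambda>' (L1 S \<alpha> w)"
proof -
  have *: "((\<lambda>\<alpha>. \<Lambda> (Lop S \<alpha> v)) has_derivative (\<lambda>\<alpha>. \<Lambda> (frechet_derivative (Lop S) (at 0) \<alpha> v))) (at 0)"
    if "bounded_linear \<Lambda>" for v and \<Lambda> :: "'x^'m \<Rightarrow> complex^'m"
    by (rule bounded_linear.has_derivative[OF that])
      (rule bounded_linear.has_derivative[OF blinfun.bounded_linear_left Lop_has_derivative])
  have "((\<lambda>\<alpha>. \<Lambda>' (Lop S \<alpha> w)) has_derivative (\<lambda>\<alpha>. \<Lambda> (frechet_derivative (Lop S) (at 0) \<alpha> v))) (at 0)"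
    by (rule has_derivative_transform_within_open[OF *[OF \<Lambda>(1)] open_nbhd zero_in_nbhd]) (rule eq)
  from has_derivative_unique[OF this *[OF \<Lambda>(2)]]
  have "\<Lambda> (frechet_derivative (Lop S) (at 0) \<alpha> v) = \<Lambda>' (frechet_derivative (Lop S) (at 0) \<alpha> w)"
    by meson
  then show ?thesis unfolding L1_def
    by (simp add: blinfun.scaleR_left linear_cmul[OF bounded_linear.linear] \<Lambda>)
qed

lemma coef_L1_tens:
  assumes "cont \<phi>"
  shows "coef S k (L1 S \<alpha> (hist S (\<lambda>\<theta>. tens S (\<phi> \<theta>) (beta S a)))) = (if a = k then L1h S \<alpha> \<phi> else 0)"
proof -
  have "coef S k (L1 S \<alpha> (hist S (\<lambda>\<theta>. tens S (\<phi> \<theta>) (beta S a)))) =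
      (if a = k then 1 else 0) *s coef S 0 (L1 S \<alpha> (cst S \<phi>))"
  proof (rule L1_transfer)
    show "bounded_linear (coef S k)" by (rule bounded_linear_coef)
    show "bounded_linear (\<lambda>u. (if a = k then 1 else 0) *s coef S 0 u)"
      by (rule bounded_linear_compose[OF bounded_linear_smult bounded_linear_coef])
    fix \<alpha> assume \<alpha>: "\<alpha> \<in> nbhd S"
    show "coef S k (Lop S \<alpha> (hist S (\<lambda>\<theta>. tens S (\<phi> \<theta>) (beta S a)))) =
        (if a = k then 1 else 0) *s coef S 0 (Lop S \<alpha> (cst S \<phi>))"
      unfolding coef_L[OF \<alpha> cont_tens_beta[OF assms]] coef_tens[OF realized_beta] wmean_beta
      by (simp add: Lh_smult[OF \<alpha> assms, unfolded Lh_def] Lh_def)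
  qed
  then show ?thesis by (simp add: L1h_def)
qed

lemma L1h_add:
  "cont \<phi> \<Longrightarrow> cont \<psi> \<Longrightarrow> L1h S \<alpha> (\<lambda>\<theta>. \<phi> \<theta> + \<psi> \<theta>) = L1h S \<alpha> \<phi> + L1h S \<alpha> \<psi>"
  by (simp add: L1h_def cst_add blinfun.add_right coef_add)

lemma L1h_smult:
  assumes "cont \<phi>"
  shows "L1h S \<alpha> (\<lambda>\<theta>. c *s \<phi> \<theta>) = c *s L1h S \<alpha> \<phi>"
  unfolding L1h_def
proof (rule L1_transfer)
  show "bounded_linear (\<lambda>u. c *s coef S 0 u)"
    by (rule bounded_linear_compose[OF bounded_linear_smult bounded_linear_coef])
qed (use Lh_smult[OF _ assms, unfolded Lh_def] in \<open>auto intro: bounded_linear_coef\<close>)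

lemma L1h_cnj:
  assumes "cont \<phi>"
  shows "L1h S \<alpha> (\<lambda>\<theta>. cnjv (\<phi> \<theta>)) = cnjv (L1h S \<alpha> \<phi>)"
  unfolding L1h_def
proof (rule L1_transfer)
  show "bounded_linear (\<lambda>u. cnjv (coef S 0 u))"
    by (rule bounded_linear_compose[OF bounded_linear_cnjv bounded_linear_coef])
qed (use Lh_cnj[OF _ assms, unfolded Lh_def] in \<open>auto intro: bounded_linear_coef\<close>)

lemma linear_L1: "linear (L1 S)"
  unfolding L1_def[abs_def]
  using has_derivative_linear[OF Lop_has_derivative] by (intro linear_compose_scale_right)

lemma linear_D1: "linear (D1 S)"
  unfolding D1_def[abs_def]
  using has_derivative_linear frechet_derivative_works dcoef_diff
  by (intro linear_compose_scale_right) blast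

lemma linear_L1h: "linear (\<lambda>\<alpha>. L1h S \<alpha> \<phi>)"
  using linear_L1 unfolding L1h_def linear_iff
  by (simp add: blinfun.add_left blinfun.scaleR_left coef_add coef_scaleR)

lemma coef_diagX: "coef S k (diagX d u) = diagC d (coef S k u)"
proof -
  have "coef S k (diagX d u) $ i = coef S k ((d $ i) *\<^sub>R u) $ i" for i
    by (simp add: coef_def diagX_def)
  then show ?thesis by (simp add: vec_eq_iff coef_scaleR diagC_def scaleR_conv_of_real[where 'a=complex])
qed

end

section \<open>The spectrum and boundary value problems on one Fourier mode\<close>

text \<open>The integral is a definite description; its value 0 is unique because fine tagged divisions
  exist.\<close>

lemma RS_integral_zero:
  assumes "a < b" "\<And>x. f x = 0"
  shows "RS_integral a b f g = 0"
  unfolding RS_integral_def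
proof (rule the_equality)
  show "has_RS_integral f g a b 0"
    using assms unfolding has_RS_integral_def by (auto simp: split_def intro!: exI[of _ 1])
  fix I assume I: "has_RS_integral f g a b I"
  have "cmod I < \<epsilon>" if \<epsilon>: "\<epsilon> > 0" for \<epsilon>
  proof -
    obtain \<delta> where \<delta>: "\<delta> > 0" "\<forall>p. p tagged_division_of {a..b} \<and> (\<lambda>x. ball x \<delta>) fine p \<longrightarrow>
        cmod ((\<Sum>(x, K)\<in>p. f x * (g (Sup K) - g (Inf K))) - I) < \<epsilon>"
      using I[unfolded has_RS_integral_def, rule_format, OF \<epsilon>] by (elim exE conjE)
    obtain p where "p tagged_division_of {a..b}" "(\<lambda>x. ball x \<delta>) fine p"
      by (rule fine_division_exists_real[OF gauge_ball[OF \<delta>(1)]])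
    then have "cmod ((\<Sum>(x, K)\<in>p. f x * (g (Sup K) - g (Inf K))) - I) < \<epsilon>"
      using \<delta>(2) by simp
    then show ?thesis using assms(2) by (simp add: split_def)
  qed
  then have "cmod I \<le> 0" by (meson less_irrefl not_le)
  then show "I = 0" by simp
qed

locale hopf_steady =
  fixes S :: "('x::{real_inner,banach}, 'm::finite) reduction"
  assumes sys: "pfde_system S"
    and hss: "hopf_steady_state S (mode1 S) (mode2 S) (om0 S)"
    and mode2: "mode2 S = 0" and mode1: "mode1 S \<noteq> 0"
    and bases: "bases S"

sublocale hopf_steady \<subseteq> rd_system
  using sys by unfold_locales

context hopf_steady
begin

abbreviation "k\<^sub>1 \<equiv> mode1 S"

abbreviation "\<omega> \<equiv> complex_of_real (om0 S)"

abbreviation "\<phi>\<^sub>1 \<equiv> phi1 S"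

abbreviation "\<phi>\<^sub>2 \<equiv> phi2 S"

abbreviation "\<phi>\<^sub>3 \<equiv> phi2b S"

abbreviation "\<psi>\<^sub>1 \<equiv> psi1 S 0"

abbreviation "\<psi>\<^sub>2 \<equiv> psi2 S 0"

abbreviation "\<psi>\<^sub>3 \<equiv> psi2b S 0"

text \<open>A function vanishing on \<open>[-r,0)\<close> does not contribute to the double integral, so \<open>(\<psi>, X\<^sub>0 v)\<^sub>k = \<psi>(0) v\<close>.\<close>

lemma bform_jump: "bform S k \<psi> (\<lambda>\<theta>. if \<theta> = 0 then v else 0) = \<psi> 0 \<odot> v"
proof -
  have "integral {\<theta>..0} (\<lambda>\<xi>. \<psi> (\<xi> - \<theta>) $ i * (if \<xi> = 0 then v else 0) $ j) = 0" for \<theta> i j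
  proof (rule integral_unique, rule has_integral_spike_finite[of "{0}"])
    show "((\<lambda>x. 0) has_integral 0) {\<theta>..0}" by simp
  qed auto
  then show ?thesis
    unfolding bform_def using delay_pos by (simp add: RS_integral_zero)
qed

definition exp_fun :: "complex \<Rightarrow> real \<Rightarrow> complex" where
  "exp_fun \<zeta> \<theta> = exp (\<zeta> * complex_of_real \<theta>)"

lemma continuous_exp_fun: "continuous_on A (exp_fun \<zeta>)"
  unfolding exp_fun_def[abs_def] by (intro continuous_intros)

lemma cont_exp: "cont (\<lambda>\<theta>. exp_fun \<zeta> \<theta> *s c)"
  by (intro continuous_smult continuous_on_const continuous_exp_fun)

lemma exp_fun_deriv:
  "((\<lambda>\<theta>. exp_fun \<zeta> \<theta> *s c) has_vector_derivative \<zeta> *s (exp_fun \<zeta> \<theta> *s c)) (at \<theta> within A)"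
proof -
  have "((\<lambda>x. exp (\<zeta> * x)) has_field_derivative \<zeta> * exp (\<zeta> * complex_of_real \<theta>)) (at (complex_of_real \<theta>))"
    by (auto intro!: derivative_eq_intros)
  then have "(exp_fun \<zeta> has_vector_derivative \<zeta> * exp_fun \<zeta> \<theta>) (at \<theta> within A)"
    unfolding exp_fun_def[abs_def]
    by (rule has_vector_derivative_at_within[OF has_vector_derivative_real_field])
  then have "(exp_fun \<zeta> has_derivative (\<lambda>h. h *\<^sub>R (\<zeta> * exp_fun \<zeta> \<theta>))) (at \<theta> within A)"
    by (simp add: has_vector_derivative_def)
  moreover have "bounded_linear (\<lambda>t. t *s c)"
    by (rule bounded_linear_intro[where K="norm c"])
      (simp_all add: vec_eq_iff distrib_right norm_vec_def norm_mult L2_set_right_distrib)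
  ultimately have "((\<lambda>\<theta>. exp_fun \<zeta> \<theta> *s c) has_derivative (\<lambda>h. (h *\<^sub>R (\<zeta> * exp_fun \<zeta> \<theta>)) *s c)) (at \<theta> within A)"
    by (rule bounded_linear.has_derivative[rotated])
  moreover have "(h *\<^sub>R (\<zeta> * exp_fun \<zeta> \<theta>)) *s c = h *\<^sub>R (\<zeta> *s (exp_fun \<zeta> \<theta> *s c))" for h
    by (simp add: vec_eq_iff mult.assoc)
  ultimately show ?thesis by (simp add: has_vector_derivative_def)
qed

lemma phi1_eq: "\<phi>\<^sub>1 = (\<lambda>\<theta>. exp_fun 0 \<theta> *s phi10 S)"
  and phi2_eq: "\<phi>\<^sub>2 = (\<lambda>\<theta>. exp_fun (\<i> * \<omega>) \<theta> *s phi20 S)"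
  and phi3_eq: "\<phi>\<^sub>3 = (\<lambda>\<theta>. exp_fun (- \<i> * \<omega>) \<theta> *s cnjv (phi20 S))"
  by (simp_all add: fun_eq_iff phi1_def phi2_def phi2b_def exp_fun_def vec_eq_iff mult.assoc exp_cnj)

lemma cont_phi [simp, intro]: "cont \<phi>\<^sub>1" "cont \<phi>\<^sub>2" "cont \<phi>\<^sub>3"
  by (simp_all only: phi1_eq phi2_eq phi3_eq cont_exp)

lemma cnj_phi [simp]: "(\<lambda>\<theta>. cnjv (\<phi>\<^sub>1 \<theta>)) = \<phi>\<^sub>1" "(\<lambda>\<theta>. cnjv (\<phi>\<^sub>2 \<theta>)) = \<phi>\<^sub>3" "(\<lambda>\<theta>. cnjv (\<phi>\<^sub>3 \<theta>)) = \<phi>\<^sub>2"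
  using bases by (simp_all add: bases_def phi1_def phi2b_def fun_eq_iff)

lemma cnj_psi [simp]: "cnjv \<psi>\<^sub>1 = \<psi>\<^sub>1" "cnjv \<psi>\<^sub>2 = \<psi>\<^sub>3" "cnjv \<psi>\<^sub>3 = \<psi>\<^sub>2"
  using bases by (simp_all add: bases_def psi1_def psi2b_def)

text \<open>\<open>L\<^sub>0 v - \<mu>\<^sub>k D\<^sub>0 v(0)\<close>: the generator of the linear equation on mode \<open>k\<close> is \<open>v \<mapsto> v'\<close> on the domain
  \<open>v'(0) = BL k v\<close>.\<close>

definition BL :: "nat \<Rightarrow> (real \<Rightarrow> complex^'m) \<Rightarrow> complex^'m" where
  "BL k v = Lh S 0 v - diagC (mu S k *\<^sub>R dcoef S 0) (v 0)"

lemma diagC_add: "diagC d (u + v) = diagC d u + diagC d v"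
  by (simp add: diagC_def vec_eq_iff distrib_left)

lemma diagC_smult: "diagC d (c *s u) = c *s diagC d u"
  by (simp add: diagC_def vec_eq_iff)

lemma diagC_cnj: "diagC d (cnjv u) = cnjv (diagC d u)"
  by (simp add: diagC_def vec_eq_iff)

lemma BL_add: "cont u \<Longrightarrow> cont v \<Longrightarrow> BL k (\<lambda>\<theta>. u \<theta> + v \<theta>) = BL k u + BL k v"
  by (simp add: BL_def Lh_add diagC_add)

lemma BL_smult: "cont u \<Longrightarrow> BL k (\<lambda>\<theta>. c *s u \<theta>) = c *s BL k u"
  by (simp add: BL_def Lh_smult[OF zero_in_nbhd] diagC_smult vector_ssub_ldistrib)

lemma BL_cnj: "cont u \<Longrightarrow> BL k (\<lambda>\<theta>. cnjv (u \<theta>)) = cnjv (BL k u)"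
  by (simp add: BL_def Lh_cnj[OF zero_in_nbhd] diagC_cnj cnjv_diff)

lemma BL_cong: "(\<And>\<theta>. \<theta> \<in> I\<^sub>r S \<Longrightarrow> u \<theta> = v \<theta>) \<Longrightarrow> BL k u = BL k v"
  unfolding BL_def by (simp cong: Lh_cong)

text \<open>The characteristic matrix at \<open>\<alpha> = 0\<close>, written with \<open>\<eta>\<^sub>k\<close>.\<close>

definition M :: "nat \<Rightarrow> complex \<Rightarrow> complex^'m^'m" where
  "M k \<zeta> = mat \<zeta> - eta_int S k (exp_fun \<zeta>)"

text \<open>On functions of \<open>\<theta>\<close> with one nonzero component, the representation of \<open>BL k\<close> by \<open>\<eta>\<^sub>k\<close> involves a
  single column of \<open>\<eta>\<^sub>k\<close>.\<close>

lemma BL_axis: "BL k (\<lambda>\<theta>. exp_fun \<zeta> \<theta> *s axis j 1) $ i = eta_int S k (exp_fun \<zeta>) $ i $ j"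
proof -
  have "- (diagC (mu S k *\<^sub>R dcoef S 0) (exp_fun \<zeta> 0 *s axis j 1)) + Lh S 0 (\<lambda>\<theta>. exp_fun \<zeta> \<theta> *s axis j 1) =
      eta_col S k (\<lambda>\<theta>. exp_fun \<zeta> \<theta> *s axis j 1)"
    using bases cont_exp unfolding bases_def eta_represents_def by blast
  then have "BL k (\<lambda>\<theta>. exp_fun \<zeta> \<theta> *s axis j 1) = eta_col S k (\<lambda>\<theta>. exp_fun \<zeta> \<theta> *s axis j 1)"
    by (simp add: BL_def)
  also have "\<dots> $ i = (\<Sum>j'\<in>UNIV. if j' = j then eta_int S k (exp_fun \<zeta>) $ i $ j else 0)"
    unfolding eta_col_def vec_lambda_beta
  proof (rule sum.cong[OF refl])
    fix j'
    show "RS_integral (- delay S) 0 (\<lambda>\<theta>. (exp_fun \<zeta> \<theta> *s axis j 1) $ j') (\<lambda>\<theta>. eta S k \<theta> $ i $ j') =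
        (if j' = j then eta_int S k (exp_fun \<zeta>) $ i $ j else 0)"
    proof (cases "j' = j")
      case True
      then show ?thesis by (simp add: eta_int_def)
    next
      case False
      then show ?thesis using delay_pos
        by (simp add: RS_integral_zero axis_def)
    qed
  qed
  finally show ?thesis by simp
qed

lemma M_mult: "M k \<zeta> *v c = \<zeta> *s c - BL k (\<lambda>\<theta>. exp_fun \<zeta> \<theta> *s c)"
proof -
  have fin: "cont (\<lambda>\<theta>. \<Sum>j\<in>A. c $ j *s (exp_fun \<zeta> \<theta> *s axis j 1)) \<and>
      BL k (\<lambda>\<theta>. \<Sum>j\<in>A. c $ j *s (exp_fun \<zeta> \<theta> *s axis j 1)) =
      (\<Sum>j\<in>A. c $ j *s BL k (\<lambda>\<theta>. exp_fun \<zeta> \<theta> *s axis j 1))" if "finite A" for A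
    using that
  proof (induction A rule: finite_induct)
    case empty
    have "BL k (\<lambda>\<theta>. 0 *s (0::complex^'m)) = 0 *s BL k (\<lambda>\<theta>. 0)" by (rule BL_smult) simp
    then show ?case by simp
  next
    case (insert a A)
    then show ?case
      by (simp only: sum.insert[OF insert(1,2)] BL_add BL_smult cont_exp continuous_smult_const
          continuous_on_add simp_thms)
  qed
  have "(\<lambda>\<theta>. exp_fun \<zeta> \<theta> *s c) = (\<lambda>\<theta>. \<Sum>j\<in>UNIV. c $ j *s (exp_fun \<zeta> \<theta> *s axis j 1))"
    by (simp only: sum_smult_axis)
  then have "BL k (\<lambda>\<theta>. exp_fun \<zeta> \<theta> *s c) = (\<Sum>j\<in>UNIV. c $ j *s BL k (\<lambda>\<theta>. exp_fun \<zeta> \<theta> *s axis j 1))"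
    using fin[of UNIV] by simp
  then have "BL k (\<lambda>\<theta>. exp_fun \<zeta> \<theta> *s c) = eta_int S k (exp_fun \<zeta>) *v c"
    by (simp add: vec_eq_iff BL_axis matrix_vector_mult_def mult.commute)
  then show ?thesis by (simp add: M_def matrix_vector_mult_diff_rdistrib mat_mult_vec)
qed

lemma char_mat_eq: "char_mat S k 0 \<zeta> = M k \<zeta>"
proof -
  have "char_mat S k 0 \<zeta> $ i $ j = M k \<zeta> $ i $ j" for i j
  proof -
    have e: "(exp_fun \<zeta> 0 *s axis j 1 :: complex^'m) $ i = (if i = j then 1 else 0)"
      by (simp add: exp_fun_def axis_def)
    have "Lh S 0 (\<lambda>\<theta>. exp (\<zeta> * complex_of_real \<theta>) *s axis j 1) $ i =
        eta_int S k (exp_fun \<zeta>) $ i $ j +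
        complex_of_real (mu S k * dcoef S 0 $ i) * (if i = j then 1 else 0)"
      using BL_axis[of k \<zeta> j i]
      by (simp only: BL_def vector_minus_component diagC_def vec_lambda_beta e[unfolded exp_fun_def]
          diff_eq_eq vector_scaleR_component real_scaleR_def exp_fun_def)
    then show ?thesis by (auto simp: char_mat_def M_def mat_def)
  qed
  then show ?thesis by (simp add: vec_eq_iff)
qed

lemma om_pos: "om0 S > 0"
  using hss by (auto simp: hopf_steady_state_def H4_def)

lemma omega_nonzero [simp]: "\<omega> \<noteq> 0" using om_pos by simp

text \<open>By (H4) the only eigenvalues on the imaginary axis are \<open>0\<close> on mode \<open>k\<^sub>1\<close> and \<open>\<plusminus>i\<omega>\<^sub>0\<close> on mode 0.\<close>

lemma M_invertible:
  assumes "Re \<zeta> = 0" "\<not> (k = k\<^sub>1 \<and> \<zeta> = 0)" "\<not> (k = 0 \<and> (\<zeta> = \<i> * \<omega> \<or> \<zeta> = - \<i> * \<omega>))"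
  shows "invertible (M k \<zeta>)"
proof -
  obtain \<gamma> \<nu> w where g: "\<gamma> 0 = 0" "\<nu> 0 = 0" "w 0 = om0 S"
    and *: "\<And>\<alpha> k \<zeta>. \<alpha> \<in> nbhd S \<Longrightarrow> char_fun S k \<alpha> \<zeta> = 0 \<and>
           \<not> (k = k\<^sub>1 \<and> \<zeta> = complex_of_real (\<gamma> \<alpha>)) \<and>
           \<not> (k = mode2 S \<and> (\<zeta> = Complex (\<nu> \<alpha>) (w \<alpha>) \<or> \<zeta> = Complex (\<nu> \<alpha>) (- w \<alpha>)))
           \<longrightarrow> Re \<zeta> \<noteq> 0"
    using hss unfolding hopf_steady_state_def H4_def by (elim conjE exE) simp
  have c: "Complex 0 (om0 S) = \<i> * \<omega>" "Complex 0 (- om0 S) = - \<i> * \<omega>"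
    by (simp_all add: complex_eq_iff)
  have "char_fun S k 0 \<zeta> \<noteq> 0"
    using *[OF zero_in_nbhd, of k \<zeta>] assms by (auto simp: g mode2 c)
  then show ?thesis by (simp add: char_fun_def char_mat_eq invertible_det_nz)
qed

lemma M_zero: "M k 0 *v x = - (eta_int S k (\<lambda>s. 1) *v x)"
proof -
  have "exp_fun 0 = (\<lambda>s. 1)" by (simp add: exp_fun_def fun_eq_iff)
  then show ?thesis
    unfolding M_def matrix_vector_mult_diff_rdistrib mat_mult_vec by simp
qed

lemma N_invertible:
  assumes "invertible (M k 0)"
  shows "invertible (eta_int S k (\<lambda>s. 1))"
  using assms by (simp add: invertible_iff_ker M_zero)

lemma BL_phi1: "BL k\<^sub>1 \<phi>\<^sub>1 = 0"
  and BL_phi2: "BL 0 \<phi>\<^sub>2 = (\<i> * \<omega>) *s \<phi>\<^sub>2 0"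
  and BL_phi3: "BL 0 \<phi>\<^sub>3 = (- \<i> * \<omega>) *s \<phi>\<^sub>3 0"
proof -
  have self: "spans_eigenspace S k \<zeta> \<phi> \<Longrightarrow> eigenfun S k \<zeta> \<phi>" for k \<zeta> \<phi>
    unfolding spans_eigenspace_def by (metis vector_smult_lid)
  have "eigenfun S k\<^sub>1 0 \<phi>\<^sub>1" "eigenfun S 0 (\<i> * \<omega>) \<phi>\<^sub>2"
    using bases self unfolding bases_def mode2 by blast+
  then show "BL k\<^sub>1 \<phi>\<^sub>1 = 0" and 2: "BL 0 \<phi>\<^sub>2 = (\<i> * \<omega>) *s \<phi>\<^sub>2 0"
    unfolding eigenfun_def BL_def by auto
  show "BL 0 \<phi>\<^sub>3 = (- \<i> * \<omega>) *s \<phi>\<^sub>3 0"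
    using BL_cnj[OF cont_phi(2), of 0] by (simp add: 2 cnjv_smult phi2b_def)
qed

text \<open>The equation \<open>\<zeta>v - A\<^sub>1 v = (X\<^sub>0 F - P)/2\<close> on mode \<open>k\<close>, split into \<open>\<theta> < 0\<close> and \<open>\<theta> = 0\<close>. It is the form that
  the homological equation takes on one Fourier mode and one monomial, the factor 1/2 being that
  of \<open>f\<^sub>2\<^sup>2/2\<close>.\<close>

definition solves :: "nat \<Rightarrow> complex \<Rightarrow> (real \<Rightarrow> complex^'m) \<Rightarrow> complex^'m \<Rightarrow> (real \<Rightarrow> complex^'m) \<Rightarrow> bool" where
  "solves k \<zeta> P F v \<longleftrightarrow> cont v \<and>
     (\<forall>\<theta>\<in>I\<^sub>r S. \<theta> \<noteq> 0 \<longrightarrow> (v has_vector_derivative (\<zeta> *s v \<theta> + (1/2) *s P \<theta>)) (at \<theta> within I\<^sub>r S)) \<and>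
     \<zeta> *s v 0 - BL k v = (1/2) *s (F - P 0)"

lemma solves_add:
  assumes "solves k \<zeta> P F u" "solves k \<zeta> P' F' v"
  shows "solves k \<zeta> (\<lambda>\<theta>. P \<theta> + P' \<theta>) (F + F') (\<lambda>\<theta>. u \<theta> + v \<theta>)"
  unfolding solves_def
proof (intro conjI ballI impI)
  fix \<theta> assume "\<theta> \<in> I\<^sub>r S" "\<theta> \<noteq> 0"
  then have "((\<lambda>\<theta>. u \<theta> + v \<theta>) has_vector_derivative (\<zeta> *s u \<theta> + (1/2) *s P \<theta>) + (\<zeta> *s v \<theta> + (1/2) *s P' \<theta>))
      (at \<theta> within I\<^sub>r S)"
    using assms by (intro has_vector_derivative_add) (auto simp: solves_def)
  then show "((\<lambda>\<theta>. u \<theta> + v \<theta>) has_vector_derivative \<zeta> *s (u \<theta> + v \<theta>) + (1/2) *s (P \<theta> + P' \<theta>)) (at \<theta> within I\<^sub>r S)"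
    by (simp add: vector_add_ldistrib algebra_simps)
next
  have "\<zeta> *s u 0 - BL k u + (\<zeta> *s v 0 - BL k v) = (1/2) *s (F - P 0) + (1/2) *s (F' - P' 0)"
    using assms by (simp add: solves_def)
  then show "\<zeta> *s (u 0 + v 0) - BL k (\<lambda>\<theta>. u \<theta> + v \<theta>) = (1/2) *s (F + F' - (P 0 + P' 0))"
    using assms by (simp add: solves_def BL_add vector_add_ldistrib vector_ssub_ldistrib algebra_simps)
qed (use assms in \<open>auto simp: solves_def intro: continuous_on_add\<close>)

lemma solves_smult:
  assumes "solves k \<zeta> P F v"
  shows "solves k \<zeta> (\<lambda>\<theta>. c *s P \<theta>) (c *s F) (\<lambda>\<theta>. c *s v \<theta>)"
  unfolding solves_def
proof (intro conjI ballI impI)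
  fix \<theta> assume "\<theta> \<in> I\<^sub>r S" "\<theta> \<noteq> 0"
  then have "(v has_vector_derivative (\<zeta> *s v \<theta> + (1/2) *s P \<theta>)) (at \<theta> within I\<^sub>r S)"
    using assms by (simp add: solves_def)
  from bounded_linear.has_vector_derivative[OF bounded_linear_smult[of c] this]
  show "((\<lambda>\<theta>. c *s v \<theta>) has_vector_derivative \<zeta> *s (c *s v \<theta>) + (1/2) *s (c *s P \<theta>)) (at \<theta> within I\<^sub>r S)"
    by (simp add: vec_eq_iff algebra_simps)
next
  have "c *s (\<zeta> *s v 0 - BL k v) = c *s ((1/2) *s (F - P 0))"
    using assms by (simp add: solves_def)
  then show "\<zeta> *s (c *s v 0) - BL k (\<lambda>\<theta>. c *s v \<theta>) = (1/2) *s (c *s F - c *s P 0)"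
    using assms by (simp add: solves_def BL_smult vec_eq_iff algebra_simps)
qed (use assms in \<open>auto simp: solves_def intro: continuous_smult_const\<close>)

lemma solves_cnj:
  assumes "solves k \<zeta> P F v"
  shows "solves k (cnj \<zeta>) (\<lambda>\<theta>. cnjv (P \<theta>)) (cnjv F) (\<lambda>\<theta>. cnjv (v \<theta>))"
  unfolding solves_def
proof (intro conjI ballI impI)
  fix \<theta> assume "\<theta> \<in> I\<^sub>r S" "\<theta> \<noteq> 0"
  then have "(v has_vector_derivative (\<zeta> *s v \<theta> + (1/2) *s P \<theta>)) (at \<theta> within I\<^sub>r S)"
    using assms by (simp add: solves_def)
  from bounded_linear.has_vector_derivative[OF bounded_linear_cnjv this]
  show "((\<lambda>\<theta>. cnjv (v \<theta>)) has_vector_derivative cnj \<zeta> *s cnjv (v \<theta>) + (1/2) *s cnjv (P \<theta>)) (at \<theta> within I\<^sub>r S)"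
    by (simp add: cnjv_add cnjv_smult)
next
  have "cnjv (\<zeta> *s v 0 - BL k v) = cnjv ((1/2) *s (F - P 0))"
    using assms by (simp add: solves_def)
  then show "cnj \<zeta> *s cnjv (v 0) - BL k (\<lambda>\<theta>. cnjv (v \<theta>)) = (1/2) *s (cnjv F - cnjv (P 0))"
    using assms by (simp add: solves_def BL_cnj cnjv_diff cnjv_smult)
qed (use assms in \<open>auto simp: solves_def intro: continuous_cnjv\<close>)

lemma solves_exponential:
  assumes "M k \<zeta> *v c = (1/2) *s F"
  shows "solves k \<zeta> (\<lambda>\<theta>. 0) F (\<lambda>\<theta>. exp_fun \<zeta> \<theta> *s c)"
  unfolding solves_def using assms exp_fun_deriv[of \<zeta> c]
  by (simp add: cont_exp M_mult) (simp add: exp_fun_def)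

text \<open>An eigenfunction to the eigenvalue \<open>\<xi>\<close> in place of \<open>P\<close> is answered by a multiple of itself: both
  the differential equation and the boundary condition reduce to \<open>(\<xi> - \<zeta>)a = 1/2\<close>.\<close>

lemma solves_eigenfunction:
  assumes "BL k (\<lambda>\<theta>. exp_fun \<xi> \<theta> *s u) = \<xi> *s u" "(\<xi> - \<zeta>) * a = 1 / 2"
  shows "solves k \<zeta> (\<lambda>\<theta>. exp_fun \<xi> \<theta> *s u) 0 (\<lambda>\<theta>. a *s (exp_fun \<xi> \<theta> *s u))"
  unfolding solves_def
proof (intro conjI ballI impI)
  have a: "\<xi> * a = \<zeta> * a + 1 / 2"
    using assms(2) by (simp only: left_diff_distrib diff_eq_eq add.commute)
  fix \<theta>
  have "a *s (\<xi> *s (exp_fun \<xi> \<theta> *s u)) = \<zeta> *s (a *s (exp_fun \<xi> \<theta> *s u)) + (1/2) *s (exp_fun \<xi> \<theta> *s u)"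
  proof -
    have "a *s (\<xi> *s (exp_fun \<xi> \<theta> *s u)) = (\<xi> * a) *s (exp_fun \<xi> \<theta> *s u)"
      by (simp add: vec_eq_iff)
    also have "\<dots> = \<zeta> *s (a *s (exp_fun \<xi> \<theta> *s u)) + (1/2) *s (exp_fun \<xi> \<theta> *s u)"
      unfolding a by (simp add: vec_eq_iff algebra_simps)
    finally show ?thesis .
  qed
  then show "((\<lambda>\<theta>. a *s (exp_fun \<xi> \<theta> *s u)) has_vector_derivative
      \<zeta> *s (a *s (exp_fun \<xi> \<theta> *s u)) + (1/2) *s (exp_fun \<xi> \<theta> *s u)) (at \<theta> within I\<^sub>r S)"
    using bounded_linear.has_vector_derivative[OF bounded_linear_smult exp_fun_deriv[of \<xi> u \<theta> "I\<^sub>r S"], of a]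
    by simp
next
  have e0: "exp_fun \<xi> 0 = 1" by (simp add: exp_fun_def)
  have "\<xi> * a = \<zeta> * a + 1 / 2"
    using assms(2) by (simp only: left_diff_distrib diff_eq_eq add.commute)
  then have a: "\<zeta> * a - a * \<xi> = - 1 / 2" by (simp only: mult.commute[of a]) simp
  have "\<zeta> *s (a *s u) - a *s (\<xi> *s u) = (\<zeta> * a - a * \<xi>) *s u"
    by (simp add: vec_eq_iff algebra_simps)
  then show "\<zeta> *s (a *s (exp_fun \<xi> 0 *s u)) - BL k (\<lambda>\<theta>. a *s (exp_fun \<xi> \<theta> *s u)) = (1/2) *s (0 - exp_fun \<xi> 0 *s u)"
    unfolding BL_smult[OF cont_exp] assms(1) e0 a vector_smult_lid by (simp add: vec_eq_iff)
qed (intro continuous_smult_const cont_exp)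

text \<open>The difference \<open>w\<close> of two solutions satisfies \<open>w' = \<zeta>w\<close> off 0 and is continuous, so it equals
  \<open>e\<^sup>\<zeta>\<^sup>\<theta> w(0)\<close>, and the boundary condition becomes \<open>M k \<zeta> w(0) = 0\<close>.\<close>

lemma solves_unique:
  assumes "solves k \<zeta> P F u" "solves k \<zeta> P F v" and inv: "invertible (M k \<zeta>)" and \<theta>: "\<theta> \<in> I\<^sub>r S"
  shows "u \<theta> = v \<theta>"
proof -
  define w where "w \<theta> = u \<theta> + (-1) *s v \<theta>" for \<theta>
  have "solves k \<zeta> (\<lambda>\<theta>. P \<theta> + (-1) *s P \<theta>) (F + (-1) *s F) w"
    unfolding w_def by (intro solves_add solves_smult assms)
  moreover have z: "x + (-1) *s x = 0" for x :: "complex^'m" by (simp add: vec_eq_iff)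
  ultimately have w: "cont w"
    "\<And>\<theta>. \<theta> \<in> I\<^sub>r S \<Longrightarrow> \<theta> \<noteq> 0 \<Longrightarrow> (w has_vector_derivative \<zeta> *s w \<theta>) (at \<theta> within I\<^sub>r S)"
    "\<zeta> *s w 0 - BL k w = 0"
    unfolding solves_def z by simp_all
  (* Multiply by the integrating factor. *)
  define g where "g \<theta> = exp_fun (- \<zeta>) \<theta> *s w \<theta>" for \<theta>
  have g: "cont g" unfolding g_def by (intro continuous_smult w(1) continuous_exp_fun)
  have g': "(g has_derivative (\<lambda>h. 0)) (at \<theta> within {- delay S..0})" if \<theta>: "\<theta> \<in> {- delay S..0} - {0}" for \<theta>
  proof -
    have "(exp_fun (- \<zeta>) has_vector_derivative - \<zeta> * exp_fun (- \<zeta>) \<theta>) (at \<theta> within I\<^sub>r S)"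
    proof -
      have "((\<lambda>x. exp (- \<zeta> * x)) has_field_derivative - \<zeta> * exp (- \<zeta> * complex_of_real \<theta>)) (at (complex_of_real \<theta>))"
        by (auto intro!: derivative_eq_intros)
      then show ?thesis
        unfolding exp_fun_def[abs_def]
        by (rule has_vector_derivative_at_within[OF has_vector_derivative_real_field])
    qed
    moreover have "(w has_vector_derivative \<zeta> *s w \<theta>) (at \<theta> within I\<^sub>r S)"
      using w(2) \<theta> by (simp add: I\<^sub>r_def)
    moreover have "bounded_bilinear (\<lambda>(c::complex) (x::complex^'m). c *s x)"
    proof
      show "\<exists>K. \<forall>a b. norm (a *s b :: complex^'m) \<le> norm a * norm b * K"
        by (rule exI[of _ 1]) (simp add: norm_vec_def norm_mult L2_set_right_distrib)
    qed (simp_all add: vec_eq_iff algebra_simps)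
    ultimately have "(g has_vector_derivative
        (exp_fun (- \<zeta>) \<theta> *s (\<zeta> *s w \<theta>) + (- \<zeta> * exp_fun (- \<zeta>) \<theta>) *s w \<theta>)) (at \<theta> within I\<^sub>r S)"
      unfolding g_def by (intro bounded_bilinear.has_vector_derivative)
    moreover have "exp_fun (- \<zeta>) \<theta> *s (\<zeta> *s w \<theta>) + (- \<zeta> * exp_fun (- \<zeta>) \<theta>) *s w \<theta> = 0"
      by (simp add: vec_eq_iff)
    ultimately have "(g has_vector_derivative 0) (at \<theta> within I\<^sub>r S)" by (simp only:)
    then show ?thesis by (simp add: has_vector_derivative_def I\<^sub>r_def)
  qed
  have const: "g \<theta> = g (- delay S)" if "\<theta> \<in> I\<^sub>r S" for \<theta>
    by (rule has_derivative_zero_unique_strong_interval[where k="{0}" and a="- delay S" and b=0, OF _ _ refl g'])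
      (use g that in \<open>auto simp: I\<^sub>r_def\<close>)
  have w_exp: "w \<theta> = exp_fun \<zeta> \<theta> *s w 0" if \<theta>: "\<theta> \<in> I\<^sub>r S" for \<theta>
  proof -
    have "g \<theta> = g 0" using const[OF \<theta>] const[OF zero_in_Ir] by simp
    then have "exp_fun \<zeta> \<theta> *s (exp_fun (- \<zeta>) \<theta> *s w \<theta>) = exp_fun \<zeta> \<theta> *s w 0"
      by (simp add: g_def exp_fun_def)
    moreover have "exp_fun \<zeta> \<theta> * exp_fun (- \<zeta>) \<theta> = 1"
      by (simp add: exp_fun_def flip: exp_add)
    ultimately show ?thesis by (simp add: vector_smult_assoc)
  qed
  have "BL k w = BL k (\<lambda>\<theta>. exp_fun \<zeta> \<theta> *s w 0)"
    by (rule BL_cong) (rule w_exp)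
  then have "M k \<zeta> *v w 0 = \<zeta> *s w 0 - BL k w" unfolding M_mult by simp
  then have "w 0 = 0" using w(3) inv by (simp add: invertible_iff_ker)
  then have "w \<theta> = 0" using w_exp[OF \<theta>] by simp
  then show ?thesis by (simp add: w_def vec_eq_iff)
qed

section \<open>Quadratic and cubic terms on the center space\<close>

lemma Bz_nth [simp]: "Bz S z $ 1 = 0" "Bz S z $ 2 = \<i> * \<omega> * z $ 2" "Bz S z $ 3 = - \<i> * \<omega> * z $ 3"
  by (simp_all add: Bz_def vector_3)

text \<open>Each monomial is an eigenvector of \<open>p \<mapsto> D\<^sub>z p Bz\<close>; its eigenvalue becomes the \<open>\<zeta>\<close> of the
  boundary value problem for the corresponding coefficient of \<open>h\<close>.\<close>

lemma quad_along_B: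
  "frechet_derivative (quad a b c d e f) (at z) (Bz S z) =
    quad 0 ((2 * \<i> * \<omega>) *s b) ((- 2 * \<i> * \<omega>) *s c) ((\<i> * \<omega>) *s d) ((- \<i> * \<omega>) *s e) 0 z"
  unfolding frechet_derivative_at[OF quad_has_derivative, symmetric]
  by (simp add: quad_def vec_eq_iff algebra_simps power2_eq_square)

definition W :: "complex^3 \<Rightarrow> real \<Rightarrow>\<^sub>C ('x^'m)" where
  "W z = hist S (wz S z)"

lemma cont_comb: "cont (\<lambda>\<theta>. a *s \<phi>\<^sub>1 \<theta>)" "cont (\<lambda>\<theta>. a *s \<phi>\<^sub>2 \<theta>)" "cont (\<lambda>\<theta>. a *s \<phi>\<^sub>3 \<theta>)"
  "cont (\<lambda>\<theta>. a *s \<phi>\<^sub>2 \<theta> + b *s \<phi>\<^sub>3 \<theta>)"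
  by (intro continuous_on_add continuous_smult_const cont_phi)+

lemma wz_eq: "wz S z = (\<lambda>\<theta>. tens S (z $ 1 *s \<phi>\<^sub>1 \<theta>) (beta S k\<^sub>1) +
    tens S (z $ 2 *s \<phi>\<^sub>2 \<theta> + z $ 3 *s \<phi>\<^sub>3 \<theta>) (beta S 0))"
  by (simp add: wz_def fun_eq_iff mode2)

lemma cont_wz: "cont (wz S z)"
  unfolding wz_eq by (intro continuous_on_add cont_tens_beta cont_comb)

lemma W_eq: "W z = hist S (\<lambda>\<theta>. tens S (z $ 1 *s \<phi>\<^sub>1 \<theta>) (beta S k\<^sub>1)) +
    hist S (\<lambda>\<theta>. tens S (z $ 2 *s \<phi>\<^sub>2 \<theta> + z $ 3 *s \<phi>\<^sub>3 \<theta>) (beta S 0))"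
  unfolding W_def wz_eq by (rule hist_add) (intro cont_tens_beta cont_comb)+

interpretation Q: bounded_bilinear "Qop S" by (rule Q_bilinear)

abbreviation "q11 \<equiv> Qh S \<phi>\<^sub>1 \<phi>\<^sub>1"

abbreviation "q12 \<equiv> Qh S \<phi>\<^sub>1 \<phi>\<^sub>2"

abbreviation "q13 \<equiv> Qh S \<phi>\<^sub>1 \<phi>\<^sub>3"

abbreviation "q22 \<equiv> Qh S \<phi>\<^sub>2 \<phi>\<^sub>2"

abbreviation "q23 \<equiv> Qh S \<phi>\<^sub>2 \<phi>\<^sub>3"

abbreviation "q33 \<equiv> Qh S \<phi>\<^sub>3 \<phi>\<^sub>3"

lemmas Qh_expand = Qh_add_left Qh_add_right Qh_smult_left Qh_smult_right cont_comb cont_phi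

lemmas Ch_expand = Ch_add_left Ch_add_mid Ch_add_right Ch_smult_left Ch_smult_mid Ch_smult_right
  cont_comb cont_phi

lemma wmean_pairs:
  "wmean (beta S k) (\<lambda>x. beta S k\<^sub>1 x * beta S 0 x) = (if k = k\<^sub>1 then 1 else 0)"
  "wmean (beta S k) (\<lambda>x. beta S 0 x * beta S k\<^sub>1 x) = (if k = k\<^sub>1 then 1 else 0)"
  "wmean (beta S k) (\<lambda>x. beta S 0 x * beta S 0 x) = (if k = 0 then 1 else 0)"
  using wmean_beta[of k k\<^sub>1] wmean_beta[of k 0] by (auto simp: beta_0)

text \<open>This table decides which monomials occur on which mode; everything else in the reduction is
  read off from it.\<close>

lemma coef_QW:
  "coef S k (Qop S (W z) (W y)) =
    (if k = 0 then 1 else if k = 2 * k\<^sub>1 then complex_of_real (1 / sqrt 2) else 0) *s ((z $ 1 * y $ 1) *s q11) +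
    (if k = k\<^sub>1 then 1 else 0) *s ((z $ 1 * y $ 2 + z $ 2 * y $ 1) *s q12 + (z $ 1 * y $ 3 + z $ 3 * y $ 1) *s q13) +
    (if k = 0 then 1 else 0) *s ((z $ 2 * y $ 2) *s q22 + (z $ 2 * y $ 3 + z $ 3 * y $ 2) *s q23 + (z $ 3 * y $ 3) *s q33)"
  unfolding W_eq Q.add_left Q.add_right coef_add coef_Q_tens[OF cont_comb(1) cont_comb(1)]
    coef_Q_tens[OF cont_comb(1) cont_comb(4)] coef_Q_tens[OF cont_comb(4) cont_comb(1)]
    coef_Q_tens[OF cont_comb(4) cont_comb(4)] wmean_beta_square[OF mode1] wmean_pairs
  by (simp only: Qh_expand Qh_commute[of \<phi>\<^sub>2 \<phi>\<^sub>1] Qh_commute[of \<phi>\<^sub>3 \<phi>\<^sub>1] Qh_commute[of \<phi>\<^sub>3 \<phi>\<^sub>2])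
    (simp add: vec_eq_iff algebra_simps)

text \<open>Since \<open>\<beta>\<^sub>k\<^sup>2 = \<beta>\<^sub>0 + \<beta>\<^sub>2\<^sub>k/\<surd>2\<close>, the part \<open>\<phi>\<^sub>1 z\<^sub>1 \<beta>\<^sub>k\<close> of \<open>w\<close> couples mode \<open>k = k\<^sub>1\<close> of the result with the
  modes 0 and \<open>2k\<close> of \<open>\<phi>\<close>.\<close>

lemma coef_Q_hist:
  assumes "cont \<phi>"
  shows "coef S k\<^sub>1 (Qop S (W z) (hist S \<phi>)) =
      z $ 1 *s Qh S \<phi>\<^sub>1 (\<lambda>\<theta>. coef S 0 (\<phi> \<theta>) + complex_of_real (1 / sqrt 2) *s coef S (2 * k\<^sub>1) (\<phi> \<theta>)) +
      z $ 2 *s Qh S \<phi>\<^sub>2 (\<lambda>\<theta>. coef S k\<^sub>1 (\<phi> \<theta>)) + z $ 3 *s Qh S \<phi>\<^sub>3 (\<lambda>\<theta>. coef S k\<^sub>1 (\<phi> \<theta>))"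
    and "coef S 0 (Qop S (W z) (hist S \<phi>)) =
      z $ 1 *s Qh S \<phi>\<^sub>1 (\<lambda>\<theta>. coef S k\<^sub>1 (\<phi> \<theta>)) +
      z $ 2 *s Qh S \<phi>\<^sub>2 (\<lambda>\<theta>. coef S 0 (\<phi> \<theta>)) + z $ 3 *s Qh S \<phi>\<^sub>3 (\<lambda>\<theta>. coef S 0 (\<phi> \<theta>))"
proof -
  have b: "(\<lambda>x. beta S 0 x * beta S k x) = beta S k" "(\<lambda>x. beta S k x * beta S 0 x) = beta S k" for k
    by (simp_all add: beta_0)
  note mixed = coef_Q_mixed[OF cont_comb(1) assms] coef_Q_mixed[OF cont_comb(4) assms]
  show "coef S k\<^sub>1 (Qop S (W z) (hist S \<phi>)) =
      z $ 1 *s Qh S \<phi>\<^sub>1 (\<lambda>\<theta>. coef S 0 (\<phi> \<theta>) + complex_of_real (1 / sqrt 2) *s coef S (2 * k\<^sub>1) (\<phi> \<theta>)) +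
      z $ 2 *s Qh S \<phi>\<^sub>2 (\<lambda>\<theta>. coef S k\<^sub>1 (\<phi> \<theta>)) + z $ 3 *s Qh S \<phi>\<^sub>3 (\<lambda>\<theta>. coef S k\<^sub>1 (\<phi> \<theta>))"
    unfolding W_eq Q.add_left coef_add mixed b wcoef_beta_square[OF mode1] coef_eq_wcoef[symmetric]
    by (simp only: Qh_add_left Qh_smult_left cont_comb cont_phi add.assoc)
  show "coef S 0 (Qop S (W z) (hist S \<phi>)) =
      z $ 1 *s Qh S \<phi>\<^sub>1 (\<lambda>\<theta>. coef S k\<^sub>1 (\<phi> \<theta>)) +
      z $ 2 *s Qh S \<phi>\<^sub>2 (\<lambda>\<theta>. coef S 0 (\<phi> \<theta>)) + z $ 3 *s Qh S \<phi>\<^sub>3 (\<lambda>\<theta>. coef S 0 (\<phi> \<theta>))"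
    unfolding W_eq Q.add_left coef_add mixed b coef_eq_wcoef[symmetric]
    by (simp only: Qh_add_left Qh_smult_left cont_comb cont_phi add.assoc)
qed

lemma C_add: "Cop S (u + v) x y = Cop S u x y + Cop S v x y" "Cop S x (u + v) y = Cop S x u y + Cop S x v y"
  "Cop S x y (u + v) = Cop S x y u + Cop S x y v"
proof -
  show 1: "Cop S (u + v) x y = Cop S u x y + Cop S v x y" for u v x y
    by (rule linear_add[OF C_linear])
  show 2: "Cop S x (u + v) y = Cop S x u y + Cop S x v y" for u v x y
    using 1 C_commute(1) by simp
  show "Cop S x y (u + v) = Cop S x y u + Cop S x y v"
    using 2 C_commute(2) by simp
qed

lemma coef_CW:
  "coef S k (Cop S (W z) (W z) (W z)) =
    (if k = k\<^sub>1 then 3 / 2 else if k = 3 * k\<^sub>1 then 1 / 2 else 0) *s ((z $ 1 ^ 3) *s Ch S \<phi>\<^sub>1 \<phi>\<^sub>1 \<phi>\<^sub>1) +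
    (3 * (if k = 0 then 1 else if k = 2 * k\<^sub>1 then complex_of_real (1 / sqrt 2) else 0)) *s
      ((z $ 1 ^ 2 * z $ 2) *s Ch S \<phi>\<^sub>1 \<phi>\<^sub>1 \<phi>\<^sub>2 + (z $ 1 ^ 2 * z $ 3) *s Ch S \<phi>\<^sub>1 \<phi>\<^sub>1 \<phi>\<^sub>3) +
    (3 * (if k = k\<^sub>1 then 1 else 0)) *s
      ((z $ 1 * z $ 2 ^ 2) *s Ch S \<phi>\<^sub>1 \<phi>\<^sub>2 \<phi>\<^sub>2 + (2 * z $ 1 * z $ 2 * z $ 3) *s Ch S \<phi>\<^sub>1 \<phi>\<^sub>2 \<phi>\<^sub>3 +
       (z $ 1 * z $ 3 ^ 2) *s Ch S \<phi>\<^sub>1 \<phi>\<^sub>3 \<phi>\<^sub>3) +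
    (if k = 0 then 1 else 0) *s
      ((z $ 2 ^ 3) *s Ch S \<phi>\<^sub>2 \<phi>\<^sub>2 \<phi>\<^sub>2 + (3 * z $ 2 ^ 2 * z $ 3) *s Ch S \<phi>\<^sub>2 \<phi>\<^sub>2 \<phi>\<^sub>3 +
       (3 * z $ 2 * z $ 3 ^ 2) *s Ch S \<phi>\<^sub>2 \<phi>\<^sub>3 \<phi>\<^sub>3 + (z $ 3 ^ 3) *s Ch S \<phi>\<^sub>3 \<phi>\<^sub>3 \<phi>\<^sub>3)"
proof -
  define A where "A = hist S (\<lambda>\<theta>. tens S (z $ 1 *s \<phi>\<^sub>1 \<theta>) (beta S k\<^sub>1))"
  define B where "B = hist S (\<lambda>\<theta>. tens S (z $ 2 *s \<phi>\<^sub>2 \<theta> + z $ 3 *s \<phi>\<^sub>3 \<theta>) (beta S 0))"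
  have W: "W z = A + B" by (simp add: W_eq A_def B_def)
  have sym: "Cop S B A A = Cop S A A B" "Cop S A B A = Cop S A A B" "Cop S B A B = Cop S A B B" "Cop S B B A = Cop S A B B"
    using C_commute by metis+
  have exp: "coef S k (Cop S (W z) (W z) (W z)) = coef S k (Cop S A A A) + 3 *s coef S k (Cop S A A B) +
      3 *s coef S k (Cop S A B B) + coef S k (Cop S B B B)"
    unfolding W C_add coef_add sym by (simp add: vec_eq_iff)
  have m: "wmean (beta S k) (\<lambda>x. beta S k\<^sub>1 x * beta S k\<^sub>1 x * beta S 0 x) =
      wmean (beta S k) (\<lambda>x. beta S k\<^sub>1 x * beta S k\<^sub>1 x)"
    "wmean (beta S k) (\<lambda>x. beta S k\<^sub>1 x * beta S 0 x * beta S 0 x) = wmean (beta S k) (\<lambda>x. beta S k\<^sub>1 x * beta S 0 x)"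
    "wmean (beta S k) (\<lambda>x. beta S 0 x * beta S 0 x * beta S 0 x) = wmean (beta S k) (\<lambda>x. beta S 0 x * beta S 0 x)"
    by (simp_all add: beta_0)
  note cm = Ch_commute(1)[of \<phi>\<^sub>3 \<phi>\<^sub>2] Ch_commute(2)[of _ \<phi>\<^sub>3 \<phi>\<^sub>2]
  show ?thesis
    unfolding exp A_def B_def coef_C_tens[OF cont_comb(1) cont_comb(1) cont_comb(1)]
      coef_C_tens[OF cont_comb(1) cont_comb(1) cont_comb(4)]
      coef_C_tens[OF cont_comb(1) cont_comb(4) cont_comb(4)]
      coef_C_tens[OF cont_comb(4) cont_comb(4) cont_comb(4)] m wmean_beta_cube[OF mode1]
      wmean_beta_square[OF mode1] wmean_pairs
    by (simp only: Ch_expand cm)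
      (simp add: vec_eq_iff algebra_simps power2_eq_square power3_eq_cube)
qed

lemma L1_0: "L1 S 0 = 0" and D1_0: "D1 S 0 = 0"
  using linear_0[OF linear_L1] linear_0[OF linear_D1] by auto

lemma F2_0: "F2 S v 0 = Qop S (hist S v) (hist S v)"
proof -
  have "diagX (0 :: real^'m) u = (0 :: 'x^'m)" for u by (simp add: diagX_def vec_eq_iff)
  then show ?thesis by (simp add: F2_def L1_0 D1_0)
qed

text \<open>The \<open>k\<close>-th Fourier coefficient of \<open>\<pi> X\<^sub>0 u\<close>, where \<open>F\<close> is that of \<open>u\<close>.\<close>

definition Pk :: "nat \<Rightarrow> complex^'m \<Rightarrow> real \<Rightarrow> complex^'m" where
  "Pk k F \<theta> = (if k = k\<^sub>1 then (\<psi>\<^sub>1 \<odot> F) *s \<phi>\<^sub>1 \<theta> else 0) +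
     (if k = 0 then (\<psi>\<^sub>2 \<odot> F) *s \<phi>\<^sub>2 \<theta> + (\<psi>\<^sub>3 \<odot> F) *s \<phi>\<^sub>3 \<theta> else 0)"

lemma Pk_add: "Pk k (F + G) \<theta> = Pk k F \<theta> + Pk k G \<theta>"
  by (auto simp: Pk_def rdot_add vec_eq_iff algebra_simps)

lemma Pk_smult: "Pk k (c *s F) \<theta> = c *s Pk k F \<theta>"
  by (auto simp: Pk_def rdot_smult vec_eq_iff algebra_simps)

lemma Pk_quad: "Pk k (quad a b c d e f z) \<theta> = quad (Pk k a \<theta>) (Pk k b \<theta>) (Pk k c \<theta>) (Pk k d \<theta>) (Pk k e \<theta>) (Pk k f \<theta>) z"
  unfolding quad_def by (simp only: Pk_add Pk_smult)

lemma coef_pi_jump: "coef S k (pi_proj S (X\<^sub>0 F) \<theta>) = Pk k (coef S k F) \<theta>"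
proof -
  have "(\<lambda>\<theta>. coef S k (X\<^sub>0 F \<theta>)) = (\<lambda>\<theta>. if \<theta> = 0 then coef S k F else 0)" for k
    by (auto simp: X\<^sub>0_def coef_zero)
  then show ?thesis
    unfolding pi_proj_def Let_def mode2
    by (simp only: bform_jump coef_add coef_tens[OF realized_beta] wmean_beta Pk_def)
      (use mode1 in \<open>auto simp: vec_eq_iff\<close>)
qed

lemma coef_f22:
  "coef S k (f22 S z (\<lambda>\<theta>. 0) 0 \<theta>) =
    (if \<theta> = 0 then coef S k (Qop S (W z) (W z)) else 0) - Pk k (coef S k (Qop S (W z) (W z))) \<theta>"
  unfolding f22_def Let_def F2_0 coef_diff coef_pi_jump
  by (simp add: W_def X\<^sub>0_def coef_zero)

lemma om0_nonzero [simp]: "om0 S \<noteq> 0"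
  using om_pos by simp

lemma Qh_cnj_phi: "cnjv q11 = q11" "cnjv q12 = q13" "cnjv q13 = q12" "cnjv q22 = q33" "cnjv q33 = q22" "cnjv q23 = q23"
  using Qh_cnj[of \<phi>\<^sub>1 \<phi>\<^sub>1] Qh_cnj[of \<phi>\<^sub>1 \<phi>\<^sub>2] Qh_cnj[of \<phi>\<^sub>1 \<phi>\<^sub>3] Qh_cnj[of \<phi>\<^sub>2 \<phi>\<^sub>2] Qh_cnj[of \<phi>\<^sub>3 \<phi>\<^sub>3]
    Qh_cnj[of \<phi>\<^sub>2 \<phi>\<^sub>3] Qh_commute[of \<phi>\<^sub>3 \<phi>\<^sub>2] by simp_all

lemma Pk_cnj: "cnjv (Pk k F \<theta>) = Pk k (cnjv F) \<theta>"
proof -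
  have "cnjv (\<phi>\<^sub>1 \<theta>) = \<phi>\<^sub>1 \<theta>" "cnjv (\<phi>\<^sub>2 \<theta>) = \<phi>\<^sub>3 \<theta>" "cnjv (\<phi>\<^sub>3 \<theta>) = \<phi>\<^sub>2 \<theta>"
    by (rule fun_cong[OF cnj_phi(1)] fun_cong[OF cnj_phi(2)] fun_cong[OF cnj_phi(3)])+
  moreover have "cnj (\<psi>\<^sub>1 \<odot> F) = \<psi>\<^sub>1 \<odot> cnjv F" "cnj (\<psi>\<^sub>2 \<odot> F) = \<psi>\<^sub>3 \<odot> cnjv F" "cnj (\<psi>\<^sub>3 \<odot> F) = \<psi>\<^sub>2 \<odot> cnjv F"
    using rdot_cnj[of \<psi>\<^sub>1 F] rdot_cnj[of \<psi>\<^sub>2 F] rdot_cnj[of \<psi>\<^sub>3 F] by simp_all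
  moreover have "cnjv 0 = (0 :: complex^'m)" by (simp add: vec_eq_iff)
  ultimately show ?thesis
    by (simp add: Pk_def cnjv_add cnjv_smult add.commute)
qed

text \<open>The solution for the projection to both Hopf eigenfunctions, with \<open>a\<close>, \<open>b\<close> and \<open>c\<close> to be supplied
  for the value of \<open>\<zeta>\<close> at hand.\<close>

lemma solves_mode0:
  assumes "M 0 \<zeta> *v c = (1/2) *s F" "(\<i> * \<omega> - \<zeta>) * a = 1/2" "(- \<i> * \<omega> - \<zeta>) * b = 1/2"
  shows "solves 0 \<zeta> (Pk 0 F) F (\<lambda>\<theta>. exp_fun \<zeta> \<theta> *s c + ((\<psi>\<^sub>2 \<odot> F) *s (a *s \<phi>\<^sub>2 \<theta>) + (\<psi>\<^sub>3 \<odot> F) *s (b *s \<phi>\<^sub>3 \<theta>)))"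
proof -
  have "solves 0 \<zeta> \<phi>\<^sub>2 0 (\<lambda>\<theta>. a *s \<phi>\<^sub>2 \<theta>)"
    using BL_phi2 assms(2) unfolding phi2_eq by (intro solves_eigenfunction) (simp_all add: exp_fun_def)
  moreover have "solves 0 \<zeta> \<phi>\<^sub>3 0 (\<lambda>\<theta>. b *s \<phi>\<^sub>3 \<theta>)"
    using BL_phi3 assms(3) unfolding phi3_eq by (intro solves_eigenfunction) (simp_all add: exp_fun_def)
  ultimately have "solves 0 \<zeta> (\<lambda>\<theta>. 0 + ((\<psi>\<^sub>2 \<odot> F) *s \<phi>\<^sub>2 \<theta> + (\<psi>\<^sub>3 \<odot> F) *s \<phi>\<^sub>3 \<theta>))
      (F + ((\<psi>\<^sub>2 \<odot> F) *s 0 + (\<psi>\<^sub>3 \<odot> F) *s 0))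
      (\<lambda>\<theta>. exp_fun \<zeta> \<theta> *s c + ((\<psi>\<^sub>2 \<odot> F) *s (a *s \<phi>\<^sub>2 \<theta>) + (\<psi>\<^sub>3 \<odot> F) *s (b *s \<phi>\<^sub>3 \<theta>)))"
    by (intro solves_add solves_smult solves_exponential assms)
  moreover have "(\<lambda>\<theta>. 0 + ((\<psi>\<^sub>2 \<odot> F) *s \<phi>\<^sub>2 \<theta> + (\<psi>\<^sub>3 \<odot> F) *s \<phi>\<^sub>3 \<theta>)) = Pk 0 F"
    using mode1 by (auto simp: Pk_def fun_eq_iff)
  moreover have "F + ((\<psi>\<^sub>2 \<odot> F) *s 0 + (\<psi>\<^sub>3 \<odot> F) *s 0) = F" by simp
  ultimately show ?thesis by (simp only:)
qed

lemma solves_mode1: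
  assumes "M k\<^sub>1 \<zeta> *v c = (1/2) *s F" "(0 - \<zeta>) * a = 1/2"
  shows "solves k\<^sub>1 \<zeta> (Pk k\<^sub>1 F) F (\<lambda>\<theta>. exp_fun \<zeta> \<theta> *s c + (\<psi>\<^sub>1 \<odot> F) *s (a *s \<phi>\<^sub>1 \<theta>))"
proof -
  have "solves k\<^sub>1 \<zeta> \<phi>\<^sub>1 0 (\<lambda>\<theta>. a *s \<phi>\<^sub>1 \<theta>)"
    using BL_phi1 assms(2) unfolding phi1_eq by (intro solves_eigenfunction) simp_all
  then have "solves k\<^sub>1 \<zeta> (\<lambda>\<theta>. 0 + (\<psi>\<^sub>1 \<odot> F) *s \<phi>\<^sub>1 \<theta>) (F + (\<psi>\<^sub>1 \<odot> F) *s 0)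
      (\<lambda>\<theta>. exp_fun \<zeta> \<theta> *s c + (\<psi>\<^sub>1 \<odot> F) *s (a *s \<phi>\<^sub>1 \<theta>))"
    by (intro solves_add solves_smult solves_exponential assms)
  moreover have "(\<lambda>\<theta>. 0 + (\<psi>\<^sub>1 \<odot> F) *s \<phi>\<^sub>1 \<theta>) = Pk k\<^sub>1 F"
    using mode1 by (auto simp: Pk_def fun_eq_iff)
  moreover have "F + (\<psi>\<^sub>1 \<odot> F) *s 0 = F" by simp
  ultimately show ?thesis by (simp only:)
qed

lemma solves_other_mode:
  assumes "M k \<zeta> *v c = (1/2) *s F" "k \<noteq> 0" "k \<noteq> k\<^sub>1"
  shows "solves k \<zeta> (Pk k F) F (\<lambda>\<theta>. exp_fun \<zeta> \<theta> *s c)"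
proof -
  have "Pk k F = (\<lambda>\<theta>. 0)" using assms by (auto simp: Pk_def fun_eq_iff)
  then show ?thesis using solves_exponential[OF assms(1)] by simp
qed

text \<open>The pairs of a mode and an exponent that occur in the problems for the coefficients of \<open>h\<close>
  under consideration.\<close>

lemma nonresonant:
  "invertible (M 0 0)" "invertible (M (2 * k\<^sub>1) 0)" "invertible (M 0 (2 * \<i> * \<omega>))" "invertible (M 0 (- 2 * \<i> * \<omega>))"
  "invertible (M k\<^sub>1 (\<i> * \<omega>))" "invertible (M k\<^sub>1 (- \<i> * \<omega>))"
  using mode1 om_pos by (intro M_invertible; simp add: complex_eq_iff)+

abbreviation "N k \<equiv> eta_int S k (\<lambda>s. 1)"

lemma M0_inverse:
  assumes "invertible (N k)"
  shows "M k 0 *v (- (1/2) *s (matrix_inv (N k) *v F)) = (1/2) *s F"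
  unfolding M_zero vector_scalar_commute matrix_inv_solve[OF assms] by (simp add: vec_eq_iff)

lemma M_inverse:
  assumes "invertible (M k \<zeta>)"
  shows "M k \<zeta> *v ((1/2) *s (matrix_inv (M k \<zeta>) *v F)) = (1/2) *s F"
  unfolding vector_scalar_commute matrix_inv_solve[OF assms] ..

section \<open>The quadratic part of the normal form\<close>

lemma modes_nth: "modes S u $ 1 = \<psi>\<^sub>1 \<odot> coef S k\<^sub>1 u" "modes S u $ 2 = \<psi>\<^sub>2 \<odot> coef S 0 u"
  "modes S u $ 3 = \<psi>\<^sub>3 \<odot> coef S 0 u"
  by (simp_all add: modes_def mode2 vector_3)

lemma bounded_linear_modes: "bounded_linear (modes S)"
proof -
  have r: "bounded_linear (\<lambda>u. (p \<odot> coef S k u) *s c)" for p k and c :: "complex^3"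
    using bounded_linear_compose[OF bounded_linear_smult_left
        bounded_linear_compose[OF linear_conv_bounded_linear[THEN iffD1, OF linear_rdot] bounded_linear_coef]] .
  have "modes S = (\<lambda>u. (\<psi>\<^sub>1 \<odot> coef S k\<^sub>1 u) *s axis 1 1 + (\<psi>\<^sub>2 \<odot> coef S 0 u) *s axis 2 1 +
      (\<psi>\<^sub>3 \<odot> coef S 0 u) *s axis 3 1)"
    by (simp add: fun_eq_iff vec_eq_iff forall_3 modes_nth axis_def)
  then show ?thesis using r by (simp add: bounded_linear_add)
qed

lemma mu_0 [simp]: "mu S 0 = 0"
  by (simp add: mu_def)

lemma coef_wz_0: "coef S k\<^sub>1 (wz S z 0) = z $ 1 *s \<phi>\<^sub>1 0"
  using mode1 by (simp add: wz_eq coef_add coef_tens[OF realized_beta] wmean_beta vec_eq_iff)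

lemma wz_dom: "wz S z 0 \<in> dom_lap S"
  unfolding wz_eq by (intro dom_lap_add tens_beta_in_dom_lap)

lemma coef_L1_W: "coef S k\<^sub>1 (L1 S \<alpha> (W z)) = z $ 1 *s L1h S \<alpha> \<phi>\<^sub>1"
  "coef S 0 (L1 S \<alpha> (W z)) = z $ 2 *s L1h S \<alpha> \<phi>\<^sub>2 + z $ 3 *s L1h S \<alpha> \<phi>\<^sub>3"
  using mode1 unfolding W_eq blinfun.add_right coef_add coef_L1_tens[OF cont_comb(1)] coef_L1_tens[OF cont_comb(4)]
  by (simp_all add: L1h_add L1h_smult cont_comb)

lemma coef_D1_wz: "coef S k\<^sub>1 (diagX (D1 S \<alpha>) (lap S (wz S z 0))) = - (z $ 1 *s diagC (mu S k\<^sub>1 *\<^sub>R D1 S \<alpha>) (\<phi>\<^sub>1 0))"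
  "coef S 0 (diagX (D1 S \<alpha>) (lap S (wz S z 0))) = 0"
  unfolding coef_diagX coef_lap[OF wz_dom] coef_wz_0 by (simp_all add: diagC_def vec_eq_iff)

lemma b2_eq: "2 * b2 S \<alpha> = \<psi>\<^sub>2 \<odot> L1h S \<alpha> \<phi>\<^sub>2"
proof -
  have "diagC 0 v = 0" for v :: "complex^'m" by (simp add: diagC_def vec_eq_iff)
  then show ?thesis by (simp add: b2_def mode2)
qed

lemma cnj_b2: "2 * cnj (b2 S \<alpha>) = \<psi>\<^sub>3 \<odot> L1h S \<alpha> \<phi>\<^sub>3"
proof -
  have "\<psi>\<^sub>3 \<odot> L1h S \<alpha> \<phi>\<^sub>3 = cnj (\<psi>\<^sub>2 \<odot> L1h S \<alpha> \<phi>\<^sub>2)"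
    using rdot_cnj[of \<psi>\<^sub>2 "L1h S \<alpha> \<phi>\<^sub>2"] L1h_cnj[OF cont_phi(2), of \<alpha>] by simp
  then show ?thesis by (simp flip: b2_eq)
qed

text \<open>With \<open>\<alpha> = 0\<close> no resonant monomial is left, by \<open>coef_QW\<close>. The terms linear in \<open>\<alpha>\<close> couple each
  mode with itself, and on mode 0 the Laplacian is zero.\<close>

lemma f21_nth:
  "f21 S z (\<lambda>\<theta>. 0) \<alpha> $ 1 = 2 * a1 S \<alpha> * z $ 1 + squad 0 0 0 (2 * (\<psi>\<^sub>1 \<odot> q12)) (2 * (\<psi>\<^sub>1 \<odot> q13)) 0 z"
  "f21 S z (\<lambda>\<theta>. 0) \<alpha> $ 2 = 2 * b2 S \<alpha> * z $ 2 + (\<psi>\<^sub>2 \<odot> L1h S \<alpha> \<phi>\<^sub>3) * z $ 3 +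
    squad (\<psi>\<^sub>2 \<odot> q11) (\<psi>\<^sub>2 \<odot> q22) (\<psi>\<^sub>2 \<odot> q33) 0 0 (2 * (\<psi>\<^sub>2 \<odot> q23)) z"
  "f21 S z (\<lambda>\<theta>. 0) \<alpha> $ 3 = 2 * cnj (b2 S \<alpha>) * z $ 3 + (\<psi>\<^sub>3 \<odot> L1h S \<alpha> \<phi>\<^sub>2) * z $ 2 +
    squad (\<psi>\<^sub>3 \<odot> q11) (\<psi>\<^sub>3 \<odot> q22) (\<psi>\<^sub>3 \<odot> q33) 0 0 (2 * (\<psi>\<^sub>3 \<odot> q23)) z"
proof -
  have F2: "F2 S (\<lambda>\<theta>. wz S z \<theta> + 0) \<alpha> = L1 S \<alpha> (W z) + diagX (D1 S \<alpha>) (lap S (wz S z 0)) + Qop S (W z) (W z)"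
    by (simp add: F2_def W_def)
  have Q0: "coef S 0 (Qop S (W z) (W z)) = quad q11 q22 q33 0 0 (2 *s q23) z"
    and Q1: "coef S k\<^sub>1 (Qop S (W z) (W z)) = quad 0 0 0 (2 *s q12) (2 *s q13) 0 z"
    using mode1 by (simp_all add: coef_QW quad_def vec_eq_iff power2_eq_square)
  show "f21 S z (\<lambda>\<theta>. 0) \<alpha> $ 1 = 2 * a1 S \<alpha> * z $ 1 + squad 0 0 0 (2 * (\<psi>\<^sub>1 \<odot> q12)) (2 * (\<psi>\<^sub>1 \<odot> q13)) 0 z"
    unfolding f21_def F2 modes_nth coef_add coef_L1_W coef_D1_wz Q1 rdot_add rdot_quad a1_def
    by (simp add: rdot_minus rdot_smult rdot_diff algebra_simps)
  show "f21 S z (\<lambda>\<theta>. 0) \<alpha> $ 2 = 2 * b2 S \<alpha> * z $ 2 + (\<psi>\<^sub>2 \<odot> L1h S \<alpha> \<phi>\<^sub>3) * z $ 3 +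
    squad (\<psi>\<^sub>2 \<odot> q11) (\<psi>\<^sub>2 \<odot> q22) (\<psi>\<^sub>2 \<odot> q33) 0 0 (2 * (\<psi>\<^sub>2 \<odot> q23)) z"
    unfolding f21_def F2 modes_nth coef_add coef_L1_W coef_D1_wz Q0 rdot_add rdot_quad b2_eq
    by (simp add: rdot_smult mult_ac)
  show "f21 S z (\<lambda>\<theta>. 0) \<alpha> $ 3 = 2 * cnj (b2 S \<alpha>) * z $ 3 + (\<psi>\<^sub>3 \<odot> L1h S \<alpha> \<phi>\<^sub>2) * z $ 2 +
    squad (\<psi>\<^sub>3 \<odot> q11) (\<psi>\<^sub>3 \<odot> q22) (\<psi>\<^sub>3 \<odot> q33) 0 0 (2 * (\<psi>\<^sub>3 \<odot> q23)) z"
    unfolding f21_def F2 modes_nth coef_add coef_L1_W coef_D1_wz Q0 rdot_add rdot_quad cnj_b2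
    by (simp add: rdot_smult mult_ac)
qed

lemma linear_a1: "linear (a1 S)"
proof -
  have d: "diagC (x + y) v = diagC x v + diagC y v" "diagC (c *\<^sub>R x) v = c *\<^sub>R diagC x v"
    for c x y and v :: "complex^'m"
    by (simp_all add: diagC_def vec_eq_iff algebra_simps scaleR_conv_of_real[where 'a=complex])
  show ?thesis
    by (rule linearI)
      (simp_all add: a1_def linear_add[OF linear_L1h] linear_cmul[OF linear_L1h] linear_add[OF linear_D1]
        linear_cmul[OF linear_D1] d rdot_add rdot_diff rdot_scaleR algebra_simps scaleR_conv_of_real[where 'a=complex])
qed

lemma linear_rdot_L1h: "linear (\<lambda>\<alpha>. p \<odot> L1h S \<alpha> \<phi>)"
  by (rule linearI) (simp_all add: linear_add[OF linear_L1h] linear_cmul[OF linear_L1h] rdot_add rdot_scaleR)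

lemma linear_b2: "linear (b2 S)"
proof -
  have "b2 S = (\<lambda>\<alpha>. (1/2) *\<^sub>R (\<psi>\<^sub>2 \<odot> L1h S \<alpha> \<phi>\<^sub>2))"
    using b2_eq by (auto simp: fun_eq_iff scaleR_conv_of_real field_simps)
  then show ?thesis using linear_compose_scale_right[OF linear_rdot_L1h] by simp
qed

lemma cnj_b2_expand: "cnj (b2 S \<alpha>) = complex_of_real (\<alpha> $ 1) * cnj (b2 S (axis 1 1)) + complex_of_real (\<alpha> $ 2) * cnj (b2 S (axis 2 1))"
  using linear_expand[OF linear_b2, of \<alpha>] by simp

text \<open>The monomials of \<open>f\<^sub>2\<^sup>1(z,0,\<alpha>)\<close> for \<open>s = 1\<close> and of \<open>f\<^sub>2\<^sup>1(z,0,0)\<close> for \<open>s = 0\<close>. Both are projected, and for the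
  second the polynomial is constant in \<open>\<alpha>\<close>.\<close>

definition L21 :: "complex \<Rightarrow> 3 \<Rightarrow> (expo \<times> complex) list" where
  "L21 s i = (if i = 1 then
      [((1,0,0,1,0), s * (2 * a1 S (axis 1 1))), ((1,0,0,0,1), s * (2 * a1 S (axis 2 1)))] @
        cub 0 0 0 1 0 0 0 (2 * (\<psi>\<^sub>1 \<odot> q12)) (2 * (\<psi>\<^sub>1 \<odot> q13)) 0
    else if i = 2 then
      [((0,1,0,1,0), s * (2 * b2 S (axis 1 1))), ((0,1,0,0,1), s * (2 * b2 S (axis 2 1))),
       ((0,0,1,1,0), s * (\<psi>\<^sub>2 \<odot> L1h S (axis 1 1) \<phi>\<^sub>3)), ((0,0,1,0,1), s * (\<psi>\<^sub>2 \<odot> L1h S (axis 2 1) \<phi>\<^sub>3))] @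
        cub 0 0 0 1 (\<psi>\<^sub>2 \<odot> q11) (\<psi>\<^sub>2 \<odot> q22) (\<psi>\<^sub>2 \<odot> q33) 0 0 (2 * (\<psi>\<^sub>2 \<odot> q23))
    else
      [((0,0,1,1,0), s * (2 * cnj (b2 S (axis 1 1)))), ((0,0,1,0,1), s * (2 * cnj (b2 S (axis 2 1)))),
       ((0,1,0,1,0), s * (\<psi>\<^sub>3 \<odot> L1h S (axis 1 1) \<phi>\<^sub>2)), ((0,1,0,0,1), s * (\<psi>\<^sub>3 \<odot> L1h S (axis 2 1) \<phi>\<^sub>2))] @
        cub 0 0 0 1 (\<psi>\<^sub>3 \<odot> q11) (\<psi>\<^sub>3 \<odot> q22) (\<psi>\<^sub>3 \<odot> q33) 0 0 (2 * (\<psi>\<^sub>3 \<odot> q23)))"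

lemma L21_expos: "fst ` set (L21 s i) \<subseteq> expos 2"
  by (auto simp: L21_def cub_def expos_def)

lemma f21_eval: "f21 S z (\<lambda>\<theta>. 0) \<alpha> $ i = meval (L21 1 i) z \<alpha>"
proof -
  have "i = 1 \<or> i = 2 \<or> i = 3" by (rule exhaust_3)
  then show ?thesis
    by (elim disjE)
      (simp_all add: L21_def f21_nth meval_cub monom_fn_def linear_expand[OF linear_a1, of \<alpha>] linear_expand[OF linear_b2, of \<alpha>]
        linear_expand[OF linear_rdot_L1h, where \<alpha>=\<alpha>] cnj_b2_expand[of \<alpha>] algebra_simps)
qed

lemma f21_eval_0: "f21 S z (\<lambda>\<theta>. 0) 0 $ i = meval (L21 0 i) z \<alpha>"
proof -
  have "i = 1 \<or> i = 2 \<or> i = 3" by (rule exhaust_3)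
  then show ?thesis
    by (elim disjE)
      (simp_all add: L21_def f21_nth meval_cub monom_fn_def linear_0[OF linear_a1] linear_0[OF linear_b2]
        linear_0[OF linear_rdot_L1h])
qed

text \<open>Projection keeps only the terms linear in \<open>\<alpha>\<close>: the coefficients of \<open>z\<^sub>1\<^sup>2\<close>, \<open>z\<^sub>2 z\<^sub>3\<close>, \<open>z\<^sub>1 z\<^sub>2\<close> and
  \<open>z\<^sub>1 z\<^sub>3\<close> in the respective components are zero.\<close>

lemma g21_nth:
  "g21 S z \<alpha> $ 1 = 2 * a1 S \<alpha> * z $ 1" "g21 S z \<alpha> $ 2 = 2 * b2 S \<alpha> * z $ 2"
  "g21 S z \<alpha> $ 3 = 2 * cnj (b2 S \<alpha>) * z $ 3"
  unfolding g21_def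
  by (simp_all add: Proj_eq[where L="L21 1", OF _ f21_eval L21_expos] resonant_def L21_def cub_def monom_fn_def
      linear_expand[OF linear_a1, of \<alpha>] linear_expand[OF linear_b2, of \<alpha>] cnj_b2_expand[of \<alpha>] algebra_simps)

lemma Proj_f21_0: "Proj 2 (\<lambda>z \<alpha>. f21 S z (\<lambda>\<theta>. 0) 0) z 0 = 0"
proof -
  have "Proj 2 (\<lambda>z \<alpha>. f21 S z (\<lambda>\<theta>. 0) 0) z 0 $ i = 0" for i
  proof -
    have "i = 1 \<or> i = 2 \<or> i = 3" by (rule exhaust_3)
    then show ?thesis
      by (elim disjE)
        (simp_all add: Proj_eq[where L="L21 0", OF _ f21_eval_0 L21_expos] resonant_def L21_def cub_def monom_fn_def)
  qed
  then show ?thesis by (simp add: vec_eq_iff)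
qed

lemma g21_0: "g21 S z 0 = 0"
  using linear_0[OF linear_a1] linear_0[OF linear_b2] by (simp add: vec_eq_iff forall_3 g21_nth)

lemma f21_0_quad: "f21 S z (\<lambda>\<theta>. 0) 0 = quad (vector [0, \<psi>\<^sub>2 \<odot> q11, \<psi>\<^sub>3 \<odot> q11]) (vector [0, \<psi>\<^sub>2 \<odot> q22, \<psi>\<^sub>3 \<odot> q22])
    (vector [0, \<psi>\<^sub>2 \<odot> q33, \<psi>\<^sub>3 \<odot> q33]) (vector [2 * (\<psi>\<^sub>1 \<odot> q12), 0, 0]) (vector [2 * (\<psi>\<^sub>1 \<odot> q13), 0, 0])
    (vector [0, 2 * (\<psi>\<^sub>2 \<odot> q23), 2 * (\<psi>\<^sub>3 \<odot> q23)]) z"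
  using linear_0[OF linear_a1] linear_0[OF linear_b2] linear_0[OF linear_rdot_L1h]
  by (simp add: vec_eq_iff forall_3 f21_nth quad_nth vector_3)

lemma Bz_quad: "Bz S (quad a b c d e f z) = quad (Bz S a) (Bz S b) (Bz S c) (Bz S d) (Bz S e) (Bz S f) z"
  by (simp add: vec_eq_iff forall_3 quad_nth squad_def algebra_simps)

lemma sum_expos_2:
  assumes "\<And>a b c d e. d > 0 \<or> e > 0 \<Longrightarrow> g (a, b, c, d, e) = (0::complex)"
  shows "(\<Sum>e\<in>expos 2. g e) = g (2,0,0,0,0) + g (0,2,0,0,0) + g (0,0,2,0,0) + g (1,1,0,0,0) + g (1,0,1,0,0) + g (0,1,1,0,0)"
proof -
  define E :: "expo set" where "E = {(2,0,0,0,0), (0,2,0,0,0), (0,0,2,0,0), (1,1,0,0,0), (1,0,1,0,0), (0,1,1,0,0)}"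
  have "(\<Sum>e\<in>expos 2. g e) = (\<Sum>e\<in>E. g e)"
  proof (rule sum.mono_neutral_right[OF finite_expos])
    show "E \<subseteq> expos 2" by (auto simp: E_def expos_def)
    show "\<forall>x\<in>expos 2 - E. g x = 0"
    proof
      fix x assume x: "x \<in> expos 2 - E"
      obtain a b c d e where abc: "x = (a, b, c, d, e)" by (cases x)
      have "d > 0 \<or> e > 0"
      proof (rule ccontr)
        assume "\<not> (d > 0 \<or> e > 0)"
        then have de: "d = 0" "e = 0" and sum: "a + b + c = 2" using x by (auto simp: abc expos_def)
        from sum have a: "a = 0 \<or> a = 1 \<or> a = 2" and b: "b = 0 \<or> b = 1 \<or> b = 2" by linarith+
        have c: "c = 2 - a - b" using sum by linarith
        have "x \<in> E" using a b sum unfolding abc de E_def c by (elim disjE) simp_all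
        with x show False by simp
      qed
      then show "g x = 0" using assms by (simp add: abc)
    qed
  qed
  also have "\<dots> = g (2,0,0,0,0) + g (0,2,0,0,0) + g (0,0,2,0,0) + g (1,1,0,0,0) + g (1,0,1,0,0) + g (0,1,1,0,0)"
    by (simp add: E_def)
  finally show ?thesis .
qed

text \<open>In component \<open>i\<close>, \<open>M\<^sub>2\<^sup>1\<close> multiplies each monomial by the difference of its eigenvalue under
  \<open>p \<mapsto> D\<^sub>z p Bz\<close> and the \<open>i\<close>-th diagonal entry of \<open>B\<close>. On the nonresonant monomials present this
  difference is \<open>\<plusminus>i\<omega>\<^sub>0\<close> or \<open>\<plusminus>3i\<omega>\<^sub>0\<close>.\<close>

lemma U_coefficients:
  assumes "is_U21 S U"
  obtains u200 u020 u002 u110 u101 u011 :: "complex^3" where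
    "U = quad u200 u020 u002 u110 u101 u011"
    "u200 $ 1 = 0" "u200 $ 2 = - (\<psi>\<^sub>2 \<odot> q11) / (\<i> * \<omega>)" "u200 $ 3 = (\<psi>\<^sub>3 \<odot> q11) / (\<i> * \<omega>)"
    "u020 $ 1 = 0" "u020 $ 2 = (\<psi>\<^sub>2 \<odot> q22) / (\<i> * \<omega>)" "u020 $ 3 = (\<psi>\<^sub>3 \<odot> q22) / (3 * \<i> * \<omega>)"
    "u002 $ 1 = 0" "u002 $ 2 = - (\<psi>\<^sub>2 \<odot> q33) / (3 * \<i> * \<omega>)" "u002 $ 3 = - (\<psi>\<^sub>3 \<odot> q33) / (\<i> * \<omega>)"
    "u110 $ 1 = 2 * (\<psi>\<^sub>1 \<odot> q12) / (\<i> * \<omega>)" "u110 $ 2 = 0" "u110 $ 3 = 0"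
    "u101 $ 1 = - 2 * (\<psi>\<^sub>1 \<odot> q13) / (\<i> * \<omega>)" "u101 $ 2 = 0" "u101 $ 3 = 0"
    "u011 $ 1 = 0" "u011 $ 2 = - 2 * (\<psi>\<^sub>2 \<odot> q23) / (\<i> * \<omega>)" "u011 $ 3 = 2 * (\<psi>\<^sub>3 \<odot> q23) / (\<i> * \<omega>)"
proof -
  obtain c where c: "hom_poly 2 (\<lambda>z \<alpha>. U z) c" "\<And>i e. e \<in> resonant 2 i \<Longrightarrow> c i e = 0"
    and M1: "\<And>z. M1 S U z = f21 S z (\<lambda>\<theta>. 0) 0 - Proj 2 (\<lambda>z \<alpha>. f21 S z (\<lambda>\<theta>. 0) 0) z 0"
    using assms unfolding is_U21_def by blast
  define u200 :: "complex^3" where "u200 = (\<chi> i. c i (2,0,0,0,0))"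
  define u020 :: "complex^3" where "u020 = (\<chi> i. c i (0,2,0,0,0))"
  define u002 :: "complex^3" where "u002 = (\<chi> i. c i (0,0,2,0,0))"
  define u110 :: "complex^3" where "u110 = (\<chi> i. c i (1,1,0,0,0))"
  define u101 :: "complex^3" where "u101 = (\<chi> i. c i (1,0,1,0,0))"
  define u011 :: "complex^3" where "u011 = (\<chi> i. c i (0,1,1,0,0))"
  note u = u200_def u020_def u002_def u110_def u101_def u011_def
  have "U z $ i = quad u200 u020 u002 u110 u101 u011 z $ i" for z i
  proof -
    have "U z $ i = (\<Sum>e\<in>expos 2. c i e * monom_fn e z 0)"
      using c(1) unfolding hom_poly_def by blast
    also have "\<dots> = squad (u200 $ i) (u020 $ i) (u002 $ i) (u110 $ i) (u101 $ i) (u011 $ i) z"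
      by (subst sum_expos_2) (auto simp: monom_fn_def squad_def u)
    finally show ?thesis by (simp only: quad_nth)
  qed
  then have U: "U = quad u200 u020 u002 u110 u101 u011" by (simp add: fun_eq_iff vec_eq_iff)
  have eq: "quad (0 - Bz S u200) ((2 * \<i> * \<omega>) *s u020 - Bz S u020) ((- 2 * \<i> * \<omega>) *s u002 - Bz S u002)
      ((\<i> * \<omega>) *s u110 - Bz S u110) ((- \<i> * \<omega>) *s u101 - Bz S u101) (0 - Bz S u011) z =
    quad (vector [0, \<psi>\<^sub>2 \<odot> q11, \<psi>\<^sub>3 \<odot> q11]) (vector [0, \<psi>\<^sub>2 \<odot> q22, \<psi>\<^sub>3 \<odot> q22])
    (vector [0, \<psi>\<^sub>2 \<odot> q33, \<psi>\<^sub>3 \<odot> q33]) (vector [2 * (\<psi>\<^sub>1 \<odot> q12), 0, 0]) (vector [2 * (\<psi>\<^sub>1 \<odot> q13), 0, 0])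
    (vector [0, 2 * (\<psi>\<^sub>2 \<odot> q23), 2 * (\<psi>\<^sub>3 \<odot> q23)]) z" for z
  proof -
    have "M1 S U z = f21 S z (\<lambda>\<theta>. 0) 0" using M1[of z] by (simp only: Proj_f21_0 diff_zero)
    then show ?thesis unfolding M1_def U quad_along_B Bz_quad quad_diff f21_0_quad .
  qed
  note q = quad_eqD[OF eq, unfolded vec_eq_iff forall_3, simplified vector_3]
  (* On the resonant monomials M1 gives no information; there U is zero by definition. *)
  have r: "u200 $ 1 = 0" "u011 $ 1 = 0" "u110 $ 2 = 0" "u101 $ 3 = 0"
    by (simp_all add: u c(2) resonant_def)
  have neg: "- x = y \<longleftrightarrow> x = - y" for x y :: complex by (metis minus_minus)
  show thesis
    by (rule that[OF U]) (use q r in \<open>simp_all add: field_simps neg\<close>)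
qed

lemma wz_add: "wz S (z + t *\<^sub>R y) \<theta> = wz S z \<theta> + t *\<^sub>R wz S y \<theta>"
proof -
  have "(z + t *\<^sub>R y) $ 1 *s \<phi>\<^sub>1 \<theta> = z $ 1 *s \<phi>\<^sub>1 \<theta> + t *\<^sub>R (y $ 1 *s \<phi>\<^sub>1 \<theta>)"
    "(z + t *\<^sub>R y) $ 2 *s \<phi>\<^sub>2 \<theta> + (z + t *\<^sub>R y) $ 3 *s \<phi>\<^sub>3 \<theta> =
      (z $ 2 *s \<phi>\<^sub>2 \<theta> + z $ 3 *s \<phi>\<^sub>3 \<theta>) + t *\<^sub>R (y $ 2 *s \<phi>\<^sub>2 \<theta> + y $ 3 *s \<phi>\<^sub>3 \<theta>)"
    by (simp_all add: vec_eq_iff algebra_simps)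
  then show ?thesis
    unfolding wz_eq by (simp only: tens_add[OF realized_beta] tens_scaleR[OF realized_beta] scaleR_add_right)
      (simp add: algebra_simps)
qed

end

section \<open>The homological equation for h\<close>

locale center_manifold = hopf_steady S for S :: "('x::{real_inner,banach}, 'm::finite) reduction" +
  fixes h :: "nat \<Rightarrow> nat \<Rightarrow> nat \<Rightarrow> real \<Rightarrow> 'x^'m"
  assumes h: "is_h S h"
begin

abbreviation quad_of :: "(nat \<Rightarrow> nat \<Rightarrow> nat \<Rightarrow> complex^'n) \<Rightarrow> complex^3 \<Rightarrow> complex^'n" where
  "quad_of g \<equiv> quad (g 2 0 0) (g 0 2 0) (g 0 0 2) (g 1 1 0) (g 1 0 1) (g 0 1 1)"

definition idx :: "(nat \<times> nat \<times> nat) set" where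
  "idx = {(2,0,0), (0,2,0), (0,0,2), (1,1,0), (1,0,1), (0,1,1)}"

lemma h_Q1: "(a, b, c) \<in> idx \<Longrightarrow> h a b c \<in> Q1 S"
  using h by (auto simp: is_h_def idx_def)

lemma h_deriv:
  assumes "(a, b, c) \<in> idx" "\<theta> \<in> I\<^sub>r S"
  shows "(h a b c has_vector_derivative dot S (h a b c) \<theta>) (at \<theta> within I\<^sub>r S)"
  using h_Q1[OF assms(1)] assms(2) unfolding Q1_def dot_def by (simp add: vector_derivative_works)

lemma cont_h: "(a, b, c) \<in> idx \<Longrightarrow> cont (h a b c)"
  using h_deriv has_vector_derivative_continuous unfolding continuous_on_eq_continuous_within by blast

lemma h_dom: "(a, b, c) \<in> idx \<Longrightarrow> h a b c 0 \<in> dom_lap S"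
  using h_Q1 by (simp add: Q1_def)

lemma idx_simps [simp]: "(2,0,0) \<in> idx" "(0,2,0) \<in> idx" "(0,0,2) \<in> idx" "(Suc 0,Suc 0,0) \<in> idx"
  "(Suc 0,0,Suc 0) \<in> idx" "(0,Suc 0,Suc 0) \<in> idx"
  by (simp_all add: idx_def)

lemma cont_hmode: "(a, b, c) \<in> idx \<Longrightarrow> cont (hmode S (h a b c) k)"
  unfolding hmode_def[abs_def] by (intro continuous_coef cont_h)

lemma coef_hz: "coef S k (hz S h z \<theta>) = quad_of (\<lambda>a b c. hmode S (h a b c) k \<theta>) z"
  by (simp only: hz_def quad_def hmode_def coef_add coef_csc)

lemma cont_hz: "cont (hz S h z)"
  unfolding hz_def[abs_def] by (intro continuous_on_add continuous_csc cont_h) simp_all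

lemma hz_dom: "hz S h z 0 \<in> dom_lap S"
  unfolding hz_def by (intro dom_lap_add dom_lap_csc h_dom) simp_all

lemma coef_hz_along_B:
  "coef S k (frechet_derivative (\<lambda>z. hz S h z \<theta>) (at z) (Bz S z)) =
    quad 0 ((2 * \<i> * \<omega>) *s hmode S (h 0 2 0) k \<theta>) ((- 2 * \<i> * \<omega>) *s hmode S (h 0 0 2) k \<theta>)
      ((\<i> * \<omega>) *s hmode S (h 1 1 0) k \<theta>) ((- \<i> * \<omega>) *s hmode S (h 1 0 1) k \<theta>) 0 z"
proof -
  have "((\<lambda>z. hz S h z \<theta>) has_derivative (\<lambda>w. csc S (2 * z $ 1 * w $ 1) (h 2 0 0 \<theta>) +
      csc S (2 * z $ 2 * w $ 2) (h 0 2 0 \<theta>) + csc S (2 * z $ 3 * w $ 3) (h 0 0 2 \<theta>) +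
      csc S (z $ 1 * w $ 2 + w $ 1 * z $ 2) (h 1 1 0 \<theta>) + csc S (z $ 1 * w $ 3 + w $ 1 * z $ 3) (h 1 0 1 \<theta>) +
      csc S (z $ 2 * w $ 3 + w $ 2 * z $ 3) (h 0 1 1 \<theta>))) (at z)"
    unfolding hz_def
    by (intro has_derivative_add bounded_linear.has_derivative[OF bounded_linear_csc_left] monomial_derivs)
  from frechet_derivative_at[OF this, symmetric] show ?thesis
    by (simp only: coef_add coef_csc hmode_def[symmetric])
      (simp add: quad_def vec_eq_iff algebra_simps power2_eq_square)
qed

lemma dot_hz:
  assumes "\<theta> \<in> I\<^sub>r S"
  shows "dot S (hz S h z) \<theta> = csc S (z $ 1 ^ 2) (dot S (h 2 0 0) \<theta>) + csc S (z $ 2 ^ 2) (dot S (h 0 2 0) \<theta>) +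
    csc S (z $ 3 ^ 2) (dot S (h 0 0 2) \<theta>) + csc S (z $ 1 * z $ 2) (dot S (h 1 1 0) \<theta>) +
    csc S (z $ 1 * z $ 3) (dot S (h 1 0 1) \<theta>) + csc S (z $ 2 * z $ 3) (dot S (h 0 1 1) \<theta>)"
proof -
  have "(hz S h z has_vector_derivative (csc S (z $ 1 ^ 2) (dot S (h 2 0 0) \<theta>) + csc S (z $ 2 ^ 2) (dot S (h 0 2 0) \<theta>) +
    csc S (z $ 3 ^ 2) (dot S (h 0 0 2) \<theta>) + csc S (z $ 1 * z $ 2) (dot S (h 1 1 0) \<theta>) +
    csc S (z $ 1 * z $ 3) (dot S (h 1 0 1) \<theta>) + csc S (z $ 2 * z $ 3) (dot S (h 0 1 1) \<theta>))) (at \<theta> within I\<^sub>r S)"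
    unfolding hz_def[abs_def]
    by (intro has_vector_derivative_add bounded_linear.has_vector_derivative[OF bounded_linear_csc] h_deriv assms)
      simp_all
  then show ?thesis
    unfolding dot_def I\<^sub>r_def using delay_pos assms
    by (intro vector_derivative_within_cbox[of "- delay S" 0 \<theta>, unfolded cbox_interval]) (auto simp: I\<^sub>r_def)
qed

text \<open>At \<open>\<theta> = 0\<close> the operator \<open>X\<^sub>0\<close> replaces the derivative by \<open>L\<^sub>0 h + D\<^sub>0 \<Delta> h(0)\<close>, whose \<open>k\<close>-th coefficient is
  \<open>BL k\<close> of that of \<open>h\<close>.\<close>

lemma coef_A1_hz:
  assumes "\<theta> \<in> I\<^sub>r S"
  shows "coef S k (A1 S (hz S h z) \<theta>) =
    (if \<theta> = 0 then quad_of (\<lambda>a b c. BL k (hmode S (h a b c) k)) z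
     else quad_of (\<lambda>a b c. coef S k (dot S (h a b c) \<theta>)) z)"
proof (cases "\<theta> = 0")
  case True
  have "coef S k (A1 S (hz S h z) 0) = coef S k (Lop S 0 (hist S (hz S h z))) +
      coef S k (diagX (dcoef S 0) (lap S (hz S h z 0)))"
    by (simp add: A1_def X\<^sub>0_def flip: coef_add)
  also have "\<dots> = BL k (\<lambda>\<theta>. coef S k (hz S h z \<theta>))"
    unfolding coef_L[OF zero_in_nbhd cont_hz] coef_diagX coef_lap[OF hz_dom] BL_def
    by (simp add: diagC_def vec_eq_iff)
  also have "\<dots> = quad_of (\<lambda>a b c. BL k (hmode S (h a b c) k)) z"
    unfolding coef_hz quad_def
    by (simp add: BL_add BL_smult continuous_on_add continuous_smult_const cont_hmode)
  finally show ?thesis using True by simp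
next
  case False
  then show ?thesis
    unfolding A1_def dot_hz[OF assms] by (simp add: X\<^sub>0_def quad_def coef_add coef_csc)
qed

text \<open>The \<open>k\<close>-th Fourier coefficient of the homological equation is an identity between quadratic forms
  in \<open>z\<close> at every \<open>\<theta>\<close>. Equality of their coefficients is the differential equation for \<open>\<theta> < 0\<close> and the
  boundary condition for \<open>\<theta> = 0\<close>.\<close>

lemma h_solves:
  assumes F: "\<And>z. coef S k (Qop S (W z) (W z)) = quad f200 f020 f002 f110 f101 f011 z"
  shows "solves k 0 (Pk k f200) f200 (hmode S (h 2 0 0) k)"
    "solves k (2 * \<i> * \<omega>) (Pk k f020) f020 (hmode S (h 0 2 0) k)"
    "solves k (- 2 * \<i> * \<omega>) (Pk k f002) f002 (hmode S (h 0 0 2) k)"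
    "solves k (\<i> * \<omega>) (Pk k f110) f110 (hmode S (h 1 1 0) k)"
    "solves k (- \<i> * \<omega>) (Pk k f101) f101 (hmode S (h 1 0 1) k)"
    "solves k 0 (Pk k f011) f011 (hmode S (h 0 1 1) k)"
proof -
  have eq: "coef S k (frechet_derivative (\<lambda>z. hz S h z \<theta>) (at z) (Bz S z)) - coef S k (A1 S (hz S h z) \<theta>) =
      (1/2) *s coef S k (f22 S z (\<lambda>\<theta>. 0) 0 \<theta>)" if "\<theta> \<in> I\<^sub>r S" for z \<theta>
  proof -
    have "frechet_derivative (\<lambda>z. hz S h z \<theta>) (at z) (Bz S z) - A1 S (hz S h z) \<theta> =
        (1 / 2) *\<^sub>R f22 S z (\<lambda>\<theta>. 0) 0 \<theta>"
      using h that by (simp add: is_h_def)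
    then show ?thesis by (simp add: smult_scaleR[symmetric] coef_scaleR flip: coef_diff) (simp add: smult_scaleR)
  qed
  have gen: "solves k \<zeta> (Pk k f) f (hmode S (h a b c) k)"
    if idx: "(a, b, c) \<in> idx"
      and in_ode: "\<And>\<theta>. \<theta> \<in> I\<^sub>r S \<Longrightarrow> \<theta> \<noteq> 0 \<Longrightarrow>
        \<zeta> *s hmode S (h a b c) k \<theta> - coef S k (dot S (h a b c) \<theta>) = (1/2) *s (0 - Pk k f \<theta>)"
      and in_bc: "\<zeta> *s hmode S (h a b c) k 0 - BL k (hmode S (h a b c) k) = (1/2) *s (f - Pk k f 0)"
    for a b c f \<zeta>
    unfolding solves_def
  proof (intro conjI ballI impI cont_hmode idx in_bc)
    fix \<theta> assume \<theta>: "\<theta> \<in> I\<^sub>r S" "\<theta> \<noteq> 0"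
    have "coef S k (dot S (h a b c) \<theta>) = \<zeta> *s hmode S (h a b c) k \<theta> + (1/2) *s Pk k f \<theta>"
      using in_ode[OF \<theta>] by (simp add: vec_eq_iff field_simps)
    then show "(hmode S (h a b c) k has_vector_derivative
        \<zeta> *s hmode S (h a b c) k \<theta> + (1/2) *s Pk k f \<theta>) (at \<theta> within I\<^sub>r S)"
      using bounded_linear.has_vector_derivative[OF bounded_linear_coef h_deriv[OF idx \<theta>(1)], of k]
      unfolding hmode_def[abs_def] by simp
  qed
  have in_ode: "quad 0 ((2 * \<i> * \<omega>) *s hmode S (h 0 2 0) k \<theta>) ((- 2 * \<i> * \<omega>) *s hmode S (h 0 0 2) k \<theta>)
      ((\<i> * \<omega>) *s hmode S (h 1 1 0) k \<theta>) ((- \<i> * \<omega>) *s hmode S (h 1 0 1) k \<theta>) 0 z -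
      quad_of (\<lambda>a b c. coef S k (dot S (h a b c) \<theta>)) z =
      (1/2) *s (quad 0 0 0 0 0 0 z - quad (Pk k f200 \<theta>) (Pk k f020 \<theta>) (Pk k f002 \<theta>) (Pk k f110 \<theta>) (Pk k f101 \<theta>) (Pk k f011 \<theta>) z)"
    if \<theta>: "\<theta> \<in> I\<^sub>r S" "\<theta> \<noteq> 0" for \<theta> z
    using eq[OF \<theta>(1), of z] \<theta>(2) unfolding coef_hz_along_B coef_A1_hz[OF \<theta>(1)] coef_f22 F Pk_quad
    by (simp add: quad_def)
  have in_bc: "quad 0 ((2 * \<i> * \<omega>) *s hmode S (h 0 2 0) k 0) ((- 2 * \<i> * \<omega>) *s hmode S (h 0 0 2) k 0)
      ((\<i> * \<omega>) *s hmode S (h 1 1 0) k 0) ((- \<i> * \<omega>) *s hmode S (h 1 0 1) k 0) 0 z -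
      quad_of (\<lambda>a b c. BL k (hmode S (h a b c) k)) z =
      (1/2) *s (quad f200 f020 f002 f110 f101 f011 z - quad (Pk k f200 0) (Pk k f020 0) (Pk k f002 0) (Pk k f110 0) (Pk k f101 0) (Pk k f011 0) z)"
    for z
    using eq[OF zero_in_Ir, of z] unfolding coef_hz_along_B coef_A1_hz[OF zero_in_Ir] coef_f22 F Pk_quad
    by simp
  note o = quad_eqD[OF in_ode[unfolded quad_diff quad_smult]]
  note b = quad_eqD[OF in_bc[unfolded quad_diff quad_smult]]
  show "solves k 0 (Pk k f200) f200 (hmode S (h 2 0 0) k)"
    by (rule gen) (use o(1) b(1) in simp_all)
  show "solves k (2 * \<i> * \<omega>) (Pk k f020) f020 (hmode S (h 0 2 0) k)"
    by (rule gen[OF _ o(2) b(2)]) simp_all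
  show "solves k (- 2 * \<i> * \<omega>) (Pk k f002) f002 (hmode S (h 0 0 2) k)"
    by (rule gen[OF _ o(3) b(3)]) simp_all
  show "solves k (\<i> * \<omega>) (Pk k f110) f110 (hmode S (h 1 1 0) k)"
    by (rule gen[OF _ o(4) b(4)]) simp_all
  show "solves k (- \<i> * \<omega>) (Pk k f101) f101 (hmode S (h 1 0 1) k)"
    by (rule gen[OF _ o(5) b(5)]) simp_all
  show "solves k 0 (Pk k f011) f011 (hmode S (h 0 1 1) k)"
    by (rule gen) (use o(6) b(6) in simp_all)
qed

section \<open>The Fourier coefficients of h\<close>

abbreviation "h200 \<equiv> hmode S (h 2 0 0)"

abbreviation "h020 \<equiv> hmode S (h 0 2 0)"

abbreviation "h002 \<equiv> hmode S (h 0 0 2)"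

abbreviation "h110 \<equiv> hmode S (h 1 1 0)"

abbreviation "h101 \<equiv> hmode S (h 1 0 1)"

abbreviation "h011 \<equiv> hmode S (h 0 1 1)"

lemma QW_0: "coef S 0 (Qop S (W z) (W z)) = quad q11 q22 q33 0 0 (2 *s q23) z"
  using mode1 by (simp add: coef_QW quad_def vec_eq_iff power2_eq_square)

lemma QW_k1: "coef S k\<^sub>1 (Qop S (W z) (W z)) = quad 0 0 0 (2 *s q12) (2 *s q13) 0 z"
  using mode1 by (simp add: coef_QW quad_def vec_eq_iff)

lemma QW_2k1: "coef S (2 * k\<^sub>1) (Qop S (W z) (W z)) = quad (complex_of_real (1 / sqrt 2) *s q11) 0 0 0 0 0 z"
  using mode1 by (simp add: coef_QW quad_def vec_eq_iff power2_eq_square)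

lemmas h_solves_0 = h_solves[OF QW_0]
  and h_solves_k1 = h_solves[OF QW_k1]
  and h_solves_2k1 = h_solves[OF QW_2k1]

text \<open>In this and the following five lemmas the formula is a solution of the problem in \<open>h_solves\<close>,
  and the solution is unique. The fractions are \<open>1/(2(\<xi> - \<zeta>))\<close> for the eigenvalues \<open>\<xi>\<close> of the
  eigenfunctions on the mode.\<close>

lemma h200_0_eq:
  assumes "\<theta> \<in> I\<^sub>r S"
  shows "h200 0 \<theta> = - (1 / 2) *s (matrix_inv (N 0) *v q11) +
    (1 / (2 * \<i> * \<omega>)) *s ((outer (\<phi>\<^sub>2 \<theta>) \<psi>\<^sub>2 - outer (\<phi>\<^sub>3 \<theta>) \<psi>\<^sub>3) *v q11)"
proof -
  have "h200 0 \<theta> = exp_fun 0 \<theta> *s (- (1/2) *s (matrix_inv (N 0) *v q11)) +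
      ((\<psi>\<^sub>2 \<odot> q11) *s ((1 / (2 * \<i> * \<omega>)) *s \<phi>\<^sub>2 \<theta>) + (\<psi>\<^sub>3 \<odot> q11) *s (- (1 / (2 * \<i> * \<omega>)) *s \<phi>\<^sub>3 \<theta>))"
    by (rule solves_unique[OF h_solves_0(1) solves_mode0[OF M0_inverse[OF N_invertible[OF nonresonant(1)]]] nonresonant(1) assms])
      (simp_all add: field_simps)
  then show ?thesis
    by (simp add: exp_fun_def matrix_vector_mult_diff_rdistrib outer_mult vec_eq_iff algebra_simps)
qed

lemma h011_0_eq:
  assumes "\<theta> \<in> I\<^sub>r S"
  shows "h011 0 \<theta> = - (matrix_inv (N 0) *v q23) +
    (1 / (\<i> * \<omega>)) *s ((outer (\<phi>\<^sub>2 \<theta>) \<psi>\<^sub>2 - outer (\<phi>\<^sub>3 \<theta>) \<psi>\<^sub>3) *v q23)"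
proof -
  have "h011 0 \<theta> = exp_fun 0 \<theta> *s (- (1/2) *s (matrix_inv (N 0) *v (2 *s q23))) +
      ((\<psi>\<^sub>2 \<odot> (2 *s q23)) *s ((1 / (2 * \<i> * \<omega>)) *s \<phi>\<^sub>2 \<theta>) + (\<psi>\<^sub>3 \<odot> (2 *s q23)) *s (- (1 / (2 * \<i> * \<omega>)) *s \<phi>\<^sub>3 \<theta>))"
    by (rule solves_unique[OF h_solves_0(6) solves_mode0[OF M0_inverse[OF N_invertible[OF nonresonant(1)]]] nonresonant(1) assms])
      (simp_all add: field_simps)
  then show ?thesis
    by (simp add: exp_fun_def matrix_vector_mult_diff_rdistrib outer_mult vec_eq_iff algebra_simps
        vector_scalar_commute rdot_smult)
qed

lemma h020_0_eq:
  assumes "\<theta> \<in> I\<^sub>r S"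
  shows "h020 0 \<theta> = (1 / 2 * exp_fun (2 * \<i> * \<omega>) \<theta>) *s (matrix_inv (M 0 (2 * \<i> * \<omega>)) *v q22) -
    (1 / (2 * \<i> * \<omega>)) *s ((outer (\<phi>\<^sub>2 \<theta>) \<psi>\<^sub>2 + (1 / 3) *\<^sub>R outer (\<phi>\<^sub>3 \<theta>) \<psi>\<^sub>3) *v q22)"
proof -
  have "h020 0 \<theta> = exp_fun (2 * \<i> * \<omega>) \<theta> *s ((1/2) *s (matrix_inv (M 0 (2 * \<i> * \<omega>)) *v q22)) +
      ((\<psi>\<^sub>2 \<odot> q22) *s (- (1 / (2 * \<i> * \<omega>)) *s \<phi>\<^sub>2 \<theta>) + (\<psi>\<^sub>3 \<odot> q22) *s (- (1 / (6 * \<i> * \<omega>)) *s \<phi>\<^sub>3 \<theta>))"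
    by (rule solves_unique[OF h_solves_0(2) solves_mode0[OF M_inverse[OF nonresonant(3)]] nonresonant(3) assms])
      (simp_all add: field_simps)
  moreover have third: "((1 / 3) *\<^sub>R outer (\<phi>\<^sub>3 \<theta>) \<psi>\<^sub>3) *v q22 = (1/3) *s ((\<psi>\<^sub>3 \<odot> q22) *s \<phi>\<^sub>3 \<theta>)"
    unfolding scaleR_outer outer_mult by (simp add: vec_eq_iff)
  ultimately show ?thesis
    unfolding matrix_vector_mult_add_rdistrib outer_mult third by (simp add: vec_eq_iff field_simps)
qed

lemma h110_k1_eq:
  assumes "\<theta> \<in> I\<^sub>r S"
  shows "h110 k\<^sub>1 \<theta> = exp_fun (\<i> * \<omega>) \<theta> *s (matrix_inv (M k\<^sub>1 (\<i> * \<omega>)) *v q12) -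
    (1 / (\<i> * \<omega>)) *s (outer (\<phi>\<^sub>1 0) \<psi>\<^sub>1 *v q12)"
proof -
  have "h110 k\<^sub>1 \<theta> = exp_fun (\<i> * \<omega>) \<theta> *s ((1/2) *s (matrix_inv (M k\<^sub>1 (\<i> * \<omega>)) *v (2 *s q12))) +
      (\<psi>\<^sub>1 \<odot> (2 *s q12)) *s (- (1 / (2 * \<i> * \<omega>)) *s \<phi>\<^sub>1 \<theta>)"
    by (rule solves_unique[OF h_solves_k1(4) solves_mode1[OF M_inverse[OF nonresonant(5)]] nonresonant(5) assms])
      (simp_all add: field_simps)
  then show ?thesis
    by (simp add: outer_mult vec_eq_iff field_simps vector_scalar_commute rdot_smult phi1_def)
qed

lemma h200_2k1_eq:
  assumes "\<theta> \<in> I\<^sub>r S"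
  shows "h200 (2 * k\<^sub>1) \<theta> = - complex_of_real (1 / (2 * sqrt 2)) *s (matrix_inv (N (2 * k\<^sub>1)) *v q11)"
proof -
  have "h200 (2 * k\<^sub>1) \<theta> = exp_fun 0 \<theta> *s (- (1/2) *s (matrix_inv (N (2 * k\<^sub>1)) *v (complex_of_real (1 / sqrt 2) *s q11)))"
    using mode1 by (intro solves_unique[OF h_solves_2k1(1) solves_other_mode[OF M0_inverse[OF N_invertible[OF nonresonant(2)]]] nonresonant(2) assms])
      simp_all
  then show ?thesis
    by (simp add: vector_scalar_commute exp_fun_def vec_eq_iff)
qed

lemma h011_2k1_eq:
  assumes "\<theta> \<in> I\<^sub>r S"
  shows "h011 (2 * k\<^sub>1) \<theta> = 0"
proof -
  have "h011 (2 * k\<^sub>1) \<theta> = exp_fun 0 \<theta> *s 0"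
    using mode1 by (intro solves_unique[OF h_solves_2k1(6) solves_other_mode nonresonant(2) assms])
      simp_all
  then show ?thesis by simp
qed

text \<open>Conjugation carries the problem for one coefficient to that for the other (for \<open>h\<^sub>2\<^sub>0\<^sub>0\<close> and \<open>h\<^sub>0\<^sub>1\<^sub>1\<close>, to
  itself), so uniqueness applies again.\<close>

lemma h_cnj:
  assumes "\<theta> \<in> I\<^sub>r S"
  shows "h002 0 \<theta> = cnjv (h020 0 \<theta>)" "h101 k\<^sub>1 \<theta> = cnjv (h110 k\<^sub>1 \<theta>)"
    "h200 0 \<theta> = cnjv (h200 0 \<theta>)" "h011 0 \<theta> = cnjv (h011 0 \<theta>)"
proof -
  have "solves 0 (- 2 * \<i> * \<omega>) (Pk 0 q33) q33 (\<lambda>\<theta>. cnjv (h020 0 \<theta>))"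
    using solves_cnj[OF h_solves_0(2)] by (simp add: Pk_cnj Qh_cnj_phi)
  from solves_unique[OF h_solves_0(3) this nonresonant(4) assms]
  show "h002 0 \<theta> = cnjv (h020 0 \<theta>)" .
  have "solves k\<^sub>1 (- \<i> * \<omega>) (Pk k\<^sub>1 (2 *s q13)) (2 *s q13) (\<lambda>\<theta>. cnjv (h110 k\<^sub>1 \<theta>))"
    using solves_cnj[OF h_solves_k1(4)] by (simp add: Pk_cnj Qh_cnj_phi cnjv_smult)
  from solves_unique[OF h_solves_k1(5) this nonresonant(6) assms]
  show "h101 k\<^sub>1 \<theta> = cnjv (h110 k\<^sub>1 \<theta>)" .
  have "solves 0 0 (Pk 0 q11) q11 (\<lambda>\<theta>. cnjv (h200 0 \<theta>))"
    using solves_cnj[OF h_solves_0(1)] by (simp add: Pk_cnj Qh_cnj_phi)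
  from solves_unique[OF h_solves_0(1) this nonresonant(1) assms]
  show "h200 0 \<theta> = cnjv (h200 0 \<theta>)" .
  have "solves 0 0 (Pk 0 (2 *s q23)) (2 *s q23) (\<lambda>\<theta>. cnjv (h011 0 \<theta>))"
    using solves_cnj[OF h_solves_0(6)] by (simp add: Pk_cnj Qh_cnj_phi cnjv_smult)
  from solves_unique[OF h_solves_0(6) this nonresonant(1) assms]
  show "h011 0 \<theta> = cnjv (h011 0 \<theta>)" .
qed

lemma Qh_h_cnj:
  "cnjv (Qh S \<phi>\<^sub>1 (h110 k\<^sub>1)) = Qh S \<phi>\<^sub>1 (h101 k\<^sub>1)" "cnjv (Qh S \<phi>\<^sub>2 (h200 0)) = Qh S \<phi>\<^sub>3 (h200 0)"
  "cnjv (Qh S \<phi>\<^sub>2 (h011 0)) = Qh S \<phi>\<^sub>3 (h011 0)" "cnjv (Qh S \<phi>\<^sub>3 (h020 0)) = Qh S \<phi>\<^sub>2 (h002 0)"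
proof -
  have *: "cnjv (Qh S \<phi> v) = Qh S (\<lambda>\<theta>. cnjv (\<phi> \<theta>)) w" if "cont \<phi>" "cont v" "\<And>\<theta>. \<theta> \<in> I\<^sub>r S \<Longrightarrow> w \<theta> = cnjv (v \<theta>)" for \<phi> v w
    using Qh_cnj[OF that(1,2)] Qh_cong_right[OF that(3), where \<rho>="\<lambda>\<theta>. cnjv (\<phi> \<theta>)"] by simp
  show "cnjv (Qh S \<phi>\<^sub>1 (h110 k\<^sub>1)) = Qh S \<phi>\<^sub>1 (h101 k\<^sub>1)"
    using *[OF cont_phi(1) cont_hmode h_cnj(2)] by simp
  show "cnjv (Qh S \<phi>\<^sub>2 (h200 0)) = Qh S \<phi>\<^sub>3 (h200 0)"
    using *[OF cont_phi(2) cont_hmode h_cnj(3)] by simp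
  show "cnjv (Qh S \<phi>\<^sub>2 (h011 0)) = Qh S \<phi>\<^sub>3 (h011 0)"
    using *[OF cont_phi(2) cont_hmode h_cnj(4)] by simp
  show "cnjv (Qh S \<phi>\<^sub>3 (h020 0)) = Qh S \<phi>\<^sub>2 (h002 0)"
    using *[OF cont_phi(3) cont_hmode h_cnj(1)] by simp
qed

section \<open>The cubic part of the normal form\<close>

interpretation Q: bounded_bilinear "Qop S" by (rule Q_bilinear)

text \<open>\<open>f\<^sub>2\<^sup>1(z,y,0)\<close> is the quadratic form of \<open>Q\<close> at \<open>w(z) + y\<close>, and its derivative in the direction
  \<open>(U, 2h)\<close> is \<open>2 Q(w, w(U) + 2h)\<close>.\<close>

lemma Df21_eq:
  "Df21_U S U h z = 2 *\<^sub>R modes S (Qop S (W z) (W (U z))) + 4 *\<^sub>R modes S (Qop S (W z) (hist S (hz S h z)))"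
proof -
  define H where "H = W (U z) + 2 *\<^sub>R hist S (hz S h z)"
  have c: "cont (\<lambda>\<theta>. wz S (U z) \<theta> + 2 *\<^sub>R hz S h z \<theta>)"
    by (intro continuous_on_add continuous_on_scaleR continuous_on_const cont_wz cont_hz)
  have H: "hist S (\<lambda>\<theta>. wz S (U z) \<theta> + 2 *\<^sub>R hz S h z \<theta>) = H"
    unfolding H_def W_def
    by (simp add: hist_add hist_scaleR cont_wz cont_hz continuous_on_scaleR continuous_on_const)
  have V: "hist S (\<lambda>\<theta>. wz S (z + t *\<^sub>R U z) \<theta> + t *\<^sub>R (2 *\<^sub>R hz S h z \<theta>)) = W z + t *\<^sub>R H" for t
  proof -
    have "(\<lambda>\<theta>. wz S (z + t *\<^sub>R U z) \<theta> + t *\<^sub>R (2 *\<^sub>R hz S h z \<theta>)) =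
        (\<lambda>\<theta>. wz S z \<theta> + t *\<^sub>R (wz S (U z) \<theta> + 2 *\<^sub>R hz S h z \<theta>))"
      by (simp add: wz_add scaleR_add_right add.assoc)
    then show ?thesis
      using hist_add[OF cont_wz[of z] continuous_on_scaleR[OF continuous_on_const c], of t] hist_scaleR[OF c, of t]
      by (simp add: H W_def)
  qed
  have f: "f21 S (z + t *\<^sub>R U z) (\<lambda>\<theta>. t *\<^sub>R (2 *\<^sub>R hz S h z \<theta>)) 0 = modes S (Qop S (W z + t *\<^sub>R H) (W z + t *\<^sub>R H))" for t
    unfolding f21_def F2_0 V ..
  have "((\<lambda>t. W z + t *\<^sub>R H) has_vector_derivative H) (at 0)"
    by (auto intro!: derivative_eq_intros)
  from Q.has_vector_derivative[OF this this]
  have "((\<lambda>t. Qop S (W z + t *\<^sub>R H) (W z + t *\<^sub>R H)) has_vector_derivative Qop S (W z) H + Qop S H (W z)) (at 0)"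
    by simp
  from bounded_linear.has_vector_derivative[OF bounded_linear_modes this]
  have "Df21_U S U h z = modes S (Qop S (W z) H + Qop S H (W z))"
    unfolding Df21_U_def f by (rule vector_derivative_at)
  also have "Qop S (W z) H + Qop S H (W z) = 2 *\<^sub>R Qop S (W z) H"
    unfolding Q_commute[of H] by (simp add: scaleR_2)
  also have "\<dots> = 2 *\<^sub>R Qop S (W z) (W (U z)) + 4 *\<^sub>R Qop S (W z) (hist S (hz S h z))"
    unfolding H_def Q.add_right Q.scaleR_right scaleR_add_right by simp
  finally show ?thesis
    using bounded_linear.linear[OF bounded_linear_modes] by (simp add: linear_add linear_cmul)
qed

abbreviation "rt \<equiv> complex_of_real (1 / sqrt 2)"

lemma Qh_quad:
  assumes "cont a" "cont b" "cont c" "cont d" "cont e" "cont f"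
  shows "Qh S \<rho> (\<lambda>\<theta>. quad (a \<theta>) (b \<theta>) (c \<theta>) (d \<theta>) (e \<theta>) (f \<theta>) z) =
    quad (Qh S \<rho> a) (Qh S \<rho> b) (Qh S \<rho> c) (Qh S \<rho> d) (Qh S \<rho> e) (Qh S \<rho> f) z"
  unfolding quad_def
  by (simp only: Qh_add_right Qh_smult_right assms continuous_on_add continuous_smult_const)

text \<open>The combination \<open>h\<^sub>q\<^sup>0 + h\<^sub>q\<^sup>2\<^sup>k/\<surd>2\<close>, which is the mean of \<open>h\<^sub>q\<close> against \<open>\<beta>\<^sub>k\<^sup>2\<close> for \<open>k = k\<^sub>1\<close>.\<close>

definition hc :: "nat \<Rightarrow> nat \<Rightarrow> nat \<Rightarrow> real \<Rightarrow> complex^'m" where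
  "hc a b c \<theta> = hmode S (h a b c) 0 \<theta> + rt *s hmode S (h a b c) (2 * k\<^sub>1) \<theta>"

lemma cont_hc: "(a, b, c) \<in> idx \<Longrightarrow> cont (hc a b c)"
  unfolding hc_def[abs_def] by (intro continuous_on_add continuous_smult_const cont_hmode)

lemma cont_hmodes: "cont (hmode S (h 2 0 0) k)" "cont (hmode S (h 0 2 0) k)" "cont (hmode S (h 0 0 2) k)"
    "cont (hmode S (h 1 1 0) k)" "cont (hmode S (h 1 0 1) k)" "cont (hmode S (h 0 1 1) k)"
  by (rule cont_hmode; simp)+

lemma cont_hcs: "cont (hc 2 0 0)" "cont (hc 0 2 0)" "cont (hc 0 0 2)" "cont (hc 1 1 0)" "cont (hc 1 0 1)" "cont (hc 0 1 1)"
  by (rule cont_hc; simp)+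

lemma coef_QW_h_0:
  "coef S 0 (Qop S (W z) (hist S (hz S h z))) =
    z $ 1 *s quad_of (\<lambda>a b c. Qh S \<phi>\<^sub>1 (hmode S (h a b c) k\<^sub>1)) z +
    z $ 2 *s quad_of (\<lambda>a b c. Qh S \<phi>\<^sub>2 (hmode S (h a b c) 0)) z +
    z $ 3 *s quad_of (\<lambda>a b c. Qh S \<phi>\<^sub>3 (hmode S (h a b c) 0)) z"
  unfolding coef_Q_hist[OF cont_hz] unfolding coef_hz Qh_quad[OF cont_hmodes] ..

lemma coef_QW_h_k1:
  "coef S k\<^sub>1 (Qop S (W z) (hist S (hz S h z))) =
    z $ 1 *s quad_of (\<lambda>a b c. Qh S \<phi>\<^sub>1 (hc a b c)) z +
    z $ 2 *s quad_of (\<lambda>a b c. Qh S \<phi>\<^sub>2 (hmode S (h a b c) k\<^sub>1)) z +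
    z $ 3 *s quad_of (\<lambda>a b c. Qh S \<phi>\<^sub>3 (hmode S (h a b c) k\<^sub>1)) z"
proof -
  have comb: "coef S 0 (hz S h z \<theta>) + rt *s coef S (2 * k\<^sub>1) (hz S h z \<theta>) = quad_of (\<lambda>a b c. hc a b c \<theta>) z" for \<theta>
    unfolding coef_hz quad_smult quad_add hc_def ..
  show ?thesis
    unfolding coef_Q_hist[OF cont_hz] comb unfolding coef_hz Qh_quad[OF cont_hmodes] Qh_quad[OF cont_hcs] ..
qed

text \<open>The term \<open>D\<^sub>z U g\<^sub>2\<^sup>1(z,0,0)\<close> vanishes with \<open>g\<^sub>2\<^sup>1(z,0,0)\<close>, and the factor 3/2 turns the \<open>2\<close> and \<open>4\<close> of
  \<open>Df21_eq\<close> into 3 and 6.\<close>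

lemma cubic_terms:
  fixes U :: "complex^3 \<Rightarrow> complex^3"
  assumes "U = quad u200 u020 u002 u110 u101 u011"
  shows "f31 S z + (3 / 2) *\<^sub>R (Df21_U S U h z - frechet_derivative U (at z) (g21 S z 0)) =
    modes S (Cop S (W z) (W z) (W z)) + 3 *s modes S (Qop S (W z) (W (U z))) +
    6 *s modes S (Qop S (W z) (hist S (hz S h z)))"
proof -
  have "frechet_derivative U (at z) 0 = 0"
    unfolding assms(1) frechet_derivative_at[OF quad_has_derivative, symmetric] by simp
  then show ?thesis
    unfolding g21_0 Df21_eq f31_def F3_def W_def smult_scaleR by (simp add: vec_eq_iff)
qed

text \<open>The terms of \<open>3 Q(w, w(U))\<close> that contain component \<open>j\<close> of \<open>U\<close> multiplied by a given component of \<open>z\<close>;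
  \<open>a, \<dots>, f\<close> are the coefficients of \<open>U\<close>.\<close>

definition ucub :: "nat \<Rightarrow> nat \<Rightarrow> nat \<Rightarrow> complex \<Rightarrow> 3 \<Rightarrow> complex^3 \<Rightarrow> complex^3 \<Rightarrow> complex^3 \<Rightarrow> complex^3 \<Rightarrow> complex^3 \<Rightarrow> complex^3 \<Rightarrow>
    (expo \<times> complex) list" where
  "ucub x y w s j a b c d e f = cub x y w (3 * s) (a $ j) (b $ j) (c $ j) (d $ j) (e $ j) (f $ j)"

text \<open>The terms of \<open>6 Q(w,h)\<close> in which the part of \<open>w\<close> along \<open>\<phi>\<close> meets the Fourier coefficients \<open>g\<close> of \<open>h\<close>.\<close>

definition hcub :: "nat \<Rightarrow> nat \<Rightarrow> nat \<Rightarrow> complex^'m \<Rightarrow> (real \<Rightarrow> complex^'m) \<Rightarrow>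
    (nat \<Rightarrow> nat \<Rightarrow> nat \<Rightarrow> real \<Rightarrow> complex^'m) \<Rightarrow> (expo \<times> complex) list" where
  "hcub x y w \<psi> \<phi> g = cub x y w 6 (\<psi> \<odot> Qh S \<phi> (g 2 0 0)) (\<psi> \<odot> Qh S \<phi> (g 0 2 0)) (\<psi> \<odot> Qh S \<phi> (g 0 0 2))
     (\<psi> \<odot> Qh S \<phi> (g 1 1 0)) (\<psi> \<odot> Qh S \<phi> (g 1 0 1)) (\<psi> \<odot> Qh S \<phi> (g 0 1 1))"

text \<open>All cubic monomials of the first equation; \<open>list2 \<psi>\<close> has those of the second and third equation, for
  \<open>\<psi> = \<psi>\<^sub>2\<close> and \<open>\<psi> = \<psi>\<^sub>3\<close>.\<close>

definition list1 where
  "list1 u200 u020 u002 u110 u101 u011 =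
    [((3,0,0,0,0), (3/2) * (\<psi>\<^sub>1 \<odot> Ch S \<phi>\<^sub>1 \<phi>\<^sub>1 \<phi>\<^sub>1)), ((1,2,0,0,0), 3 * (\<psi>\<^sub>1 \<odot> Ch S \<phi>\<^sub>1 \<phi>\<^sub>2 \<phi>\<^sub>2)),
     ((1,1,1,0,0), 6 * (\<psi>\<^sub>1 \<odot> Ch S \<phi>\<^sub>1 \<phi>\<^sub>2 \<phi>\<^sub>3)), ((1,0,2,0,0), 3 * (\<psi>\<^sub>1 \<odot> Ch S \<phi>\<^sub>1 \<phi>\<^sub>3 \<phi>\<^sub>3))] @
    ucub 1 0 0 (\<psi>\<^sub>1 \<odot> q12) 2 u200 u020 u002 u110 u101 u011 @ ucub 0 1 0 (\<psi>\<^sub>1 \<odot> q12) 1 u200 u020 u002 u110 u101 u011 @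
    ucub 1 0 0 (\<psi>\<^sub>1 \<odot> q13) 3 u200 u020 u002 u110 u101 u011 @ ucub 0 0 1 (\<psi>\<^sub>1 \<odot> q13) 1 u200 u020 u002 u110 u101 u011 @
    hcub 1 0 0 \<psi>\<^sub>1 \<phi>\<^sub>1 hc @ hcub 0 1 0 \<psi>\<^sub>1 \<phi>\<^sub>2 (\<lambda>a b c. hmode S (h a b c) k\<^sub>1) @ hcub 0 0 1 \<psi>\<^sub>1 \<phi>\<^sub>3 (\<lambda>a b c. hmode S (h a b c) k\<^sub>1)"

definition list2 where
  "list2 \<psi> u200 u020 u002 u110 u101 u011 =
    [((2,1,0,0,0), 3 * (\<psi> \<odot> Ch S \<phi>\<^sub>1 \<phi>\<^sub>1 \<phi>\<^sub>2)), ((2,0,1,0,0), 3 * (\<psi> \<odot> Ch S \<phi>\<^sub>1 \<phi>\<^sub>1 \<phi>\<^sub>3)),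
     ((0,3,0,0,0), \<psi> \<odot> Ch S \<phi>\<^sub>2 \<phi>\<^sub>2 \<phi>\<^sub>2), ((0,2,1,0,0), 3 * (\<psi> \<odot> Ch S \<phi>\<^sub>2 \<phi>\<^sub>2 \<phi>\<^sub>3)),
     ((0,1,2,0,0), 3 * (\<psi> \<odot> Ch S \<phi>\<^sub>2 \<phi>\<^sub>3 \<phi>\<^sub>3)), ((0,0,3,0,0), \<psi> \<odot> Ch S \<phi>\<^sub>3 \<phi>\<^sub>3 \<phi>\<^sub>3)] @
    ucub 1 0 0 (\<psi> \<odot> q11) 1 u200 u020 u002 u110 u101 u011 @ ucub 0 1 0 (\<psi> \<odot> q22) 2 u200 u020 u002 u110 u101 u011 @
    ucub 0 1 0 (\<psi> \<odot> q23) 3 u200 u020 u002 u110 u101 u011 @ ucub 0 0 1 (\<psi> \<odot> q23) 2 u200 u020 u002 u110 u101 u011 @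
    ucub 0 0 1 (\<psi> \<odot> q33) 3 u200 u020 u002 u110 u101 u011 @
    hcub 1 0 0 \<psi> \<phi>\<^sub>1 (\<lambda>a b c. hmode S (h a b c) k\<^sub>1) @ hcub 0 1 0 \<psi> \<phi>\<^sub>2 (\<lambda>a b c. hmode S (h a b c) 0) @
    hcub 0 0 1 \<psi> \<phi>\<^sub>3 (\<lambda>a b c. hmode S (h a b c) 0)"

lemma meval_list1:
  assumes U: "U = quad u200 u020 u002 u110 u101 u011"
  shows "(\<psi>\<^sub>1 \<odot> coef S k\<^sub>1 (Cop S (W z) (W z) (W z))) +
      3 * (\<psi>\<^sub>1 \<odot> coef S k\<^sub>1 (Qop S (W z) (W (U z)))) + 6 * (\<psi>\<^sub>1 \<odot> coef S k\<^sub>1 (Qop S (W z) (hist S (hz S h z)))) =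
    meval (list1 u200 u020 u002 u110 u101 u011) z \<alpha>"
proof -
  have 1: "\<psi>\<^sub>1 \<odot> coef S k\<^sub>1 (Cop S (W z) (W z) (W z)) = (3/2) * (\<psi>\<^sub>1 \<odot> Ch S \<phi>\<^sub>1 \<phi>\<^sub>1 \<phi>\<^sub>1) * z $ 1 ^ 3 +
      3 * (\<psi>\<^sub>1 \<odot> Ch S \<phi>\<^sub>1 \<phi>\<^sub>2 \<phi>\<^sub>2) * z $ 1 * z $ 2 ^ 2 + 6 * (\<psi>\<^sub>1 \<odot> Ch S \<phi>\<^sub>1 \<phi>\<^sub>2 \<phi>\<^sub>3) * z $ 1 * z $ 2 * z $ 3 +
      3 * (\<psi>\<^sub>1 \<odot> Ch S \<phi>\<^sub>1 \<phi>\<^sub>3 \<phi>\<^sub>3) * z $ 1 * z $ 3 ^ 2"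
    using mode1 unfolding coef_CW by (simp add: rdot_add rdot_smult algebra_simps)
  have 2: "\<psi>\<^sub>1 \<odot> coef S k\<^sub>1 (Qop S (W z) (W (U z))) = (z $ 1 * U z $ 2 + z $ 2 * U z $ 1) * (\<psi>\<^sub>1 \<odot> q12) +
      (z $ 1 * U z $ 3 + z $ 3 * U z $ 1) * (\<psi>\<^sub>1 \<odot> q13)"
    using mode1 unfolding coef_QW by (simp add: rdot_add rdot_smult distrib_right)
  show ?thesis
    unfolding 1 2 coef_QW_h_k1 rdot_add rdot_smult rdot_quad list1_def ucub_def hcub_def meval_simps meval_cub
    by (simp add: U quad_nth monom_fn_def algebra_simps)
qed

lemma meval_list2:
  assumes U: "U = quad u200 u020 u002 u110 u101 u011"
  shows "(\<psi> \<odot> coef S 0 (Cop S (W z) (W z) (W z))) +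
      3 * (\<psi> \<odot> coef S 0 (Qop S (W z) (W (U z)))) + 6 * (\<psi> \<odot> coef S 0 (Qop S (W z) (hist S (hz S h z)))) =
    meval (list2 \<psi> u200 u020 u002 u110 u101 u011) z \<alpha>"
proof -
  have 1: "\<psi> \<odot> coef S 0 (Cop S (W z) (W z) (W z)) = 3 * (\<psi> \<odot> Ch S \<phi>\<^sub>1 \<phi>\<^sub>1 \<phi>\<^sub>2) * z $ 1 ^ 2 * z $ 2 +
      3 * (\<psi> \<odot> Ch S \<phi>\<^sub>1 \<phi>\<^sub>1 \<phi>\<^sub>3) * z $ 1 ^ 2 * z $ 3 + (\<psi> \<odot> Ch S \<phi>\<^sub>2 \<phi>\<^sub>2 \<phi>\<^sub>2) * z $ 2 ^ 3 +
      3 * (\<psi> \<odot> Ch S \<phi>\<^sub>2 \<phi>\<^sub>2 \<phi>\<^sub>3) * z $ 2 ^ 2 * z $ 3 + 3 * (\<psi> \<odot> Ch S \<phi>\<^sub>2 \<phi>\<^sub>3 \<phi>\<^sub>3) * z $ 2 * z $ 3 ^ 2 +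
      (\<psi> \<odot> Ch S \<phi>\<^sub>3 \<phi>\<^sub>3 \<phi>\<^sub>3) * z $ 3 ^ 3"
    using mode1 unfolding coef_CW by (simp add: rdot_add rdot_smult algebra_simps)
  have 2: "\<psi> \<odot> coef S 0 (Qop S (W z) (W (U z))) = z $ 1 * U z $ 1 * (\<psi> \<odot> q11) + z $ 2 * U z $ 2 * (\<psi> \<odot> q22) +
      (z $ 2 * U z $ 3 + z $ 3 * U z $ 2) * (\<psi> \<odot> q23) + z $ 3 * U z $ 3 * (\<psi> \<odot> q33)"
    using mode1 unfolding coef_QW by (simp add: rdot_add rdot_smult distrib_right)
  show ?thesis
    unfolding 1 2 coef_QW_h_0 rdot_add rdot_smult rdot_quad list2_def ucub_def hcub_def meval_simps meval_cub
    by (simp add: U quad_nth monom_fn_def algebra_simps)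
qed

lemma list1_expos: "fst ` set (list1 u200 u020 u002 u110 u101 u011) \<subseteq> expos 3"
  by (auto simp: list1_def ucub_def hcub_def cub_def expos_def)

lemma list2_expos: "fst ` set (list2 \<psi> u200 u020 u002 u110 u101 u011) \<subseteq> expos 3"
  by (auto simp: list2_def ucub_def hcub_def cub_def expos_def)

definition C111 where
  "C111 = (1 / 4) * (\<psi>\<^sub>1 \<odot> Ch S \<phi>\<^sub>1 \<phi>\<^sub>1 \<phi>\<^sub>1)
            + (1 / \<omega>) * (\<psi>\<^sub>1 \<odot> (Re_mat (outer (\<i> *s q12) \<psi>\<^sub>2) *v q11))
            + (\<psi>\<^sub>1 \<odot> Qh S \<phi>\<^sub>1 (\<lambda>\<theta>. h200 0 \<theta> + rt *s h200 (2 * k\<^sub>1) \<theta>))"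

definition C123 where
  "C123 = (\<psi>\<^sub>1 \<odot> Ch S \<phi>\<^sub>1 \<phi>\<^sub>2 \<phi>\<^sub>3)
            + (2 / \<omega>) * (\<psi>\<^sub>1 \<odot> (Re_mat (outer (\<i> *s q12) \<psi>\<^sub>2) *v q23))
            + (\<psi>\<^sub>1 \<odot> (Qh S \<phi>\<^sub>1 (\<lambda>\<theta>. h011 0 \<theta> + rt *s h011 (2 * k\<^sub>1) \<theta>)
                      + Qh S \<phi>\<^sub>2 (h101 k\<^sub>1) + Qh S \<phi>\<^sub>3 (h110 k\<^sub>1)))"

definition C112 where
  "C112 = (1 / 2) * (\<psi>\<^sub>2 \<odot> Ch S \<phi>\<^sub>1 \<phi>\<^sub>1 \<phi>\<^sub>2)
            + (1 / (2 * \<i> * \<omega>)) * (\<psi>\<^sub>2 \<odot> (2 *s (outer q11 \<psi>\<^sub>1 *v q12)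
                + (- outer q22 \<psi>\<^sub>2 + outer q23 \<psi>\<^sub>3) *v q11))
            + (\<psi>\<^sub>2 \<odot> (Qh S \<phi>\<^sub>1 (h110 k\<^sub>1) + Qh S \<phi>\<^sub>2 (h200 0)))"

definition C223 where
  "C223 = (1 / 2) * (\<psi>\<^sub>2 \<odot> Ch S \<phi>\<^sub>2 \<phi>\<^sub>2 \<phi>\<^sub>3)
            + (1 / (4 * \<i> * \<omega>)) * (\<psi>\<^sub>2 \<odot> ((2 / 3) *s (outer q33 \<psi>\<^sub>3 *v q22)
                + ((- 2) *\<^sub>R outer q22 \<psi>\<^sub>2 + 4 *\<^sub>R outer q23 \<psi>\<^sub>3) *v q23))
            + (\<psi>\<^sub>2 \<odot> (Qh S \<phi>\<^sub>2 (h011 0) + Qh S \<phi>\<^sub>3 (h020 0)))"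

text \<open>The real part of the matrix is half the sum of it and its conjugate; this is how the two
  contributions of \<open>U\<close>, from \<open>u\<^sub>2\<close> and \<open>u\<^sub>3\<close>, appear as one term in the formulas.\<close>

lemma Re_mat_q: "\<psi>\<^sub>1 \<odot> (Re_mat (outer (\<i> *s q12) \<psi>\<^sub>2) *v x) =
    (\<i> / 2) * ((\<psi>\<^sub>2 \<odot> x) * (\<psi>\<^sub>1 \<odot> q12) - (\<psi>\<^sub>3 \<odot> x) * (\<psi>\<^sub>1 \<odot> q13))"
  unfolding Re_mat_mult cnj_outer outer_mult cnjv_smult Qh_cnj_phi cnj_psi rdot_smult rdot_add
  by (simp add: algebra_simps)

lemma C112_eq: "C112 = (1 / 2) * (\<psi>\<^sub>2 \<odot> Ch S \<phi>\<^sub>1 \<phi>\<^sub>1 \<phi>\<^sub>2)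
    + (1 / (2 * \<i> * \<omega>)) * (2 * (\<psi>\<^sub>1 \<odot> q12) * (\<psi>\<^sub>2 \<odot> q11) - (\<psi>\<^sub>2 \<odot> q11) * (\<psi>\<^sub>2 \<odot> q22) + (\<psi>\<^sub>3 \<odot> q11) * (\<psi>\<^sub>2 \<odot> q23))
    + (\<psi>\<^sub>2 \<odot> Qh S \<phi>\<^sub>1 (h110 k\<^sub>1)) + (\<psi>\<^sub>2 \<odot> Qh S \<phi>\<^sub>2 (h200 0))"
  unfolding C112_def minus_outer matrix_vector_mult_add_rdistrib outer_mult rdot_add rdot_smult rdot_minus
  by (simp add: algebra_simps)

lemma C223_eq: "C223 = (1 / 2) * (\<psi>\<^sub>2 \<odot> Ch S \<phi>\<^sub>2 \<phi>\<^sub>2 \<phi>\<^sub>3)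
    + (1 / (4 * \<i> * \<omega>)) * ((2 / 3) * (\<psi>\<^sub>3 \<odot> q22) * (\<psi>\<^sub>2 \<odot> q33) - 2 * (\<psi>\<^sub>2 \<odot> q23) * (\<psi>\<^sub>2 \<odot> q22) + 4 * (\<psi>\<^sub>3 \<odot> q23) * (\<psi>\<^sub>2 \<odot> q23))
    + (\<psi>\<^sub>2 \<odot> Qh S \<phi>\<^sub>2 (h011 0)) + (\<psi>\<^sub>2 \<odot> Qh S \<phi>\<^sub>3 (h020 0))"
  unfolding C223_def scaleR_outer matrix_vector_mult_add_rdistrib outer_mult rdot_add rdot_smult
  by (simp add: algebra_simps)

lemma Ch_cnj_phi: "cnjv (Ch S \<phi>\<^sub>1 \<phi>\<^sub>1 \<phi>\<^sub>2) = Ch S \<phi>\<^sub>1 \<phi>\<^sub>1 \<phi>\<^sub>3" "cnjv (Ch S \<phi>\<^sub>2 \<phi>\<^sub>2 \<phi>\<^sub>3) = Ch S \<phi>\<^sub>2 \<phi>\<^sub>3 \<phi>\<^sub>3"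
proof -
  show "cnjv (Ch S \<phi>\<^sub>1 \<phi>\<^sub>1 \<phi>\<^sub>2) = Ch S \<phi>\<^sub>1 \<phi>\<^sub>1 \<phi>\<^sub>3" using Ch_cnj[of \<phi>\<^sub>1 \<phi>\<^sub>1 \<phi>\<^sub>2] by simp
  have "cnjv (Ch S \<phi>\<^sub>2 \<phi>\<^sub>2 \<phi>\<^sub>3) = Ch S \<phi>\<^sub>3 \<phi>\<^sub>3 \<phi>\<^sub>2" using Ch_cnj[of \<phi>\<^sub>2 \<phi>\<^sub>2 \<phi>\<^sub>3] by simp
  also have "\<dots> = Ch S \<phi>\<^sub>3 \<phi>\<^sub>2 \<phi>\<^sub>3" by (rule Ch_commute(2))
  also have "\<dots> = Ch S \<phi>\<^sub>2 \<phi>\<^sub>3 \<phi>\<^sub>3" by (rule Ch_commute(1))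
  finally show "cnjv (Ch S \<phi>\<^sub>2 \<phi>\<^sub>2 \<phi>\<^sub>3) = Ch S \<phi>\<^sub>2 \<phi>\<^sub>3 \<phi>\<^sub>3" .
qed

lemma cnj_rdot_psi: "cnj (\<psi>\<^sub>1 \<odot> v) = \<psi>\<^sub>1 \<odot> cnjv v" "cnj (\<psi>\<^sub>2 \<odot> v) = \<psi>\<^sub>3 \<odot> cnjv v" "cnj (\<psi>\<^sub>3 \<odot> v) = \<psi>\<^sub>2 \<odot> cnjv v"
  by (simp_all flip: rdot_cnj)

text \<open>The list of all cubic monomials is projected by looking up the resonant exponents. In the third
  component the coefficients are those of the second with all data conjugated, by the reality of \<open>Q\<close>
  and \<open>C\<close> and the symmetry of \<open>h\<close>.\<close>

lemma g31_nth:
  assumes "is_U21 S U"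
  shows "g31 S U h z $ 1 = 6 * (C111 * z $ 1 ^ 3 + C123 * z $ 1 * z $ 2 * z $ 3)"
    "g31 S U h z $ 2 = 6 * (C112 * z $ 1 ^ 2 * z $ 2 + C223 * z $ 2 ^ 2 * z $ 3)"
    "g31 S U h z $ 3 = 6 * (cnj C112 * z $ 1 ^ 2 * z $ 3 + cnj C223 * z $ 2 * z $ 3 ^ 2)"
proof -
  obtain u200 u020 u002 u110 u101 u011 where U: "U = quad u200 u020 u002 u110 u101 u011"
    and u: "u200 $ 1 = 0" "u200 $ 2 = - (\<psi>\<^sub>2 \<odot> q11) / (\<i> * \<omega>)" "u200 $ 3 = (\<psi>\<^sub>3 \<odot> q11) / (\<i> * \<omega>)"
    "u020 $ 1 = 0" "u020 $ 2 = (\<psi>\<^sub>2 \<odot> q22) / (\<i> * \<omega>)" "u020 $ 3 = (\<psi>\<^sub>3 \<odot> q22) / (3 * \<i> * \<omega>)"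
    "u002 $ 1 = 0" "u002 $ 2 = - (\<psi>\<^sub>2 \<odot> q33) / (3 * \<i> * \<omega>)" "u002 $ 3 = - (\<psi>\<^sub>3 \<odot> q33) / (\<i> * \<omega>)"
    "u110 $ 1 = 2 * (\<psi>\<^sub>1 \<odot> q12) / (\<i> * \<omega>)" "u110 $ 2 = 0" "u110 $ 3 = 0"
    "u101 $ 1 = - 2 * (\<psi>\<^sub>1 \<odot> q13) / (\<i> * \<omega>)" "u101 $ 2 = 0" "u101 $ 3 = 0"
    "u011 $ 1 = 0" "u011 $ 2 = - 2 * (\<psi>\<^sub>2 \<odot> q23) / (\<i> * \<omega>)" "u011 $ 3 = 2 * (\<psi>\<^sub>3 \<odot> q23) / (\<i> * \<omega>)"
    using U_coefficients[OF assms] by metis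
  define L where "L i = (if i = 1 then list1 u200 u020 u002 u110 u101 u011
      else if i = 2 then list2 \<psi>\<^sub>2 u200 u020 u002 u110 u101 u011 else list2 \<psi>\<^sub>3 u200 u020 u002 u110 u101 u011)"
    for i :: 3
  have ev: "(f31 S z + (3 / 2) *\<^sub>R (Df21_U S U h z - frechet_derivative U (at z) (g21 S z 0))) $ i = meval (L i) z \<alpha>"
    for z and \<alpha> :: "real^2" and i
  proof -
    have "i = 1 \<or> i = 2 \<or> i = 3" by (rule exhaust_3)
    then show ?thesis
      by (elim disjE)
        (simp_all only: cubic_terms[OF U] vector_add_component vector_smult_component modes_nth
          meval_list1[OF U, of z \<alpha>] meval_list2[OF U, of _ z \<alpha>] L_def, simp_all)
  qed
  have Le: "fst ` set (L i) \<subseteq> expos 3" for i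
    unfolding L_def using list1_expos list2_expos by simp
  have g: "g31 S U h z $ i = (\<Sum>e\<in>resonant 3 i. mcoeff (L i) e * monom_fn e z 0)" for i
    unfolding g31_def by (rule Proj_eq[OF _ ev Le]) simp
  have m1: "mcoeff (L 1) (3,0,0,0,0) = 6 * C111" "mcoeff (L 1) (1,1,1,0,0) = 6 * C123"
    by (simp_all add: L_def list1_def ucub_def hcub_def cub_def u C111_def C123_def Re_mat_q rdot_add hc_def[abs_def] field_simps)
  have m2: "mcoeff (L 2) (2,1,0,0,0) = 6 * C112" "mcoeff (L 2) (0,2,1,0,0) = 6 * C223"
    by (simp_all add: L_def list2_def ucub_def hcub_def cub_def u C112_eq C223_eq field_simps)
  have m3: "mcoeff (L 3) (2,0,1,0,0) = 6 * cnj C112" "mcoeff (L 3) (0,1,2,0,0) = 6 * cnj C223"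
    by (simp_all add: L_def list2_def ucub_def hcub_def cub_def u C112_eq C223_eq cnj_rdot_psi Qh_cnj_phi
        Ch_cnj_phi Qh_h_cnj[simplified] field_simps)
  show "g31 S U h z $ 1 = 6 * (C111 * z $ 1 ^ 3 + C123 * z $ 1 * z $ 2 * z $ 3)"
    unfolding g by (simp add: resonant_def m1 m1[simplified] monom_fn_def algebra_simps)
  show "g31 S U h z $ 2 = 6 * (C112 * z $ 1 ^ 2 * z $ 2 + C223 * z $ 2 ^ 2 * z $ 3)"
    unfolding g by (simp add: resonant_def m2 m2[simplified] monom_fn_def algebra_simps)
  show "g31 S U h z $ 3 = 6 * (cnj C112 * z $ 1 ^ 2 * z $ 3 + cnj C223 * z $ 2 * z $ 3 ^ 2)"
    unfolding g by (simp add: resonant_def m3 m3[simplified] monom_fn_def algebra_simps)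
qed

lemma normal_form_nth:
  assumes "is_U21 S U"
  shows "normal_form S U h z \<alpha> $ 1 = a1 S \<alpha> * z $ 1 + 0 * z $ 1 ^ 2 + 0 * z $ 2 * z $ 3 + C111 * z $ 1 ^ 3 + C123 * z $ 1 * z $ 2 * z $ 3"
    "normal_form S U h z \<alpha> $ 2 = \<i> * \<omega> * z $ 2 + b2 S \<alpha> * z $ 2 + 0 * z $ 1 * z $ 2 + C112 * z $ 1 ^ 2 * z $ 2 + C223 * z $ 2 ^ 2 * z $ 3"
    "normal_form S U h z \<alpha> $ 3 = - \<i> * \<omega> * z $ 3 + cnj (b2 S \<alpha>) * z $ 3 + cnj 0 * z $ 1 * z $ 3 +
       cnj C112 * z $ 1 ^ 2 * z $ 3 + cnj C223 * z $ 2 * z $ 3 ^ 2"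
  unfolding normal_form_def vector_add_component vector_scaleR_component g31_nth[OF assms] g21_nth Bz_nth
  by (simp_all add: scaleR_conv_of_real[where 'a=complex] algebra_simps)

end

theorem proposition4p3:
  fixes S :: "('x::{real_inner,banach}, 'm::finite) reduction"
    and U :: "complex^3 \<Rightarrow> complex^3"
    and h :: "nat \<Rightarrow> nat \<Rightarrow> nat \<Rightarrow> real \<Rightarrow> 'x^'m"
  assumes "pfde_system S"
    and "hopf_steady_state S (mode1 S) (mode2 S) (om0 S)"
    and "mode2 S = 0" and "mode1 S \<noteq> 0"
    and "bases S"
    and "is_U21 S U"
    and "is_h S h"
  shows "let
      k\<^sub>1 = mode1 S; \<omega>\<^sub>0 = complex_of_real (om0 S);
      \<phi>\<^sub>1 = phi1 S; \<phi>\<^sub>2 = phi2 S; \<phi>\<^sub>2' = phi2b S;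
      \<psi>\<^sub>1 = psi1 S 0; \<psi>\<^sub>2 = psi2 S 0; \<psi>\<^sub>2' = psi2b S 0;
      Q = Qh S; C = Ch S;
      h200_0 = hmode S (h 2 0 0) 0; h200_2k = hmode S (h 2 0 0) (2 * k\<^sub>1);
      h011_0 = hmode S (h 0 1 1) 0; h011_2k = hmode S (h 0 1 1) (2 * k\<^sub>1);
      h020_0 = hmode S (h 0 2 0) 0; h002_0 = hmode S (h 0 0 2) 0;
      h110_k = hmode S (h 1 1 0) k\<^sub>1; h101_k = hmode S (h 1 0 1) k\<^sub>1;
      isqrt2 = complex_of_real (1 / sqrt 2);
      N\<^sub>0 = eta_int S 0 (\<lambda>s. 1);
      N\<^sub>2\<^sub>k = eta_int S (2 * k\<^sub>1) (\<lambda>s. 1);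
      R\<^sub>0 = mat (2 * \<i> * \<omega>\<^sub>0) - eta_int S 0 (\<lambda>s. exp (2 * \<i> * \<omega>\<^sub>0 * complex_of_real s));
      R\<^sub>k = mat (\<i> * \<omega>\<^sub>0) - eta_int S k\<^sub>1 (\<lambda>s. exp (\<i> * \<omega>\<^sub>0 * complex_of_real s))
    in
    (\<exists>a11 a23 a111 a123 b12 b112 b223 :: complex.
       (\<forall>z \<alpha>.
          normal_form S U h z \<alpha> $ 1 =
            a1 S \<alpha> * z $ 1 + a11 * z $ 1 ^ 2 + a23 * z $ 2 * z $ 3 +
            a111 * z $ 1 ^ 3 + a123 * z $ 1 * z $ 2 * z $ 3 \<and>
          normal_form S U h z \<alpha> $ 2 =
            \<i> * \<omega>\<^sub>0 * z $ 2 + b2 S \<alpha> * z $ 2 + b12 * z $ 1 * z $ 2 +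
            b112 * z $ 1 ^ 2 * z $ 2 + b223 * z $ 2 ^ 2 * z $ 3 \<and>
          normal_form S U h z \<alpha> $ 3 =
            - \<i> * \<omega>\<^sub>0 * z $ 3 + cnj (b2 S \<alpha>) * z $ 3 + cnj b12 * z $ 1 * z $ 3 +
            cnj b112 * z $ 1 ^ 2 * z $ 3 + cnj b223 * z $ 2 * z $ 3 ^ 2) \<and>
       a11 = 0 \<and> a23 = 0 \<and> b12 = 0 \<and>
       a111 = (1 / 4) * (\<psi>\<^sub>1 \<odot> C \<phi>\<^sub>1 \<phi>\<^sub>1 \<phi>\<^sub>1)
            + (1 / \<omega>\<^sub>0) * (\<psi>\<^sub>1 \<odot> (Re_mat (outer (\<i> *s Q \<phi>\<^sub>1 \<phi>\<^sub>2) \<psi>\<^sub>2) *v Q \<phi>\<^sub>1 \<phi>\<^sub>1))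
            + (\<psi>\<^sub>1 \<odot> Q \<phi>\<^sub>1 (\<lambda>\<theta>. h200_0 \<theta> + isqrt2 *s h200_2k \<theta>)) \<and>
       a123 = (\<psi>\<^sub>1 \<odot> C \<phi>\<^sub>1 \<phi>\<^sub>2 \<phi>\<^sub>2')
            + (2 / \<omega>\<^sub>0) * (\<psi>\<^sub>1 \<odot> (Re_mat (outer (\<i> *s Q \<phi>\<^sub>1 \<phi>\<^sub>2) \<psi>\<^sub>2) *v Q \<phi>\<^sub>2 \<phi>\<^sub>2'))
            + (\<psi>\<^sub>1 \<odot> (Q \<phi>\<^sub>1 (\<lambda>\<theta>. h011_0 \<theta> + isqrt2 *s h011_2k \<theta>)
                      + Q \<phi>\<^sub>2 h101_k + Q \<phi>\<^sub>2' h110_k)) \<and>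
       b112 = (1 / 2) * (\<psi>\<^sub>2 \<odot> C \<phi>\<^sub>1 \<phi>\<^sub>1 \<phi>\<^sub>2)
            + (1 / (2 * \<i> * \<omega>\<^sub>0)) * (\<psi>\<^sub>2 \<odot> (2 *s (outer (Q \<phi>\<^sub>1 \<phi>\<^sub>1) \<psi>\<^sub>1 *v Q \<phi>\<^sub>1 \<phi>\<^sub>2)
                + (- outer (Q \<phi>\<^sub>2 \<phi>\<^sub>2) \<psi>\<^sub>2 + outer (Q \<phi>\<^sub>2 \<phi>\<^sub>2') \<psi>\<^sub>2') *v Q \<phi>\<^sub>1 \<phi>\<^sub>1))
            + (\<psi>\<^sub>2 \<odot> (Q \<phi>\<^sub>1 h110_k + Q \<phi>\<^sub>2 h200_0)) \<and>
       b223 = (1 / 2) * (\<psi>\<^sub>2 \<odot> C \<phi>\<^sub>2 \<phi>\<^sub>2 \<phi>\<^sub>2')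
            + (1 / (4 * \<i> * \<omega>\<^sub>0)) * (\<psi>\<^sub>2 \<odot> ((2 / 3) *s (outer (Q \<phi>\<^sub>2' \<phi>\<^sub>2') \<psi>\<^sub>2' *v Q \<phi>\<^sub>2 \<phi>\<^sub>2)
                + ((- 2) *\<^sub>R outer (Q \<phi>\<^sub>2 \<phi>\<^sub>2) \<psi>\<^sub>2 + 4 *\<^sub>R outer (Q \<phi>\<^sub>2 \<phi>\<^sub>2') \<psi>\<^sub>2') *v Q \<phi>\<^sub>2 \<phi>\<^sub>2'))
            + (\<psi>\<^sub>2 \<odot> (Q \<phi>\<^sub>2 h011_0 + Q \<phi>\<^sub>2' h020_0))) \<and>
    invertible N\<^sub>0 \<and> invertible N\<^sub>2\<^sub>k \<and> invertible R\<^sub>0 \<and> invertible R\<^sub>k \<and>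
    (\<forall>\<theta>\<in>{- delay S..0}.
       h200_0 \<theta> = - (1 / 2) *s (matrix_inv N\<^sub>0 *v Q \<phi>\<^sub>1 \<phi>\<^sub>1)
          + (1 / (2 * \<i> * \<omega>\<^sub>0)) *s ((outer (\<phi>\<^sub>2 \<theta>) \<psi>\<^sub>2 - outer (\<phi>\<^sub>2' \<theta>) \<psi>\<^sub>2') *v Q \<phi>\<^sub>1 \<phi>\<^sub>1) \<and>
       h200_2k \<theta> = - complex_of_real (1 / (2 * sqrt 2)) *s (matrix_inv N\<^sub>2\<^sub>k *v Q \<phi>\<^sub>1 \<phi>\<^sub>1) \<and>
       h011_0 \<theta> = - (matrix_inv N\<^sub>0 *v Q \<phi>\<^sub>2 \<phi>\<^sub>2')
          + (1 / (\<i> * \<omega>\<^sub>0)) *s ((outer (\<phi>\<^sub>2 \<theta>) \<psi>\<^sub>2 - outer (\<phi>\<^sub>2' \<theta>) \<psi>\<^sub>2') *v Q \<phi>\<^sub>2 \<phi>\<^sub>2') \<and>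
       h011_2k \<theta> = 0 \<and>
       h020_0 \<theta> = (1 / 2 * exp (2 * \<i> * \<omega>\<^sub>0 * complex_of_real \<theta>)) *s (matrix_inv R\<^sub>0 *v Q \<phi>\<^sub>2 \<phi>\<^sub>2)
          - (1 / (2 * \<i> * \<omega>\<^sub>0)) *s
              ((outer (\<phi>\<^sub>2 \<theta>) \<psi>\<^sub>2 + (1 / 3) *\<^sub>R outer (\<phi>\<^sub>2' \<theta>) \<psi>\<^sub>2') *v Q \<phi>\<^sub>2 \<phi>\<^sub>2) \<and>
       h110_k \<theta> = exp (\<i> * \<omega>\<^sub>0 * complex_of_real \<theta>) *s (matrix_inv R\<^sub>k *v Q \<phi>\<^sub>1 \<phi>\<^sub>2)
          - (1 / (\<i> * \<omega>\<^sub>0)) *s (outer (\<phi>\<^sub>1 0) \<psi>\<^sub>1 *v Q \<phi>\<^sub>1 \<phi>\<^sub>2) \<and>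
       h002_0 \<theta> = cnjv (h020_0 \<theta>) \<and>
       h101_k \<theta> = cnjv (h110_k \<theta>))"
proof -
  interpret center_manifold S h
    by unfold_locales (fact assms)+
  have R: "mat (2 * \<i> * \<omega>) - eta_int S 0 (\<lambda>s. exp (2 * \<i> * \<omega> * complex_of_real s)) = M 0 (2 * \<i> * \<omega>)"
    "mat (\<i> * \<omega>) - eta_int S k\<^sub>1 (\<lambda>s. exp (\<i> * \<omega> * complex_of_real s)) = M k\<^sub>1 (\<i> * \<omega>)"
    by (simp_all add: M_def exp_fun_def[abs_def])
  have e: "exp (\<zeta> * complex_of_real \<theta>) = exp_fun \<zeta> \<theta>" for \<zeta> \<theta>
    by (simp add: exp_fun_def)
  note nf = normal_form_nth[OF assms(6)]
  show ?thesis
    unfolding Let_def R unfolding e I\<^sub>r_def[symmetric]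
    by (rule conjI, rule exI[of _ 0], rule exI[of _ 0], rule exI[of _ C111], rule exI[of _ C123],
        rule exI[of _ 0], rule exI[of _ C112], rule exI[of _ C223])
      (intro conjI allI ballI refl nf C111_def C123_def C112_def C223_def
        N_invertible nonresonant h200_0_eq h200_2k1_eq h011_0_eq h011_2k1_eq h020_0_eq h110_k1_eq
        h_cnj(1,2); assumption)+
qed

end
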